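(* Let $A=kQ/I$ be a monomial algebra. Then the families of $A$-bimodule maps $\mathbf F=(F_n)_{n\ge 0}$, $F_n: A\otimes kAP_n\otimes A\to A^{\otimes (n+2)}$, and $\mathbf G=(G_n)_{n\ge 0}$, $G_n: A^{\otimes (n+2)}\to A\otimes kAP_n\otimes A$, defined in the context, are comparison morphisms between Bardzell's resolution $\mathbb{A}\mathrm{p}A$ and the bar resolution $\mathbb{B}\mathrm{ar}A$; that is, they are morphisms of chain complexes lifting the identity of $A$: $$\varepsilon\circ F_0=\mu,\qquad F_{n-1}\circ d_n=b_n\circ F_n\quad\text{for all } n\ge 1,$$ $$\mu\circ G_0=\varepsilon,\qquad G_{n-1}\circ b_n=d_n\circ G_n\quad\text{for all } n\ge 1.$$
   Context: **Setting.** $k$ is a field, $Q$ a finite quiver with vertices $Q_0$, arrows $Q_1$, source and target maps $s,t$. Paths are written left to right: $\alpha_1\cdots\alpha_l$ with $t(\alpha_i)=s(\alpha_{i+1})$; $|w|$ is the length of $w$; $e_x$ is the trivial path at $x$. $I\subset kQ$ is a two-sided ideal generated by paths such that $J^m\subseteq I\subseteq J^2$ for some $m\ge 2$, where $J$ is the ideal generated by the arrows; $A=kQ/I$. $\mathcal R$ is the minimal set of paths (of minimal length) generating $I$, i.e. the paths in $I$ no proper subpath of which lies in $I$. $\mathcal P$ is the set of paths not in $I$ (it contains the trivial paths and the arrows); its classes form a $k$-basis of $A$. $E=kQ_0$ is the subalgebra spanned by the vertices, and all $\otimes$ are over $E$. $kX$ is the vector space with basis $X$. **Positions.** Subpaths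 of a given path $T$ are regarded as occurrences in $T$; for such an occurrence $p$, $s(p)$ and $t(p)$ denote its starting and ending positions on $T$, compared in the natural order along $T$. If $p$ is a subpath of $T$ we write $T=L(p)\,p\,R(p)$. $\mathcal R(T)$ is the set of (occurrences of) paths of $\mathcal R$ in $T$. **The sets $AP_n$.** $AP_0=Q_0$, $AP_1=Q_1$. For $n\ge2$, $AP_n$ is the set of supports of $n$-concatenations $(p_1,\dots,p_{n-1})$: for a path $T$, $p_1\in\mathcal R(T)$; $p_2\in L_1=\{p\in\mathcal R(T): s(p_1)<s(p)<t(p_1)\}$ with $s(p_2)$ minimal in $L_1$; and for $j\ge2$, $p_{j+1}\in L_{j+1}=\{p\in\mathcal R(T): t(p_{j-1})\le s(p)<t(p_j)\}$ with $s(p_{j+1})$ minimal in $L_{j+1}$. The support is the path along $T$ from $s(p_1)$ to $t(p_{n-1})$. For $w\in AP_n$, $\mathrm{Sub}(w)$ is the set of (occurrences of) elements of $AP_{n-1}$ that are subpaths of $w$. It is known that for odd $n\ge 3$, $\mathrm{Sub}(w)=\{\psi_1,\psi_2\}$ with $w=\psi_1R(\psi_1)=L(\psi_2)\psi_2$. **Bar resolution.** $\mathbb{B}\mathrm{ar}A=(A^{\otimes(n+2)},b_n)$ with $b_{n+1}(a_0\otimes\cdots\otimes a_{n+2})=\sum_{i=0}^{n+1}(-1)^ia_0\otimes\cdots\otimes a_ia_{i+1}\otimes\cdots\otimes a_{n+2}$ and augmentation $\varepsilon(a\otimes b)=ab$. **Bardzell's resolution.** $\mathbb{A}\mathrm{p}A=(A\otimes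 kAP_n\otimes A,d_n)$, where $d_1(1\otimes\alpha\otimes1)=\alpha\otimes e_{t(\alpha)}\otimes1-1\otimes e_{s(\alpha)}\otimes\alpha$; $d_{2m}(1\otimes w\otimes1)=\sum_{\psi\in\mathrm{Sub}(w)}L(\psi)\otimes\psi\otimes R(\psi)$ for $m\ge1$; $d_{2m+1}(1\otimes w\otimes1)=L(\psi_2)\otimes\psi_2\otimes1-1\otimes\psi_1\otimes R(\psi_1)$ for $m\ge1$; augmentation $\mu(1\otimes e_i\otimes1)=e_i$. All maps are $A$-bimodule maps. **The map $\mathbf F$.** $F_0(1\otimes e\otimes1)=e\otimes1$, $F_1(1\otimes\alpha\otimes1)=1\otimes\alpha\otimes1$, and for $n\ge2$, $w\in AP_n$, with $\mathrm{Sub}(w)=\{\zeta_1,\dots,\zeta_m\}$ ordered by $s(\zeta_1)<\cdots<s(\zeta_m)$ and $w=L_i\zeta_iR_i$, $$F_n(1\otimes w\otimes1)=\sum_{i=1}^{m-1}1\otimes L_{i+1}F_{n-1}(1\otimes\zeta_{i+1}\otimes1)R_{i+1},$$ where $1\otimes(a_0\otimes\cdots\otimes a_n)$ means $1\otimes a_0\otimes\cdots\otimes a_n$. **The map $\mathbf G$.** A sequence $(v_1,\dots,v_n)\in\mathcal P^n$ is well-concatenated if $t(v_i)=s(v_{i+1})$ for $1\le i\le n-1$. Put $\mathcal M_{odd}=\{j: v_{2j-1}v_{2j}\notin I\}$ and $\mathcal M_{even}=\{j: v_{2j}v_{2j+1}\notin I\}$ (indices between $1$ and $n$). A well-concatenated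 sequence is good if $n$ is even and $\mathcal M_{odd}=\emptyset$, or $n$ is odd and $\mathcal M_{even}=\emptyset$; otherwise it is bad. For a good sequence, $\chi(v_1,\dots,v_n)$ is the set of (occurrences of) $w\in AP_n$ with $v_1\cdots v_n=L(w)wR(w)$. Then $G_0(1\otimes1)=\sum_{i\in Q_0}1\otimes e_i\otimes1$; $G_1(1\otimes v\otimes1)=\sum_{i=1}^s\alpha_1\cdots\alpha_{i-1}\otimes\alpha_i\otimes\alpha_{i+1}\cdots\alpha_s$ if $v=\alpha_1\cdots\alpha_s$ with $s\ge1$, and $0$ if $|v|=0$. For $n\ge2$ and a well-concatenated sequence in $\mathcal P^n$: $G_n(1\otimes v_1\otimes\cdots\otimes v_n\otimes1)=0$ if the sequence is bad or $\chi(v_1,\dots,v_n)=\emptyset$; otherwise it equals $L(w_1)\otimes w_1\otimes R(w_1)$ if $n$ is even, where $w_1\in\chi(v_1,\dots,v_n)$ has minimal $s(w_1)$, and $\sum L(w)\otimes w\otimes R(w)$ over $w\in\chi(v_1,\dots,v_n)$ with $s(v_1)\le s(w)<t(v_1)$ if $n$ is odd. (Positions are on $v_1\cdots v_n$.) *)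

theory Defs
  imports
    "Graph_Theory.Arc_Walk"
    "HOL-Algebra.QuotRing"
    "HOL-Algebra.Ideal_Product"
    "HOL-Algebra.Free_Abelian_Groups"
begin

section \<open>Quivers, paths and occurrences of subpaths\<close>

text \<open>A quiver is a finite directed multigraph, loops allowed (\<^locale>\<open>fin_digraph\<close>). A path is its
  starting vertex together with its list of arrows, so that \<open>(x, [])\<close> is the trivial path at \<open>x\<close>.\<close>

type_synonym ('v, 'a) path = "'v \<times> 'a list"

definition paths :: "('v, 'a) pre_digraph \<Rightarrow> ('v, 'a) path set" where
  "paths Q = {p. \<exists>y. pre_digraph.awalk Q (fst p) (snd p) y}"

definition source :: "('v, 'a) path \<Rightarrow> 'v" where
  "source p = fst p"

definition target :: "('v, 'a) pre_digraph \<Rightarrow> ('v, 'a) path \<Rightarrow> 'v" where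
  "target Q p = pre_digraph.awlast Q (fst p) (snd p)"

definition plength :: "('v, 'a) path \<Rightarrow> nat" where
  "plength p = length (snd p)"

definition triv :: "'v \<Rightarrow> ('v, 'a) path" where
  "triv x = (x, [])"

definition arrow :: "('v, 'a) pre_digraph \<Rightarrow> 'a \<Rightarrow> ('v, 'a) path" where
  "arrow Q \<alpha> = (tail Q \<alpha>, [\<alpha>])"

definition pcat :: "('v, 'a) path \<Rightarrow> ('v, 'a) path \<Rightarrow> ('v, 'a) path" where
  "pcat p q = (fst p, snd p @ snd q)"

definition pconcat :: "('v, 'a) path list \<Rightarrow> ('v, 'a) path" where
  "pconcat vs = (fst (hd vs), concat (map snd vs))"

text \<open>Positions on a path \<open>T\<close> are the numbers \<open>0, \<dots>, |T|\<close>. An occurrence of a subpath is the pair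
  \<open>(i, j)\<close> of its starting and ending positions.\<close>

type_synonym occ = "nat \<times> nat"

definition pseg :: "('v, 'a) pre_digraph \<Rightarrow> ('v, 'a) path \<Rightarrow> occ \<Rightarrow> ('v, 'a) path" where
  "pseg Q T p = (pre_digraph.awlast Q (fst T) (take (fst p) (snd T)),
                 take (snd p - fst p) (drop (fst p) (snd T)))"

definition occs :: "('v, 'a) pre_digraph \<Rightarrow> ('v, 'a) path set \<Rightarrow> ('v, 'a) path \<Rightarrow> occ set" where
  "occs Q X T = {(i, j). i \<le> j \<and> j \<le> plength T \<and> pseg Q T (i, j) \<in> X}"

definition lpart :: "('v, 'a) pre_digraph \<Rightarrow> ('v, 'a) path \<Rightarrow> occ \<Rightarrow> ('v, 'a) path" where
  "lpart Q T p = pseg Q T (0, fst p)"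

definition rpart :: "('v, 'a) pre_digraph \<Rightarrow> ('v, 'a) path \<Rightarrow> occ \<Rightarrow> ('v, 'a) path" where
  "rpart Q T p = pseg Q T (snd p, plength T)"


section \<open>The monomial algebra\<close>

definition path_algebra ::
  "('v, 'a) pre_digraph \<Rightarrow> (('v, 'a) path \<Rightarrow>\<^sub>0 'k::field) ring" where
  "path_algebra Q = \<lparr>
     carrier = {f. Poly_Mapping.keys f \<subseteq> paths Q},
     monoid.mult = (\<lambda>f g. \<Sum>p\<in>Poly_Mapping.keys f. \<Sum>q\<in>Poly_Mapping.keys g.
        if target Q p = source q
        then Poly_Mapping.single (pcat p q) (Poly_Mapping.lookup f p * Poly_Mapping.lookup g q)
        else 0),
     one = (\<Sum>x\<in>verts Q. Poly_Mapping.single (triv x) 1),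
     ring.zero = 0,
     add = (+)\<rparr>"

definition pbasis :: "('v, 'a) path \<Rightarrow> (('v, 'a) path \<Rightarrow>\<^sub>0 'k::field)" where
  "pbasis p = Poly_Mapping.single p 1"

text \<open>The \<open>k\<close>-span in \<open>kQ\<close> of a set of paths; the subalgebra \<open>E\<close> is the case \<open>X = Q\<^sub>0\<close>.\<close>

definition pspan :: "('v, 'a) path set \<Rightarrow> (('v, 'a) path \<Rightarrow>\<^sub>0 'k::field) set" where
  "pspan X = {f. Poly_Mapping.keys f \<subseteq> X}"

definition vertex_algebra :: "('v, 'a) pre_digraph \<Rightarrow> (('v, 'a) path \<Rightarrow>\<^sub>0 'k::field) set" where
  "vertex_algebra Q = pspan (triv ` verts Q)"

definition arrow_ideal :: "('v, 'a) pre_digraph \<Rightarrow> (('v, 'a) path \<Rightarrow>\<^sub>0 'k::field) set" where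
  "arrow_ideal Q = genideal (path_algebra Q) (pbasis ` arrow Q ` arcs Q)"

definition ideal_power ::
  "('v, 'a) pre_digraph \<Rightarrow> (('v, 'a) path \<Rightarrow>\<^sub>0 'k::field) set \<Rightarrow> nat \<Rightarrow> (('v, 'a) path \<Rightarrow>\<^sub>0 'k) set" where
  "ideal_power Q J m = J [^]\<^bsub>ideals_set (path_algebra Q)\<^esub> m"

locale monomial_algebra = fin_digraph Q
  for Q :: "('v, 'a) pre_digraph" +
  fixes I :: "(('v, 'a) path \<Rightarrow>\<^sub>0 'k::field) set"
  assumes generated_by_paths: "\<exists>S\<subseteq>paths Q. I = genideal (path_algebra Q) (pbasis ` S)"
    and admissible: "\<exists>m\<ge>2. ideal_power Q (arrow_ideal Q) m \<subseteq> I \<and> I \<subseteq> ideal_power Q (arrow_ideal Q) 2"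

type_synonym ('v, 'a, 'k) alg = "(('v, 'a) path \<Rightarrow>\<^sub>0 'k) set"

definition malg ::
  "('v, 'a) pre_digraph \<Rightarrow> (('v, 'a) path \<Rightarrow>\<^sub>0 'k::field) set \<Rightarrow> ('v, 'a, 'k) alg ring" where
  "malg Q I = path_algebra Q Quot I"

definition qcls ::
  "('v, 'a) pre_digraph \<Rightarrow> (('v, 'a) path \<Rightarrow>\<^sub>0 'k::field) set \<Rightarrow> (('v, 'a) path \<Rightarrow>\<^sub>0 'k) \<Rightarrow> ('v, 'a, 'k) alg" where
  "qcls Q I f = I +>\<^bsub>path_algebra Q\<^esub> f"

definition pcls ::
  "('v, 'a) pre_digraph \<Rightarrow> (('v, 'a) path \<Rightarrow>\<^sub>0 'k::field) set \<Rightarrow> ('v, 'a) path \<Rightarrow> ('v, 'a, 'k) alg" where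
  "pcls Q I p = qcls Q I (pbasis p)"

definition nonzero_paths ::
  "('v, 'a) pre_digraph \<Rightarrow> (('v, 'a) path \<Rightarrow>\<^sub>0 'k::field) set \<Rightarrow> ('v, 'a) path set" where
  "nonzero_paths Q I = {p \<in> paths Q. pbasis p \<notin> I}"

definition relations ::
  "('v, 'a) pre_digraph \<Rightarrow> (('v, 'a) path \<Rightarrow>\<^sub>0 'k::field) set \<Rightarrow> ('v, 'a) path set" where
  "relations Q I = {p \<in> paths Q. pbasis p \<in> I \<and>
     (\<forall>i j. i \<le> j \<and> j \<le> plength p \<and> (i, j) \<noteq> (0, plength p) \<longrightarrow> pbasis (pseg Q p (i, j)) \<notin> I)}"


section \<open>The sets \<open>AP\<^sub>n\<close>\<close>

definition least_start :: "occ set \<Rightarrow> occ \<Rightarrow> bool" where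
  "least_start L p \<longleftrightarrow> p \<in> L \<and> (\<forall>q\<in>L. fst p \<le> fst q)"

text \<open>The list \<open>ps\<close> is \<open>[p\<^sub>1, \<dots>, p\<^sub>r]\<close> with \<open>r = n - 1\<close>, so \<open>ps ! j\<close> is \<open>p\<^bsub>j+1\<^esub>\<close>.\<close>

definition is_concatenation ::
  "('v, 'a) pre_digraph \<Rightarrow> (('v, 'a) path \<Rightarrow>\<^sub>0 'k::field) set \<Rightarrow> ('v, 'a) path \<Rightarrow> occ list \<Rightarrow> bool" where
  "is_concatenation Q I T ps \<longleftrightarrow>
     (let RT = occs Q (relations Q I) T in
       ps \<noteq> [] \<and> ps ! 0 \<in> RT \<and>
       (1 < length ps \<longrightarrow>
          least_start {p \<in> RT. fst (ps ! 0) < fst p \<and> fst p < snd (ps ! 0)} (ps ! 1)) \<and>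
       (\<forall>j. 2 \<le> j \<and> j < length ps \<longrightarrow>
          least_start {p \<in> RT. snd (ps ! (j - 2)) \<le> fst p \<and> fst p < snd (ps ! (j - 1))} (ps ! j)))"

definition AP ::
  "('v, 'a) pre_digraph \<Rightarrow> (('v, 'a) path \<Rightarrow>\<^sub>0 'k::field) set \<Rightarrow> nat \<Rightarrow> ('v, 'a) path set" where
  "AP Q I n =
     (if n = 0 then triv ` verts Q
      else if n = 1 then arrow Q ` arcs Q
      else {w. \<exists>T ps. T \<in> paths Q \<and> is_concatenation Q I T ps \<and> length ps = n - 1 \<and>
                 w = pseg Q T (fst (hd ps), snd (last ps))})"

definition Sub ::
  "('v, 'a) pre_digraph \<Rightarrow> (('v, 'a) path \<Rightarrow>\<^sub>0 'k::field) set \<Rightarrow> nat \<Rightarrow> ('v, 'a) path \<Rightarrow> occ set" where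
  "Sub Q I n w = occs Q (AP Q I (n - 1)) w"


section \<open>Bimodules and tensor products over \<open>E\<close>\<close>

text \<open>As in the record of one-sided modules in \<open>HOL-Algebra\<close>, the fields \<open>mult\<close> and \<open>one\<close> of the underlying ring record are
  irrelevant. The scalars \<open>k\<close> lie in \<open>A\<close> and in \<open>E\<close>, and act centrally on all bimodules below, so
  additive maps commuting with the actions of \<open>A\<close> are automatically \<open>k\<close>-linear.\<close>

record ('r, 'm) bimodule = "'m ring" +
  lact :: "'r \<Rightarrow> 'm \<Rightarrow> 'm"
  ract :: "'m \<Rightarrow> 'r \<Rightarrow> 'm"

definition bimod_hom ::
  "('r, 's) ring_scheme \<Rightarrow> ('r, 'm, 'x) bimodule_scheme \<Rightarrow> ('r, 'n, 'y) bimodule_scheme \<Rightarrow> ('m \<Rightarrow> 'n) set" where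
  "bimod_hom R M N = {f. f \<in> carrier M \<rightarrow> carrier N \<and>
     (\<forall>x\<in>carrier M. \<forall>y\<in>carrier M. f (x \<oplus>\<^bsub>M\<^esub> y) = f x \<oplus>\<^bsub>N\<^esub> f y) \<and>
     (\<forall>a\<in>carrier R. \<forall>x\<in>carrier M. f (lact M a x) = lact N a (f x)) \<and>
     (\<forall>a\<in>carrier R. \<forall>x\<in>carrier M. f (ract M x a) = ract N (f x) a)}"

text \<open>The abelian group with generators \<open>X\<close> and relators \<open>Rel\<close>: cosets in the free abelian group
  on \<open>X\<close>. A tensor product over the ring \<open>E\<close> is such a group, with pure tensors as generators and
  additivity in each factor and \<open>E\<close>-balancedness as relators.\<close>

definition pres_cls :: "'x set \<Rightarrow> ('x \<Rightarrow>\<^sub>0 int) set \<Rightarrow> ('x \<Rightarrow>\<^sub>0 int) \<Rightarrow> ('x \<Rightarrow>\<^sub>0 int) set" where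
  "pres_cls X Rel c =
     generate (free_Abelian_group X) Rel #>\<^bsub>free_Abelian_group X\<^esub> c"

definition pres_bimodule ::
  "'x set \<Rightarrow> ('x \<Rightarrow>\<^sub>0 int) set \<Rightarrow>
   ('r \<Rightarrow> ('x \<Rightarrow>\<^sub>0 int) set \<Rightarrow> ('x \<Rightarrow>\<^sub>0 int) set) \<Rightarrow>
   (('x \<Rightarrow>\<^sub>0 int) set \<Rightarrow> 'r \<Rightarrow> ('x \<Rightarrow>\<^sub>0 int) set) \<Rightarrow> ('r, ('x \<Rightarrow>\<^sub>0 int) set) bimodule" where
  "pres_bimodule X Rel l r =
     (let G = free_Abelian_group X Mod generate (free_Abelian_group X) Rel in
       \<lparr>carrier = carrier G, monoid.mult = undefined, one = undefined,
        ring.zero = one G, add = monoid.mult G, lact = l, ract = r\<rparr>)"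

text \<open>The additive map of presented groups that sends a generator \<open>x\<close> to the generator \<open>f x\<close>.\<close>

definition pres_map ::
  "('x \<Rightarrow> 'y) \<Rightarrow> 'y set \<Rightarrow> ('y \<Rightarrow>\<^sub>0 int) set \<Rightarrow> ('x \<Rightarrow>\<^sub>0 int) set \<Rightarrow> ('y \<Rightarrow>\<^sub>0 int) set" where
  "pres_map f Y Rel C = (\<Union>c\<in>C. pres_cls Y Rel (frag_extend (\<lambda>x. frag_of (f x)) c))"

definition alg_bimodule ::
  "('v, 'a) pre_digraph \<Rightarrow> (('v, 'a) path \<Rightarrow>\<^sub>0 'k::field) set \<Rightarrow> (('v, 'a, 'k) alg, ('v, 'a, 'k) alg) bimodule" where
  "alg_bimodule Q I = ring.extend (malg Q I)
     \<lparr>lact = monoid.mult (malg Q I), ract = monoid.mult (malg Q I)\<rparr>"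


subsection \<open>The modules \<open>A\<^bsup>\<otimes>(n+2)\<^esup>\<close> of the bar resolution\<close>

definition bar_gens ::
  "('v, 'a) pre_digraph \<Rightarrow> (('v, 'a) path \<Rightarrow>\<^sub>0 'k::field) set \<Rightarrow> nat \<Rightarrow> ('v, 'a, 'k) alg list set" where
  "bar_gens Q I n = {as. length as = n + 2 \<and> set as \<subseteq> carrier (malg Q I)}"

definition bar_rels ::
  "('v, 'a) pre_digraph \<Rightarrow> (('v, 'a) path \<Rightarrow>\<^sub>0 'k::field) set \<Rightarrow> nat \<Rightarrow> (('v, 'a, 'k) alg list \<Rightarrow>\<^sub>0 int) set" where
  "bar_rels Q I n =
     {frag_of (as @ (x \<oplus>\<^bsub>malg Q I\<^esub> y) # bs) - frag_of (as @ x # bs) - frag_of (as @ y # bs) | as x y bs.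
        as @ x # bs \<in> bar_gens Q I n \<and> y \<in> carrier (malg Q I)} \<union>
     {frag_of (as @ (x \<otimes>\<^bsub>malg Q I\<^esub> qcls Q I e) # y # bs) - frag_of (as @ x # (qcls Q I e \<otimes>\<^bsub>malg Q I\<^esub> y) # bs) | as x y bs e.
        as @ x # y # bs \<in> bar_gens Q I n \<and> e \<in> vertex_algebra Q}"

definition bar_tensor ::
  "('v, 'a) pre_digraph \<Rightarrow> (('v, 'a) path \<Rightarrow>\<^sub>0 'k::field) set \<Rightarrow> nat \<Rightarrow>
   ('v, 'a, 'k) alg list \<Rightarrow> (('v, 'a, 'k) alg list \<Rightarrow>\<^sub>0 int) set" where
  "bar_tensor Q I n as = pres_cls (bar_gens Q I n) (bar_rels Q I n) (frag_of as)"

definition Bar ::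
  "('v, 'a) pre_digraph \<Rightarrow> (('v, 'a) path \<Rightarrow>\<^sub>0 'k::field) set \<Rightarrow> nat \<Rightarrow>
   (('v, 'a, 'k) alg, (('v, 'a, 'k) alg list \<Rightarrow>\<^sub>0 int) set) bimodule" where
  "Bar Q I n = pres_bimodule (bar_gens Q I n) (bar_rels Q I n)
     (\<lambda>a. pres_map (\<lambda>as. (a \<otimes>\<^bsub>malg Q I\<^esub> hd as) # tl as) (bar_gens Q I n) (bar_rels Q I n))
     (\<lambda>C a. pres_map (\<lambda>as. butlast as @ [last as \<otimes>\<^bsub>malg Q I\<^esub> a]) (bar_gens Q I n) (bar_rels Q I n) C)"

text \<open>The map \<open>u \<mapsto> 1 \<otimes> u\<close> from \<open>A\<^bsup>\<otimes>(n+2)\<^esup>\<close> to \<open>A\<^bsup>\<otimes>(n+3)\<^esup>\<close>.\<close>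

definition one_tensor ::
  "('v, 'a) pre_digraph \<Rightarrow> (('v, 'a) path \<Rightarrow>\<^sub>0 'k::field) set \<Rightarrow> nat \<Rightarrow>
   (('v, 'a, 'k) alg list \<Rightarrow>\<^sub>0 int) set \<Rightarrow> (('v, 'a, 'k) alg list \<Rightarrow>\<^sub>0 int) set" where
  "one_tensor Q I n =
     pres_map (\<lambda>as. \<one>\<^bsub>malg Q I\<^esub> # as) (bar_gens Q I (Suc n)) (bar_rels Q I (Suc n))"


subsection \<open>The modules \<open>A \<otimes> kAP\<^sub>n \<otimes> A\<close> of Bardzell's resolution\<close>

type_synonym ('v, 'a, 'k) ap_gen =
  "('v, 'a, 'k) alg \<times> (('v, 'a) path \<Rightarrow>\<^sub>0 'k) \<times> ('v, 'a, 'k) alg"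

definition ap_gens ::
  "('v, 'a) pre_digraph \<Rightarrow> (('v, 'a) path \<Rightarrow>\<^sub>0 'k::field) set \<Rightarrow> nat \<Rightarrow> ('v, 'a, 'k) ap_gen set" where
  "ap_gens Q I n = carrier (malg Q I) \<times> pspan (AP Q I n) \<times> carrier (malg Q I)"

definition ap_rels ::
  "('v, 'a) pre_digraph \<Rightarrow> (('v, 'a) path \<Rightarrow>\<^sub>0 'k::field) set \<Rightarrow> nat \<Rightarrow> (('v, 'a, 'k) ap_gen \<Rightarrow>\<^sub>0 int) set" where
  "ap_rels Q I n =
     {frag_of (a \<oplus>\<^bsub>malg Q I\<^esub> a', x, c) - frag_of (a, x, c) - frag_of (a', x, c) | a a' x c.
        (a, x, c) \<in> ap_gens Q I n \<and> (a', x, c) \<in> ap_gens Q I n} \<union>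
     {frag_of (a, x \<oplus>\<^bsub>path_algebra Q\<^esub> x', c) - frag_of (a, x, c) - frag_of (a, x', c) | a x x' c.
        (a, x, c) \<in> ap_gens Q I n \<and> (a, x', c) \<in> ap_gens Q I n} \<union>
     {frag_of (a, x, c \<oplus>\<^bsub>malg Q I\<^esub> c') - frag_of (a, x, c) - frag_of (a, x, c') | a x c c'.
        (a, x, c) \<in> ap_gens Q I n \<and> (a, x, c') \<in> ap_gens Q I n} \<union>
     {frag_of (a \<otimes>\<^bsub>malg Q I\<^esub> qcls Q I e, x, c) - frag_of (a, e \<otimes>\<^bsub>path_algebra Q\<^esub> x, c) | a x c e.
        (a, x, c) \<in> ap_gens Q I n \<and> e \<in> vertex_algebra Q} \<union>
     {frag_of (a, x \<otimes>\<^bsub>path_algebra Q\<^esub> e, c) - frag_of (a, x, qcls Q I e \<otimes>\<^bsub>malg Q I\<^esub> c) | a x c e.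
        (a, x, c) \<in> ap_gens Q I n \<and> e \<in> vertex_algebra Q}"

text \<open>The element \<open>a \<otimes> w \<otimes> c\<close> for a path \<open>w \<in> AP\<^sub>n\<close>.\<close>

definition ap_tensor ::
  "('v, 'a) pre_digraph \<Rightarrow> (('v, 'a) path \<Rightarrow>\<^sub>0 'k::field) set \<Rightarrow> nat \<Rightarrow>
   ('v, 'a, 'k) alg \<Rightarrow> ('v, 'a) path \<Rightarrow> ('v, 'a, 'k) alg \<Rightarrow> (('v, 'a, 'k) ap_gen \<Rightarrow>\<^sub>0 int) set" where
  "ap_tensor Q I n a w c = pres_cls (ap_gens Q I n) (ap_rels Q I n) (frag_of (a, pbasis w, c))"

definition Ap ::
  "('v, 'a) pre_digraph \<Rightarrow> (('v, 'a) path \<Rightarrow>\<^sub>0 'k::field) set \<Rightarrow> nat \<Rightarrow>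
   (('v, 'a, 'k) alg, (('v, 'a, 'k) ap_gen \<Rightarrow>\<^sub>0 int) set) bimodule" where
  "Ap Q I n = pres_bimodule (ap_gens Q I n) (ap_rels Q I n)
     (\<lambda>b. pres_map (\<lambda>(a, x, c). (b \<otimes>\<^bsub>malg Q I\<^esub> a, x, c)) (ap_gens Q I n) (ap_rels Q I n))
     (\<lambda>C b. pres_map (\<lambda>(a, x, c). (a, x, c \<otimes>\<^bsub>malg Q I\<^esub> b)) (ap_gens Q I n) (ap_rels Q I n) C)"

text \<open>\<open>L(p) \<otimes> p \<otimes> R(p)\<close> for an occurrence \<open>p\<close> in the path \<open>T\<close> of an element of \<open>AP\<^sub>n\<close>. The outer
  parts may lie in \<open>I\<close>, and then the tensor vanishes.\<close>

definition occ_tensor ::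
  "('v, 'a) pre_digraph \<Rightarrow> (('v, 'a) path \<Rightarrow>\<^sub>0 'k::field) set \<Rightarrow> nat \<Rightarrow>
   ('v, 'a) path \<Rightarrow> occ \<Rightarrow> (('v, 'a, 'k) ap_gen \<Rightarrow>\<^sub>0 int) set" where
  "occ_tensor Q I n T p =
     ap_tensor Q I n (pcls Q I (lpart Q T p)) (pseg Q T p) (pcls Q I (rpart Q T p))"


section \<open>The two resolutions\<close>

definition is_bar_resolution ::
  "('v, 'a) pre_digraph \<Rightarrow> (('v, 'a) path \<Rightarrow>\<^sub>0 'k::field) set \<Rightarrow>
   (nat \<Rightarrow> (('v, 'a, 'k) alg list \<Rightarrow>\<^sub>0 int) set \<Rightarrow> (('v, 'a, 'k) alg list \<Rightarrow>\<^sub>0 int) set) \<Rightarrow>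
   ((('v, 'a, 'k) alg list \<Rightarrow>\<^sub>0 int) set \<Rightarrow> ('v, 'a, 'k) alg) \<Rightarrow> bool" where
  "is_bar_resolution Q I b \<epsilon> \<longleftrightarrow>
     (\<forall>n. b (Suc n) \<in> bimod_hom (malg Q I) (Bar Q I (Suc n)) (Bar Q I n)) \<and>
     (\<forall>n. \<forall>as\<in>bar_gens Q I (Suc n).
        b (Suc n) (bar_tensor Q I (Suc n) as) =
          (\<Oplus>\<^bsub>Bar Q I n\<^esub>i\<in>{0..n + 1}.
             let u = bar_tensor Q I n (take i as @ (as ! i \<otimes>\<^bsub>malg Q I\<^esub> as ! (i + 1)) # drop (i + 2) as)
             in if even i then u else \<ominus>\<^bsub>Bar Q I n\<^esub> u)) \<and>
     \<epsilon> \<in> bimod_hom (malg Q I) (Bar Q I 0) (alg_bimodule Q I) \<and>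
     (\<forall>a\<in>carrier (malg Q I). \<forall>c\<in>carrier (malg Q I).
        \<epsilon> (bar_tensor Q I 0 [a, c]) = a \<otimes>\<^bsub>malg Q I\<^esub> c)"

definition is_Bardzell_resolution ::
  "('v, 'a) pre_digraph \<Rightarrow> (('v, 'a) path \<Rightarrow>\<^sub>0 'k::field) set \<Rightarrow>
   (nat \<Rightarrow> (('v, 'a, 'k) ap_gen \<Rightarrow>\<^sub>0 int) set \<Rightarrow> (('v, 'a, 'k) ap_gen \<Rightarrow>\<^sub>0 int) set) \<Rightarrow>
   ((('v, 'a, 'k) ap_gen \<Rightarrow>\<^sub>0 int) set \<Rightarrow> ('v, 'a, 'k) alg) \<Rightarrow> bool" where
  "is_Bardzell_resolution Q I d \<mu> \<longleftrightarrow>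
     (\<forall>n. d (Suc n) \<in> bimod_hom (malg Q I) (Ap Q I (Suc n)) (Ap Q I n)) \<and>
     (\<forall>\<alpha>\<in>arcs Q.
        d 1 (ap_tensor Q I 1 \<one>\<^bsub>malg Q I\<^esub> (arrow Q \<alpha>) \<one>\<^bsub>malg Q I\<^esub>) =
          ap_tensor Q I 0 (pcls Q I (arrow Q \<alpha>)) (triv (head Q \<alpha>)) \<one>\<^bsub>malg Q I\<^esub> \<ominus>\<^bsub>Ap Q I 0\<^esub>
          ap_tensor Q I 0 \<one>\<^bsub>malg Q I\<^esub> (triv (tail Q \<alpha>)) (pcls Q I (arrow Q \<alpha>))) \<and>
     (\<forall>m\<ge>1. \<forall>w\<in>AP Q I (2 * m).
        d (2 * m) (ap_tensor Q I (2 * m) \<one>\<^bsub>malg Q I\<^esub> w \<one>\<^bsub>malg Q I\<^esub>) =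
          (\<Oplus>\<^bsub>Ap Q I (2 * m - 1)\<^esub>\<psi>\<in>Sub Q I (2 * m) w. occ_tensor Q I (2 * m - 1) w \<psi>)) \<and>
     (\<forall>m\<ge>1. \<forall>w\<in>AP Q I (2 * m + 1). \<forall>\<psi>\<^sub>1 \<psi>\<^sub>2.
        Sub Q I (2 * m + 1) w = {\<psi>\<^sub>1, \<psi>\<^sub>2} \<and> fst \<psi>\<^sub>1 = 0 \<and> snd \<psi>\<^sub>2 = plength w \<longrightarrow>
        d (2 * m + 1) (ap_tensor Q I (2 * m + 1) \<one>\<^bsub>malg Q I\<^esub> w \<one>\<^bsub>malg Q I\<^esub>) =
          ap_tensor Q I (2 * m) (pcls Q I (lpart Q w \<psi>\<^sub>2)) (pseg Q w \<psi>\<^sub>2) \<one>\<^bsub>malg Q I\<^esub> \<ominus>\<^bsub>Ap Q I (2 * m)\<^esub>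
          ap_tensor Q I (2 * m) \<one>\<^bsub>malg Q I\<^esub> (pseg Q w \<psi>\<^sub>1) (pcls Q I (rpart Q w \<psi>\<^sub>1))) \<and>
     \<mu> \<in> bimod_hom (malg Q I) (Ap Q I 0) (alg_bimodule Q I) \<and>
     (\<forall>x\<in>verts Q. \<mu> (ap_tensor Q I 0 \<one>\<^bsub>malg Q I\<^esub> (triv x) \<one>\<^bsub>malg Q I\<^esub>) = pcls Q I (triv x))"


section \<open>The comparison maps\<close>

text \<open>The elements of \<open>Sub(w)\<close> have distinct starting positions, so \<open>\<zeta>\<^sub>2, \<dots>, \<zeta>\<^sub>m\<close> are those that do
  not start first.\<close>

definition is_F ::
  "('v, 'a) pre_digraph \<Rightarrow> (('v, 'a) path \<Rightarrow>\<^sub>0 'k::field) set \<Rightarrow>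
   (nat \<Rightarrow> (('v, 'a, 'k) ap_gen \<Rightarrow>\<^sub>0 int) set \<Rightarrow> (('v, 'a, 'k) alg list \<Rightarrow>\<^sub>0 int) set) \<Rightarrow> bool" where
  "is_F Q I F \<longleftrightarrow>
     (\<forall>n. F n \<in> bimod_hom (malg Q I) (Ap Q I n) (Bar Q I n)) \<and>
     (\<forall>x\<in>verts Q.
        F 0 (ap_tensor Q I 0 \<one>\<^bsub>malg Q I\<^esub> (triv x) \<one>\<^bsub>malg Q I\<^esub>) =
          bar_tensor Q I 0 [pcls Q I (triv x), \<one>\<^bsub>malg Q I\<^esub>]) \<and>
     (\<forall>\<alpha>\<in>arcs Q.
        F 1 (ap_tensor Q I 1 \<one>\<^bsub>malg Q I\<^esub> (arrow Q \<alpha>) \<one>\<^bsub>malg Q I\<^esub>) =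
          bar_tensor Q I 1 [\<one>\<^bsub>malg Q I\<^esub>, pcls Q I (arrow Q \<alpha>), \<one>\<^bsub>malg Q I\<^esub>]) \<and>
     (\<forall>n\<ge>2. \<forall>w\<in>AP Q I n.
        F n (ap_tensor Q I n \<one>\<^bsub>malg Q I\<^esub> w \<one>\<^bsub>malg Q I\<^esub>) =
          (\<Oplus>\<^bsub>Bar Q I n\<^esub>\<zeta>\<in>{\<zeta> \<in> Sub Q I n w. \<exists>\<zeta>'\<in>Sub Q I n w. fst \<zeta>' < fst \<zeta>}.
             one_tensor Q I (n - 1)
               (ract (Bar Q I (n - 1))
                 (lact (Bar Q I (n - 1)) (pcls Q I (lpart Q w \<zeta>))
                   (F (n - 1) (ap_tensor Q I (n - 1) \<one>\<^bsub>malg Q I\<^esub> (pseg Q w \<zeta>) \<one>\<^bsub>malg Q I\<^esub>)))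
                 (pcls Q I (rpart Q w \<zeta>)))))"

text \<open>In the list \<open>vs = [v\<^sub>1, \<dots>, v\<^sub>n]\<close> the entry \<open>v\<^sub>i\<close> is \<open>vs ! (i - 1)\<close>.\<close>

definition well_concatenated ::
  "('v, 'a) pre_digraph \<Rightarrow> (('v, 'a) path \<Rightarrow>\<^sub>0 'k::field) set \<Rightarrow> nat \<Rightarrow> ('v, 'a) path list \<Rightarrow> bool" where
  "well_concatenated Q I n vs \<longleftrightarrow> length vs = n \<and> set vs \<subseteq> nonzero_paths Q I \<and>
     (\<forall>i. 1 \<le> i \<and> i \<le> n - 1 \<longrightarrow> target Q (vs ! (i - 1)) = source (vs ! i))"

definition M_odd :: "(('v, 'a) path \<Rightarrow>\<^sub>0 'k::field) set \<Rightarrow> ('v, 'a) path list \<Rightarrow> nat set" where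
  "M_odd I vs = {j. 1 \<le> j \<and> 2 * j \<le> length vs \<and>
     pbasis (pcat (vs ! (2 * j - 2)) (vs ! (2 * j - 1))) \<notin> I}"

definition M_even :: "(('v, 'a) path \<Rightarrow>\<^sub>0 'k::field) set \<Rightarrow> ('v, 'a) path list \<Rightarrow> nat set" where
  "M_even I vs = {j. 1 \<le> j \<and> 2 * j + 1 \<le> length vs \<and>
     pbasis (pcat (vs ! (2 * j - 1)) (vs ! (2 * j))) \<notin> I}"

definition good :: "(('v, 'a) path \<Rightarrow>\<^sub>0 'k::field) set \<Rightarrow> ('v, 'a) path list \<Rightarrow> bool" where
  "good I vs \<longleftrightarrow> even (length vs) \<and> M_odd I vs = {} \<or> odd (length vs) \<and> M_even I vs = {}"

definition \<chi> ::
  "('v, 'a) pre_digraph \<Rightarrow> (('v, 'a) path \<Rightarrow>\<^sub>0 'k::field) set \<Rightarrow> ('v, 'a) path list \<Rightarrow> occ set" where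
  "\<chi> Q I vs = occs Q (AP Q I (length vs)) (pconcat vs)"

definition is_G ::
  "('v, 'a) pre_digraph \<Rightarrow> (('v, 'a) path \<Rightarrow>\<^sub>0 'k::field) set \<Rightarrow>
   (nat \<Rightarrow> (('v, 'a, 'k) alg list \<Rightarrow>\<^sub>0 int) set \<Rightarrow> (('v, 'a, 'k) ap_gen \<Rightarrow>\<^sub>0 int) set) \<Rightarrow> bool" where
  "is_G Q I G \<longleftrightarrow>
     (\<forall>n. G n \<in> bimod_hom (malg Q I) (Bar Q I n) (Ap Q I n)) \<and>
     G 0 (bar_tensor Q I 0 [\<one>\<^bsub>malg Q I\<^esub>, \<one>\<^bsub>malg Q I\<^esub>]) =
       (\<Oplus>\<^bsub>Ap Q I 0\<^esub>x\<in>verts Q. ap_tensor Q I 0 \<one>\<^bsub>malg Q I\<^esub> (triv x) \<one>\<^bsub>malg Q I\<^esub>) \<and>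
     (\<forall>v\<in>nonzero_paths Q I.
        G 1 (bar_tensor Q I 1 [\<one>\<^bsub>malg Q I\<^esub>, pcls Q I v, \<one>\<^bsub>malg Q I\<^esub>]) =
          (if plength v = 0 then \<zero>\<^bsub>Ap Q I 1\<^esub>
           else (\<Oplus>\<^bsub>Ap Q I 1\<^esub>i\<in>{1..plength v}. occ_tensor Q I 1 v (i - 1, i)))) \<and>
     (\<forall>n\<ge>2. \<forall>vs. well_concatenated Q I n vs \<longrightarrow>
        (let T = pconcat vs;
             z = G n (bar_tensor Q I n (\<one>\<^bsub>malg Q I\<^esub> # map (pcls Q I) vs @ [\<one>\<^bsub>malg Q I\<^esub>]))
         in (\<not> good I vs \<or> \<chi> Q I vs = {} \<longrightarrow> z = \<zero>\<^bsub>Ap Q I n\<^esub>) \<and>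
            (good I vs \<and> even n \<longrightarrow>
               (\<forall>w\<^sub>1. least_start (\<chi> Q I vs) w\<^sub>1 \<longrightarrow> z = occ_tensor Q I n T w\<^sub>1)) \<and>
            (good I vs \<and> odd n \<and> \<chi> Q I vs \<noteq> {} \<longrightarrow>
               z = (\<Oplus>\<^bsub>Ap Q I n\<^esub>w\<in>{w \<in> \<chi> Q I vs. 0 \<le> fst w \<and> fst w < plength (hd vs)}.
                      occ_tensor Q I n T w))))"

end

theory Submission
  imports Defs
begin

text \<open>Over a field, every module of both complexes has a basis of composable lists of nonzero paths: for the
  bar module \<open>A\<^bsup>\<otimes>(n+2)\<^esup>\<close> the lists \<open>[p, v\<^sub>1, \<dots>, v\<^sub>n, q]\<close>, for \<open>A \<otimes> kAP\<^sub>n \<otimes> A\<close> the lists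
  \<open>[p, w, q]\<close> with \<open>w \<in> AP\<^sub>n\<close>. A bimodule map amounts to a linear map on these coordinates that commutes
  with multiplication on the first and on the last path, hence is determined by its values on lists whose
  outer entries are trivial. This gives existence of all the maps, and it turns each of the four equations
  into an identity on generators (\<open>represents_exists\<close>, \<open>representsI\<close>, \<open>chom_eqI\<close>).

  The identities concern positions on one path \<open>T\<close>. Let \<open>zer i j\<close> say that the segment of \<open>T\<close> from \<open>i\<close> to \<open>j\<close>
  lies in \<open>I\<close>. An element of \<open>AP\<^sub>n\<close> is then an Anick chain \<open>u\<^sub>0 < u\<^sub>1 = u\<^sub>0 + 1 < u\<^sub>2 < \<dots> < u\<^sub>n\<close>, where \<open>u\<^bsub>k+2\<^esub>\<close> is
  the first position with \<open>zer u\<^sub>k u\<^bsub>k+2\<^esub>\<close> and the segment from \<open>u\<^bsub>k+1\<^esub>\<close> to \<open>u\<^bsub>k+2\<^esub>\<close> is nonzero. Either end of a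
  chain interval determines the other, and the reversal of a line turns chain intervals into chain
  intervals; all facts about overlapping elements of \<open>AP\<^sub>n\<close> follow from these two (\<open>ap_reflect\<close>, \<open>ap_link\<close>).

  For \<open>G\<close>, a list \<open>v\<^sub>1, \<dots>, v\<^sub>n\<close> is a sequence of cuts of \<open>T = v\<^sub>1 \<dots> v\<^sub>n\<close>, and the bar differential is the alternating
  sum over the ways to drop one cut. In \<open>cut_sum_boundary\<close> this sum collapses, by telescoping along
  consecutive chain intervals, to the boundary of the intervals that \<open>G\<close> selects.

  For \<open>F\<close>, the map \<open>u \<mapsto> 1 \<otimes> u\<close> is a contracting homotopy of the bar complex, so
  \<open>b F\<^sub>n = F\<^bsub>n-1\<^esub> D - 1 \<otimes> b F\<^bsub>n-1\<^esub> D\<close> on a generator \<open>w\<close>, where \<open>D\<close> is the part of \<open>d w\<close> that omits the first face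
  \<open>\<zeta>\<^sub>1\<close>. By induction and \<open>d d = 0\<close> (\<open>boundary_boundary\<close>), the last term is \<open>F\<^bsub>n-1\<^esub>\<close> applied to the first face: the
  only other contribution would come from the first face of \<open>\<zeta>\<^sub>1\<close>, and its right factor contains the
  segment from \<open>u\<^bsub>n-2\<^esub>\<close> to \<open>u\<^sub>n\<close>, which is zero.\<close>

abbreviation supp :: "('x \<Rightarrow>\<^sub>0 'k::zero) \<Rightarrow> 'x set" where
  "supp \<equiv> Poly_Mapping.keys"

abbreviation sgl :: "'x \<Rightarrow> 'k::zero \<Rightarrow> ('x \<Rightarrow>\<^sub>0 'k)" where
  "sgl \<equiv> Poly_Mapping.single"

section \<open>Anick chains on a line\<close>

text \<open>The position \<open>z\<close> closes the earliest zero segment that starts at \<open>x\<close>, and this zero segment is not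
  already contained in the segment that starts at \<open>y\<close>.\<close>

definition anick_step :: "(nat => nat => bool) => nat => nat => nat => bool" where
 "anick_step zer x y z \<longleftrightarrow> zer x z \<and> (\<forall>z'. zer x z' --> z <= z') \<and> \<not> zer y z"

definition anick_chain :: "(nat => nat => bool) => nat => (nat => nat) => bool" where
 "anick_chain zer n u \<longleftrightarrow> (1 <= n --> u 1 = Suc (u 0)) \<and>
  (\<forall>k. k + 2 <= n --> anick_step zer (u k) (u (k + 1)) (u (k + 2)))"

definition ap_intervals :: "(nat => nat => bool) => nat => occ set" where
 "ap_intervals zer n = {(u 0, u n) | u. anick_chain zer n u}"

text \<open>Reversal of the line segment from \<open>0\<close> to \<open>N\<close>.\<close>

definition reflect :: "nat => (nat => nat => bool) => nat => nat => bool" where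
 "reflect N zer i j \<longleftrightarrow> zer (N - j) (N - i)"

text \<open>The chain read from the left end alone: the minimality condition leaves no choice after the
  start, so this is the only candidate for a chain that starts at \<open>i\<close>.\<close>

fun reflected_chain :: "(nat => nat => bool) => nat => nat => nat" where
 "reflected_chain zer i 0 = i"
| "reflected_chain zer i (Suc 0) = Suc i"
| "reflected_chain zer i (Suc (Suc k)) = (LEAST z. zer (reflected_chain zer i k) z)"

text \<open>The only properties of a monomial ideal that the combinatorics uses: a segment that contains a zero
  segment is zero, and zero segments have length at least two because \<open>I \<subseteq> J\<^sup>2\<close>.\<close>

locale zero_intervals =
 fixes zer :: "nat => nat => bool"
 assumes zer_mono: "zer i j ==> i' <= i ==> j <= j' ==> zer i' j'"
  and zer_length: "zer i j ==> i + 2 <= j"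
begin

abbreviation "step \<equiv> anick_step zer"
abbreviation "chain \<equiv> anick_chain zer"
abbreviation "ap \<equiv> ap_intervals zer"

lemma chain_step: "chain n u ==> k + 2 <= n ==> step (u k) (u (k + 1)) (u (k + 2))"
 by (auto simp: anick_chain_def)

lemma chain_zer: "chain n u ==> k + 2 <= n ==> zer (u k) (u (k + 2))"
 using chain_step by (auto simp: anick_step_def)

lemma chain_least: "chain n u ==> k + 2 <= n ==> zer (u k) z ==> u (k + 2) <= z"
 using chain_step[of n u k] by (auto simp: anick_step_def)

lemma chain_first: "chain n u ==> 1 <= n ==> u 1 = Suc (u 0)"
 by (auto simp: anick_chain_def)

lemma chain_prefix: "chain n u ==> m <= n ==> chain m u"
 by (auto simp: anick_chain_def)

lemma chain_not_zer: assumes "chain n u" "k + 1 <= n" shows "\<not> zer (u k) (u (k + 1))"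
proof (cases k)
 case 0
 then show ?thesis using assms chain_first[of n u] zer_length[of "u 0" "u 1"] by auto
next
 case (Suc l)
 then show ?thesis using assms chain_step[of n u l] by (auto simp: anick_step_def)
qed

lemma chain_less_Suc: assumes "chain n u" "k + 1 <= n" shows "u k < u (k + 1)"
proof (cases k)
 case 0
 then show ?thesis using assms chain_first[of n u] by auto
next
 case (Suc l)
 have "zer (u l) (u (l + 2))" using chain_zer assms Suc by simp
 moreover have "\<not> zer (u l) (u (l + 1))" using chain_not_zer assms Suc by simp
 ultimately have "\<not> u (l + 2) <= u (l + 1)" using zer_mono by blast
 then show ?thesis using Suc by simp
qed

lemma chain_mono: assumes "chain n u" "k <= l" "l <= n" shows "u k <= u l"
 using assms(2,3)
proof (induction l rule: dec_induct)
 case (step l)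
 then show ?case using chain_less_Suc[OF assms(1), of l] by simp
qed simp

lemma chain_less: assumes "chain n u" "k < l" "l <= n" shows "u k < u l"
 using chain_less_Suc[OF assms(1), of k] chain_mono[OF assms(1), of "k+1" l] assms by simp

lemma chain_unique:
 assumes "chain n u" "chain n' u'" "u 0 = u' 0" "k <= n" "k <= n'"
 shows "u k = u' k"
 using assms(4,5)
proof (induction k rule: less_induct)
 case (less k)
 have "k = 0 \<or> k = 1 \<or> (\<exists>l. k = l + 2)" by presburger
 then consider "k = 0" | "k = 1" | l where "k = l + 2" by blast
 then show ?case
 proof cases
  case 3
  have "u l = u' l" using less 3 by simp
  then show ?thesis using 3 less
  chain_least[OF assms(1), of l "u' (l+2)"] chain_least[OF assms(2), of l "u (l+2)"]
  chain_zer[OF assms(1), of l] chain_zer[OF assms(2), of l] by auto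
 qed (use assms less chain_first[OF assms(1)] chain_first[OF assms(2)] in auto)
qed

lemma chain_odd_le:
 assumes "chain n c" "c 0 < y 0" "\<And>j. j < k ==> zer (y j) (y (j + 1))" "2 * k + 1 <= n"
 shows "c (2 * k + 1) <= y k"
 using assms(3,4)
proof (induction k)
 case 0
 then show ?case using assms(2) chain_first[OF assms(1)] by simp
next
 case (Suc k)
 have "c (2 * k + 1) <= y k" using Suc by simp
 then have "zer (c (2 * k + 1)) (y (k + 1))" using Suc.prems(1)[of k] zer_mono by blast
 from chain_least[OF assms(1) _ this] Suc.prems show ?case by simp
qed

text \<open>Two chains interleave because each step depends monotonically on the position two steps earlier.\<close>

lemma chain_interleave:
 assumes "chain n u" "chain n' u'" "u 0 < u' 0" "2 * k + 1 <= n" "2 * k <= n'"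
 shows "u (2 * k + 1) <= u' (2 * k)"
proof -
 have "zer (u' (2 * j)) (u' (2 * (j + 1)))" if "j < k" for j
  using chain_zer[OF assms(2), of "2 * j"] that assms(5) by simp
 from chain_odd_le[of n u "\<lambda>j. u' (2 * j)" k, OF assms(1) _ this assms(4)]
 show ?thesis using assms(3) by simp
qed

lemma apE: assumes "(i, j) \<in> ap n" obtains u where "chain n u" "u 0 = i" "u n = j"
 using assms by (auto simp: ap_intervals_def)

lemma apI: "chain n u ==> (u 0, u n) \<in> ap n"
 by (auto simp: ap_intervals_def)

lemma ap_0: "ap 0 = {(i, i) | i. True}"
 by (auto simp: ap_intervals_def anick_chain_def)

lemma ap_1: "ap 1 = {(i, Suc i) | i. True}"
proof -
 have "\<exists>u::nat => nat. (i, Suc i) = (u 0, u 1) \<and> u 1 = Suc (u 0)" for i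
  by (intro exI[where x = "\<lambda>k. i + k"]) simp
 then show ?thesis unfolding ap_intervals_def anick_chain_def by force
qed

lemma ap_le: "(i, j) \<in> ap n ==> i <= j"
 by (metis apE chain_mono le0 order_refl)

lemma ap_less: "(i, j) \<in> ap n ==> 1 <= n ==> i < j"
 by (metis apE chain_less One_nat_def Suc_le_eq order_refl)

lemma ap_end_unique: "(i, j) \<in> ap n ==> (i, j') \<in> ap n ==> j = j'"
 by (metis apE chain_unique order_refl)

lemma ap_end_less:
 assumes "(i, j) \<in> ap n" "(i', j') \<in> ap n" "i < i'"
 shows "j < j'"
proof -
 obtain u where u: "chain n u" "u 0 = i" "u n = j" using assms apE by blast
 obtain u' where u': "chain n u'" "u' 0 = i'" "u' n = j'" using assms apE by blast
 note il = chain_interleave[OF u(1) u'(1)]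
 have "(\<exists>k. n = 2 * k + 1) \<or> n = 0 \<or> (\<exists>k. n = 2 * k + 2)" by presburger
 then consider k where "n = 2 * k + 1" | "n = 0" | k where "n = 2 * k + 2" by blast
 then show ?thesis
 proof cases
  case 1
  have "u n <= u' (2 * k)" using il[of k] 1 u u' assms by simp
  also have "\<dots> < u' n" using chain_less_Suc[OF u'(1), of "2*k"] 1 by simp
  finally show ?thesis using u u' by simp
 next
  case 2
  then show ?thesis using u u' assms by simp
 next
  case 3
  have a: "u (2 * k + 1) <= u' (2 * k)" using il[of k] 3 u u' assms by simp
  have z: "zer (u' (2 * k)) (u' n)" using chain_zer[OF u'(1), of "2*k"] 3 by simp
  then have z': "zer (u (2 * k + 1)) (u' n)" using a zer_mono by blast
  have "\<not> zer (u (2 * k + 1)) (u n)" using chain_not_zer[OF u(1), of "2*k+1"] 3 by simp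
  then have "\<not> u' n <= u n" using z' zer_mono by blast
  then show ?thesis using u u' by simp
 qed
qed

lemma ap_start_unique: "(i, j) \<in> ap n ==> (i', j) \<in> ap n ==> i = i'"
 by (metis ap_end_less less_irrefl linorder_neqE_nat)

lemma ap_start_less_iff:
 "(i, j) \<in> ap n ==> (i', j') \<in> ap n ==> i < i' \<longleftrightarrow> j < j'"
 by (metis ap_end_less ap_end_unique less_asym linorder_neqE_nat less_irrefl)

lemma reflect_zero_intervals: "zero_intervals (reflect N zer)"
proof
 show "reflect N zer i' j'" if "reflect N zer i j" "i' <= i" "j <= j'" for i j i' j'
  using that zer_mono unfolding reflect_def by (meson diff_le_mono2)
 show "i + 2 <= j" if "reflect N zer i j" for i j
  using that zer_length unfolding reflect_def by fastforce
qed

text \<open>Chains are defined from left to right, but a chain interval can also be rebuilt from its right end: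
  the greedy chain of the reversed line hits the gaps of the original chain. This is what makes starting
  positions unique.\<close>

lemma ap_reflect:
 assumes "(i, j) \<in> ap n" "j <= N"
 shows "(N - j, N - i) \<in> ap_intervals (reflect N zer) n"
proof -
 obtain u where u: "chain n u" "u 0 = i" "u n = j" using assms apE by blast
 define w where "w = reflected_chain (reflect N zer) (N - j)"
 have w01: "w 0 = N - j" "w 1 = Suc (N - j)" by (simp_all add: w_def)
 have w2: "w (k + 2) = (LEAST z. reflect N zer (w k) z)" for k by (simp add: w_def)
 have uN: "u k <= N" if "k <= n" for k
  using chain_mono[OF u(1) that order_refl] u assms by simp
 define iv where "iv k \<longleftrightarrow> w k <= N \<and> u (n - k) <= N - w k \<and> (k = 0 --> N - w k = u n) \<and>
  (0 < k --> N - w k < u (n - k + 1))" for k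
 have main: "iv k \<and> iv (k + 1) \<and> reflect N zer (w k) (w (k + 2)) \<and> iv (k + 2)"
  if "k + 2 <= n" "iv k" "iv (k + 1)" for k
 proof -
  obtain m where n: "n = m + k + 2" using \<open>k + 2 <= n\<close> by (metis add.assoc add.commute le_Suc_ex)
  have xN: "u m <= N" using uN n by simp
  have ivk: "w k <= N" "u (m + 2) <= N - w k" "k = 0 ==> N - w k = u n"
  "0 < k ==> N - w k < u (m + 3)"
  using \<open>iv k\<close> by (auto simp: iv_def n add.commute numeral_3_eq_3)
  have z: "zer (u m) (u (m + 2))" using chain_zer[OF u(1), of m] n by simp
  have z1: "zer (u m) (N - w k)" using zer_mono[OF z] ivk by blast
  have r: "reflect N zer (w k) (N - u m)" using z1 xN by (simp add: reflect_def)
  have rw: "reflect N zer (w k) (w (k + 2))" unfolding w2 by (rule LeastI, rule r)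
  have le: "w (k + 2) <= N - u m" unfolding w2 by (rule Least_le, rule r)
  have lt: "N - w (k + 2) < u (m + 1)"
  proof (rule ccontr)
  assume "\<not> ?thesis"
  then have z2: "zer (u (m + 1)) (N - w k)"
  using rw zer_mono[of "N - w (k + 2)" "N - w k" "u (m + 1)" "N - w k"]
  unfolding reflect_def by simp
  show False
  proof (cases "k = 0")
  case True
  then show False using z2 ivk(3) chain_not_zer[OF u(1), of "m + 1"] n by simp
  next
  case False
  then have "u (m + 3) <= N - w k"
  using chain_least[OF u(1) _ z2] n by (simp add: numeral_3_eq_3)
  then show False using ivk(4) False by simp
  qed
  qed
  have "n - (k + 2) = m" using n by simp
  then have "iv (k + 2)" using le lt xN unfolding iv_def by auto
  then show ?thesis using that rw by simp
 qed
 have iv0: "iv 0" using assms u w01 by (simp add: iv_def)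
 have iv1: "iv 1" if "1 <= n"
 proof -
  have "u (n - 1) < u n" using chain_less_Suc[OF u(1), of "n - 1"] that by simp
  then show ?thesis using assms u w01 that by (auto simp: iv_def)
 qed
 have ivs: "k + 1 <= n ==> iv k \<and> iv (k + 1)" for k
 proof (induction k)
  case 0
  then show ?case using iv0 iv1 by simp
 next
  case (Suc k)
  then show ?case using main[of k] by simp
 qed
 have "anick_chain (reflect N zer) n w"
  unfolding anick_chain_def
 proof (intro conjI impI allI)
  show "w 1 = Suc (w 0)" using w01 by simp
  fix k assume k: "k + 2 <= n"
  have i: "iv k" "iv (k + 1)" using ivs[of k] k by simp_all
  have i2: "iv (k + 2)" and r: "reflect N zer (w k) (w (k + 2))" using main[OF k i] by auto
  have "\<not> zer (N - w (k + 2)) (N - w (k + 1))"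
  proof
  assume z: "zer (N - w (k + 2)) (N - w (k + 1))"
  obtain m where n: "n = m + k + 2" using k by (metis add.assoc add.commute le_Suc_ex)
  have "u m <= N - w (k + 2)" "N - w (k + 1) < u (m + 2)"
  using i(2) i2 by (auto simp: iv_def n)
  moreover from this have "u (m + 2) <= N - w (k + 1)"
  using chain_least[OF u(1), of m] zer_mono[OF z] n by simp
  ultimately show False by simp
  qed
  then show "anick_step (reflect N zer) (w k) (w (k + 1)) (w (k + 2))"
  unfolding anick_step_def using r w2[of k]
  by (auto simp: reflect_def intro: Least_le)
 qed
 moreover have "w n = N - i"
 proof (cases n)
  case 0
  then show ?thesis using u w01 by simp
 next
  case (Suc m)
  then have "iv n" using ivs[of m] by simp
  then show ?thesis using Suc u chain_first[OF u(1)] by (auto simp: iv_def)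
 qed
 ultimately show ?thesis unfolding ap_intervals_def using w01
  by (intro CollectI exI[where x = w]) simp
qed

lemma chain_cong:
 assumes "anick_chain z n u" "\<And>i j. j <= N ==> i <= N ==> z i j = zer i j" "u n <= N" "zero_intervals z"
 shows "anick_chain zer n u"
proof -
 interpret z: zero_intervals z by fact
 have uN: "u k <= N" if "k <= n" for k
  using z.chain_mono[OF assms(1) that] assms(3) by simp
 show ?thesis unfolding anick_chain_def
 proof (intro conjI impI allI)
  show "1 <= n ==> u 1 = Suc (u 0)" using z.chain_first assms by blast
  fix k assume k: "k + 2 <= n"
  have s: "anick_step z (u k) (u (k+1)) (u (k+2))" using z.chain_step[OF assms(1) k] .
  have N: "u k <= N" "u (k+1) <= N" "u (k+2) <= N" using uN k by auto
  show "step (u k) (u (k+1)) (u (k+2))" unfolding anick_step_def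
  proof (intro conjI allI impI)
  show "zer (u k) (u (k+2))" "\<not> zer (u (k+1)) (u (k+2))"
  using s assms(2) N by (auto simp: anick_step_def)
  fix z' assume z': "zer (u k) z'"
  show "u (k + 2) <= z'"
  proof (cases "z' <= N")
  case True
  then show ?thesis using s z' assms(2) N by (auto simp: anick_step_def)
  qed (use N in simp)
  qed
 qed
qed

lemma ap_reflect_iff:
 assumes "i <= N" "j <= N"
 shows "(N - j, N - i) \<in> ap_intervals (reflect N zer) n \<longleftrightarrow> (i, j) \<in> ap n"
proof
 assume "(N - j, N - i) \<in> ap_intervals (reflect N zer) n"
 from zero_intervals.ap_reflect[OF reflect_zero_intervals this, of N]
 have "(i, j) \<in> ap_intervals (reflect N (reflect N zer)) n" using assms by simp
 then obtain u where u: "anick_chain (reflect N (reflect N zer)) n u" "u 0 = i" "u n = j"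
  by (auto simp: ap_intervals_def)
 have "chain n u"
  by (rule chain_cong[OF u(1), where N = N])
  (use assms u zero_intervals.reflect_zero_intervals reflect_zero_intervals in
  \<open>auto simp: reflect_def\<close>)
 then show "(i, j) \<in> ap n" using u apI by blast
qed (use ap_reflect assms in auto)

end

section \<open>Prefixes, suffixes and overlaps of chains\<close>

context zero_intervals begin

lemma ap_prefix: assumes "(i, j) \<in> ap (Suc n)" shows "\<exists>e<j. (i, e) \<in> ap n"
proof -
 obtain u where u: "chain (Suc n) u" "u 0 = i" "u (Suc n) = j" using assms apE by blast
 have "(u 0, u n) \<in> ap n" using chain_prefix[OF u(1), of n] by (intro apI) simp
 then show ?thesis using u chain_less_Suc[OF u(1), of n] by auto
qed

lemma ap_suffix: assumes "(i, j) \<in> ap (Suc n)" shows "\<exists>s>i. (s, j) \<in> ap n"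
proof -
 interpret r: zero_intervals "reflect j zer" by (rule reflect_zero_intervals)
 have ij: "i < j" using ap_less[OF assms] by simp
 from ap_reflect[OF assms order_refl] have "(0, j - i) \<in> r.ap (Suc n)" by simp
 from r.ap_prefix[OF this] obtain e where e: "e < j - i" "(0, e) \<in> r.ap n" by blast
 then have "(j - j, j - (j - e)) \<in> r.ap n" by simp
 then have "(j - e, j) \<in> ap n" using ap_reflect_iff[of "j - e" j j n] by simp
 then show ?thesis using e by (intro exI[of _ "j - e"]) auto
qed

lemma chain_extend:
 assumes "chain n u" "1 <= n" "zer (u (n - 1)) N" "\<not> zer (u n) N"
 shows "\<exists>e\<le>N. (u 0, e) \<in> ap (Suc n)"
proof -
 define e where "e = (LEAST z. zer (u (n - 1)) z)"
 have z: "zer (u (n - 1)) e" unfolding e_def by (rule LeastI, rule assms(3))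
 have le: "e <= z" if "zer (u (n - 1)) z" for z unfolding e_def by (rule Least_le, rule that)
 have nz: "\<not> zer (u n) e" using assms(4) le[OF assms(3)] zer_mono by blast
 have "chain (Suc n) (u(Suc n := e))"
  unfolding anick_chain_def
 proof (intro conjI impI allI)
  show "(u(Suc n := e)) 1 = Suc ((u(Suc n := e)) 0)"
  using chain_first[OF assms(1,2)] assms(2) by simp
  fix k assume k: "k + 2 <= Suc n"
  show "step ((u(Suc n := e)) k) ((u(Suc n := e)) (k + 1)) ((u(Suc n := e)) (k + 2))"
  proof (cases "k + 2 <= n")
  case True
  then show ?thesis using chain_step[OF assms(1)] by simp
  next
  case False
  then have "k = n - 1" "k + 1 = n" "k + 2 = Suc n" using k assms(2) by auto
  then have "n - 1 \<noteq> Suc n" by simp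
  with \<open>k = n - 1\<close> \<open>k + 1 = n\<close> \<open>k + 2 = Suc n\<close> show ?thesis
  using z le nz assms(2) by (simp add: anick_step_def)
  qed
 qed
 from apI[OF this] show ?thesis using le[OF assms(3)] by auto
qed

lemma ap_extend_forward:
 assumes "(i, j) \<in> ap (2 * m)" "i < y 0" "\<And>k. k < m ==> zer (y k) (y (k + 1))" "\<not> zer j (y m)"
 shows "\<exists>e\<le>y m. (i, e) \<in> ap (2 * m + 1)"
proof (cases m)
 case 0
 then show ?thesis using assms ap_0 ap_1 by (auto intro!: exI[of _ "Suc i"])
next
 case (Suc l)
 obtain c where c: "chain (2 * m) c" "c 0 = i" "c (2 * m) = j" using assms apE by blast
 have "c (2 * l + 1) <= y l" using chain_odd_le[OF c(1), of y l] assms c Suc by simp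
 then have "zer (c (2 * l + 1)) (y m)" using assms(3)[of l] Suc zer_mono by auto
 then show ?thesis using chain_extend[OF c(1), of "y m"] Suc assms c by simp
qed

lemma ap_extend_backward:
 assumes "(i, j) \<in> ap (2 * m)" "y 0 <= i" "y m < j" "\<And>k. k < m ==> zer (y k) (y (k + 1))"
  "\<And>k. k <= m ==> y k <= j" "\<not> zer (y 0) i"
 shows "\<exists>s\<ge>y 0. (s, j) \<in> ap (2 * m + 1)"
proof -
 interpret r: zero_intervals "reflect j zer" by (rule reflect_zero_intervals)
 have ij: "i <= j" using ap_le[OF assms(1)] by simp
 define y' where "y' k = j - y (m - k)" for k
 have "(0, j - i) \<in> r.ap (2 * m)" using ap_reflect[OF assms(1) order_refl] by simp
 moreover have "0 < y' 0" using assms(3) by (simp add: y'_def)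
 moreover have "reflect j zer (y' k) (y' (k + 1))" if "k < m" for k
 proof -
  have "zer (y (m - (k + 1))) (y (m - k))" using assms(4)[of "m - (k + 1)"] that
  by (simp add: Suc_diff_Suc)
  then show ?thesis unfolding reflect_def y'_def using assms(5) by simp
 qed
 moreover have "\<not> reflect j zer (j - i) (y' m)"
  unfolding reflect_def y'_def using ij assms by simp
 ultimately obtain e where e: "e <= y' m" "(0, e) \<in> r.ap (2 * m + 1)"
  using r.ap_extend_forward by blast
 have ej: "e <= j - y 0" "y 0 <= j" using e assms(5)[of 0] unfolding y'_def by auto
 have "(j - j, j - (j - e)) \<in> r.ap (2 * m + 1)" using e ej by simp
 then have "(j - e, j) \<in> ap (2 * m + 1)" using ap_reflect_iff[of "j - e" j j] by simp
 then show ?thesis using ej by (intro exI[of _ "j - e"]) auto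
qed

text \<open>The reason why an element of \<open>AP\<^bsub>2m+1\<^esub>\<close> contains only two elements of \<open>AP\<^bsub>2m\<^esub>\<close>, its prefix and its suffix.\<close>

lemma ap_odd_end_le:
 assumes "(i, e) \<in> ap (2 * m + 1)" "(i', j') \<in> ap (2 * m)" "i < i'"
 shows "e <= j'"
proof -
 obtain u where u: "chain (2 * m + 1) u" "u 0 = i" "u (2 * m + 1) = e" using assms apE by blast
 obtain u' where u': "chain (2 * m) u'" "u' 0 = i'" "u' (2 * m) = j'" using assms apE by blast
 show ?thesis using chain_interleave[OF u(1) u'(1), of m] u u' assms by simp
qed

lemma ap_link_forward:
 assumes "(i, j) \<in> ap (2 * m)" "(i', j') \<in> ap (2 * m)" "i < i'" "\<not> zer j j'"
 shows "\<exists>e\<le>j'. (i, e) \<in> ap (2 * m + 1)"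
proof -
 obtain u' where u': "chain (2 * m) u'" "u' 0 = i'" "u' (2 * m) = j'" using assms apE by blast
 have "zer (u' (2 * k)) (u' (2 * (k + 1)))" if "k < m" for k
  using chain_zer[OF u'(1), of "2 * k"] that by simp
 then show ?thesis
  using ap_extend_forward[OF assms(1), where y = "\<lambda>k. u' (2 * k)"] assms u' by simp
qed

lemma ap_link_backward:
 assumes "(i, j) \<in> ap (2 * m)" "(i', j') \<in> ap (2 * m)" "i < i'" "\<not> zer i i'"
 shows "\<exists>s\<ge>i. (s, j') \<in> ap (2 * m + 1)"
proof -
 obtain u where u: "chain (2 * m) u" "u 0 = i" "u (2 * m) = j" using assms apE by blast
 have jj: "j < j'" using ap_end_less assms by blast
 have "zer (u (2 * k)) (u (2 * (k + 1)))" if "k < m" for k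
  using chain_zer[OF u(1), of "2 * k"] that by simp
 moreover have "u (2 * k) <= j'" if "k <= m" for k
  using chain_mono[OF u(1), of "2 * k" "2 * m"] that u jj by simp
 ultimately show ?thesis
  using ap_extend_backward[OF assms(2), where y = "\<lambda>k. u (2 * k)"] assms u jj by simp
qed

text \<open>Links two consecutive even chain intervals into an odd one; boundaries of odd intervals telescope along
  such links.\<close>

lemma ap_link:
 assumes "(i, j) \<in> ap (2 * m)" "(i', j') \<in> ap (2 * m)" "i < i'"
  "\<And>a b. (a, b) \<in> ap (2 * m) ==> i < a ==> i' <= a" "\<not> zer j j' \<or> \<not> zer i i'"
 shows "(i, j') \<in> ap (2 * m + 1)"
 using assms(5)
proof
 assume "\<not> zer j j'"
 from ap_link_forward[OF assms(1-3) this]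
 obtain e where e: "e <= j'" "(i, e) \<in> ap (2 * m + 1)" by blast
 then obtain s where s: "i < s" "(s, e) \<in> ap (2 * m)" using ap_suffix[of i e "2*m"] by auto
 have "\<not> s < i'" using assms(4)[OF s(2,1)] by simp
 then have "\<not> e < j'" using ap_start_less_iff[OF s(2) assms(2)] by simp
 then show ?thesis using e by simp
next
 assume "\<not> zer i i'"
 from ap_link_backward[OF assms(1-3) this]
 obtain s where s: "i <= s" "(s, j') \<in> ap (2 * m + 1)" by blast
 then obtain e where e: "e < j'" "(s, e) \<in> ap (2 * m)" using ap_prefix[of s j' "2*m"] by auto
 have "s < i'" using ap_start_less_iff[OF e(2) assms(2)] e(1) by simp
 then have "s = i" using assms(4)[OF e(2)] s(1) by fastforce
 then show ?thesis using s by simp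
qed

lemma ap_even_exists:
 assumes "\<And>k. k <= m ==> zer (y k) (y (k + 1))" "(i, j) \<in> ap (2 * m + 1)" "y 0 <= i"
  "\<not> zer (y 0) i" "\<not> zer j (y (m + 1))" "j <= y (m + 1)"
 shows "\<exists>s e. (s, e) \<in> ap (2 * m + 2) \<and> y 0 <= s \<and> e <= y (m + 1)"
 using assms
proof (induction m arbitrary: i j)
 case (0 i j)
 have ap: "(i, j) \<in> ap 1" and zy: "zer (y 0) (y 1)" and nz: "\<not> zer j (y 1)" and yi: "y 0 <= i"
  using "0.prems"(2) "0.prems"(1)[of 0] "0.prems"(5) "0.prems"(3) by simp_all
 have ij: "j = Suc i" using ap unfolding ap_1 by simp
 show ?case
 proof (cases "zer i (y 1)")
  case True
  obtain c where c: "chain 1 c" "c 0 = i" "c 1 = j" using ap apE by blast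
  then have "\<exists>e\<le>y 1. (i, e) \<in> ap (Suc 1)" using chain_extend[OF c(1), of "y 1"] True nz by simp
  then show ?thesis using yi by (auto simp: numeral_2_eq_2)
 next
  case False
  define S where "S = {s. zer s (y 1)}"
  have fin: "finite S" unfolding S_def by (rule finite_subset[of _ "{..y 1}"]) (use zer_length in force)+
  have ne: "y 0 \<in> S" using zy by (simp add: S_def)
  define s where "s = Max S"
  have sS: "s \<in> S" using Max_in[OF fin] ne s_def by blast
  have s0: "y 0 <= s" using Max_ge[OF fin ne] s_def by simp
  have ns: "\<not> zer (Suc s) (y 1)"
  proof
  assume "zer (Suc s) (y 1)"
  then have "Suc s <= s" using Max_ge[OF fin, of "Suc s"] unfolding s_def S_def by simp
  then show False by simp
  qed
  have "(s, Suc s) \<in> ap 1" unfolding ap_1 by simp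
  then obtain c where c: "chain 1 c" "c 0 = s" "c 1 = Suc s" by (rule apE)
  then have "\<exists>e\<le>y 1. (s, e) \<in> ap (Suc 1)"
  using chain_extend[OF c(1), of "y 1"] ns sS by (simp add: S_def)
  then show ?thesis using s0 by (auto simp: numeral_2_eq_2)
 qed
next
 case (Suc m' i j)
 define m where "m = Suc m'"
 define N where "N = y (m + 1)"
 have zy: "k <= m ==> zer (y k) (y (k + 1))" for k using Suc.prems(1) m_def by simp
 obtain c where c: "chain (2 * m + 1) c" "c 0 = i" "c (2 * m + 1) = j"
  using Suc.prems apE m_def by blast
 have pre: "(i, c (2 * m)) \<in> ap (2 * m)" using apI[OF chain_prefix[OF c(1), of "2*m"]] c by simp
 have njN: "\<not> zer j N" and jN: "j <= N" using Suc.prems by (auto simp: N_def m_def)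
 show ?case
 proof (cases "zer (c (2 * m)) N")
  case True
  have "\<exists>e\<le>N. (c 0, e) \<in> ap (Suc (2 * m + 1))"
  using chain_extend[OF c(1), of N] True njN c by simp
  then show ?thesis using Suc.prems(3) c(2) unfolding m_def N_def by auto
 next
  case False
  have i1: "i < y 1" using Suc.prems(3,4) zy[of 0] zer_mono[of "y 0" "y 1" "y 0" i] by force
  have cm: "c (2 * m' + 1) <= y (m' + 1)"
  using chain_odd_le[OF c(1), of "\<lambda>k. y (k + 1)" m'] i1 c zy m_def by simp
  have cn: "\<not> zer (c (2 * m' + 1)) (y (m' + 1))"
  proof
  assume "zer (c (2 * m' + 1)) (y (m' + 1))"
  then have "j <= y m" using chain_least[OF c(1), of "2 * m' + 1"] c m_def by simp
  then show False using njN zy[of m] zer_mono unfolding N_def by blast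
  qed
  have "(i, c (2 * m' + 1)) \<in> ap (2 * m' + 1)"
  using apI[OF chain_prefix[OF c(1), of "2*m'+1"]] c m_def by simp
  from Suc.IH[OF _ this _ _ cn cm] Suc.prems
  obtain s0 e0 where se0: "(s0, e0) \<in> ap (2 * m' + 2)" "y 0 <= s0" "e0 <= y (m' + 1)" by auto
  define W where "W = {(s, e). (s, e) \<in> ap (2 * m) \<and> y 0 <= s \<and> zer e N}"
  have finW: "finite W"
  proof (rule finite_subset)
  show "W <= {..N} \<times> {..N}" unfolding W_def using zer_length ap_le by fastforce
  qed simp
  have "(s0, e0) \<in> W" using se0 zy[of m] zer_mono unfolding W_def N_def m_def by auto
  then have "fst ` W \<noteq> {}" by blast
  from Max_in[OF finite_imageI[OF finW] this] obtain i0 j0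
  where w0: "(i0, j0) \<in> W" and i0: "i0 = Max (fst ` W)" by fastforce
  have max0: "s <= i0" if "(s, e) \<in> W" for s e
  unfolding i0 using Max_ge[OF finite_imageI[OF finW], of s fst] that by force
  have w0': "(i0, j0) \<in> ap (2 * m)" "y 0 <= i0" "zer j0 N" using w0 by (auto simp: W_def)
  have "j0 < c (2 * m)" using w0'(3) False zer_mono[of j0 N "c (2 * m)" N] by force
  then have i0i: "i0 < i" using ap_start_less_iff[OF w0'(1) pre] by simp
  define i1 where "i1 = (LEAST s. i0 < s \<and> (\<exists>e. (s, e) \<in> ap (2 * m)))"
  have ex: "i0 < i \<and> (\<exists>e. (i, e) \<in> ap (2 * m))" using i0i pre by blast
  from LeastI[of "\<lambda>s. i0 < s \<and> (\<exists>e. (s, e) \<in> ap (2 * m))", OF ex]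
  obtain j1 where ij1: "i0 < i1" "(i1, j1) \<in> ap (2 * m)" unfolding i1_def by blast
  have i1i: "i1 <= i" unfolding i1_def by (rule Least_le, rule ex)
  have "\<not> zer i0 i1" using Suc.prems(4) w0'(2) i1i zer_mono by blast
  moreover have "i1 <= a" if "(a, b) \<in> ap (2 * m)" "i0 < a" for a b
  unfolding i1_def by (rule Least_le) (use that in blast)
  ultimately have l: "(i0, j1) \<in> ap (2 * m + 1)"
  using ap_link[OF w0'(1) ij1(2) ij1(1)] by simp
  have nj1: "\<not> zer j1 N" using max0[of i1 j1] ij1 w0'(2) unfolding W_def by auto
  obtain u where u: "chain (2 * m + 1) u" "u 0 = i0" "u (2 * m + 1) = j1" using l apE by blast
  have "(i0, u (2 * m)) \<in> ap (2 * m)" using apI[OF chain_prefix[OF u(1), of "2*m"]] u by simp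
  then have "u (2 * m) = j0" using ap_end_unique w0' by blast
  then have "\<exists>e\<le>N. (i0, e) \<in> ap (Suc (2 * m + 1))"
  using chain_extend[OF u(1), of N] w0' nj1 u by simp
  then show ?thesis using w0'(2) unfolding m_def N_def by auto
 qed
qed

end

section \<open>The boundary of a chain interval\<close>

definition ap_inside :: "(nat => nat => bool) => nat => nat => nat => occ set" where
 "ap_inside zer n a b = {(i, j). (i, j) \<in> ap_intervals zer n \<and> a <= i \<and> j <= b}"

text \<open>Bardzell's differential with \<open>\<tau> \<zeta>\<close> in place of \<open>L(\<zeta>) \<otimes> \<zeta> \<otimes> R(\<zeta>)\<close>. In the odd case the two sums have
  at most one term each, the suffix and the prefix of \<open>w\<close>.\<close>

definition boundary_sum ::
 "(nat => nat => bool) => (occ => 'm::ab_group_add) => nat => occ => 'm" where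
 "boundary_sum zer \<tau> n w =
  (if even n then (\<Sum>\<zeta>\<in>ap_inside zer (n - 1) (fst w) (snd w). \<tau> \<zeta>)
  else (\<Sum>\<zeta>\<in>{\<zeta> \<in> ap_inside zer (n - 1) (fst w) (snd w). snd \<zeta> = snd w}. \<tau> \<zeta>) -
  (\<Sum>\<zeta>\<in>{\<zeta> \<in> ap_inside zer (n - 1) (fst w) (snd w). fst \<zeta> = fst w}. \<tau> \<zeta>))"

context zero_intervals begin

abbreviation "inside \<equiv> ap_inside zer"
abbreviation "bd \<equiv> boundary_sum zer"

lemma inside_iff: "(i, j) \<in> inside n a b \<longleftrightarrow> (i, j) \<in> ap n \<and> a <= i \<and> j <= b"
 by (simp add: ap_inside_def)

lemma finite_inside [simp]: "finite (inside n a b)"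
proof (rule finite_subset)
 show "inside n a b <= {..b} \<times> {..b}" unfolding ap_inside_def using ap_le by fastforce
qed simp

definition sfx :: "nat => occ => occ" where
 "sfx n w = ((THE s. (s, snd w) \<in> ap n), snd w)"

definition pfx :: "nat => occ => occ" where
 "pfx n w = (fst w, (THE e. (fst w, e) \<in> ap n))"

lemma sfx_eq: "(s, j) \<in> ap n ==> sfx n (i, j) = (s, j)"
 unfolding sfx_def using ap_start_unique by (auto intro!: the_equality)

lemma pfx_eq: "(i, e) \<in> ap n ==> pfx n (i, j) = (i, e)"
 unfolding pfx_def using ap_end_unique by (auto intro!: the_equality)

lemma bd_odd:
 assumes "odd n" "(i, j) \<in> ap n"
 shows "bd \<tau> n (i, j) = \<tau> (sfx (n - 1) (i, j)) - \<tau> (pfx (n - 1) (i, j))"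
proof -
 obtain m where n: "n = Suc m" using assms(1) by (metis odd_pos Suc_pred')
 obtain s where s: "i < s" "(s, j) \<in> ap m" using ap_suffix assms n by blast
 obtain e where e: "e < j" "(i, e) \<in> ap m" using ap_prefix assms n by blast
 have "{\<zeta> \<in> inside m i j. snd \<zeta> = j} = {(s, j)}"
  using s ap_start_unique by (auto simp: inside_iff)
 moreover have "{\<zeta> \<in> inside m i j. fst \<zeta> = i} = {(i, e)}"
  using e ap_end_unique by (auto simp: inside_iff)
 ultimately show ?thesis using assms(1) s e n by (simp add: boundary_sum_def sfx_eq pfx_eq)
qed

text \<open>Vanishing of the square of the differential.\<close>

lemma sum_supported:
 assumes "finite A" "B <= A" "\<And>x. x \<in> A ==> x \<notin> B ==> \<tau> x = (0::'m::comm_monoid_add)"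
 shows "sum \<tau> B = sum \<tau> A"
 using assms by (intro sum.mono_neutral_left) auto

lemma bd_bd_even:
 fixes \<tau> :: "occ => 'm::ab_group_add"
 assumes w: "(p, q) \<in> ap (2 * m + 2)"
  and \<tau>: "\<And>i j. p <= i ==> j <= q ==> zer p i \<or> zer j q ==> \<tau> (i, j) = 0"
 shows "bd (bd \<tau> (2 * m + 1)) (2 * m + 2) (p, q) = 0"
proof -
 define Z where "Z = inside (2 * m + 1) p q"
 have Zap: "\<zeta> \<in> ap (2 * m + 1)" "p <= fst \<zeta>" "snd \<zeta> <= q" if "\<zeta> \<in> Z" for \<zeta>
  using that by (cases \<zeta>, auto simp: Z_def inside_iff)+
 have sf: "\<exists>s>fst \<zeta>. sfx (2 * m) \<zeta> = (s, snd \<zeta>) \<and> (s, snd \<zeta>) \<in> ap (2 * m)" if "\<zeta> \<in> Z" for \<zeta>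
  using Zap[OF that] ap_suffix[of "fst \<zeta>" "snd \<zeta>" "2 * m"] sfx_eq[of _ "snd \<zeta>" "2 * m" "fst \<zeta>"]
  by auto
 have pf: "\<exists>e<snd \<zeta>. pfx (2 * m) \<zeta> = (fst \<zeta>, e) \<and> (fst \<zeta>, e) \<in> ap (2 * m)" if "\<zeta> \<in> Z" for \<zeta>
  using Zap[OF that] ap_prefix[of "fst \<zeta>" "snd \<zeta>" "2 * m"] pfx_eq[of "fst \<zeta>" _ "2 * m" "snd \<zeta>"]
  by auto
 have injs: "inj_on (sfx (2 * m)) Z"
  by (rule inj_onI) (metis Zap(1) ap_start_unique prod.collapse sfx_def snd_conv)
 have injp: "inj_on (pfx (2 * m)) Z"
  by (rule inj_onI) (metis Zap(1) ap_end_unique prod.collapse pfx_def fst_conv)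
 obtain u where u: "chain (2 * m + 2) u" "u 0 = p" "u (2 * m + 2) = q" using w apE by blast
 have uz: "zer (u (2 * k)) (u (2 * (k + 1)))" if "k <= m" for k
  using chain_zer[OF u(1), of "2 * k"] that by simp
 have key: "\<tau> \<eta> = 0 \<or> \<eta> \<in> sfx (2 * m) ` Z \<and> \<eta> \<in> pfx (2 * m) ` Z" if "\<eta> \<in> inside (2 * m) p q" for \<eta>
 proof -
  obtain i j where \<eta>: "\<eta> = (i, j)" by force
  then have ij: "(i, j) \<in> ap (2 * m)" "p <= i" "j <= q" using that by (auto simp: inside_iff)
  show ?thesis
  proof (cases "zer p i \<or> zer j q")
  case True
  then show ?thesis using \<tau> ij \<eta> by blast
  next
  case False
  have "zer p (u 2)" using uz[of 0] u by (simp add: numeral_2_eq_2)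
  then have i2: "i < u 2" using False zer_mono[of p "u 2" p i] by force
  have "\<exists>e\<le>u (2 * (m + 1)). (i, e) \<in> ap (2 * m + 1)"
  proof (rule ap_extend_forward[OF ij(1), where y = "\<lambda>k. u (2 * (k + 1))"])
  show "i < u (2 * (0 + 1))" using i2 by simp
  show "zer (u (2 * (k + 1))) (u (2 * (k + 1 + 1)))" if "k < m" for k using uz[of "k+1"] that by simp
  show "\<not> zer j (u (2 * (m + 1)))" using False u by simp
  qed
  then obtain e where e: "e <= q" "(i, e) \<in> ap (2 * m + 1)" using u by auto
  have "(i, j) = pfx (2 * m) (i, e)" using pfx_eq[OF ij(1)] by simp
  moreover have "(i, e) \<in> Z" using e ij by (simp add: Z_def inside_iff)
  ultimately have 1: "\<eta> \<in> pfx (2 * m) ` Z" using \<eta> by blast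
  have "zer (u (2 * m)) q" using uz[of m] u by simp
  then have jm: "u (2 * m) < j" using False zer_mono[of "u (2 * m)" q j q] by force
  have "\<exists>s\<ge>u (2 * 0). (s, j) \<in> ap (2 * m + 1)"
  proof (rule ap_extend_backward[OF ij(1), where y = "\<lambda>k. u (2 * k)"])
  show "u (2 * 0) <= i" "\<not> zer (u (2 * 0)) i" using u ij False by simp_all
  show "u (2 * m) < j" by (rule jm)
  show "zer (u (2 * k)) (u (2 * (k + 1)))" if "k < m" for k using uz that by simp
  show "u (2 * k) <= j" if "k <= m" for k
  using chain_mono[OF u(1), of "2 * k" "2 * m"] that jm by simp
  qed
  then obtain s where s: "p <= s" "(s, j) \<in> ap (2 * m + 1)" using u by auto
  have "(i, j) = sfx (2 * m) (s, j)" using sfx_eq[OF ij(1)] by simp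
  moreover have "(s, j) \<in> Z" using s ij by (simp add: Z_def inside_iff)
  ultimately have 2: "\<eta> \<in> sfx (2 * m) ` Z" using \<eta> by blast
  show ?thesis using 1 2 by blast
  qed
 qed
 have subs: "sfx (2 * m) ` Z <= inside (2 * m) p q"
  using sf Zap by (force simp: inside_iff)
 have subp: "pfx (2 * m) ` Z <= inside (2 * m) p q"
  using pf Zap by (force simp: inside_iff)
 have "bd (bd \<tau> (2 * m + 1)) (2 * m + 2) (p, q) = (\<Sum>\<zeta>\<in>Z. bd \<tau> (2 * m + 1) \<zeta>)"
  by (subst boundary_sum_def) (simp add: Z_def)
 also have "\<dots> = (\<Sum>\<zeta>\<in>Z. \<tau> (sfx (2 * m) \<zeta>) - \<tau> (pfx (2 * m) \<zeta>))"
  using Zap(1) bd_odd[of "2 * m + 1"] by (intro sum.cong refl) force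
 also have "\<dots> = sum \<tau> (sfx (2 * m) ` Z) - sum \<tau> (pfx (2 * m) ` Z)"
  by (simp add: sum_subtractf sum.reindex[OF injs] sum.reindex[OF injp])
 also have "sum \<tau> (sfx (2 * m) ` Z) = sum \<tau> (inside (2 * m) p q)"
  by (rule sum_supported[OF finite_inside subs]) (use key in blast)
 also have "sum \<tau> (pfx (2 * m) ` Z) = sum \<tau> (inside (2 * m) p q)"
  by (rule sum_supported[OF finite_inside subp]) (use key in blast)
 finally show ?thesis by simp
qed

lemma bd_bd_odd:
 fixes \<tau> :: "occ => 'm::ab_group_add"
 assumes w: "(p, q) \<in> ap (2 * m + 3)"
  and \<tau>: "\<And>i j. p <= i ==> j <= q ==> zer p i \<or> zer j q ==> \<tau> (i, j) = 0"
 shows "bd (bd \<tau> (2 * m + 2)) (2 * m + 3) (p, q) = 0"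
proof -
 have w': "(p, q) \<in> ap (Suc (2 * m + 2))" using w by (simp add: numeral_3_eq_3)
 obtain s where s: "p < s" "(s, q) \<in> ap (2 * m + 2)" using ap_suffix[OF w'] by blast
 obtain e where e: "e < q" "(p, e) \<in> ap (2 * m + 2)" using ap_prefix[OF w'] by blast
 obtain u where u: "chain (2 * m + 2) u" "u 0 = p" "u (2 * m + 2) = e" using e apE by blast
 obtain v where v: "chain (2 * m + 2) v" "v 0 = s" "v (2 * m + 2) = q" using s apE by blast
 have uz: "zer (u (2 * k)) (u (2 * (k + 1)))" if "k <= m" for k
  using chain_zer[OF u(1), of "2 * k"] that by simp
 have vz: "zer (v (2 * k)) (v (2 * (k + 1)))" if "k <= m" for k
  using chain_zer[OF v(1), of "2 * k"] that by simp
 have key: "\<tau> \<zeta> = 0 \<or> \<zeta> \<in> inside (2 * m + 1) s q \<and> \<zeta> \<in> inside (2 * m + 1) p e"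
  if "\<zeta> \<in> inside (2 * m + 1) p q" for \<zeta>
 proof -
  obtain i j where \<zeta>: "\<zeta> = (i, j)" by force
  then have ij: "(i, j) \<in> ap (2 * m + 1)" "p <= i" "j <= q" using that by (auto simp: inside_iff)
  show ?thesis
  proof (cases "zer p i \<or> zer j q")
  case True
  then show ?thesis using \<tau> ij \<zeta> by blast
  next
  case False
  obtain c where c: "chain (2 * m + 1) c" "c 0 = i" "c (2 * m + 1) = j" using ij apE by blast
  have "zer p (u 2)" using uz[of 0] u by (simp add: numeral_2_eq_2)
  then have i2: "i < u 2" using False zer_mono[of p "u 2" p i] by force
  have "zer (u (2 * (k + 1))) (u (2 * (k + 1 + 1)))" if "k < m" for k
  using uz[of "k + 1"] that by simp
  then have "c (2 * m + 1) <= u (2 * (m + 1))"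
  using chain_odd_le[OF c(1), of "\<lambda>k. u (2 * (k + 1))" m] i2 c by simp
  then have 1: "j <= e" using c u by simp
  have "s <= i"
  proof (rule ccontr)
  assume "\<not> s <= i"
  then have "c (2 * m + 1) <= v (2 * m)"
  using chain_odd_le[OF c(1), of "\<lambda>k. v (2 * k)" m] vz c v by simp
  then have "zer j q" using c v vz[of m] zer_mono[of "v (2*m)" q j q] by simp
  then show False using False by simp
  qed
  then show ?thesis using 1 ij \<zeta> by (simp add: inside_iff)
  qed
 qed
 have "bd (bd \<tau> (2 * m + 2)) (2 * m + 3) (p, q) =
  bd \<tau> (2 * m + 2) (s, q) - bd \<tau> (2 * m + 2) (p, e)"
  using bd_odd[of "2 * m + 3", OF _ w] sfx_eq[OF s(2)] pfx_eq[OF e(2)]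
  by (simp add: numeral_3_eq_3)
 also have "\<dots> = sum \<tau> (inside (2 * m + 1) s q) - sum \<tau> (inside (2 * m + 1) p e)"
  by (simp add: boundary_sum_def)
 also have "sum \<tau> (inside (2 * m + 1) s q) = sum \<tau> (inside (2 * m + 1) p q)"
  by (rule sum_supported[OF finite_inside]) (use key s in \<open>auto simp: ap_inside_def\<close>)
 also have "sum \<tau> (inside (2 * m + 1) p e) = sum \<tau> (inside (2 * m + 1) p q)"
  by (rule sum_supported[OF finite_inside]) (use key e in \<open>auto simp: ap_inside_def\<close>)
 finally show ?thesis by simp
qed

text \<open>The square of Bardzell's differential vanishes: the contributions either cancel in pairs or have an
  outer factor that contains a zero segment, on which \<open>\<tau>\<close> is assumed to vanish.\<close>

theorem boundary_boundary:
 fixes \<tau> :: "occ => 'm::ab_group_add"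
 assumes "2 <= n" "(p, q) \<in> ap n"
  and "\<And>i j. p <= i ==> j <= q ==> zer p i \<or> zer j q ==> \<tau> (i, j) = 0"
 shows "bd (bd \<tau> (n - 1)) n (p, q) = 0"
proof (cases "even n")
 case True
 then obtain k where "n = 2 * k" by (rule evenE)
 then have "n = 2 * (k - 1) + 2" using assms(1) by simp
 then show ?thesis using bd_bd_even[of p q "k - 1" \<tau>] assms by simp
next
 case False
 then obtain k where "n = 2 * k + 1" by (rule oddE)
 then have n: "n = 2 * (k - 1) + 3" using assms(1) by simp
 then have "n - 1 = 2 * (k - 1) + 2" by simp
 then show ?thesis using bd_bd_odd[of p q "k - 1" \<tau>] assms n by simp
qed

end

section \<open>Sums over intervals between cuts\<close>

text \<open>In terms of the cuts \<open>y 0 \<le> \<dots> \<le> y n\<close>, a factor is the segment between consecutive cuts; the second condition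
  says that the products indexed by \<open>\<M>\<^bsub>odd\<^esub>\<close> (for even \<open>n\<close>) or \<open>\<M>\<^bsub>even\<^esub>\<close> (for odd \<open>n\<close>) all vanish.\<close>

definition cuts_good :: "(nat => nat => bool) => nat => (nat => nat) => bool" where
 "cuts_good zer n y \<longleftrightarrow> (\<forall>k<n. \<not> zer (y k) (y (k + 1))) \<and>
  (\<forall>k. n mod 2 + 2 * k + 2 <= n --> zer (y (n mod 2 + 2 * k)) (y (n mod 2 + 2 * k + 2)))"

definition leftmost :: "occ set => occ set" where
 "leftmost W = {w \<in> W. \<forall>w'\<in>W. fst w <= fst w'}"

definition selected :: "(nat => nat => bool) => nat => (nat => nat) => occ set" where
 "selected zer n y =
  (if even n then leftmost (ap_inside zer n (y 0) (y n))
  else {w \<in> ap_inside zer n (y 0) (y n). fst w < y 1})"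

text \<open>The value of \<open>G\<close> on the factors cut out by \<open>y\<close>, with \<open>\<tau> \<zeta>\<close> in place of \<open>L(\<zeta>) \<otimes> \<zeta> \<otimes> R(\<zeta>)\<close>.\<close>

definition cut_sum ::
 "(nat => nat => bool) => (occ => 'm::ab_group_add) => nat => (nat => nat) => 'm" where
 "cut_sum zer \<tau> n y = (if cuts_good zer n y then sum \<tau> (selected zer n y) else 0)"

definition drop_cut :: "nat => (nat => nat) => nat => nat" where
 "drop_cut i y = (\<lambda>k. if k < i then y k else y (k + 1))"

lemma sum_delta_unique:
 assumes "\<And>j. j \<in> A ==> R j ==> j = a" "finite A"
 shows "(\<Sum>j\<in>A. if R j then V else (0::'m::comm_monoid_add)) = (if a \<in> A \<and> R a then V else 0)"
proof -
 have "(\<Sum>j\<in>A. if R j then V else 0) = (\<Sum>j\<in>A. if j = a then (if R a then V else 0) else 0)"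
  using assms(1) by (intro sum.cong) auto
 then show ?thesis using assms(2) by (simp add: sum.delta)
qed

lemma telescoping_pattern:
 fixes V :: "'m::ab_group_add" and P Q M :: "nat => bool"
 assumes M: "\<And>k. k < m ==> P k \<or> Q k ==> M k"
 shows "(\<Sum>l<m. if \<not> Q l \<and> M l \<and> (\<forall>k<l. P k) \<and> (\<forall>k<m. l < k --> Q k) then V else 0)
  - (\<Sum>j\<le>m. if (j < m --> \<not> P j \<and> M j) \<and> (\<forall>k<j. P k) \<and> (\<forall>k<m. j < k --> Q k) then V else 0)
  = (if \<forall>k<m. Q k then - V else 0)"
  (is "(\<Sum>l<m. if ?E l then V else 0) - (\<Sum>j\<le>m. if ?O j then V else 0) = _")
proof -
 define a where "a = (LEAST j. m <= j \<or> \<not> P j)"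
 have a: "m <= a \<or> \<not> P a" unfolding a_def by (rule LeastI[of _ m]) simp
 have am: "a <= m" unfolding a_def by (rule Least_le) simp
 have Pa: "P k" if "k < a" for k using not_less_Least[OF that[unfolded a_def]] by simp
 have O: "(\<Sum>j\<le>m. if ?O j then V else 0) = (if a \<in> {..m} \<and> ?O a then V else 0)"
 proof (rule sum_delta_unique)
  fix j assume j: "j \<in> {..m}" "?O j"
  show "j = a"
  proof (rule linorder_cases[of j a])
  assume "j < a" then show ?thesis using Pa j am by auto
  next
  assume "a < j" then show ?thesis using a j by auto
  qed
 qed simp
 show ?thesis
 proof (cases "\<forall>k<m. Q k")
  case True
  then have "?O a" using Pa a am M by auto
  then show ?thesis using O True am by simp
 next
  case False
  define S where "S = {k. k < m \<and> \<not> Q k}"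
  have fin: "finite S" unfolding S_def by simp
  have ne: "S \<noteq> {}" using False S_def by auto
  define b where "b = Max S"
  have b: "b < m" "\<not> Q b" using Max_in[OF fin ne] unfolding b_def S_def by auto
  have bQ: "Q k" if "b < k" "k < m" for k
  using Max_ge[OF fin, of k] that unfolding b_def S_def by fastforce
  have E: "(\<Sum>l<m. if ?E l then V else 0) = (if b \<in> {..<m} \<and> ?E b then V else 0)"
  proof (rule sum_delta_unique)
  fix j assume j: "j \<in> {..<m}" "?E j"
  show "j = b"
  proof (rule linorder_cases[of j b])
  assume "j < b" then show ?thesis using b j by auto
  next
  assume "b < j" then show ?thesis using bQ j by auto
  qed
  qed simp
  have "?E b \<longleftrightarrow> ?O a"
  proof (rule linorder_cases[of a b])
  assume ab: "a < b"
  then have "\<not> ?E b" using a b by auto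
  moreover have "\<not> ?O a" using ab b by auto
  ultimately show ?thesis by blast
  next
  assume ab: "a = b"
  then show ?thesis using a b bQ Pa by auto
  next
  assume ab: "b < a"
  then have "?E b" using Pa b bQ M by auto
  moreover have "?O a" using ab a b bQ Pa M by auto
  ultimately show ?thesis by blast
  qed
  then show ?thesis using E O am b False by auto
 qed
qed

lemma all_trichotomy:
 fixes l m :: nat
 assumes "l <= m"
 shows "(\<forall>k<m. if k < l then A k else if k = l then B else C k) \<longleftrightarrow>
  (\<forall>k<l. A k) \<and> (l < m --> B) \<and> (\<forall>k<m. l < k --> C k)" (is "?L \<longleftrightarrow> ?R")
proof
 assume L: ?L
 show ?R
 proof (intro conjI allI impI)
  show "A k" if "k < l" for k using L[rule_format, of k] that assms by simp
  show B if "l < m" using L[rule_format, of l] that by simp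
  show "C k" if "k < m" "l < k" for k using L[rule_format, of k] that by simp
 qed
next
 assume ?R
 then show ?L by auto
qed

lemma sum_even_odd_split:
 fixes f :: "nat => 'm::comm_monoid_add"
 shows "(\<Sum>i\<le>p + 2 * m + 1. f i) =
  (\<Sum>i<p. f i) + (f p + (\<Sum>l<m. f (p + 2 * l + 2))) + (\<Sum>j\<le>m. f (p + 2 * j + 1))"
proof (induction m)
 case 0
 have "{..p + 2 * 0 + 1} = insert (p + 1) (insert p {..<p})" by auto
 then show ?case by (simp add: ac_simps)
next
 case (Suc m)
 have "{..p + 2 * Suc m + 1} = insert (p + 2 * m + 3) (insert (p + 2 * m + 2) {..p + 2 * m + 1})"
  by auto
 then have "(\<Sum>i\<le>p + 2 * Suc m + 1. f i) =
  f (p + 2 * m + 3) + (f (p + 2 * m + 2) + (\<Sum>i\<le>p + 2 * m + 1. f i))"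
  by simp
 then show ?case unfolding Suc by (simp add: ac_simps numeral_3_eq_3)
qed

context zero_intervals begin

lemma drop_cut_pieces:
 assumes "\<And>k. k < Suc n ==> \<not> zer (x k) (x (k + 1))"
 shows "(\<forall>k<n. \<not> zer (drop_cut i x k) (drop_cut i x (k + 1))) \<longleftrightarrow>
  (1 <= i \<and> i <= n --> \<not> zer (x (i - 1)) (x (i + 1)))" (is "?L \<longleftrightarrow> ?R")
proof
 assume L: ?L
 show ?R
 proof
  assume i: "1 <= i \<and> i <= n"
  then have "i - 1 < n" by linarith
  then show "\<not> zer (x (i - 1)) (x (i + 1))" using L[rule_format, of "i - 1"] i
  by (simp add: drop_cut_def)
 qed
next
 assume R: ?R
 show ?L
 proof (intro allI impI)
  fix k assume k: "k < n"
  consider "k + 1 < i" | "k + 1 = i" | "i <= k" by linarith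
  then show "\<not> zer (drop_cut i x k) (drop_cut i x (k + 1))"
  proof cases
  case 1
  then show ?thesis using assms[of k] k by (simp add: drop_cut_def)
  next
  case 2
  then have "i - 1 = k" "1 <= i" "i <= n" using k by auto
  then show ?thesis using R 2 by (simp add: drop_cut_def)
  next
  case 3
  then show ?thesis using assms[of "k + 1"] k by (simp add: drop_cut_def)
  qed
 qed
qed

context
 fixes x :: "nat => nat" and p m :: nat
 assumes p: "p < 2" and pieces: "\<And>k. k < Suc (p + 2 * m) ==> \<not> zer (x k) (x (k + 1))"
begin

private lemma good_iff:
 "cuts_good zer (p + 2 * m) (drop_cut i x) \<longleftrightarrow>
  (1 <= i \<and> i <= p + 2 * m --> \<not> zer (x (i - 1)) (x (i + 1))) \<and>
  (\<forall>k<m. zer (drop_cut i x (p + 2 * k)) (drop_cut i x (p + 2 * k + 2)))"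
proof -
 have "(p + 2 * m) mod 2 = p" using p by simp
 moreover have "p + 2 * k + 2 <= p + 2 * m \<longleftrightarrow> k < m" for k by auto
 ultimately show ?thesis unfolding cuts_good_def using drop_cut_pieces[of "p + 2 * m" x i, OF pieces] by simp
qed

lemma good_drop_even:
 assumes "l < m"
 shows "cuts_good zer (p + 2 * m) (drop_cut (p + 2 * l + 2) x) \<longleftrightarrow>
  \<not> zer (x (p + 2 * l + 1)) (x (p + 2 * l + 3)) \<and> zer (x (p + 2 * l)) (x (p + 2 * l + 3)) \<and>
  (\<forall>k<l. zer (x (p + 2 * k)) (x (p + 2 * k + 2))) \<and>
  (\<forall>k<m. l < k --> zer (x (p + 2 * k + 1)) (x (p + 2 * k + 3)))"
proof -
 let ?y = "drop_cut (p + 2 * l + 2) x"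
 have *: "zer (?y (p + 2 * k)) (?y (p + 2 * k + 2)) \<longleftrightarrow>
  (if k < l then zer (x (p + 2 * k)) (x (p + 2 * k + 2))
  else if k = l then zer (x (p + 2 * l)) (x (p + 2 * l + 3))
  else zer (x (p + 2 * k + 1)) (x (p + 2 * k + 3)))" for k
  by (auto simp: drop_cut_def numeral_3_eq_3)
 have 1: "p + 2 * l + 2 - 1 = p + 2 * l + 1" "p + 2 * l + 2 + 1 = p + 2 * l + 3" by simp_all
 show ?thesis unfolding good_iff * 1 all_trichotomy[OF less_imp_le[OF assms]] using assms by auto
qed

lemma good_drop_odd:
 assumes "j <= m"
 shows "cuts_good zer (p + 2 * m) (drop_cut (p + 2 * j + 1) x) \<longleftrightarrow>
  (j < m --> \<not> zer (x (p + 2 * j)) (x (p + 2 * j + 2)) \<and> zer (x (p + 2 * j)) (x (p + 2 * j + 3))) \<and>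
  (\<forall>k<j. zer (x (p + 2 * k)) (x (p + 2 * k + 2))) \<and>
  (\<forall>k<m. j < k --> zer (x (p + 2 * k + 1)) (x (p + 2 * k + 3)))"
proof -
 let ?y = "drop_cut (p + 2 * j + 1) x"
 have *: "zer (?y (p + 2 * k)) (?y (p + 2 * k + 2)) \<longleftrightarrow>
  (if k < j then zer (x (p + 2 * k)) (x (p + 2 * k + 2))
  else if k = j then zer (x (p + 2 * j)) (x (p + 2 * j + 3))
  else zer (x (p + 2 * k + 1)) (x (p + 2 * k + 3)))" for k
  by (auto simp: drop_cut_def numeral_3_eq_3)
 have 1: "p + 2 * j + 1 - 1 = p + 2 * j" "p + 2 * j + 1 + 1 = p + 2 * j + 2" by simp_all
 have 2: "(1 <= p + 2 * j + 1 \<and> p + 2 * j + 1 <= p + 2 * m) \<longleftrightarrow> j < m" by auto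
 show ?thesis unfolding good_iff * 1 2 all_trichotomy[OF assms] by auto
qed

lemma good_drop_0:
 "cuts_good zer (p + 2 * m) (drop_cut 0 x) \<longleftrightarrow>
  (\<forall>k<m. zer (x (p + 2 * k + 1)) (x (p + 2 * k + 3)))"
 unfolding good_iff by (simp add: drop_cut_def numeral_3_eq_3)

lemma good_drop_1:
 "p = 1 ==> cuts_good zer (p + 2 * m) (drop_cut 1 x) \<longleftrightarrow> \<not> zer (x 0) (x 2) \<and>
  (\<forall>k<m. zer (x (p + 2 * k + 1)) (x (p + 2 * k + 3)))"
 unfolding good_iff by (simp add: drop_cut_def numeral_3_eq_3 numeral_2_eq_2)

lemma cuts_good_Suc:
 "cuts_good zer (Suc (p + 2 * m)) x \<longleftrightarrow> (p = 1 --> zer (x 0) (x 2)) \<and>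
  (\<forall>k<m. zer (x (p + 2 * k + 1)) (x (p + 2 * k + 3)))"
proof (cases "p = 0")
 case True
 then have *: "Suc (p + 2 * m) mod 2 + 2 * k + 2 <= Suc (p + 2 * m) \<longleftrightarrow> k < m"
  "Suc (p + 2 * m) mod 2 = 1" for k by auto
 have "Suc (Suc (2 * k)) <= 2 * m \<longleftrightarrow> k < m" for k by auto
 then show ?thesis unfolding cuts_good_def * using pieces True by (simp add: numeral_3_eq_3)
next
 case False
 then have p1: "p = 1" using p by simp
 then have 1: "Suc (p + 2 * m) mod 2 = 0" by auto
 have 2: "0 + 2 * k + 2 <= Suc (p + 2 * m) \<longleftrightarrow> k < Suc m" for k using p1 by auto
 show ?thesis unfolding cuts_good_def 1 2 All_less_Suc2 using pieces p1
  by (simp add: numeral_3_eq_3 numeral_2_eq_2)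
qed

end

lemma leftmost_single:
 assumes "(i, j) \<in> inside n a b" "\<And>i' j'. (i', j') \<in> inside n a b ==> i <= i'"
 shows "leftmost (inside n a b) = {(i, j)}"
proof (intro Set.set_eqI iffI)
 fix w assume w: "w \<in> leftmost (inside n a b)"
 obtain i' j' where w': "w = (i', j')" by force
 have m: "(i', j') \<in> inside n a b" using w w' by (simp add: leftmost_def)
 moreover have "i' <= i" using w w' assms(1) unfolding leftmost_def by force
 ultimately have "i' = i" using assms(2) by (simp add: order_antisym)
 then have "j' = j" using m assms(1) ap_end_unique[of i j' n j] by (simp add: inside_iff)
 then show "w \<in> {(i, j)}" using w' \<open>i' = i\<close> by simp
next
 fix w assume "w \<in> {(i, j)}"
 then show "w \<in> leftmost (inside n a b)" using assms unfolding leftmost_def by auto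
qed

lemma leftmost_cases:
 obtains "inside n a b = {}" | i j where "(i, j) \<in> inside n a b"
  "\<And>i' j'. (i', j') \<in> inside n a b ==> i <= i'" "leftmost (inside n a b) = {(i, j)}"
proof (cases "inside n a b = {}")
 case False
 then have "fst ` inside n a b \<noteq> {}" by blast
 from Min_in[OF finite_imageI[OF finite_inside] this] obtain i j
  where ij: "(i, j) \<in> inside n a b" and i: "i = Min (fst ` inside n a b)" by fastforce
 have min: "i <= i'" if "(i', j') \<in> inside n a b" for i' j'
  unfolding i by (rule Min_le[OF finite_imageI[OF finite_inside]]) (use that in force)
 have "leftmost (inside n a b) = {(i, j)}" by (rule leftmost_single[OF ij], erule min)
 show ?thesis by (rule that(2)[of i j], rule ij, erule min, fact)
next
 case True
 then show ?thesis by (rule that(1))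
qed

lemma leftmost_empty [simp]: "leftmost {} = {}"
 by (simp add: leftmost_def)

lemma telescope:
 fixes \<tau> :: "occ => 'm::ab_group_add"
 assumes y: "\<And>k. k < m ==> zer (y k) (y (k + 1))"
  and \<tau>: "\<And>i j. a <= i ==> j <= y m ==> zer a i \<or> zer j (y m) ==> \<tau> (i, j) = 0"
  and "a <= t" "t <= y 0"
 shows "(\<Sum>w\<in>{w \<in> inside (2 * m + 1) a (y m). fst w < t}. bd \<tau> (2 * m + 1) w) =
  sum \<tau> (leftmost (inside (2 * m) t (y m))) - sum \<tau> (leftmost (inside (2 * m) a (y m)))"
 using assms(3,4)
proof (induction t rule: dec_induct)
 case base
 have "{w \<in> inside (2 * m + 1) a (y m). fst w < a} = {}" by (auto simp: ap_inside_def)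
 then show ?case by (simp only: sum.empty diff_self)
next
 case (step t)
 define N where "N = y m"
 let ?B = "bd \<tau> (2 * m + 1)"
 let ?W = "{w \<in> inside (2 * m + 1) a N. fst w = t}"
 let ?L = "\<lambda>t. sum \<tau> (leftmost (inside (2 * m) t N))"
 have *: "sum ?B ?W = ?L (Suc t) - ?L t"
 proof (cases "\<exists>j\<le>N. (t, j) \<in> ap (2 * m)")
  case False
  have "?W = {}"
  proof (rule ccontr)
  assume "?W \<noteq> {}"
  then obtain e where e: "(t, e) \<in> ap (Suc (2 * m))" "e <= N" by (auto simp: inside_iff)
  then show False using ap_prefix[OF e(1)] False by (meson less_imp_le order_trans)
  qed
  moreover have "inside (2 * m) t N = inside (2 * m) (Suc t) N"
  unfolding ap_inside_def using False by (auto simp: Suc_le_eq nat_less_le)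
  ultimately show ?thesis by (simp only: sum.empty diff_self)
 next
  case True
  then obtain j where j: "j <= N" "(t, j) \<in> ap (2 * m)" by blast
  have Lt: "?L t = \<tau> (t, j)"
  using leftmost_single[of t j "2 * m" t N] j by (simp add: inside_iff)
  show ?thesis
  proof (cases "\<exists>e\<le>N. (t, e) \<in> ap (2 * m + 1)")
  case True
  then obtain e where e: "e <= N" "(t, e) \<in> ap (2 * m + 1)" by blast
  have "?W = {(t, e)}" using e ap_end_unique step by (auto simp: inside_iff)
  moreover obtain s where s: "t < s" "(s, e) \<in> ap (2 * m)"
  using ap_suffix[of t e "2 * m"] e by auto
  moreover have "leftmost (inside (2 * m) (Suc t) N) = {(s, e)}"
  proof (rule leftmost_single)
  show "(s, e) \<in> inside (2 * m) (Suc t) N" using s e by (simp add: inside_iff)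
  fix i' j' assume "(i', j') \<in> inside (2 * m) (Suc t) N"
  then have ij: "(i', j') \<in> ap (2 * m)" "t < i'" by (auto simp: inside_iff)
  have "e <= j'" by (rule ap_odd_end_le[OF e(2) ij])
  then show "s <= i'" using ap_start_less_iff[OF ij(1) s(2)] by simp
  qed
  ultimately show ?thesis using bd_odd[OF _ e(2), of \<tau>] Lt sfx_eq[OF s(2)] pfx_eq[OF j(2)]
  by simp
  next
  case False
  then have "?W = {}" by (auto simp: inside_iff)
  then have "sum ?B ?W = 0" by (simp only: sum.empty)
  moreover have "\<tau> (t, j) = 0"
  proof (rule \<tau>)
  show "a <= t" "j <= y m" using step j N_def by auto
  show "zer a t \<or> zer j (y m)"
  using ap_extend_forward[OF j(2), of y] y step False N_def by auto
  qed
  moreover have "?L (Suc t) = 0"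
  proof (cases rule: leftmost_cases[of "2 * m" "Suc t" N])
  case (2 i' j')
  have ij: "(i', j') \<in> ap (2 * m)" "t < i'" "j' <= N" using 2 by (auto simp: inside_iff)
  have min: "i' <= c" if "(c, d) \<in> ap (2 * m)" "t < c" for c d
  proof (cases "d <= N")
  case True
  then show ?thesis using 2(2)[of c d] that by (simp add: inside_iff)
  next
  case False
  then show ?thesis using ap_start_less_iff[OF that(1) ij(1)] ij(3) by simp
  qed
  have "zer t i'"
  proof (rule ccontr)
  assume "\<not> zer t i'"
  then have "(t, j') \<in> ap (2 * m + 1)" using ap_link[OF j(2) ij(1) ij(2) min] by simp
  then show False using False ij(3) by blast
  qed
  then have "zer a i'" using zer_mono step by blast
  then have "\<tau> (i', j') = 0" using \<tau>[of i' j'] step ij N_def by simp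
  then show ?thesis using 2 by simp
  qed simp
  ultimately show ?thesis using Lt by simp
  qed
 qed
 have "{w \<in> inside (2 * m + 1) a N. fst w < Suc t} = {w \<in> inside (2 * m + 1) a N. fst w < t} \<union> ?W"
  by auto
 moreover have "sum ?B ({w \<in> inside (2 * m + 1) a N. fst w < t} \<union> ?W) =
  sum ?B {w \<in> inside (2 * m + 1) a N. fst w < t} + sum ?B ?W"
  by (rule sum.union_disjoint) (auto intro: finite_subset[OF _ finite_inside])
 ultimately have "sum ?B {w \<in> inside (2 * m + 1) a N. fst w < Suc t} =
  sum ?B {w \<in> inside (2 * m + 1) a N. fst w < t} + sum ?B ?W" by (simp only:)
 also have "sum ?B {w \<in> inside (2 * m + 1) a N. fst w < t} = ?L t - ?L a"
  unfolding N_def by (rule step.IH) (use step.prems in linarith)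
 also have "?L t - ?L a + sum ?B ?W = ?L t - ?L a + (?L (Suc t) - ?L t)" by (simp only: *)
 also have "\<dots> = ?L (Suc t) - ?L a"
 proof -
  have "b - a' + (c - b) = c - a'" for a' b c :: 'm by simp
  then show ?thesis .
 qed
 finally show ?case unfolding N_def .
qed

lemma leftmost_truncate:
 fixes \<tau> :: "occ => 'm::ab_group_add"
 assumes y: "\<And>k. k < m ==> zer (y k) (y (k + 1))" "\<And>k. k <= m ==> y k <= y m" "y m <= N"
  and \<tau>: "\<And>i j. y 0 <= i ==> j <= N ==> zer (y 0) i \<or> zer j N ==> \<tau> (i, j) = 0"
 shows "sum \<tau> (leftmost (inside (2 * m) (y 0) (y m))) = sum \<tau> (leftmost (inside (2 * m) (y 0) N))"
proof (cases rule: leftmost_cases[of "2 * m" "y 0" N])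
 case 1
 moreover have "inside (2 * m) (y 0) (y m) <= inside (2 * m) (y 0) N"
  using y(3) by (auto simp: ap_inside_def)
 ultimately have "inside (2 * m) (y 0) (y m) = {}" by blast
 then show ?thesis using 1 by simp
next
 case (2 i j)
 have ij: "(i, j) \<in> ap (2 * m)" "y 0 <= i" "j <= N" using 2 by (auto simp: inside_iff)
 show ?thesis
 proof (cases "j <= y m")
  case True
  have "leftmost (inside (2 * m) (y 0) (y m)) = {(i, j)}"
  proof (rule leftmost_single)
  show "(i, j) \<in> inside (2 * m) (y 0) (y m)" using True ij by (simp add: inside_iff)
  show "i <= i'" if "(i', j') \<in> inside (2 * m) (y 0) (y m)" for i' j'
  using that y(3) 2(2)[of i' j'] by (simp add: inside_iff)
  qed
  then show ?thesis using 2 by simp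
 next
  case False
  have "inside (2 * m) (y 0) (y m) = {}"
  proof (rule ccontr)
  assume "inside (2 * m) (y 0) (y m) \<noteq> {}"
  then obtain c d where cd: "(c, d) \<in> ap (2 * m)" "y 0 <= c" "d <= y m"
  by (auto simp: ap_inside_def)
  then have "i <= c" using 2(2)[of c d] y(3) by (simp add: inside_iff)
  moreover have "d < j" using cd False by simp
  ultimately show False using ap_start_less_iff[OF cd(1) ij(1)] by simp
  qed
  moreover have "zer (y 0) i"
  proof (rule ccontr)
  assume nz: "\<not> zer (y 0) i"
  have yj: "y k <= j" if "k <= m" for k using y(2)[OF that] False by linarith
  have "y m < j" using False by simp
  from ap_extend_backward[of i j m y, OF ij(1,2) this y(1) yj nz]
  obtain s where s: "y 0 <= s" "(s, j) \<in> ap (Suc (2 * m))" by auto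
  obtain e where e: "e < j" "(s, e) \<in> ap (2 * m)" using ap_prefix[OF s(2)] by blast
  then have "s < i" using ap_start_less_iff[OF e(2) ij(1)] by simp
  then show False using 2(2)[of s e] s e ij by (simp add: inside_iff)
  qed
  ultimately show ?thesis using 2 \<tau> ij by simp
 qed
qed

lemma inside_even_cover:
 fixes \<tau> :: "occ => 'm::ab_group_add"
 assumes y: "\<And>k. k <= m ==> zer (y k) (y (k + 1))"
  and \<tau>: "\<And>i j. y 0 <= i ==> j <= y (m + 1) ==> zer (y 0) i \<or> zer j (y (m + 1)) ==> \<tau> (i, j) = 0"
 shows "(\<Sum>w\<in>leftmost (inside (2 * m + 2) (y 0) (y (m + 1))). bd \<tau> (2 * m + 2) w) =
  sum \<tau> (inside (2 * m + 1) (y 0) (y (m + 1)))"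
proof (cases rule: leftmost_cases[of "2 * m + 2" "y 0" "y (m + 1)"])
 case 1
 have "\<tau> w = 0" if "w \<in> inside (2 * m + 1) (y 0) (y (m + 1))" for w
 proof -
  obtain i j where w: "w = (i, j)" by force
  then have ij: "(i, j) \<in> ap (2 * m + 1)" "y 0 <= i" "j <= y (m + 1)"
  using that by (auto simp: inside_iff)
  have "zer (y 0) i \<or> zer j (y (m + 1))"
  proof (rule ccontr)
  assume "\<not> ?thesis"
  then have "\<not> zer (y 0) i" "\<not> zer j (y (m + 1))" by auto
  from ap_even_exists[of m y, OF y ij(1,2) this ij(3)]
  show False using 1 by (auto simp: ap_inside_def)
  qed
  then show ?thesis using \<tau> ij w by blast
 qed
 then show ?thesis using 1 by (simp add: sum.neutral)
next
 case (2 p q)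
 define N where "N = y (m + 1)"
 have pq: "(p, q) \<in> ap (2 * m + 2)" "y 0 <= p" "q <= N" using 2(1) by (auto simp: inside_iff N_def)
 obtain u where u: "chain (2 * m + 2) u" "u 0 = p" "u (2 * m + 2) = q" using pq apE by blast
 have uz: "zer (u (2 * k)) (u (2 * (k + 1)))" if "k <= m" for k
  using chain_zer[OF u(1), of "2 * k"] that by simp
 have key: "w \<in> inside (2 * m + 1) p q" if "w \<in> inside (2 * m + 1) (y 0) N" "\<tau> w \<noteq> 0" for w
 proof -
  obtain i j where w: "w = (i, j)" by force
  then have ij: "(i, j) \<in> ap (2 * m + 1)" "y 0 <= i" "j <= N"
  using that by (auto simp: inside_iff)
  have nz: "\<not> zer (y 0) i" "\<not> zer j N" using \<tau>[of i j] that w ij N_def by auto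
  obtain c where c: "chain (2 * m + 1) c" "c 0 = i" "c (2 * m + 1) = j" using ij apE by blast
  have "p <= i"
  proof (rule ccontr)
  assume ip: "\<not> p <= i"
  have "c (2 * m) <= u (2 * m)"
  using ap_end_less[of i "c (2*m)" "2*m" p "u (2*m)"] ip c u
  apI[OF chain_prefix[OF c(1), of "2*m"]] apI[OF chain_prefix[OF u(1), of "2*m"]] by simp
  then have "zer (c (2 * m)) N" using uz[of m] u pq(3) zer_mono by simp
  then have "\<exists>e\<le>N. (i, e) \<in> ap (2 * m + 2)"
  using chain_extend[OF c(1), of N] nz c by simp
  then show False using 2(2) ip ij unfolding N_def by (auto simp: inside_iff)
  qed
  moreover have "j <= q"
  proof -
  have "zer (y 0) (u 2)" using uz[of 0] u pq(2) zer_mono[of "u 0" "u 2" "y 0" "u 2"]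
  by (simp add: numeral_2_eq_2)
  then have i2: "i < u 2" using nz zer_mono[of "y 0" "u 2" "y 0" i] by force
  have "zer (u (2 * (k + 1))) (u (2 * (k + 1 + 1)))" if "k < m" for k
  using uz[of "k + 1"] that by simp
  then have "c (2 * m + 1) <= u (2 * (m + 1))"
  using chain_odd_le[OF c(1), of "\<lambda>k. u (2 * (k + 1))" m] i2 c by simp
  then show ?thesis using c u by simp
  qed
  ultimately show ?thesis using w ij by (simp add: inside_iff)
 qed
 have "sum \<tau> (inside (2 * m + 1) p q) = sum \<tau> (inside (2 * m + 1) (y 0) N)"
  by (rule sum_supported[OF finite_inside]) (use key pq in \<open>auto simp: ap_inside_def\<close>)
 then show ?thesis using 2(3) by (simp add: boundary_sum_def N_def)
qed

end

section \<open>Dropping a cut\<close>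

context zero_intervals begin

theorem cut_sum_odd:
 fixes \<tau> :: "occ => 'm::ab_group_add"
 assumes n: "n = 2 * m + 1"
  and mono: "\<And>k. k < n ==> x k <= x (k + 1)"
  and pieces: "\<And>k. k < n ==> \<not> zer (x k) (x (k + 1))"
  and \<tau>: "\<And>i j. x 0 <= i ==> j <= x n ==> zer (x 0) i \<or> zer j (x n) ==> \<tau> (i, j) = 0"
 shows "(\<Sum>i\<le>n. if even i then cut_sum zer \<tau> (n - 1) (drop_cut i x)
  else - cut_sum zer \<tau> (n - 1) (drop_cut i x)) =
  (if cuts_good zer n x then (\<Sum>w\<in>selected zer n x. bd \<tau> n w) else 0)"
proof -
 have mono': "x i <= x j" if "i <= j" "j <= n" for i j
  using that
 proof (induction j rule: dec_induct)
  case (step j)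
  then have "x i <= x j" "x j <= x (Suc j)" using mono[of j] by simp_all
  then show ?case by (rule order_trans)
 qed simp
 have n1: "n - 1 = 2 * m" and n2: "n = 0 + 2 * m + 1" using n by simp_all
 define P where "P k \<longleftrightarrow> zer (x (2 * k)) (x (2 * k + 2))" for k
 define Q where "Q k \<longleftrightarrow> zer (x (2 * k + 1)) (x (2 * k + 3))" for k
 define M where "M k \<longleftrightarrow> zer (x (2 * k)) (x (2 * k + 3))" for k
 define A where "A \<longleftrightarrow> (\<forall>k<m. Q k)"
 define V where "V = sum \<tau> (leftmost (inside (2 * m) (x 0) (x n)))"
 define T where "T i = cut_sum zer \<tau> (2 * m) (drop_cut i x)" for i
 have pieces': "\<not> zer (x k) (x (k + 1))" if "k < Suc (0 + 2 * m)" for k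
  using pieces that n by simp
 have M: "M k" if "k < m" "P k \<or> Q k" for k
  using that zer_mono[of "x (2 * k)" "x (2 * k + 2)" "x (2 * k)" "x (2 * k + 3)"]
  zer_mono[of "x (2 * k + 1)" "x (2 * k + 3)" "x (2 * k)" "x (2 * k + 3)"]
  mono'[of "2 * k" "2 * k + 1"] mono'[of "2 * k + 2" "2 * k + 3"] n
  unfolding P_def Q_def M_def by auto
 have E: "T (2 * l + 2) = (if \<not> Q l \<and> M l \<and> (\<forall>k<l. P k) \<and> (\<forall>k<m. l < k --> Q k) then V else 0)"
  if "l < m" for l
 proof -
  have good: "cuts_good zer (2 * m) (drop_cut (2 * l + 2) x) \<longleftrightarrow>
  \<not> Q l \<and> M l \<and> (\<forall>k<l. P k) \<and> (\<forall>k<m. l < k --> Q k)"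
  using good_drop_even[of 0 m x l, OF _ pieces' that] unfolding P_def Q_def M_def by simp
  have sel: "selected zer (2 * m) (drop_cut (2 * l + 2) x) = leftmost (inside (2 * m) (x 0) (x n))"
  using that n by (simp add: selected_def drop_cut_def)
  show ?thesis unfolding T_def cut_sum_def good sel V_def by (rule refl)
 qed
 have O: "T (2 * j + 1) =
  (if (j < m --> \<not> P j \<and> M j) \<and> (\<forall>k<j. P k) \<and> (\<forall>k<m. j < k --> Q k) then V else 0)"
  if "j <= m" for j
 proof -
  have good: "cuts_good zer (2 * m) (drop_cut (2 * j + 1) x) \<longleftrightarrow>
  (j < m --> \<not> P j \<and> M j) \<and> (\<forall>k<j. P k) \<and> (\<forall>k<m. j < k --> Q k)"
  using good_drop_odd[of 0 m x j, OF _ pieces' that] unfolding P_def Q_def M_def by simp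
  show ?thesis
  proof (cases "j < m")
  case True
  then have sel: "selected zer (2 * m) (drop_cut (2 * j + 1) x) = leftmost (inside (2 * m) (x 0) (x n))"
  using n by (simp add: selected_def drop_cut_def)
  show ?thesis unfolding T_def cut_sum_def good sel V_def by (rule refl)
  next
  case False
  then have sel: "selected zer (2 * m) (drop_cut (2 * j + 1) x) =
  leftmost (inside (2 * m) (x 0) (x (2 * m)))"
  using that n by (simp add: selected_def drop_cut_def)
  have trunc: "sum \<tau> (leftmost (inside (2 * m) (x 0) (x (2 * m)))) = V" if "\<forall>k<m. P k"
  using leftmost_truncate[of m "\<lambda>k. x (2 * k)" "x n" \<tau>] that mono' \<tau> n
  unfolding P_def V_def by simp
  have "j = m" using False that by simp
  then show ?thesis unfolding T_def cut_sum_def good sel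
  by (intro if_cong refl) (use trunc in blast)
  qed
 qed
 have T0: "T 0 = (if \<forall>k<m. Q k then sum \<tau> (leftmost (inside (2 * m) (x 1) (x n))) else 0)"
 proof -
  have good: "cuts_good zer (2 * m) (drop_cut 0 x) \<longleftrightarrow> (\<forall>k<m. Q k)"
  using good_drop_0[of 0 m x, OF _ pieces'] unfolding Q_def by simp
  have sel: "selected zer (2 * m) (drop_cut 0 x) = leftmost (inside (2 * m) (x 1) (x n))"
  using n by (simp add: selected_def drop_cut_def)
  show ?thesis unfolding T_def cut_sum_def good sel by (rule refl)
 qed
 have "(\<Sum>i\<le>n. if even i then cut_sum zer \<tau> (n - 1) (drop_cut i x)
  else - cut_sum zer \<tau> (n - 1) (drop_cut i x)) =
  (\<Sum>i\<le>0 + 2 * m + 1. if even i then T i else - T i)"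
  unfolding T_def n1 n2[symmetric] by (rule refl)
 also have "\<dots> = T 0 + ((\<Sum>l<m. T (2 * l + 2)) - (\<Sum>j\<le>m. T (2 * j + 1)))"
  unfolding sum_even_odd_split by (simp add: sum_negf)
 also have "(\<Sum>l<m. T (2 * l + 2)) - (\<Sum>j\<le>m. T (2 * j + 1)) = (if \<forall>k<m. Q k then - V else 0)"
  using telescoping_pattern[of m P Q M V, OF M] E O by simp
 also have "T 0 + \<dots> = (if \<forall>k<m. Q k then
  sum \<tau> (leftmost (inside (2 * m) (x 1) (x n))) - V else 0)"
  unfolding T0 A_def[symmetric] by simp
 also have "\<dots> = (if cuts_good zer n x then (\<Sum>w\<in>selected zer n x. bd \<tau> n w) else 0)"
 proof -
  have g: "cuts_good zer n x \<longleftrightarrow> (\<forall>k<m. Q k)"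
  using cuts_good_Suc[of 0 m x, OF _ pieces'] n unfolding Q_def by simp
  have "(\<Sum>w\<in>selected zer n x. bd \<tau> n w) = sum \<tau> (leftmost (inside (2 * m) (x 1) (x n))) - V"
  if "\<forall>k<m. Q k"
  using telescope[of m "\<lambda>k. x (2 * k + 1)" "x 0" \<tau> "x 1"] that \<tau> n mono'[of 0 1]
  unfolding Q_def V_def selected_def by (simp add: numeral_3_eq_3)
  then show ?thesis unfolding g A_def[symmetric] by simp
 qed
 finally show ?thesis .
qed

theorem cut_sum_even:
 fixes \<tau> :: "occ => 'm::ab_group_add"
 assumes n: "n = 2 * m + 2"
  and mono: "\<And>k. k < n ==> x k <= x (k + 1)"
  and pieces: "\<And>k. k < n ==> \<not> zer (x k) (x (k + 1))"
  and \<tau>: "\<And>i j. x 0 <= i ==> j <= x n ==> zer (x 0) i \<or> zer j (x n) ==> \<tau> (i, j) = 0"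
 shows "(\<Sum>i\<le>n. if even i then cut_sum zer \<tau> (n - 1) (drop_cut i x)
  else - cut_sum zer \<tau> (n - 1) (drop_cut i x)) =
  (if cuts_good zer n x then (\<Sum>w\<in>selected zer n x. bd \<tau> n w) else 0)"
proof -
 have mono': "x i <= x j" if "i <= j" "j <= n" for i j
  using that
 proof (induction j rule: dec_induct)
  case (step j)
  then have "x i <= x j" "x j <= x (Suc j)" using mono[of j] by simp_all
  then show ?case by (rule order_trans)
 qed simp
 have n1: "n - 1 = 1 + 2 * m" and n2: "n = 1 + 2 * m + 1" using n by simp_all
 define P where "P k \<longleftrightarrow> zer (x (1 + 2 * k)) (x (1 + 2 * k + 2))" for k
 define Q where "Q k \<longleftrightarrow> zer (x (1 + 2 * k + 1)) (x (1 + 2 * k + 3))" for k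
 define M where "M k \<longleftrightarrow> zer (x (1 + 2 * k)) (x (1 + 2 * k + 3))" for k
 define A where "A \<longleftrightarrow> (\<forall>k<m. Q k)"
 define S where "S t = sum \<tau> {w \<in> inside (1 + 2 * m) (x 0) (x n). fst w < t}" for t
 define T where "T i = cut_sum zer \<tau> (1 + 2 * m) (drop_cut i x)" for i
 have pieces': "\<not> zer (x k) (x (k + 1))" if "k < Suc (1 + 2 * m)" for k
  using pieces that n by simp
 have M: "M k" if "k < m" "P k \<or> Q k" for k
  using that zer_mono[of "x (1 + 2 * k)" "x (1 + 2 * k + 2)" "x (1 + 2 * k)" "x (1 + 2 * k + 3)"]
  zer_mono[of "x (1 + 2 * k + 1)" "x (1 + 2 * k + 3)" "x (1 + 2 * k)" "x (1 + 2 * k + 3)"]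
  mono'[of "1 + 2 * k" "1 + 2 * k + 1"] mono'[of "1 + 2 * k + 2" "1 + 2 * k + 3"] n
  unfolding P_def Q_def M_def by auto
 have E: "T (1 + 2 * l + 2) =
  (if \<not> Q l \<and> M l \<and> (\<forall>k<l. P k) \<and> (\<forall>k<m. l < k --> Q k) then S (x 1) else 0)"
  if "l < m" for l
 proof -
  have good: "cuts_good zer (1 + 2 * m) (drop_cut (1 + 2 * l + 2) x) \<longleftrightarrow>
  \<not> Q l \<and> M l \<and> (\<forall>k<l. P k) \<and> (\<forall>k<m. l < k --> Q k)"
  using good_drop_even[of 1 m x l, OF _ pieces' that] unfolding P_def Q_def M_def by simp
  have sel: "selected zer (1 + 2 * m) (drop_cut (1 + 2 * l + 2) x) =
  {w \<in> inside (1 + 2 * m) (x 0) (x n). fst w < x 1}"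
  using that n by (simp add: selected_def drop_cut_def)
  show ?thesis unfolding T_def cut_sum_def good sel S_def by (rule refl)
 qed
 have O: "T (1 + 2 * j + 1) =
  (if (j < m --> \<not> P j \<and> M j) \<and> (\<forall>k<j. P k) \<and> (\<forall>k<m. j < k --> Q k) then S (x 1) else 0)"
  if "j <= m" for j
 proof -
  have good: "cuts_good zer (1 + 2 * m) (drop_cut (1 + 2 * j + 1) x) \<longleftrightarrow>
  (j < m --> \<not> P j \<and> M j) \<and> (\<forall>k<j. P k) \<and> (\<forall>k<m. j < k --> Q k)"
  using good_drop_odd[of 1 m x j, OF _ pieces' that] unfolding P_def Q_def M_def by simp
  show ?thesis
  proof (cases "j < m")
  case True
  then have sel: "selected zer (1 + 2 * m) (drop_cut (1 + 2 * j + 1) x) =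
  {w \<in> inside (1 + 2 * m) (x 0) (x n). fst w < x 1}"
  using n by (simp add: selected_def drop_cut_def)
  show ?thesis unfolding T_def cut_sum_def good sel S_def by (rule refl)
  next
  case False
  then have sel: "selected zer (1 + 2 * m) (drop_cut (1 + 2 * j + 1) x) =
  {w \<in> inside (1 + 2 * m) (x 0) (x (1 + 2 * m)). fst w < x 1}"
  using that n by (simp add: selected_def drop_cut_def)
  have trunc: "{w \<in> inside (1 + 2 * m) (x 0) (x (1 + 2 * m)). fst w < x 1} =
  {w \<in> inside (1 + 2 * m) (x 0) (x n). fst w < x 1}" if P: "\<forall>k<m. P k"
  proof -
  have "e <= x (1 + 2 * m)" if ie: "(i, e) \<in> ap (1 + 2 * m)" "i < x 1" for i e
  proof -
  obtain c where c: "chain (1 + 2 * m) c" "c 0 = i" "c (1 + 2 * m) = e"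
  using ie apE by blast
  then show ?thesis
  using chain_odd_le[OF c(1), of "\<lambda>k. x (1 + 2 * k)" m] P ie unfolding P_def by simp
  qed
  moreover have "x (1 + 2 * m) <= x n" using mono' n by simp
  ultimately have "e <= x (1 + 2 * m) \<longleftrightarrow> e <= x n" if "(i, e) \<in> ap (1 + 2 * m)" "i < x 1" for i e
  using that by (meson order_trans)
  then show ?thesis unfolding ap_inside_def by auto
  qed
  have "j = m" using False that by simp
  then show ?thesis unfolding T_def cut_sum_def good sel S_def
  by (intro if_cong refl) (use trunc in \<open>metis (no_types, lifting)\<close>)
  qed
 qed
 have T0: "T 0 + S (x 1) = S (x 2)" if "\<forall>k<m. Q k"
 proof -
  have "cuts_good zer (1 + 2 * m) (drop_cut 0 x)"
  using good_drop_0[of 1 m x, OF _ pieces'] that unfolding Q_def by simp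
  moreover have "selected zer (1 + 2 * m) (drop_cut 0 x) =
  {w \<in> inside (1 + 2 * m) (x 1) (x n). fst w < x 2}"
  using n by (simp add: selected_def drop_cut_def flip: numeral_2_eq_2)
  ultimately have "T 0 = sum \<tau> {w \<in> inside (1 + 2 * m) (x 1) (x n). fst w < x 2}"
  unfolding T_def cut_sum_def by (simp only: if_True)
  moreover have "{w \<in> inside (1 + 2 * m) (x 0) (x n). fst w < x 2} =
  {w \<in> inside (1 + 2 * m) (x 1) (x n). fst w < x 2} \<union>
  {w \<in> inside (1 + 2 * m) (x 0) (x n). fst w < x 1}"
  unfolding ap_inside_def using mono'[of 0 1] mono'[of 1 2] n by auto
  moreover have "{w \<in> inside (1 + 2 * m) (x 1) (x n). fst w < x 2} \<inter>
  {w \<in> inside (1 + 2 * m) (x 0) (x n). fst w < x 1} = {}"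
  unfolding ap_inside_def by auto
  moreover have "sum \<tau> ({w \<in> inside (1 + 2 * m) (x 1) (x n). fst w < x 2} \<union>
  {w \<in> inside (1 + 2 * m) (x 0) (x n). fst w < x 1}) =
  sum \<tau> {w \<in> inside (1 + 2 * m) (x 1) (x n). fst w < x 2} +
  sum \<tau> {w \<in> inside (1 + 2 * m) (x 0) (x n). fst w < x 1}"
  by (rule sum.union_disjoint) (simp, simp, fact)
  ultimately show ?thesis unfolding S_def by (simp only:)
 qed
 have T0': "T 0 = 0" if "\<not> (\<forall>k<m. Q k)"
 proof -
  have "\<not> cuts_good zer (1 + 2 * m) (drop_cut 0 x)"
  using good_drop_0[of 1 m x, OF _ pieces'] that unfolding Q_def by simp
  then show ?thesis unfolding T_def cut_sum_def by (rule if_not_P)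
 qed
 have T1: "T 1 = (if \<not> zer (x 0) (x 2) \<and> (\<forall>k<m. Q k) then S (x 2) else 0)"
 proof -
  have good: "cuts_good zer (1 + 2 * m) (drop_cut 1 x) \<longleftrightarrow> \<not> zer (x 0) (x 2) \<and> (\<forall>k<m. Q k)"
  using good_drop_1[of 1 m x, OF _ pieces'] unfolding Q_def by simp
  have sel: "selected zer (1 + 2 * m) (drop_cut 1 x) =
  {w \<in> inside (1 + 2 * m) (x 0) (x n). fst w < x 2}"
  using n by (simp add: selected_def drop_cut_def flip: numeral_2_eq_2)
  show ?thesis unfolding T_def cut_sum_def good sel S_def by (rule refl)
 qed
 have "(\<Sum>i\<le>n. if even i then cut_sum zer \<tau> (n - 1) (drop_cut i x)
  else - cut_sum zer \<tau> (n - 1) (drop_cut i x)) =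
  (\<Sum>i\<le>1 + 2 * m + 1. if even i then T i else - T i)"
  unfolding T_def n1 n2[symmetric] by (rule refl)
 also have "\<dots> = T 0 - T 1 - ((\<Sum>l<m. T (1 + 2 * l + 2)) - (\<Sum>j\<le>m. T (1 + 2 * j + 1)))"
  unfolding sum_even_odd_split by (simp add: sum_negf)
 also have "(\<Sum>l<m. T (1 + 2 * l + 2)) - (\<Sum>j\<le>m. T (1 + 2 * j + 1)) =
  (if \<forall>k<m. Q k then - S (x 1) else 0)"
  using telescoping_pattern[of m P Q M "S (x 1)", OF M] E O by simp
 also have "T 0 - T 1 - \<dots> = (if zer (x 0) (x 2) \<and> (\<forall>k<m. Q k) then S (x 2) else 0)"
  using T0 T0' unfolding T1 A_def[symmetric] by (auto simp: algebra_simps)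
 also have "\<dots> = (if cuts_good zer n x then (\<Sum>w\<in>selected zer n x. bd \<tau> n w) else 0)"
 proof -
  have g: "cuts_good zer n x \<longleftrightarrow> zer (x 0) (x 2) \<and> (\<forall>k<m. Q k)"
  using cuts_good_Suc[of 1 m x, OF _ pieces'] n unfolding Q_def by simp
  have "(\<Sum>w\<in>selected zer n x. bd \<tau> n w) = S (x 2)" if z: "zer (x 0) (x 2)" and Q: "\<forall>k<m. Q k"
  proof -
  have zy: "zer (x (2 * k)) (x (2 * (k + 1)))" if "k <= m" for k
  proof (cases k)
  case 0
  then show ?thesis using z by simp
  next
  case (Suc l)
  then have "Q l" using Q that by simp
  then show ?thesis using Suc unfolding Q_def by (simp add: numeral_3_eq_3)
  qed
  have "(\<Sum>w\<in>selected zer n x. bd \<tau> n w) = sum \<tau> (inside (2 * m + 1) (x 0) (x n))"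
  using inside_even_cover[of m "\<lambda>k. x (2 * k)" \<tau>] zy \<tau> n by (simp add: selected_def)
  also have "\<dots> = S (x 2)"
  proof -
  have "\<tau> w = 0" if "w \<in> inside (2 * m + 1) (x 0) (x n)" "\<not> fst w < x 2" for w
  using that z \<tau>[of "fst w" "snd w"] zer_mono[of "x 0" "x 2" "x 0" "fst w"]
  by (auto simp: ap_inside_def)
  then show ?thesis unfolding S_def
  by (intro sum_supported[symmetric]) auto
  qed
  finally show ?thesis .
  qed
  then show ?thesis unfolding g A_def[symmetric] by auto
 qed
 finally show ?thesis .
qed

text \<open>The combinatorial core of the compatibility of \<open>G\<close> with the differentials. The left side is \<open>G\<close> of the bar
  differential, the right side the differential of \<open>G\<close>.\<close>

theorem cut_sum_boundary:
 fixes \<tau> :: "occ => 'm::ab_group_add"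
 assumes "1 <= n"
  and "\<And>k. k < n ==> x k <= x (k + 1)"
  and "\<And>k. k < n ==> \<not> zer (x k) (x (k + 1))"
  and "\<And>i j. x 0 <= i ==> j <= x n ==> zer (x 0) i \<or> zer j (x n) ==> \<tau> (i, j) = 0"
 shows "(\<Sum>i\<le>n. if even i then cut_sum zer \<tau> (n - 1) (drop_cut i x)
  else - cut_sum zer \<tau> (n - 1) (drop_cut i x)) =
  (if cuts_good zer n x then (\<Sum>w\<in>selected zer n x. bd \<tau> n w) else 0)"
proof -
 have "(\<exists>m. n = 2 * m + 1) \<or> (\<exists>m. n = 2 * m + 2)" using assms(1) by presburger
 then show ?thesis using cut_sum_odd[of n _ x \<tau>, OF _ assms(2-4)] cut_sum_even[of n _ x \<tau>, OF _ assms(2-4)] by blast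
qed

end

section \<open>Linear maps on free vector spaces\<close>

definition smul :: "'k::field => ('x \<Rightarrow>\<^sub>0 'k) => ('x \<Rightarrow>\<^sub>0 'k)" where
 "smul c f = Poly_Mapping.map ((*) c) f"

definition klinear :: "(('x \<Rightarrow>\<^sub>0 'k::field) => ('y \<Rightarrow>\<^sub>0 'k)) => bool" where
 "klinear h \<longleftrightarrow> (\<forall>f g. h (f + g) = h f + h g) \<and> (\<forall>c f. h (smul c f) = smul c (h f))"

definition lin :: "('x => ('y \<Rightarrow>\<^sub>0 'k)) => ('x \<Rightarrow>\<^sub>0 'k::field) => ('y \<Rightarrow>\<^sub>0 'k)" where
 "lin g f = (\<Sum>x\<in>supp f. smul (Poly_Mapping.lookup f x) (g x))"

definition bilin :: "('x => 'y => ('z \<Rightarrow>\<^sub>0 'k)) => ('x \<Rightarrow>\<^sub>0 'k::field) => ('y \<Rightarrow>\<^sub>0 'k) => ('z \<Rightarrow>\<^sub>0 'k)" where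
 "bilin m f g = lin (\<lambda>x. lin (m x) g) f"

abbreviation basis :: "'x => ('x \<Rightarrow>\<^sub>0 'k::field)" where
 "basis x \<equiv> sgl x 1"

lemma lookup_smul [simp]: "Poly_Mapping.lookup (smul c f) x = c * Poly_Mapping.lookup f x"
 by (simp add: smul_def Poly_Mapping.map.rep_eq when_def)

lemma smul_simps [simp]:
 "smul c (f + g) = smul c f + smul c g" "smul c (f - g) = smul c f - smul c g"
 "smul c (- f) = - smul c f" "smul c 0 = 0" "smul 0 f = 0" "smul 1 f = f"
 "smul c (smul d f) = smul (c * d) f" "smul c (sgl x d) = sgl x (c * d)"
 by (rule poly_mapping_eqI; simp add: algebra_simps lookup_add lookup_minus lookup_single when_def)+

lemma smul_add_left: "smul (c + d) f = smul c f + smul d f"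
 by (rule poly_mapping_eqI) (simp add: algebra_simps lookup_add)

lemma smul_sum: "smul c (sum f A) = (\<Sum>x\<in>A. smul c (f x))"
 by (induction A rule: infinite_finite_induct) auto

lemma klinearI:
 assumes "\<And>f g. h (f + g) = h f + h g" "\<And>c f. h (smul c f) = smul c (h f)"
 shows "klinear h"
 using assms by (simp add: klinear_def)

lemma klinear_add: "klinear h ==> h (f + g) = h f + h g"
 and klinear_smul: "klinear h ==> h (smul c f) = smul c (h f)"
 by (auto simp: klinear_def)

lemma klinear_0: "klinear h ==> h 0 = 0"
 using klinear_smul[of h 0 0] by simp

lemma klinear_minus: "klinear h ==> h (- f) = - h f"
 using klinear_add[of h f "- f"] klinear_0[of h] by (simp add: eq_neg_iff_add_eq_0 add.commute)

lemma klinear_diff: "klinear h ==> h (f - g) = h f - h g"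
 using klinear_add[of h f "- g"] klinear_minus[of h g] by simp

lemma klinear_sum: assumes "klinear h" shows "h (sum f A) = (\<Sum>x\<in>A. h (f x))"
 by (induction A rule: infinite_finite_induct)
  (simp_all add: klinear_0[OF assms] klinear_add[OF assms])

lemma lin_superset:
 assumes "finite A" "supp f <= A"
 shows "lin g f = (\<Sum>x\<in>A. smul (Poly_Mapping.lookup f x) (g x))"
 unfolding lin_def using assms
 by (intro sum.mono_neutral_left) (auto simp: in_keys_iff)

lemma klinear_lin: "klinear (lin g)"
proof (rule klinearI)
 fix f f' :: "'a \<Rightarrow>\<^sub>0 'b"
 let ?A = "supp f \<union> supp f'"
 have "supp (f + f') <= ?A" by (rule Poly_Mapping.keys_add)
 then show "lin g (f + f') = lin g f + lin g f'"
  using lin_superset[of ?A "f + f'" g] lin_superset[of ?A f g] lin_superset[of ?A f' g]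
  by (simp add: lookup_add smul_add_left sum.distrib)
next
 fix c and f :: "'a \<Rightarrow>\<^sub>0 'b"
 have "supp (smul c f) <= supp f" by (auto simp: in_keys_iff)
 then show "lin g (smul c f) = smul c (lin g f)"
  using lin_superset[of "supp f" "smul c f" g] by (simp add: lin_def smul_sum)
qed

lemma lin_single [simp]: "lin g (sgl x c) = smul c (g x)"
 by (cases "c = 0") (simp_all add: lin_def)

lemma lin_0 [simp]: "lin g 0 = 0" by (simp add: lin_def)

lemmas lin_add [simp] = klinear_add[OF klinear_lin]
lemmas lin_minus [simp] = klinear_minus[OF klinear_lin]
lemmas lin_diff [simp] = klinear_diff[OF klinear_lin]
lemmas lin_smul [simp] = klinear_smul[OF klinear_lin]
lemmas lin_sum = klinear_sum[OF klinear_lin]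

lemma lin_cong: "(\<And>x. x \<in> supp f ==> g x = h x) ==> lin g f = lin h f"
 by (simp add: lin_def cong: sum.cong)

lemma lin_basis [simp]: "lin basis f = f"
proof (rule poly_mapping_eqI)
 fix x
 have "Poly_Mapping.lookup (lin basis f) x =
  (\<Sum>y\<in>supp f. if y = x then Poly_Mapping.lookup f y else 0)"
  unfolding lin_def lookup_sum by (intro sum.cong refl) (simp add: lookup_single)
 also have "\<dots> = Poly_Mapping.lookup f x"
  by (simp add: in_keys_iff)
 finally show "Poly_Mapping.lookup (lin basis f) x = Poly_Mapping.lookup f x" .
qed

lemma klinear_eq_lin: assumes "klinear h" shows "h f = lin (\<lambda>x. h (basis x)) f"
proof -
 have "h f = h (lin basis f)" by simp
 also have "\<dots> = lin (\<lambda>x. h (basis x)) f"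
  unfolding lin_def by (simp only: klinear_sum[OF assms] klinear_smul[OF assms])
 finally show ?thesis .
qed

lemma klinear_eqI:
 assumes "klinear h" "klinear h'" "\<And>x. x \<in> supp f ==> h (basis x) = h' (basis x)"
 shows "h f = h' f"
 unfolding klinear_eq_lin[OF assms(1), of f] klinear_eq_lin[OF assms(2), of f]
 by (rule lin_cong) (rule assms(3))

lemma klinear_lin_comp: assumes "klinear h" shows "h (lin g f) = lin (\<lambda>x. h (g x)) f"
 unfolding lin_def by (simp only: klinear_sum[OF assms] klinear_smul[OF assms])

lemma klinear_id: "klinear (\<lambda>f. f)" by (simp add: klinear_def)
lemma klinear_comp: "klinear g ==> klinear h ==> klinear (\<lambda>f. g (h f))" by (simp add: klinear_def)
lemma klinear_plus: "klinear g ==> klinear h ==> klinear (\<lambda>f. g f + h f)" by (simp add: klinear_def)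
lemma klinear_uminus: "klinear g ==> klinear (\<lambda>f. - g f)" by (simp add: klinear_def)
lemma klinear_zero: "klinear (\<lambda>f. 0)" by (simp add: klinear_def)
lemma klinear_smul_comp: "klinear g ==> klinear (\<lambda>f. smul c (g f))"
 by (simp add: klinear_def mult.commute)

lemma klinear_sum_fun:
 assumes "\<And>i. i \<in> A ==> klinear (g i)" shows "klinear (\<lambda>f. \<Sum>i\<in>A. g i f)"
 using assms by (induction A rule: infinite_finite_induct) (auto intro: klinear_zero klinear_plus)

lemma klinear_lin_fun:
 assumes "\<And>x. klinear (g x)" shows "klinear (\<lambda>f. lin (\<lambda>x. g x f) a)"
 unfolding lin_def by (intro klinear_sum_fun klinear_smul_comp assms)

lemma klinear_bilin_right: "klinear (bilin m f)"
proof -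
 have "klinear (\<lambda>g. lin (\<lambda>x. lin (m x) g) f)" by (intro klinear_lin_fun klinear_lin)
 then show ?thesis by (simp add: bilin_def[abs_def])
qed

lemma klinear_bilin_left: "klinear (\<lambda>f. bilin m f g)"
 unfolding bilin_def by (rule klinear_lin)

lemma bilin_single [simp]:
 "bilin m (sgl x a) (sgl y b) = smul (a * b) (m x y)"
 by (simp add: bilin_def)

lemma bilin_0 [simp]: "bilin m 0 g = 0" "bilin m f 0 = 0"
 by (rule klinear_0[OF klinear_bilin_left], rule klinear_0[OF klinear_bilin_right])

lemmas bilin_add_left = klinear_add[OF klinear_bilin_left]
lemmas bilin_add_right = klinear_add[OF klinear_bilin_right]
lemmas bilin_minus_left = klinear_minus[OF klinear_bilin_left]
lemmas bilin_diff_left = klinear_diff[OF klinear_bilin_left]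
lemmas bilin_smul_left = klinear_smul[OF klinear_bilin_left]
lemmas bilin_smul_right = klinear_smul[OF klinear_bilin_right]

lemma keys_smul: "supp (smul c f) <= supp f"
 by (auto simp: in_keys_iff)

lemma keys_sum_subset:
 assumes "\<And>x. x \<in> A ==> supp (f x) <= B"
 shows "supp (sum f A) <= B"
 using assms
proof (induction A rule: infinite_finite_induct)
 case (insert x F)
 then have "supp (f x) \<union> supp (sum f F) <= B" by simp
 moreover have "supp (f x + sum f F) <= supp (f x) \<union> supp (sum f F)"
  by (rule Poly_Mapping.keys_add)
 ultimately show ?case unfolding sum.insert[OF insert.hyps] by (rule order_trans[rotated])
qed simp_all

lemma keys_lin:
 assumes "\<And>x. x \<in> supp f ==> supp (g x) <= B"
 shows "supp (lin g f) <= B"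
 unfolding lin_def by (rule keys_sum_subset) (rule order_trans[OF keys_smul assms])

lemma keys_bilin:
 assumes "\<And>x y. x \<in> supp f ==> y \<in> supp g ==> supp (m x y) <= B"
 shows "supp (bilin m f g) <= B"
 unfolding bilin_def by (intro keys_lin assms)

lemma keys_basis [simp]: "supp (basis x :: 'x \<Rightarrow>\<^sub>0 'k::field) = {x}" by simp

section \<open>Paths and the path algebra\<close>

definition vat :: "('v, 'a) pre_digraph => ('v, 'a) path => nat => 'v" where
 "vat Q p i = pre_digraph.awlast Q (fst p) (take i (snd p))"

lemma awlast_append:
 "pre_digraph.awlast Q u (xs @ ys) = pre_digraph.awlast Q (pre_digraph.awlast Q u xs) ys"
proof (induction xs arbitrary: u)
 case Nil
 then show ?case by (simp add: pre_digraph.awalk_verts.simps)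
next
 case (Cons e es)
 then show ?case by (simp add: pre_digraph.awalk_verts.simps pre_digraph.awalk_verts_non_Nil)
qed

lemma awlast_Nil [simp]: "pre_digraph.awlast Q u [] = u"
 by (simp add: pre_digraph.awalk_verts.simps)

lemma cas_append:
 "pre_digraph.cas Q u (xs @ ys) v \<longleftrightarrow>
  pre_digraph.cas Q u xs (pre_digraph.awlast Q u xs) \<and>
  pre_digraph.cas Q (pre_digraph.awlast Q u xs) ys v"
proof (induction xs arbitrary: u)
 case Nil
 then show ?case by (simp add: pre_digraph.awalk_verts.simps pre_digraph.cas.simps)
next
 case (Cons e es)
 then show ?case by (simp add: pre_digraph.awalk_verts.simps pre_digraph.awalk_verts_non_Nil
  pre_digraph.cas.simps)
qed

lemma source_pcat [simp]: "source (pcat p q) = source p"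
 by (simp add: source_def pcat_def)

lemma target_pcat: "target Q p = source q ==> target Q (pcat p q) = target Q q"
 by (simp add: target_def source_def pcat_def awlast_append)

lemma pcat_assoc: "pcat (pcat p q) r = pcat p (pcat q r)"
 by (simp add: pcat_def)

lemma plength_pcat [simp]: "plength (pcat p q) = plength p + plength q"
 by (simp add: plength_def pcat_def)

lemma source_triv [simp]: "source (triv x) = x" and target_triv [simp]: "target Q (triv x) = x"
 and plength_triv [simp]: "plength (triv x) = 0"
 by (simp_all add: source_def target_def triv_def plength_def)

lemma pcat_triv [simp]: "pcat (triv (source p)) p = p" "pcat p (triv x) = p"
 by (simp_all add: pcat_def triv_def source_def)

lemma source_arrow [simp]: "source (arrow Q \<alpha>) = tail Q \<alpha>"
 and target_arrow [simp]: "target Q (arrow Q \<alpha>) = head Q \<alpha>"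
 and plength_arrow [simp]: "plength (arrow Q \<alpha>) = 1"
 by (simp_all add: source_def target_def arrow_def plength_def pre_digraph.awalk_verts.simps)

lemma source_pseg [simp]: "source (pseg Q p (i, j)) = vat Q p i"
 by (simp add: source_def pseg_def vat_def)

lemma plength_pseg [simp]: "j <= plength p ==> plength (pseg Q p (i, j)) = j - i"
 by (simp add: plength_def pseg_def)

lemma vat_pseg:
 assumes "i + k <= j" "j <= plength p"
 shows "vat Q (pseg Q p (i, j)) k = vat Q p (i + k)"
proof -
 have "take (i + k) (snd p) = take i (snd p) @ take k (drop i (snd p))" by (rule take_add)
 moreover have "min k (j - i) = k" using assms by simp
 ultimately show ?thesis by (simp add: vat_def pseg_def awlast_append)
qed

lemma vat_0 [simp]: "vat Q p 0 = source p"
 by (simp add: vat_def source_def)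

lemma vat_end [simp]: "vat Q p (plength p) = target Q p"
 by (simp add: vat_def target_def plength_def)

lemma target_pseg: assumes "i <= j" "j <= plength p" shows "target Q (pseg Q p (i, j)) = vat Q p j"
 using vat_pseg[of i "j - i" j p Q] vat_end[of Q "pseg Q p (i, j)"] assms by simp

lemma pseg_full [simp]: "pseg Q p (0, plength p) = p"
 by (simp add: pseg_def plength_def)

lemma pseg_triv [simp]: "pseg Q p (i, i) = triv (vat Q p i)"
 by (simp add: pseg_def triv_def vat_def)

lemma pcat_pseg:
 assumes "i <= j" "j <= k"
 shows "pcat (pseg Q p (i, j)) (pseg Q p (j, k)) = pseg Q p (i, k)"
proof -
 have "take (k - i) (drop i (snd p)) = take (j - i) (drop i (snd p)) @ take (k - j) (drop j (snd p))"
  using take_add[of "j - i" "k - j" "drop i (snd p)"] assms by simp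
 then show ?thesis by (simp add: pcat_def pseg_def)
qed

lemma pseg_pseg:
 assumes "a <= b" "b <= plength p" "i <= j" "a + j <= b"
 shows "pseg Q (pseg Q p (a, b)) (i, j) = pseg Q p (a + i, a + j)"
proof -
 have "a + i <= b" using assms by linarith
 then have "vat Q (pseg Q p (a, b)) i = vat Q p (a + i)" using vat_pseg assms(2) by blast
 moreover have "take (j - i) (drop i (take (b - a) (drop a (snd p)))) = take (j - i) (drop (a + i) (snd p))"
  using assms by (simp add: drop_take add.commute min_def)
 ultimately show ?thesis by (simp add: pseg_def vat_def)
qed

lemma pseg_pcat_left:
 assumes "j <= plength p" "i <= j"
 shows "pseg Q (pcat p q) (i, j) = pseg Q p (i, j)"
 using assms by (simp add: pseg_def pcat_def plength_def)

lemma pseg_pcat_right: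
 assumes "target Q p = source q"
 shows "pseg Q (pcat p q) (plength p + i, plength p + j) = pseg Q q (i, j)"
 using assms by (simp add: pseg_def pcat_def plength_def target_def source_def awlast_append)

lemma lpart_eq: "lpart Q T (i, j) = pseg Q T (0, i)"
 and rpart_eq: "rpart Q T (i, j) = pseg Q T (j, plength T)"
 by (simp_all add: lpart_def rpart_def)

context fin_digraph
begin

lemma paths_iff: "p \<in> paths G \<longleftrightarrow> fst p \<in> verts G \<and> set (snd p) <= arcs G \<and>
  cas (fst p) (snd p) (awlast (fst p) (snd p))"
 unfolding paths_def awalk_def using awlast_if_cas by auto

lemma pcat_in_paths:
 "p \<in> paths G ==> q \<in> paths G ==> target G p = source q ==> pcat p q \<in> paths G"
 unfolding paths_iff pcat_def target_def source_def by (auto simp: cas_append awlast_append)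

lemma triv_in_paths [simp]: "triv x \<in> paths G \<longleftrightarrow> x \<in> verts G"
 unfolding paths_iff triv_def by simp

lemma source_in_verts: "p \<in> paths G ==> source p \<in> verts G"
 unfolding paths_iff source_def by simp

lemma target_in_verts: "p \<in> paths G ==> target G p \<in> verts G"
 unfolding paths_iff target_def using awlast_in_verts by blast

lemma arrow_in_paths: "\<alpha> \<in> arcs G ==> arrow G \<alpha> \<in> paths G"
 unfolding paths_iff arrow_def by (simp add: wellformed)

lemma pseg_in_paths:
 assumes "p \<in> paths G" "i <= j" "j <= plength p"
 shows "pseg G p (i, j) \<in> paths G"
proof -
 have a: "fst p \<in> verts G" "set (snd p) <= arcs G" "cas (fst p) (snd p) (awlast (fst p) (snd p))"
  using assms paths_iff by auto
 define xs where "xs = take i (snd p)"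
 define ys where "ys = take (j - i) (drop i (snd p))"
 define zs where "zs = drop (j - i) (drop i (snd p))"
 have e: "snd p = xs @ ys @ zs" unfolding xs_def ys_def zs_def by (simp only: append_take_drop_id)
 have "awlast (fst p) xs \<in> verts G" using a e by (intro awlast_in_verts) auto
 moreover have "cas (awlast (fst p) xs) ys (awlast (awlast (fst p) xs) ys)"
  using a(3) unfolding e cas_append by simp
 moreover have "set ys <= arcs G" using a(2) e by auto
 ultimately show ?thesis unfolding paths_iff pseg_def xs_def ys_def by simp
qed

lemma pseg_one:
 assumes "p \<in> paths G" "i < plength p"
 shows "pseg G p (i, Suc i) = arrow G (snd p ! i)" "snd p ! i \<in> arcs G"
proof -
 have i: "i < length (snd p)" using assms by (simp add: plength_def)
 have s: "snd p = take i (snd p) @ (snd p ! i) # drop (Suc i) (snd p)" using i by (simp add: id_take_nth_drop)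
 have "cas (fst p) (snd p) (awlast (fst p) (snd p))" using assms paths_iff by simp
 then have "cas (awlast (fst p) (take i (snd p))) ((snd p ! i) # drop (Suc i) (snd p)) (awlast (fst p) (snd p))"
  using cas_append[of G "fst p" "take i (snd p)"] s by metis
 then have "tail G (snd p ! i) = awlast (fst p) (take i (snd p))" by simp
 then show "pseg G p (i, Suc i) = arrow G (snd p ! i)"
  using i by (simp add: pseg_def arrow_def take_Suc_conv_app_nth Cons_nth_drop_Suc[symmetric])
 show "snd p ! i \<in> arcs G" using assms i paths_iff by (meson nth_mem subsetD)
qed

end

definition path_times :: "('v, 'a) pre_digraph => (('v, 'a) path \<Rightarrow>\<^sub>0 'k::field) =>
  (('v, 'a) path \<Rightarrow>\<^sub>0 'k) => (('v, 'a) path \<Rightarrow>\<^sub>0 'k)" where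
 "path_times Q = bilin (\<lambda>p q. if target Q p = source q then basis (pcat p q) else 0)"

lemma path_algebra_simps [simp]:
 fixes Q :: "('v, 'a) pre_digraph"
 shows "carrier (path_algebra Q) = {f :: ('v, 'a) path \<Rightarrow>\<^sub>0 'k::field. supp f <= paths Q}"
  "\<one>\<^bsub>path_algebra Q\<^esub> = (\<Sum>x\<in>verts Q. basis (triv x) :: ('v, 'a) path \<Rightarrow>\<^sub>0 'k)"
  "\<zero>\<^bsub>path_algebra Q\<^esub> = (0 :: ('v, 'a) path \<Rightarrow>\<^sub>0 'k)"
  "(f :: ('v, 'a) path \<Rightarrow>\<^sub>0 'k) \<oplus>\<^bsub>path_algebra Q\<^esub> g = f + g"
 by (simp_all add: path_algebra_def)

lemma path_algebra_mult [simp]: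
 fixes f :: "('v, 'a) path \<Rightarrow>\<^sub>0 'k::field"
 shows "f \<otimes>\<^bsub>path_algebra Q\<^esub> g = path_times Q f g"
 unfolding path_algebra_def path_times_def bilin_def lin_def
 by (auto simp: smul_sum intro!: sum.cong)

lemma klinear_path_times: "klinear (path_times Q f)" "klinear (\<lambda>f. path_times Q f g)"
 unfolding path_times_def by (rule klinear_bilin_right, rule klinear_bilin_left)

lemma klinear_path_times_comp:
 assumes "klinear h"
 shows "klinear (\<lambda>f. path_times Q a (h f))" "klinear (\<lambda>f. path_times Q (h f) a)"
 by (rule klinearI; simp add: klinear_add[OF assms] klinear_smul[OF assms]
  klinear_add[OF klinear_path_times(1)] klinear_add[OF klinear_path_times(2)]
  klinear_smul[OF klinear_path_times(1)] klinear_smul[OF klinear_path_times(2)])+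

lemma path_times_single:
 "path_times Q (sgl p a) (sgl q b) =
  (if target Q p = source q then sgl (pcat p q) (a * b) else 0)"
 by (simp add: path_times_def)

lemma path_times_0 [simp]: "path_times Q 0 g = 0" "path_times Q f 0 = 0"
 by (simp_all add: path_times_def)

lemma path_times_assoc:
 fixes f g h :: "('v, 'a) path \<Rightarrow>\<^sub>0 'k::field"
 shows "path_times Q (path_times Q f g) h = path_times Q f (path_times Q g h)"
proof (rule klinear_eqI[of "\<lambda>f. path_times Q (path_times Q f g) h" "\<lambda>f. path_times Q f (path_times Q g h)"])
 fix p :: "('v, 'a) path"
 show "path_times Q (path_times Q (basis p) g) h = path_times Q (basis p) (path_times Q g h)"
 proof (rule klinear_eqI[of "\<lambda>g. path_times Q (path_times Q (basis p) g) h" "\<lambda>g. path_times Q (basis p) (path_times Q g h)"])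
  fix q :: "('v, 'a) path"
  show "path_times Q (path_times Q (basis p) (basis q)) h = path_times Q (basis p) (path_times Q (basis q) h)"
  proof (rule klinear_eqI[of "\<lambda>h. path_times Q (path_times Q (basis p) (basis q)) h"])
  fix r :: "('v, 'a) path"
  show "path_times Q (path_times Q (basis p) (basis q)) (basis r) =
  path_times Q (basis p :: ('v, 'a) path \<Rightarrow>\<^sub>0 'k) (path_times Q (basis q) (basis r))"
  by (simp add: path_times_single pcat_assoc target_pcat)
  qed (rule klinear_path_times(1), rule klinear_path_times_comp(1)[OF klinear_path_times(1)])
 qed (rule klinear_path_times_comp(2)[OF klinear_path_times(1)],
  rule klinear_path_times_comp(1)[OF klinear_path_times(2)])
qed (rule klinear_path_times_comp(2)[OF klinear_path_times(2)], rule klinear_path_times(2))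

lemma keys_path_times:
 assumes "fin_digraph Q" "supp f <= paths Q" "supp g <= paths Q"
 shows "supp (path_times Q f g) <= paths Q"
 unfolding path_times_def
proof (rule keys_bilin)
 fix p q assume "p \<in> supp f" "q \<in> supp g"
 then have "p \<in> paths Q" "q \<in> paths Q" using assms by auto
 then show "supp (if target Q p = source q then basis (pcat p q) else 0) <= paths Q"
  using fin_digraph.pcat_in_paths[OF assms(1), of p q] by simp
qed

lemma path_times_one_left:
 fixes f :: "('v, 'a) path \<Rightarrow>\<^sub>0 'k::field"
 assumes "fin_digraph Q" "supp f <= paths Q"
 shows "path_times Q (\<Sum>x\<in>verts Q. basis (triv x)) f = f"
proof (rule klinear_eqI[of "path_times Q (\<Sum>x\<in>verts Q. basis (triv x))"])
 fix p assume p: "p \<in> supp f"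
 then have v: "source p \<in> verts Q" using assms fin_digraph.source_in_verts by blast
 have fin: "finite (verts Q)" using assms(1) by (rule fin_digraph.finite_verts)
 have "path_times Q (\<Sum>x\<in>verts Q. basis (triv x)) (basis p :: ('v, 'a) path \<Rightarrow>\<^sub>0 'k) =
  (\<Sum>x\<in>verts Q. if x = source p then basis p else 0)"
  unfolding klinear_sum[OF klinear_path_times(2)]
  by (intro sum.cong refl) (auto simp: path_times_single)
 then show "path_times Q (\<Sum>x\<in>verts Q. basis (triv x)) (basis p) = (basis p :: ('v, 'a) path \<Rightarrow>\<^sub>0 'k)"
  using v fin by (simp add: sum.delta)
qed (rule klinear_path_times klinear_id)+

lemma path_times_one_right:
 fixes f :: "('v, 'a) path \<Rightarrow>\<^sub>0 'k::field"
 assumes "fin_digraph Q" "supp f <= paths Q"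
 shows "path_times Q f (\<Sum>x\<in>verts Q. basis (triv x)) = f"
proof (rule klinear_eqI[of "\<lambda>f. path_times Q f (\<Sum>x\<in>verts Q. basis (triv x))" "\<lambda>f. f"])
 fix p assume p: "p \<in> supp f"
 then have v: "target Q p \<in> verts Q" using assms fin_digraph.target_in_verts by blast
 have fin: "finite (verts Q)" using assms(1) by (rule fin_digraph.finite_verts)
 have "path_times Q (basis p :: ('v, 'a) path \<Rightarrow>\<^sub>0 'k) (\<Sum>x\<in>verts Q. basis (triv x)) =
  (\<Sum>x\<in>verts Q. if x = target Q p then basis p else 0)"
  unfolding klinear_sum[OF klinear_path_times(1)]
  by (intro sum.cong refl) (auto simp: path_times_single)
 then show "path_times Q (basis p :: ('v, 'a) path \<Rightarrow>\<^sub>0 'k) (\<Sum>x\<in>verts Q. basis (triv x)) = basis p"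
  using v fin by (simp add: sum.delta)
qed (rule klinear_path_times klinear_id)+

lemma ring_path_algebra:
 assumes "fin_digraph Q"
 shows "ring (path_algebra Q :: (('v, 'a) path \<Rightarrow>\<^sub>0 'k::field) ring)"
proof (rule ringI)
 show "abelian_group (path_algebra Q :: (('v, 'a) path \<Rightarrow>\<^sub>0 'k) ring)"
 proof (rule abelian_groupI)
  fix f g h :: "('v, 'a) path \<Rightarrow>\<^sub>0 'k"
  assume f: "f \<in> carrier (path_algebra Q)" and g: "g \<in> carrier (path_algebra Q)"
  show "f \<oplus>\<^bsub>path_algebra Q\<^esub> g \<in> carrier (path_algebra Q)"
  using f g order_trans[OF Poly_Mapping.keys_add[of f g]] by simp
  show "\<exists>g\<in>carrier (path_algebra Q). g \<oplus>\<^bsub>path_algebra Q\<^esub> f = \<zero>\<^bsub>path_algebra Q\<^esub>"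
  using f by (intro bexI[of _ "- f"]) (simp_all add: keys_minus)
 qed (simp_all add: ac_simps)
 have one: "supp (\<Sum>x\<in>verts Q. basis (triv x) :: ('v, 'a) path \<Rightarrow>\<^sub>0 'k) <= paths Q"
  by (rule keys_sum_subset) (simp add: fin_digraph.triv_in_paths[OF assms])
 show "Group.monoid (path_algebra Q :: (('v, 'a) path \<Rightarrow>\<^sub>0 'k) ring)"
  by (rule monoidI) (simp_all add: keys_path_times[OF assms] one path_times_assoc
  path_times_one_left[OF assms] path_times_one_right[OF assms])
qed (simp_all add: klinear_add[OF klinear_path_times(1)] klinear_add[OF klinear_path_times(2)])

section \<open>Monomial ideals\<close>

lemma pspan_ideal:
 assumes Q: "fin_digraph Q" and Z: "Z <= paths Q"
  and l: "\<And>p q. p \<in> paths Q ==> q \<in> Z ==> target Q p = source q ==> pcat p q \<in> Z"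
  and r: "\<And>p q. p \<in> Z ==> q \<in> paths Q ==> target Q p = source q ==> pcat p q \<in> Z"
 shows "ideal (pspan Z :: (('v, 'a) path \<Rightarrow>\<^sub>0 'k::field) set) (path_algebra Q)"
proof (rule idealI)
 let ?R = "path_algebra Q :: (('v, 'a) path \<Rightarrow>\<^sub>0 'k::field) ring"
 show R: "ring ?R" by (rule ring_path_algebra[OF Q])
 interpret ring ?R by fact
 show "subgroup (pspan Z) (add_monoid ?R)"
 proof (rule add.subgroupI)
  show "pspan Z <= carrier ?R" using Z by (auto simp: pspan_def)
  show "pspan Z \<noteq> ({} :: (('v, 'a) path \<Rightarrow>\<^sub>0 'k) set)" unfolding pspan_def by (auto intro: exI[of _ 0])
  fix f g :: "('v, 'a) path \<Rightarrow>\<^sub>0 'k"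
  assume f: "f \<in> pspan Z"
  have "f \<oplus>\<^bsub>?R\<^esub> (- f) = \<zero>\<^bsub>?R\<^esub>" "- f \<in> carrier ?R" "f \<in> carrier ?R"
  using f Z by (auto simp: pspan_def keys_minus)
  then have "\<ominus>\<^bsub>?R\<^esub> f = - f" by (metis minus_equality a_comm)
  then show "\<ominus>\<^bsub>?R\<^esub> f \<in> pspan Z" using f by (simp add: pspan_def keys_minus)
  assume "g \<in> pspan Z"
  then show "f \<oplus>\<^bsub>?R\<^esub> g \<in> pspan Z"
  using f Poly_Mapping.keys_add[of f g] by (auto simp: pspan_def)
 qed
 fix f g :: "('v, 'a) path \<Rightarrow>\<^sub>0 'k"
 assume f: "f \<in> pspan Z" and g: "g \<in> carrier ?R"
 have "supp (path_times Q g f) <= Z" unfolding path_times_def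
 proof (rule keys_bilin)
  fix p q assume "p \<in> supp g" "q \<in> supp f"
  then show "supp (if target Q p = source q then basis (pcat p q) else 0) <= Z"
  using f g l[of p q] by (auto simp: pspan_def)
 qed
 then show "g \<otimes>\<^bsub>?R\<^esub> f \<in> pspan Z" by (simp add: pspan_def)
 have "supp (path_times Q f g) <= Z" unfolding path_times_def
 proof (rule keys_bilin)
  fix p q assume "p \<in> supp f" "q \<in> supp g"
  then show "supp (if target Q p = source q then basis (pcat p q) else 0) <= Z"
  using f g r[of p q] by (auto simp: pspan_def)
 qed
 then show "f \<otimes>\<^bsub>?R\<^esub> g \<in> pspan Z" by (simp add: pspan_def)
qed

lemma ideal_prod_pspan_length:
 assumes "X <= pspan {p \<in> paths Q. a <= plength p}" "Y <= pspan {p \<in> paths Q. b <= plength p}"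
  and Q: "fin_digraph Q"
 shows "ideal_prod (path_algebra Q) X Y \<subseteq>
  (pspan {p \<in> paths Q. a + b <= plength p} :: (('v, 'a) path \<Rightarrow>\<^sub>0 'k::field) set)"
proof
 fix f :: "('v, 'a) path \<Rightarrow>\<^sub>0 'k"
 assume "f \<in> ideal_prod (path_algebra Q) X Y"
 then show "f \<in> pspan {p \<in> paths Q. a + b <= plength p}"
 proof induction
  case (prod f g)
  then have fg: "supp f <= {p \<in> paths Q. a <= plength p}"
  "supp g <= {p \<in> paths Q. b <= plength p}" using assms by (auto simp: pspan_def)
  have "supp (path_times Q f g) <= {p \<in> paths Q. a + b <= plength p}" unfolding path_times_def
  proof (rule keys_bilin)
  fix p q assume "p \<in> supp f" "q \<in> supp g"
  then have "p \<in> paths Q" "q \<in> paths Q" "a <= plength p" "b <= plength q" using fg by auto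
  then show "supp (if target Q p = source q then basis (pcat p q) else 0)
  <= {p \<in> paths Q. a + b <= plength p}"
  using fin_digraph.pcat_in_paths[OF Q, of p q] by simp
  qed
  then show ?case by (simp add: pspan_def)
 next
  case (sum f g)
  then show ?case using Poly_Mapping.keys_add[of f g] by (auto simp: pspan_def)
 qed
qed

context monomial_algebra
begin

abbreviation R :: "(('v, 'a) path \<Rightarrow>\<^sub>0 'k) ring" where "R \<equiv> path_algebra Q"

lemma fin_digraph_Q: "fin_digraph Q" by (rule fin_digraph_axioms)

sublocale R: ring R by (rule ring_path_algebra[OF fin_digraph_Q])

definition zpath :: "('v, 'a) path => bool" where
 "zpath p \<longleftrightarrow> p \<in> paths Q \<and> pbasis p \<in> I"

lemma ideal_I: "ideal I R"
proof -
 obtain S where S: "S <= paths Q" "I = genideal R (pbasis ` S)" using generated_by_paths by blast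
 show ?thesis unfolding S(2) by (rule R.genideal_ideal) (use S(1) in \<open>auto simp: pbasis_def\<close>)
qed

sublocale I: ideal I R by (rule ideal_I)

lemma zpath_pcat_right:
 assumes "zpath p" "q \<in> paths Q" "target Q p = source q" shows "zpath (pcat p q)"
proof -
 have "pbasis p \<otimes>\<^bsub>R\<^esub> pbasis q \<in> I"
  by (rule I.I_r_closed) (use assms in \<open>auto simp: zpath_def pbasis_def\<close>)
 then show ?thesis using assms pcat_in_paths[of p q]
  by (simp add: pbasis_def path_times_single zpath_def)
qed

lemma zpath_pcat_left:
 assumes "p \<in> paths Q" "zpath q" "target Q p = source q" shows "zpath (pcat p q)"
proof -
 have "pbasis p \<otimes>\<^bsub>R\<^esub> pbasis q \<in> I"
  by (rule I.I_l_closed) (use assms in \<open>auto simp: zpath_def pbasis_def\<close>)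
 then show ?thesis using assms pcat_in_paths[of p q]
  by (simp add: pbasis_def path_times_single zpath_def)
qed

text \<open>A monomial ideal is spanned by the paths that it contains, so membership can be tested path by path.\<close>

lemma I_eq: "I = pspan {p. zpath p}"
proof
 obtain S where S: "S <= paths Q" "I = genideal R (pbasis ` S)" using generated_by_paths by blast
 have "ideal (pspan {p. zpath p} :: (('v, 'a) path \<Rightarrow>\<^sub>0 'k) set) R"
  by (rule pspan_ideal[OF fin_digraph_Q])
  (use zpath_pcat_left zpath_pcat_right in \<open>auto simp: zpath_def\<close>)
 moreover have "pbasis ` S <= (pspan {p. zpath p} :: (('v, 'a) path \<Rightarrow>\<^sub>0 'k) set)"
 proof
  fix f :: "('v, 'a) path \<Rightarrow>\<^sub>0 'k" assume f: "f \<in> pbasis ` S"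
  then obtain p where p: "p \<in> S" "f = pbasis p" by blast
  have "pbasis ` S <= carrier R" using S(1) by (auto simp: pbasis_def)
  then have "f \<in> I" unfolding S(2) using R.genideal_self f by blast
  then show "f \<in> pspan {p. zpath p}" using p S(1) by (auto simp: pspan_def zpath_def pbasis_def)
 qed
 ultimately show "I <= pspan {p. zpath p}" unfolding S(2) by (rule R.genideal_minimal)
next
 show "pspan {p. zpath p} <= I"
 proof
  fix f :: "('v, 'a) path \<Rightarrow>\<^sub>0 'k" assume f: "f \<in> pspan {p. zpath p}"
  have single_I: "sgl p c \<in> I" if "zpath p" for p and c :: 'k
  proof -
  have "sgl (triv (source p)) c \<otimes>\<^bsub>R\<^esub> pbasis p \<in> I"
  by (rule I.I_l_closed) (use that source_in_verts[of p] in \<open>auto simp: zpath_def pbasis_def\<close>)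
  then show ?thesis by (simp add: pbasis_def path_times_single)
  qed
  have "(\<Sum>p\<in>X. sgl p (Poly_Mapping.lookup f p)) \<in> I" if "finite X" "X <= {p. zpath p}" for X
  using that
  proof (induction X)
  case empty
  then show ?case using I.zero_closed by simp
  next
  case (insert p X)
  then have "sgl p (Poly_Mapping.lookup f p) \<oplus>\<^bsub>R\<^esub>
  (\<Sum>p\<in>X. sgl p (Poly_Mapping.lookup f p)) \<in> I"
  by (intro I.a_closed single_I) auto
  then show ?case using insert by simp
  qed
  from this[of "supp f"] have "lin basis f \<in> I"
  unfolding lin_def using f by (simp add: pspan_def)
  then show "f \<in> I" by simp
 qed
qed

lemma pbasis_in_I_iff: "pbasis p \<in> I \<longleftrightarrow> zpath p"
proof -
 have "(pbasis p :: ('v, 'a) path \<Rightarrow>\<^sub>0 'k) \<in> pspan {p. zpath p} \<longleftrightarrow> zpath p"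
  by (simp add: pspan_def pbasis_def)
 then show ?thesis by (simp only: I_eq[symmetric])
qed

lemma zpath_length: assumes "zpath p" shows "2 <= plength p"
proof -
 let ?L = "\<lambda>k. pspan {p \<in> paths Q. k <= plength p} :: (('v, 'a) path \<Rightarrow>\<^sub>0 'k) set"
 have L: "ideal (?L k) R" for k
  by (rule pspan_ideal[OF fin_digraph_Q]) (auto intro: pcat_in_paths)
 let ?J = "arrow_ideal Q :: (('v, 'a) path \<Rightarrow>\<^sub>0 'k) set"
 have J: "?J <= ?L 1" unfolding arrow_ideal_def
  by (rule R.genideal_minimal[OF L]) (auto simp: pspan_def pbasis_def arrow_in_paths)
 have C: "carrier R <= ?L 0" by (auto simp: pspan_def)
 have "ideal_power Q ?J 2 = ideal_prod R (ideal_prod R (carrier R) ?J) ?J"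
  by (simp add: ideal_power_def ideals_set_def nat_pow_def numeral_2_eq_2)
 also have "\<dots> <= ?L (0 + 1 + 1)"
  by (rule ideal_prod_pspan_length[OF ideal_prod_pspan_length[OF C J fin_digraph_Q] J fin_digraph_Q])
 finally have "I <= ?L 2" using admissible by (auto simp: numeral_2_eq_2)
 then have "pbasis p \<in> ?L 2" using assms pbasis_in_I_iff by blast
 then show ?thesis by (simp add: pspan_def pbasis_def)
qed

lemma nonzero_iff: "p \<in> nonzero_paths Q I \<longleftrightarrow> p \<in> paths Q \<and> \<not> zpath p"
 by (auto simp: nonzero_paths_def zpath_def)

lemma relations_iff: "p \<in> relations Q I \<longleftrightarrow> zpath p \<and>
  (\<forall>i j. i <= j \<and> j <= plength p \<and> (i, j) \<noteq> (0, plength p) --> \<not> zpath (pseg Q p (i, j)))"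
proof -
 have "zpath p ==> p \<in> paths Q" by (simp add: zpath_def)
 then show ?thesis unfolding relations_def mem_Collect_eq pbasis_in_I_iff by blast
qed

abbreviation rocc :: "('v, 'a) path => occ set" where
 "rocc T \<equiv> occs Q (relations Q I) T"

text \<open>The minimal relations detect the zero segments of \<open>T\<close>, so the combinatorics of relations on \<open>T\<close> is that of
  the relation \<open>zint T\<close> on positions.\<close>

definition zint :: "('v, 'a) path => nat => nat => bool" where
 "zint T i j \<longleftrightarrow> (\<exists>(s, t)\<in>rocc T. i <= s \<and> t <= j)"

lemma rocc_iff: "(s, t) \<in> rocc T \<longleftrightarrow> s <= t \<and> t <= plength T \<and> pseg Q T (s, t) \<in> relations Q I"
 by (simp add: occs_def)

lemma rocc_length: assumes "(s, t) \<in> rocc T" shows "s + 2 <= t"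
proof -
 have "2 <= plength (pseg Q T (s, t))" "t <= plength T"
  using assms zpath_length relations_iff rocc_iff by blast+
 then show ?thesis by simp
qed

lemma rocc_antichain:
 assumes "(s, t) \<in> rocc T" "(s', t') \<in> rocc T" "s <= s'" "t' <= t"
 shows "s' = s \<and> t' = t"
proof (rule ccontr)
 assume ne: "\<not> (s' = s \<and> t' = t)"
 have a: "s <= t" "t <= plength T" "pseg Q T (s, t) \<in> relations Q I"
  and b: "s' <= t'" "pseg Q T (s', t') \<in> relations Q I" using assms rocc_iff by auto
 have "pseg Q (pseg Q T (s, t)) (s' - s, t' - s) = pseg Q T (s', t')"
  using pseg_pseg[of s t T "s' - s" "t' - s" Q] assms(3,4) a b by simp
 moreover have "s' - s <= t' - s" "t' - s <= plength (pseg Q T (s, t))"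
  "(s' - s, t' - s) \<noteq> (0, plength (pseg Q T (s, t)))"
  using assms(3,4) a b ne by auto
 moreover have "\<not> zpath (pseg Q (pseg Q T (s, t)) (c, d))"
  if "c <= d" "d <= plength (pseg Q T (s, t))" "(c, d) \<noteq> (0, plength (pseg Q T (s, t)))" for c d
  using a(3) that relations_iff by blast
 moreover have "zpath (pseg Q T (s', t'))" using b relations_iff by blast
 ultimately show False by (metis (no_types, lifting))
qed

lemma zintI: "(s, t) \<in> rocc T ==> i <= s ==> t <= j ==> zint T i j"
 unfolding zint_def by blast

lemma zintE:
 assumes "zint T i j" obtains s t where "(s, t) \<in> rocc T" "i <= s" "t <= j"
 using assms unfolding zint_def by blast

sublocale zint: zero_intervals "zint T" for T
proof
 show "zint T i j ==> i' <= i ==> j <= j' ==> zint T i' j'" for i j i' j'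
  by (erule zintE) (rule zintI, assumption, simp, simp)
 show "zint T i j ==> i + 2 <= j" for i j
  by (erule zintE) (use rocc_length in fastforce)
qed

lemma zpath_contains_relation:
 assumes "zpath p" shows "\<exists>(s, t)\<in>rocc p. True"
proof -
 let ?P = "\<lambda>(i, j). i <= j \<and> j <= plength p \<and> zpath (pseg Q p (i, j))"
 have "?P (0, plength p)" using assms by simp
 from ex_has_least_nat[of ?P, OF this, of "\<lambda>(i, j). j - i"]
 obtain i j where ij: "i <= j" "j <= plength p" "zpath (pseg Q p (i, j))"
  and min: "\<And>i' j'. i' <= j' ==> j' <= plength p ==> zpath (pseg Q p (i', j')) ==> j - i <= j' - i'"
  by auto
 have "pseg Q p (i, j) \<in> relations Q I"
  unfolding relations_iff
 proof (intro conjI allI impI)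
  fix a b assume ab: "a <= b \<and> b <= plength (pseg Q p (i, j)) \<and> (a, b) \<noteq> (0, plength (pseg Q p (i, j)))"
  then have b: "i + b <= j" "b - a < j - i" using ij by auto
  then have "pseg Q (pseg Q p (i, j)) (a, b) = pseg Q p (i + a, i + b)"
  using pseg_pseg ab ij by blast
  then show "\<not> zpath (pseg Q (pseg Q p (i, j)) (a, b))"
  using min[of "i + a" "i + b"] ab b ij by auto
 qed fact
 then show ?thesis using ij by (auto simp: rocc_iff)
qed

lemma zint_iff:
 assumes "T \<in> paths Q" "i <= j" "j <= plength T"
 shows "zint T i j \<longleftrightarrow> zpath (pseg Q T (i, j))"
proof
 assume "zint T i j"
 then obtain s t where st: "(s, t) \<in> rocc T" "i <= s" "t <= j" unfolding zint_def by blast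
 then have z: "zpath (pseg Q T (s, t))" "s <= t" "t <= plength T" using rocc_iff relations_iff by auto
 have "zpath (pcat (pseg Q T (s, t)) (pseg Q T (t, j)))"
  using z st assms by (intro zpath_pcat_right pseg_in_paths) (auto simp: target_pseg)
 then have "zpath (pseg Q T (s, j))" using pcat_pseg z st by metis
 then have "zpath (pcat (pseg Q T (i, s)) (pseg Q T (s, j)))"
  using z st assms by (intro zpath_pcat_left pseg_in_paths) (auto simp: target_pseg)
 then show "zpath (pseg Q T (i, j))" using pcat_pseg[of i s j Q T] z st by simp
next
 assume "zpath (pseg Q T (i, j))"
 then obtain a b where ab: "(a, b) \<in> rocc (pseg Q T (i, j))" using zpath_contains_relation by blast
 then have b: "a <= b" "i + b <= j" "pseg Q (pseg Q T (i, j)) (a, b) \<in> relations Q I"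
  using rocc_iff assms by auto
 then have "(i + a, i + b) \<in> rocc T" using pseg_pseg[of i j T a b Q] assms rocc_iff by auto
 then show "zint T i j" by (rule zintI) (use b in simp_all)
qed

lemma zint_pseg:
 assumes "T \<in> paths Q" "a <= b" "b <= plength T" "i <= b - a" "j <= b - a"
 shows "zint (pseg Q T (a, b)) i j \<longleftrightarrow> zint T (a + i) (a + j)"
proof (cases "i <= j")
 case True
 then show ?thesis
  using zint_iff[OF pseg_in_paths[OF assms(1-3)] True] zint_iff[OF assms(1), of "a + i" "a + j"]
  pseg_pseg[of a b T i j Q] assms by simp
next
 case False
 then show ?thesis using zint.zer_length[of "pseg Q T (a, b)" i j] zint.zer_length[of T "a + i" "a + j"]
  by auto
qed

end

section \<open>The sets AP as chain intervals\<close>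

lemma ap_intervals_shift:
 assumes z: "zero_intervals z" "zero_intervals z'"
  and eq: "\<And>i j. i <= N ==> j <= N ==> z i j = z' (a + i) (a + j)"
  and j: "j <= N"
 shows "(i, j) \<in> ap_intervals z n \<longleftrightarrow> (a + i, a + j) \<in> ap_intervals z' n"
proof
 interpret z: zero_intervals z by fact
 interpret z': zero_intervals z' by fact
 show "(a + i, a + j) \<in> ap_intervals z' n" if ij: "(i, j) \<in> ap_intervals z n"
 proof -
  obtain u where u: "z.chain n u" "u 0 = i" "u n = j" using z.apE[OF ij] .
  have uN: "u k <= N" if "k <= n" for k using z.chain_mono[OF u(1) that order_refl] u j by simp
  have "z'.chain n (\<lambda>k. a + u k)"
  unfolding anick_chain_def
  proof (intro conjI impI allI)
  show "a + u 1 = Suc (a + u 0)" if "1 <= n" using z.chain_first[OF u(1) that] by simp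
  fix k assume k: "k + 2 <= n"
  have s: "z.step (u k) (u (k + 1)) (u (k + 2))" using z.chain_step[OF u(1) k] .
  have N: "u k <= N" "u (k + 1) <= N" "u (k + 2) <= N" using uN k by auto
  show "z'.step (a + u k) (a + u (k + 1)) (a + u (k + 2))"
  unfolding anick_step_def
  proof (intro conjI allI impI)
  show "z' (a + u k) (a + u (k + 2))" "\<not> z' (a + u (k + 1)) (a + u (k + 2))"
  using s N eq by (auto simp: anick_step_def)
  fix b assume b: "z' (a + u k) b"
  show "a + u (k + 2) <= b"
  proof (cases "b <= a + N")
  case True
  obtain c where c: "b = a + c" using z'.zer_length[OF b] by (metis add.assoc le_Suc_ex)
  then have "z (u k) c" using b eq N True by simp
  then show ?thesis using s c by (auto simp: anick_step_def)
  qed (use N in simp)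
  qed
  qed
  from z'.apI[OF this] show ?thesis using u by simp
 qed
 show "(i, j) \<in> ap_intervals z n" if ij: "(a + i, a + j) \<in> ap_intervals z' n"
 proof -
  obtain v where v: "z'.chain n v" "v 0 = a + i" "v n = a + j" using z'.apE[OF ij] .
  define u where "u k = v k - a" for k
  have vu: "v k = a + u k" "u k <= N" if "k <= n" for k
  using z'.chain_mono[OF v(1) le0 that] z'.chain_mono[OF v(1) that order_refl] v j
  by (auto simp: u_def)
  have "z.chain n u"
  unfolding anick_chain_def
  proof (intro conjI impI allI)
  show "u 1 = Suc (u 0)" if "1 <= n" using z'.chain_first[OF v(1) that] v(2) by (simp add: u_def)
  fix k assume k: "k + 2 <= n"
  have s: "z'.step (a + u k) (a + u (k + 1)) (a + u (k + 2))"
  using z'.chain_step[OF v(1) k] vu(1)[of k] vu(1)[of "k+1"] vu(1)[of "k+2"] k by simp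
  have N: "u k <= N" "u (k + 1) <= N" "u (k + 2) <= N" using vu(2) k by auto
  show "z.step (u k) (u (k + 1)) (u (k + 2))"
  unfolding anick_step_def
  proof (intro conjI allI impI)
  show "z (u k) (u (k + 2))" "\<not> z (u (k + 1)) (u (k + 2))"
  using s N eq by (auto simp: anick_step_def)
  fix b assume b: "z (u k) b"
  show "u (k + 2) <= b"
  proof (cases "b <= N")
  case True
  then have "z' (a + u k) (a + b)" using b eq N by simp
  then show ?thesis using s by (auto simp: anick_step_def)
  qed (use N in simp)
  qed
  qed
  from z.apI[OF this] show ?thesis using v by (simp add: u_def)
 qed
qed

context monomial_algebra
begin

lemma step_iff:
 "anick_step (zint T) x y z \<longleftrightarrow> (\<exists>s. (s, z) \<in> rocc T \<and> x <= s \<and> s < y \<and> (\<forall>(s', t')\<in>rocc T. x <= s' --> s <= s'))"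
proof
 assume st: "anick_step (zint T) x y z"
 then have z: "zint T x z" "\<And>z'. zint T x z' ==> z <= z'" "\<not> zint T y z" by (auto simp: anick_step_def)
 from z(1) obtain s t where st: "(s, t) \<in> rocc T" "x <= s" "t <= z" by (rule zintE)
 have tz: "t = z" using z(2)[OF zintI[OF st(1,2) order_refl]] st by simp
 have "s < y" using z(3) zintI[OF st(1), of y z] st by force
 moreover have "s <= s'" if "(s', t') \<in> rocc T" "x <= s'" for s' t'
 proof (rule ccontr)
  assume "\<not> s <= s'"
  moreover have "z <= t'" using z(2)[OF zintI[OF that order_refl]] .
  ultimately show False using rocc_antichain[OF that(1) st(1)] tz by simp
 qed
 ultimately show "\<exists>s. (s, z) \<in> rocc T \<and> x <= s \<and> s < y \<and> (\<forall>(s', t')\<in>rocc T. x <= s' --> s <= s')"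
  using st tz by blast
next
 assume "\<exists>s. (s, z) \<in> rocc T \<and> x <= s \<and> s < y \<and> (\<forall>(s', t')\<in>rocc T. x <= s' --> s <= s')"
 then obtain s where s: "(s, z) \<in> rocc T" "x <= s" "s < y"
  and min: "\<And>s' t'. (s', t') \<in> rocc T ==> x <= s' ==> s <= s'" by blast
 show "anick_step (zint T) x y z" unfolding anick_step_def
 proof (intro conjI allI impI)
  show "zint T x z" using zintI s by blast
  show "z <= z'" if "zint T x z'" for z'
  proof (rule ccontr)
  assume "\<not> z <= z'"
  from that obtain s' t' where s': "(s', t') \<in> rocc T" "x <= s'" "t' <= z'" by (rule zintE)
  then show False using rocc_antichain[OF s(1) s'(1) min[OF s'(1,2)]] \<open>\<not> z <= z'\<close> by simp
  qed
  show "\<not> zint T y z"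
  proof
  assume "zint T y z"
  then obtain s' t' where s': "(s', t') \<in> rocc T" "y <= s'" "t' <= z" by (rule zintE)
  then show False using rocc_antichain[OF s(1) s'(1)] s by simp
  qed
 qed
qed

lemma step_least_start:
 "anick_step (zint T) x y z \<longleftrightarrow>
  (\<exists>s. least_start {p \<in> rocc T. x <= fst p \<and> fst p < y} (s, z))"
 unfolding step_iff least_start_def by fastforce

definition concat_chain :: "occ list => nat => nat" where
 "concat_chain ps k = (if k = 0 then fst (ps ! 0) else if k = 1 then Suc (fst (ps ! 0)) else snd (ps ! (k - 2)))"

lemma concat_chain_simps [simp]:
 "concat_chain ps 0 = fst (ps ! 0)" "concat_chain ps (Suc 0) = Suc (fst (ps ! 0))"
 "concat_chain ps (Suc (Suc k)) = snd (ps ! k)"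
 by (simp_all add: concat_chain_def)

lemma is_concatenation_iff:
 assumes "ps \<noteq> []"
 shows "is_concatenation Q I T ps \<longleftrightarrow> (\<forall>k<length ps.
  least_start {p \<in> rocc T. concat_chain ps k <= fst p \<and> fst p < concat_chain ps (Suc k)} (ps ! k))"
  (is "_ \<longleftrightarrow> (\<forall>k<length ps. ?L k)")
proof -
 have 0: "?L 0 \<longleftrightarrow> ps ! 0 \<in> rocc T" unfolding least_start_def by auto
 have 1: "?L 1 \<longleftrightarrow> least_start {p \<in> rocc T. fst (ps ! 0) < fst p \<and> fst p < snd (ps ! 0)} (ps ! 1)"
  by (simp add: Suc_le_eq)
 have 2: "?L j \<longleftrightarrow> least_start {p \<in> rocc T. snd (ps ! (j - 2)) <= fst p \<and> fst p < snd (ps ! (j - 1))} (ps ! j)"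
  if "2 <= j" for j
 proof -
  obtain l where "j = Suc (Suc l)" using \<open>2 <= j\<close> by (metis add_2_eq_Suc le_Suc_ex)
  then show ?thesis by simp
 qed
 have "(\<forall>k<length ps. ?L k) \<longleftrightarrow> ?L 0 \<and> (1 < length ps --> ?L 1) \<and> (\<forall>j. 2 <= j \<and> j < length ps --> ?L j)"
 proof
  assume R: "?L 0 \<and> (1 < length ps --> ?L 1) \<and> (\<forall>j. 2 <= j \<and> j < length ps --> ?L j)"
  show "\<forall>k<length ps. ?L k"
  proof (intro allI impI)
  fix k assume k: "k < length ps"
  have "k = 0 \<or> k = 1 \<or> 2 <= k" by linarith
  then show "?L k" using R k by blast
  qed
 qed (use assms in auto)
 then show ?thesis unfolding is_concatenation_def Let_def using assms 0 1 2 by blast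
qed

lemma concatenation_ap:
 assumes "is_concatenation Q I T ps"
 shows "(fst (hd ps), snd (last ps)) \<in> ap_intervals (zint T) (Suc (length ps))" "snd (last ps) <= plength T"
proof -
 have ne: "ps \<noteq> []" using assms by (simp add: is_concatenation_def Let_def)
 have L: "least_start {p \<in> rocc T. concat_chain ps k <= fst p \<and> fst p < concat_chain ps (Suc k)} (ps ! k)"
  if "k < length ps" for k using assms that is_concatenation_iff[OF ne] by blast
 have "anick_chain (zint T) (Suc (length ps)) (concat_chain ps)"
  unfolding anick_chain_def
 proof (intro conjI impI allI)
  fix k assume "k + 2 <= Suc (length ps)"
  then have "k < length ps" by simp
  from L[OF this] show "anick_step (zint T) (concat_chain ps k) (concat_chain ps (k + 1)) (concat_chain ps (k + 2))"
  unfolding step_least_start by (intro exI[of _ "fst (ps ! k)"]) simp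
 qed simp
 from zint.apI[OF this]
 show "(fst (hd ps), snd (last ps)) \<in> ap_intervals (zint T) (Suc (length ps))"
  using ne by (simp add: hd_conv_nth last_conv_nth concat_chain_def Suc_diff_le)
 have "last ps \<in> rocc T" using L[of "length ps - 1"] ne by (simp add: least_start_def last_conv_nth)
 then show "snd (last ps) <= plength T" by (cases "last ps") (simp add: rocc_iff)
qed

lemma ap_concatenation:
 assumes "(i, j) \<in> ap_intervals (zint T) n" "2 <= n"
 shows "\<exists>ps. is_concatenation Q I T ps \<and> length ps = n - 1 \<and> fst (hd ps) = i \<and> snd (last ps) = j"
proof -
 obtain u where u: "anick_chain (zint T) n u" "u 0 = i" "u n = j" using zint.apE[OF assms(1)] by blast
 define f where "f k = (SOME s. least_start {p \<in> rocc T. u k <= fst p \<and> fst p < u (k + 1)} (s, u (k + 2)))" for k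
 have f: "least_start {p \<in> rocc T. u k <= fst p \<and> fst p < u (k + 1)} (f k, u (k + 2))" if "k < n - 1" for k
  unfolding f_def
  by (rule someI_ex) (use zint.chain_step[OF u(1), of k] that in \<open>simp add: step_least_start\<close>)
 define ps where "ps = map (\<lambda>k. (f k, u (k + 2))) [0..<n - 1]"
 have len: "length ps = n - 1" by (simp add: ps_def)
 have nth: "ps ! k = (f k, u (k + 2))" if "k < n - 1" for k using that by (simp add: ps_def)
 have ne: "ps \<noteq> []" using assms(2) by (simp add: ps_def)
 have f0: "f 0 = i"
  using f[of 0] assms(2) zint.chain_first[OF u(1)] u by (auto simp: least_start_def)
 have cc: "concat_chain ps k = u k" if "k <= n" for k
 proof -
  have "k = 0 \<or> k = 1 \<or> (\<exists>l. k = l + 2)" by presburger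
  then show ?thesis
  using nth[of 0] nth[of "k - 2"] assms(2) that f0 u zint.chain_first[OF u(1)] by auto
 qed
 have "is_concatenation Q I T ps"
  unfolding is_concatenation_iff[OF ne] len using f cc nth by simp
 moreover have "fst (hd ps) = i" using nth[of 0] assms(2) f0 ne by (simp add: hd_conv_nth)
 moreover have "snd (last ps) = j"
 proof -
  have "n - 1 - 1 + 2 = n" using assms(2) by simp
  then show ?thesis using nth[of "n - 1 - 1"] assms(2) u ne len by (simp add: last_conv_nth)
 qed
 ultimately show ?thesis using len by blast
qed

lemma ap_pseg:
 assumes "T \<in> paths Q" "a <= b" "b <= plength T"
 shows "(0, b - a) \<in> ap_intervals (zint (pseg Q T (a, b))) n \<longleftrightarrow> (a, b) \<in> ap_intervals (zint T) n"
 using ap_intervals_shift[OF zint.zero_intervals_axioms zint.zero_intervals_axioms,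
  of "b - a" "pseg Q T (a, b)" T a "b - a" 0 n] zint_pseg[OF assms] assms by simp

text \<open>An \<open>n\<close>-concatenation \<open>(p\<^sub>1, \<dots>, p\<^bsub>n-1\<^esub>)\<close> corresponds to the chain of the positions \<open>s(p\<^sub>1), s(p\<^sub>1) + 1\<close>,
  \<open>t(p\<^sub>1), \<dots>, t(p\<^bsub>n-1\<^esub>)\<close>: a relation with minimal start among those that begin in the allowed range is the one
  that ends first. The support depends on its own path only, so it may be read inside any path \<open>T\<close>.\<close>

lemma pseg_AP_iff:
 assumes T: "T \<in> paths Q" and ij: "i <= j" "j <= plength T"
 shows "pseg Q T (i, j) \<in> AP Q I n \<longleftrightarrow> (i, j) \<in> ap_intervals (zint T) n"
proof -
 let ?w = "pseg Q T (i, j)"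
 have w: "?w \<in> paths Q" "plength ?w = j - i" using pseg_in_paths assms by auto
 consider "n = 0" | "n = 1" | "2 <= n" by linarith
 then show ?thesis
 proof cases
  case 1
  have "?w \<in> triv ` verts Q \<longleftrightarrow> i = j"
  proof
  assume "?w \<in> triv ` verts Q"
  then have "plength ?w = 0" by auto
  then show "i = j" using w ij by simp
  next
  assume "i = j"
  then show "?w \<in> triv ` verts Q" using w(1) ij by (auto simp del: vat_0)
  qed
  then show ?thesis using 1 zint.ap_0 by (auto simp: AP_def)
 next
  case 2
  have "?w \<in> arrow Q ` arcs Q \<longleftrightarrow> j = Suc i"
  proof
  assume "?w \<in> arrow Q ` arcs Q"
  then have "plength ?w = 1" by auto
  then show "j = Suc i" using w ij by simp
  next
  assume "j = Suc i"
  then show "?w \<in> arrow Q ` arcs Q" using pseg_one[OF T, of i] ij by auto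
  qed
  then show ?thesis using 2 zint.ap_1 by (auto simp: AP_def)
 next
  case 3
  have "?w \<in> AP Q I n \<longleftrightarrow> (0, j - i) \<in> ap_intervals (zint ?w) n"
  proof
  assume "?w \<in> AP Q I n"
  then obtain T' ps where T': "T' \<in> paths Q" "is_concatenation Q I T' ps" "length ps = n - 1"
  "?w = pseg Q T' (fst (hd ps), snd (last ps))" using 3 by (auto simp: AP_def)
  define a where "a = fst (hd ps)"
  define b where "b = snd (last ps)"
  have ab: "(a, b) \<in> ap_intervals (zint T') n" "b <= plength T'"
  using concatenation_ap[OF T'(2)] T'(3) 3 unfolding a_def b_def by auto
  have le: "a <= b" using zint.ap_le[OF ab(1)] .
  have wab: "?w = pseg Q T' (a, b)" using T' a_def b_def by simp
  then have "j - i = b - a" using w(2) ab(2) by simp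
  then show "(0, j - i) \<in> ap_intervals (zint ?w) n"
  using ap_pseg[OF T'(1) le ab(2)] ab(1) wab by simp
  next
  assume "(0, j - i) \<in> ap_intervals (zint ?w) n"
  from ap_concatenation[OF this 3] obtain ps where ps: "is_concatenation Q I ?w ps" "length ps = n - 1"
  "fst (hd ps) = 0" "snd (last ps) = j - i" by blast
  have "?w = pseg Q ?w (fst (hd ps), snd (last ps))" unfolding ps w(2)[symmetric] by simp
  then have "\<exists>T ps. T \<in> paths Q \<and> is_concatenation Q I T ps \<and> length ps = n - 1 \<and>
  ?w = pseg Q T (fst (hd ps), snd (last ps))" using w(1) ps(1,2) by blast
  then show "?w \<in> AP Q I n" using 3 unfolding AP_def by simp
  qed
  then show ?thesis using ap_pseg[OF T ij] by simp
 qed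
qed

lemma AP_paths: assumes "w \<in> AP Q I n" shows "w \<in> paths Q"
proof -
 consider "n = 0" | "n = 1" | "2 <= n" by linarith
 then show ?thesis
 proof cases
  case 3
  then obtain T ps where T: "T \<in> paths Q" "is_concatenation Q I T ps" "length ps = n - 1"
  "w = pseg Q T (fst (hd ps), snd (last ps))" using assms by (auto simp: AP_def)
  show ?thesis unfolding T(4)
  by (rule pseg_in_paths[OF T(1) zint.ap_le[OF concatenation_ap(1)[OF T(2)]] concatenation_ap(2)[OF T(2)]])
 qed (use assms in \<open>auto simp: AP_def arrow_in_paths\<close>)
qed

lemma AP_iff: "w \<in> AP Q I n \<longleftrightarrow> w \<in> paths Q \<and> (0, plength w) \<in> ap_intervals (zint w) n"
 using pseg_AP_iff[of w 0 "plength w" n] AP_paths[of w n] by auto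

lemma occs_AP:
 assumes "T \<in> paths Q"
 shows "occs Q (AP Q I n) T = ap_inside (zint T) n 0 (plength T)"
 using pseg_AP_iff[OF assms] zint.ap_le[of _ _ T n] by (auto simp: occs_def ap_inside_def)

end

section \<open>Normal forms and the two outer actions\<close>

lemma span_induct [consumes 1, case_names zero single add]:
 fixes f :: "'x \<Rightarrow>\<^sub>0 'k::field"
 assumes "supp f <= A" "P 0" "\<And>x c. x \<in> A ==> P (sgl x c)"
  "\<And>f g. P f ==> P g ==> P (f + g)"
 shows "P f"
proof -
 have "P (\<Sum>x\<in>X. sgl x (Poly_Mapping.lookup f x))" if "finite X" "X <= A" for X
  using that by (induction X) (auto intro: assms)
 from this[OF finite_keys assms(1)] have "P (lin basis f)" unfolding lin_def by simp
 then show ?thesis by simp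
qed

lemma pspan_iff: "f \<in> pspan X \<longleftrightarrow> supp f <= X"
 by (simp add: pspan_def)

lemma path_times_add [simp]:
 "path_times Q (f + f') g = path_times Q f g + path_times Q f' g"
 "path_times Q f (g + g') = path_times Q f g + path_times Q f g'"
 by (simp_all add: klinear_add[OF klinear_path_times(1)] klinear_add[OF klinear_path_times(2)])

context monomial_algebra
begin

abbreviation nz :: "('v, 'a) path => bool" where
 "nz p \<equiv> p \<in> nonzero_paths Q I"

lemma nz_paths: "nz p ==> p \<in> paths Q" by (simp add: nonzero_iff)

lemma nz_pcatD:
 assumes "nz (pcat p q)" "p \<in> paths Q" "q \<in> paths Q" "target Q p = source q"
 shows "nz p" "nz q"
 using assms zpath_pcat_left[of p q] zpath_pcat_right[of p q] by (auto simp: nonzero_iff)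

lemma nz_triv [simp]: "nz (triv x) \<longleftrightarrow> x \<in> verts Q"
 using zpath_length[of "triv x"] by (auto simp: nonzero_iff)

lemma nz_arrow: "\<alpha> \<in> arcs Q ==> nz (arrow Q \<alpha>)"
 using zpath_length[of "arrow Q \<alpha>"] by (auto simp: nonzero_iff arrow_in_paths)

definition trunc :: "(('v, 'a) path \<Rightarrow>\<^sub>0 'k) => (('v, 'a) path \<Rightarrow>\<^sub>0 'k)" where
 "trunc = lin (\<lambda>p. if nz p then basis p else 0)"

lemma trunc_simps [simp]:
 "trunc (f + g) = trunc f + trunc g" "trunc (- f) = - trunc f" "trunc (f - g) = trunc f - trunc g"
 "trunc 0 = 0" "trunc (sgl p c) = (if nz p then sgl p c else 0)"
 by (simp_all add: trunc_def)

lemma keys_trunc: "supp (trunc f) <= nonzero_paths Q I"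
 unfolding trunc_def by (rule keys_lin) simp

lemma trunc_id: "supp f <= nonzero_paths Q I ==> trunc f = f"
 by (induction f rule: span_induct) simp_all

lemma trunc_eq_0_iff:
 assumes "supp f <= paths Q"
 shows "trunc f = 0 \<longleftrightarrow> f \<in> I"
proof
 assume "f \<in> I"
 then have "supp f <= {p. zpath p}" using I_eq pspan_iff by blast
 then show "trunc f = 0" by (induction f rule: span_induct) (simp_all add: nonzero_iff)
next
 assume 0: "trunc f = 0"
 have "f - trunc f \<in> pspan {p. zpath p}" using assms
 proof (induction f rule: span_induct)
  case (add f g)
  then show ?case using Poly_Mapping.keys_add[of "f - trunc f" "g - trunc g"]
  by (auto simp: pspan_iff algebra_simps)
 qed (auto simp: pspan_iff nonzero_iff)
 then show "f \<in> I" using 0 by (simp add: I_eq[symmetric])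
qed

abbreviation A :: "('v, 'a, 'k) alg ring" where "A \<equiv> malg Q I"

abbreviation unitA :: "('v, 'a, 'k) alg" where "unitA \<equiv> \<one>\<^bsub>malg Q I\<^esub>"

sublocale A: ring "malg Q I"
 unfolding malg_def by (rule I.quotient_is_ring)

lemma carrier_A: "carrier A = qcls Q I ` carrier R"
 by (auto simp: malg_def FactRing_def A_RCOSETS_def' qcls_def)

lemma qcls_closed [simp]: "supp f <= paths Q ==> qcls Q I f \<in> carrier A"
 by (simp add: carrier_A)

lemma qcls_mult: "supp f <= paths Q ==> supp g <= paths Q ==>
  qcls Q I f \<otimes>\<^bsub>A\<^esub> qcls Q I g = qcls Q I (path_times Q f g)"
 using I.rcoset_mult_add[of f g] by (simp add: malg_def FactRing_def qcls_def)

lemma qcls_add: "supp f <= paths Q ==> supp g <= paths Q ==>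
  qcls Q I f \<oplus>\<^bsub>A\<^esub> qcls Q I g = qcls Q I (f + g)"
 using I.a_rcos_sum[of f g] by (simp add: malg_def FactRing_def qcls_def)

lemma one_A: "unitA = qcls Q I (\<Sum>x\<in>verts Q. basis (triv x))"
 by (simp add: malg_def FactRing_def qcls_def)

lemma qcls_eq_iff:
 assumes "supp f <= paths Q" "supp g <= paths Q"
 shows "qcls Q I f = qcls Q I g \<longleftrightarrow> trunc f = trunc g"
proof -
 have k: "supp (f - g) <= paths Q" using assms Poly_Mapping.keys_diff[of f g] by blast
 have "qcls Q I f = qcls Q I g \<longleftrightarrow> f \<ominus>\<^bsub>R\<^esub> g \<in> I"
  unfolding qcls_def using R.quotient_eq_iff_same_a_r_cos[OF I.is_ideal, of f g] assms by auto
 also have "f \<ominus>\<^bsub>R\<^esub> g = f - g"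
 proof -
  have "g \<oplus>\<^bsub>R\<^esub> (- g) = \<zero>\<^bsub>R\<^esub>" "- g \<in> carrier R" "g \<in> carrier R" using assms by (auto simp: keys_minus)
  then have "\<ominus>\<^bsub>R\<^esub> g = - g" by (metis R.minus_equality R.a_comm)
  then show ?thesis by (simp add: a_minus_def)
 qed
 also have "f - g \<in> I \<longleftrightarrow> trunc f = trunc g" using trunc_eq_0_iff[OF k] by auto
 finally show ?thesis .
qed

text \<open>The nonzero paths form a basis of \<open>A\<close>; the normal form is the representative supported on them.\<close>

definition nf :: "('v, 'a, 'k) alg => (('v, 'a) path \<Rightarrow>\<^sub>0 'k)" where
 "nf a = (SOME f. supp f <= nonzero_paths Q I \<and> a = qcls Q I f)"

lemma keys_paths: "supp f <= nonzero_paths Q I ==> supp f <= paths Q"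
 using nz_paths by blast

lemma nf_spec:
 assumes "a \<in> carrier A"
 shows "supp (nf a) <= nonzero_paths Q I \<and> a = qcls Q I (nf a)"
 unfolding nf_def
proof (rule someI_ex)
 obtain f where f: "supp f <= paths Q" "a = qcls Q I f" using assms carrier_A by auto
 have "qcls Q I (trunc f) = qcls Q I f"
  using qcls_eq_iff[OF keys_paths[OF keys_trunc] f(1)] trunc_id[OF keys_trunc] by simp
 then show "\<exists>f. supp f <= nonzero_paths Q I \<and> a = qcls Q I f"
  using f keys_trunc by metis
qed

lemma nf_keys: "a \<in> carrier A ==> supp (nf a) <= nonzero_paths Q I"
 using nf_spec by blast

lemma qcls_nf: "a \<in> carrier A ==> qcls Q I (nf a) = a"
 using nf_spec by blast

lemma nf_paths: "a \<in> carrier A ==> supp (nf a) <= paths Q"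
 using nf_keys keys_paths by blast

lemma nf_qcls: assumes "supp f <= paths Q" shows "nf (qcls Q I f) = trunc f"
proof -
 have c: "qcls Q I f \<in> carrier A" using assms by simp
 have "trunc (nf (qcls Q I f)) = trunc f"
  using qcls_eq_iff[OF nf_paths[OF c] assms] qcls_nf[OF c] by simp
 then show ?thesis using trunc_id[OF nf_keys[OF c]] by simp
qed

lemma nf_mult:
 assumes "a \<in> carrier A" "b \<in> carrier A"
 shows "nf (a \<otimes>\<^bsub>A\<^esub> b) = trunc (path_times Q (nf a) (nf b))"
proof -
 have "a \<otimes>\<^bsub>A\<^esub> b = qcls Q I (path_times Q (nf a) (nf b))"
  using qcls_mult[OF nf_paths nf_paths, OF assms] qcls_nf assms by simp
 then show ?thesis
  using nf_qcls[OF keys_path_times[OF fin_digraph_Q nf_paths[OF assms(1)] nf_paths[OF assms(2)]]] by simp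
qed

lemma nf_add:
 assumes "a \<in> carrier A" "b \<in> carrier A"
 shows "nf (a \<oplus>\<^bsub>A\<^esub> b) = nf a + nf b"
proof -
 have "a \<oplus>\<^bsub>A\<^esub> b = qcls Q I (nf a + nf b)"
  using qcls_add[OF nf_paths nf_paths, OF assms] qcls_nf assms by simp
 moreover have "supp (nf a + nf b) <= paths Q"
  using Poly_Mapping.keys_add[of "nf a" "nf b"] nf_paths assms by blast
 ultimately show ?thesis
  using nf_qcls[of "nf a + nf b"] trunc_id[OF nf_keys] assms by simp
qed

lemma keys_one: "supp (\<Sum>x\<in>verts Q. basis (triv x) :: ('v, 'a) path \<Rightarrow>\<^sub>0 'k) <= nonzero_paths Q I"
 by (rule keys_sum_subset) simp

lemma nf_one: "nf unitA = (\<Sum>x\<in>verts Q. basis (triv x))"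
 unfolding one_A using nf_qcls[OF keys_paths[OF keys_one]] trunc_id[OF keys_one] by simp

lemma keys_vertex_algebra: "e \<in> vertex_algebra Q ==> supp e <= nonzero_paths Q I"
 unfolding vertex_algebra_def pspan_iff using nz_triv by blast

lemma nf_vertex: assumes "e \<in> vertex_algebra Q" shows "nf (qcls Q I e) = e"
 using nf_qcls[OF keys_paths] trunc_id keys_vertex_algebra[OF assms] by simp

lemma pcls_closed [simp]: "p \<in> paths Q ==> pcls Q I p \<in> carrier A"
 by (simp add: pcls_def pbasis_def)

lemma nf_pcls: "p \<in> paths Q ==> nf (pcls Q I p) = (if nz p then basis p else 0)"
 unfolding pcls_def by (subst nf_qcls) (simp_all add: pbasis_def)

lemma trunc_times_vertex:
 assumes "e \<in> vertex_algebra Q" "supp f <= nonzero_paths Q I"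
 shows "trunc (path_times Q f e) = path_times Q f e" "trunc (path_times Q e f) = path_times Q e f"
proof -
 have e: "supp e <= triv ` verts Q" using assms(1) by (simp add: vertex_algebra_def pspan_iff)
 show "trunc (path_times Q f e) = path_times Q f e"
 proof (rule trunc_id, unfold path_times_def, rule keys_bilin)
  fix p q assume "p \<in> supp f" "q \<in> supp e"
  then have "nz p" "q \<in> triv ` verts Q" using assms e by auto
  then show "supp (if target Q p = source q then basis (pcat p q) else 0 :: ('v, 'a) path \<Rightarrow>\<^sub>0 'k)
  <= nonzero_paths Q I" by auto
 qed
 show "trunc (path_times Q e f) = path_times Q e f"
 proof (rule trunc_id, unfold path_times_def, rule keys_bilin)
  fix q p assume "p \<in> supp f" "q \<in> supp e"
  then have "nz p" "q \<in> triv ` verts Q" using assms e by auto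
  then show "supp (if target Q q = source p then basis (pcat q p) else 0 :: ('v, 'a) path \<Rightarrow>\<^sub>0 'k)
  <= nonzero_paths Q I" by auto
 qed
qed

text \<open>Multiplication by \<open>A\<close> from the left in coordinates; it only touches the first path of a list.\<close>

definition lmul :: "(('v, 'a) path \<Rightarrow>\<^sub>0 'k) => (('v, 'a) path list \<Rightarrow>\<^sub>0 'k) => (('v, 'a) path list \<Rightarrow>\<^sub>0 'k)" where
 "lmul = bilin (\<lambda>p ps. if target Q p = source (hd ps) \<and> nz (pcat p (hd ps))
  then basis (pcat p (hd ps) # tl ps) else 0)"

definition rmul :: "(('v, 'a) path \<Rightarrow>\<^sub>0 'k) => (('v, 'a) path list \<Rightarrow>\<^sub>0 'k) => (('v, 'a) path list \<Rightarrow>\<^sub>0 'k)" where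
 "rmul = bilin (\<lambda>p ps. if target Q (last ps) = source p \<and> nz (pcat (last ps) p)
  then basis (butlast ps @ [pcat (last ps) p]) else 0)"

lemma klinear_mul: "klinear (lmul f)" "klinear (rmul f)" "klinear (\<lambda>f. lmul f u)" "klinear (\<lambda>f. rmul f u)"
 unfolding lmul_def rmul_def by (rule klinear_bilin_right klinear_bilin_left)+

lemma mul_add [simp]:
 "lmul f (u + v) = lmul f u + lmul f v" "rmul f (u + v) = rmul f u + rmul f v"
 "lmul (f + g) u = lmul f u + lmul g u" "rmul (f + g) u = rmul f u + rmul g u"
 by (rule klinear_add[OF klinear_mul(1)] klinear_add[OF klinear_mul(2)]
  klinear_add[OF klinear_mul(3)] klinear_add[OF klinear_mul(4)])+

lemma mul_0 [simp]: "lmul f 0 = 0" "rmul f 0 = 0" "lmul 0 u = 0" "rmul 0 u = 0"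
 by (simp_all add: lmul_def rmul_def)

lemma mul_single:
 "lmul (sgl p a) (sgl ps b) =
  (if target Q p = source (hd ps) \<and> nz (pcat p (hd ps))
  then sgl (pcat p (hd ps) # tl ps) (a * b) else 0)"
 "rmul (sgl p a) (sgl ps b) =
  (if target Q (last ps) = source p \<and> nz (pcat (last ps) p)
  then sgl (butlast ps @ [pcat (last ps) p]) (a * b) else 0)"
 by (simp_all add: lmul_def rmul_def)

definition nzlists :: "('v, 'a) path list set" where
 "nzlists = {ps. ps \<noteq> [] \<and> nz (hd ps) \<and> nz (last ps)}"

lemma nzlistsD: "ps \<in> nzlists ==> ps \<noteq> []" "ps \<in> nzlists ==> nz (hd ps)" "ps \<in> nzlists ==> nz (last ps)"
 by (auto simp: nzlists_def)

lemma keys_lmul: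
 assumes "supp u <= nzlists"
 shows "supp (lmul f u) <= nzlists"
 unfolding lmul_def
proof (rule keys_bilin)
 fix p ps assume "ps \<in> supp u"
 then have "ps \<in> nzlists" using assms by blast
 then show "supp (if target Q p = source (hd ps) \<and> nz (pcat p (hd ps))
  then basis (pcat p (hd ps) # tl ps) else 0 :: ('v, 'a) path list \<Rightarrow>\<^sub>0 'k) <= nzlists"
  by (cases ps) (auto simp: nzlists_def)
qed

lemma lmul_lmul:
 assumes "supp f <= paths Q" "supp g <= paths Q" "supp u <= nzlists"
 shows "lmul f (lmul g u) = lmul (path_times Q f g) u"
 using assms(1)
proof (induction f rule: span_induct)
 case (single p a)
 show ?case using assms(2)
 proof (induction g rule: span_induct)
  case (single q b)
  show ?case using assms(3)
  proof (induction u rule: span_induct)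
  case (single ps c)
  note ps = nzlistsD[OF single]
  have "nz (pcat p (pcat q (hd ps))) ==> target Q q = source (hd ps) ==> target Q p = source q ==>
  nz (pcat q (hd ps))"
  using nz_pcatD(2)[of p "pcat q (hd ps)"] pcat_in_paths[of q "hd ps"] nz_paths[OF ps(2)]
  \<open>p \<in> paths Q\<close> \<open>q \<in> paths Q\<close> by simp
  then show ?case by (auto simp: mul_single path_times_single target_pcat pcat_assoc ac_simps)
  qed simp_all
 qed simp_all
qed simp_all

lemma rmul_rmul:
 assumes "supp f <= paths Q" "supp g <= paths Q" "supp u <= nzlists"
 shows "rmul f (rmul g u) = rmul (path_times Q g f) u"
 using assms(1)
proof (induction f rule: span_induct)
 case (single p a)
 show ?case using assms(2)
 proof (induction g rule: span_induct)
  case (single q b)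
  show ?case using assms(3)
  proof (induction u rule: span_induct)
  case (single ps c)
  note ps = nzlistsD[OF single]
  have "nz (pcat (pcat (last ps) q) p) ==> target Q (last ps) = source q ==> target Q q = source p ==>
  nz (pcat (last ps) q)"
  using nz_pcatD(1)[of "pcat (last ps) q" p] pcat_in_paths[of "last ps" q] nz_paths[OF ps(3)]
  \<open>p \<in> paths Q\<close> \<open>q \<in> paths Q\<close> by (simp add: target_pcat)
  then show ?case by (auto simp: mul_single path_times_single target_pcat pcat_assoc ac_simps)
  qed simp_all
 qed simp_all
qed simp_all

lemma lmul_rmul:
 assumes "supp f <= paths Q" "supp g <= paths Q" "supp u <= nzlists"
 shows "lmul f (rmul g u) = rmul g (lmul f u)"
 using assms(1)
proof (induction f rule: span_induct)
 case (single p a)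
 show ?case using assms(2)
 proof (induction g rule: span_induct)
  case (single q b)
  show ?case using assms(3)
  proof (induction u rule: span_induct)
  case (single ps c)
  note ps = nzlistsD[OF single]
  have pq: "p \<in> paths Q" "q \<in> paths Q" by fact+
  show ?case
  proof (cases "tl ps = []")
  case True
  then obtain r where r: "ps = [r]" using ps(1) by (cases ps) auto
  have "nz r" using ps r by simp
  have *: "nz (pcat p (pcat r q)) ==> target Q p = source r ==> target Q r = source q ==>
  nz (pcat p r) \<and> nz (pcat r q)"
  using nz_pcatD(2)[of p "pcat r q"] nz_pcatD(1)[of "pcat p r" q] pcat_in_paths[of p r]
  pcat_in_paths[of r q] nz_paths[OF \<open>nz r\<close>] pq by (simp add: pcat_assoc target_pcat)
  then show ?thesis unfolding r by (auto simp: mul_single target_pcat pcat_assoc ac_simps)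
  next
  case False
  then obtain r rs where "ps = r # rs" "rs \<noteq> []" using ps(1) by (cases ps) auto
  then show ?thesis by (auto simp: mul_single ac_simps)
  qed
  qed simp_all
 qed simp_all
qed simp_all

lemma lmul_zpath: assumes "zpath p" "supp u <= nzlists" shows "lmul (basis p) u = 0"
 using assms(2)
proof (induction u rule: span_induct)
 case (single ps c)
 then show ?case using nzlistsD[OF single] zpath_pcat_right[OF assms(1), of "hd ps"] nz_paths
  by (auto simp: mul_single nonzero_iff)
qed simp_all

lemma rmul_zpath: assumes "zpath p" "supp u <= nzlists" shows "rmul (basis p) u = 0"
 using assms(2)
proof (induction u rule: span_induct)
 case (single ps c)
 then show ?case using nzlistsD[OF single] zpath_pcat_left[OF _ assms(1), of "last ps"] nz_paths
  by (auto simp: mul_single nonzero_iff)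
qed simp_all

end

section \<open>Coordinates of pure tensors\<close>

context monomial_algebra
begin

abbreviation comp :: "('v, 'a) path list => bool" where
 "comp \<equiv> successively (\<lambda>p q. target Q p = source q)"

definition sing :: "(('v, 'a) path \<Rightarrow>\<^sub>0 'k) => (('v, 'a) path list \<Rightarrow>\<^sub>0 'k)" where
 "sing = lin (\<lambda>p. basis [p])"

definition consl :: "(('v, 'a) path \<Rightarrow>\<^sub>0 'k) => (('v, 'a) path list \<Rightarrow>\<^sub>0 'k) => (('v, 'a) path list \<Rightarrow>\<^sub>0 'k)" where
 "consl = bilin (\<lambda>p ps. if target Q p = source (hd ps) then basis (p # ps) else 0)"

text \<open>The coordinates of a pure tensor. Lists that do not compose are dropped, which is the effect of
  tensoring over the span of the vertices.\<close>

fun theta :: "(('v, 'a) path \<Rightarrow>\<^sub>0 'k) list => (('v, 'a) path list \<Rightarrow>\<^sub>0 'k)" where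
 "theta [] = 0"
| "theta [f] = sing f"
| "theta (f # g # fs) = consl f (theta (g # fs))"

lemma theta_Cons: "fs \<noteq> [] ==> theta (f # fs) = consl f (theta fs)"
 by (cases fs) simp_all

lemma sing_simps [simp]: "sing (f + g) = sing f + sing g" "sing 0 = 0"
 "sing (sgl p c) = sgl [p] c"
 by (simp_all add: sing_def)

lemma consl_simps [simp]:
 "consl (f + g) u = consl f u + consl g u" "consl f (u + v) = consl f u + consl f v"
 "consl 0 u = 0" "consl f 0 = 0"
 "consl (sgl p a) (sgl ps b) =
  (if target Q p = source (hd ps) then sgl (p # ps) (a * b) else 0)"
 unfolding consl_def by (simp_all add: bilin_add_left bilin_add_right)

lemma keys_theta: "supp (theta fs) <= {ps. ps \<noteq> [] \<and> list_all2 (\<lambda>p f. p \<in> supp f) ps fs \<and> comp ps}"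
proof (induction fs rule: theta.induct)
 case (2 f)
 show ?case unfolding theta.simps sing_def by (rule keys_lin) simp
next
 case (3 f g fs)
 show ?case unfolding theta.simps consl_def
 proof (rule keys_bilin)
  fix p ps assume "p \<in> supp f" "ps \<in> supp (theta (g # fs))"
  then show "supp (if target Q p = source (hd ps) then basis (p # ps) else 0 :: ('v, 'a) path list \<Rightarrow>\<^sub>0 'k)
  <= {ps. ps \<noteq> [] \<and> list_all2 (\<lambda>p f. p \<in> supp f) ps (f # g # fs) \<and> comp ps}"
  using 3 by (cases ps) auto
 qed
qed simp

lemma theta_keys_nonempty: "ps \<in> supp (theta fs) ==> ps \<noteq> []"
 using keys_theta by blast

lemma theta_add: "theta (as @ (x + y) # bs) = theta (as @ x # bs) + theta (as @ y # bs)"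
proof (induction as)
 case Nil
 then show ?case by (cases bs) simp_all
next
 case (Cons f as)
 then show ?case by (simp add: theta_Cons)
qed

lemma consl_times_vertex:
 assumes "e \<in> vertex_algebra Q"
 shows "consl (path_times Q x e) (consl y u) = consl x (consl (path_times Q e y) u)"
  and "consl (path_times Q x e) (sing y) = consl x (sing (path_times Q e y))"
proof -
 have e: "supp e <= triv ` verts Q" using assms by (simp add: vertex_algebra_def pspan_iff)
 have x: "supp x <= UNIV" "supp y <= UNIV" "supp u <= UNIV" by auto
 show "consl (path_times Q x e) (consl y u) = consl x (consl (path_times Q e y) u)" using e
 proof (induction e rule: span_induct)
  case (single v c)
  then obtain z where v: "v = triv z" by blast
  show ?case using x(1)
  proof (induction x rule: span_induct)
  case (single p a)
  show ?case using x(2)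
  proof (induction y rule: span_induct)
  case (single q b)
  show ?case using x(3) by (induction u rule: span_induct) (auto simp: v path_times_single ac_simps)
  qed simp_all
  qed simp_all
 qed simp_all
 show "consl (path_times Q x e) (sing y) = consl x (sing (path_times Q e y))" using e
 proof (induction e rule: span_induct)
  case (single v c)
  then obtain z where v: "v = triv z" by blast
  show ?case using x(1)
  proof (induction x rule: span_induct)
  case (single p a)
  show ?case using x(2) by (induction y rule: span_induct) (auto simp: v path_times_single ac_simps)
  qed simp_all
 qed simp_all
qed

lemma theta_balanced:
 assumes "e \<in> vertex_algebra Q"
 shows "theta (as @ path_times Q x e # y # bs) = theta (as @ x # path_times Q e y # bs)"
proof (induction as)
 case Nil
 then show ?case using consl_times_vertex[OF assms] by (cases bs) simp_all
next
 case (Cons f as)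
 then show ?case by (simp add: theta_Cons)
qed

lemma theta_lmul: "theta (trunc (path_times Q f x) # bs) = lmul f (theta (x # bs))"
proof -
 have U: "supp f <= UNIV" "supp x <= UNIV" for f :: "('v, 'a) path \<Rightarrow>\<^sub>0 'k" and x :: "('v, 'a) path \<Rightarrow>\<^sub>0 'k" by auto
 have 1: "sing (trunc (path_times Q f x)) = lmul f (sing x)" using U(1)[of f]
 proof (induction f rule: span_induct)
  case (single p a)
  show ?case using U(2)[of x]
  by (induction x rule: span_induct) (auto simp: path_times_single mul_single)
 qed simp_all
 have 2: "consl (trunc (path_times Q f x)) u = lmul f (consl x u)" for u using U(1)[of f]
 proof (induction f rule: span_induct)
  case (single p a)
  show ?case using U(2)[of x]
  proof (induction x rule: span_induct)
  case (single q b)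
  have "supp u <= UNIV" by simp
  then show ?case
  by (induction u rule: span_induct) (auto simp: path_times_single mul_single target_pcat ac_simps)
  qed simp_all
 qed simp_all
 show ?thesis using 1 2 by (cases bs) simp_all
qed

lemma theta_rmul: "theta (bs @ [trunc (path_times Q x f)]) = rmul f (theta (bs @ [x]))"
proof (induction bs)
 case Nil
 have U: "supp f <= UNIV" "supp x <= UNIV" by auto
 have "sing (trunc (path_times Q x f)) = rmul f (sing x)" using U(1)
 proof (induction f rule: span_induct)
  case (single p a)
  show ?case using U(2)
  by (induction x rule: span_induct) (auto simp: path_times_single mul_single ac_simps)
 qed simp_all
 then show ?case by simp
next
 case (Cons g bs)
 have U: "supp f <= UNIV" "supp g <= UNIV" by auto
 have "consl g (rmul f u) = rmul f (consl g u)" if "supp u <= {ps. ps \<noteq> []}" for u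
  using U(1)
 proof (induction f rule: span_induct)
  case (single p a)
  show ?case using U(2)
  proof (induction g rule: span_induct)
  case (single q b)
  show ?case using that
  proof (induction u rule: span_induct)
  case (single ps c)
  then obtain r rs where "ps = r # rs" by (cases ps) auto
  then show ?case by (auto simp: mul_single ac_simps)
  qed simp_all
  qed simp_all
 qed simp_all
 moreover have "supp (theta (bs @ [x])) <= {ps. ps \<noteq> []}"
  using theta_keys_nonempty by blast
 ultimately have "consl g (rmul f (theta (bs @ [x]))) = rmul f (consl g (theta (bs @ [x])))" by simp
 then show ?case using Cons by (simp add: theta_Cons)
qed

lemma theta_single: "theta (sgl p c # map basis ps) = (if comp (p # ps) then sgl (p # ps) c else 0)"
proof (induction ps arbitrary: p c)
 case (Cons q ps)
 then show ?case by (cases ps) auto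
qed simp

lemma theta_basis: "ps \<noteq> [] ==> theta (map basis ps) = (if comp ps then basis ps else 0)"
 using theta_single[of "hd ps" 1 "tl ps"] by (cases ps) simp_all

definition merge :: "nat => (('v, 'a) path list \<Rightarrow>\<^sub>0 'k) => (('v, 'a) path list \<Rightarrow>\<^sub>0 'k)" where
 "merge i = lin (\<lambda>ps. if nz (pcat (ps ! i) (ps ! (i + 1)))
  then basis (take i ps @ pcat (ps ! i) (ps ! (i + 1)) # drop (i + 2) ps) else 0)"

lemma merge_simps [simp]: "merge i (u + v) = merge i u + merge i v" "merge i 0 = 0"
 "merge i (sgl ps c) = (if nz (pcat (ps ! i) (ps ! (i + 1)))
  then sgl (take i ps @ pcat (ps ! i) (ps ! (i + 1)) # drop (i + 2) ps) c else 0)"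
 by (simp_all add: merge_def)

lemma theta_merge:
 assumes "i + 1 < length fs"
 shows "theta (take i fs @ trunc (path_times Q (fs ! i) (fs ! (i + 1))) # drop (i + 2) fs) = merge i (theta fs)"
 using assms
proof (induction i arbitrary: fs)
 case 0
 then obtain x y bs where fs: "fs = x # y # bs"
  by (cases fs; cases "tl fs") auto
 have U: "supp x <= UNIV" "supp y <= UNIV" by auto
 have 1: "sing (trunc (path_times Q x y)) = merge 0 (consl x (sing y))" using U(1)
 proof (induction x rule: span_induct)
  case (single p a)
  show ?case using U(2)
  by (induction y rule: span_induct) (auto simp: path_times_single)
 qed simp_all
 have 2: "consl (trunc (path_times Q x y)) u = merge 0 (consl x (consl y u))" for u using U(1)
 proof (induction x rule: span_induct)
  case (single p a)
  show ?case using U(2)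
  proof (induction y rule: span_induct)
  case (single q b)
  have "supp u <= UNIV" by simp
  then show ?case
  by (induction u rule: span_induct) (auto simp: path_times_single target_pcat ac_simps)
  qed simp_all
 qed simp_all
 show ?case unfolding fs using 1 2 by (cases bs) (simp_all add: theta_Cons numeral_2_eq_2)
next
 case (Suc i)
 then obtain f gs where fs: "fs = f # gs" by (cases fs) auto
 have i: "i + 1 < length gs" using Suc fs by simp
 have U: "supp f <= UNIV" by auto
 have "consl f (merge i u) = merge (Suc i) (consl f u)" if "supp u <= {ps. i + 1 < length ps}" for u
  using U
 proof (induction f rule: span_induct)
  case (single p a)
  show ?case using that
  proof (induction u rule: span_induct)
  case (single ps c)
  have "source (hd (take i ps @ pcat (ps ! i) (ps ! (i + 1)) # drop (i + 2) ps)) = source (hd ps)"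
  using single by (cases i; cases ps) auto
  then show ?case by (auto simp: numeral_2_eq_2)
  qed simp_all
 qed simp_all
 note commute = this
 have "supp (theta gs) <= {ps. i + 1 < length ps}"
 proof
  fix ps assume "ps \<in> supp (theta gs)"
  then have "list_all2 (\<lambda>p f. p \<in> supp f) ps gs" using keys_theta[of gs] by blast
  then have "length ps = length gs" by (rule list_all2_lengthD)
  then show "ps \<in> {ps. i + 1 < length ps}" using i by simp
 qed
 then have "consl f (merge i (theta gs)) = merge (Suc i) (consl f (theta gs))" by (rule commute)
 moreover have "gs \<noteq> []" using i by auto
 ultimately show ?case using Suc.IH[OF i] fs by (simp add: theta_Cons)
qed

text \<open>The map \<open>u \<mapsto> 1 \<otimes> u\<close> in coordinates: of the sum \<open>1\<close> of all vertices only one survives.\<close>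

definition ins :: "(('v, 'a) path list \<Rightarrow>\<^sub>0 'k) => (('v, 'a) path list \<Rightarrow>\<^sub>0 'k)" where
 "ins = lin (\<lambda>ps. basis (triv (source (hd ps)) # ps))"

lemma ins_simps [simp]: "ins (u + v) = ins u + ins v" "ins 0 = 0" "ins (- u) = - ins u" "ins (u - v) = ins u - ins v"
 "ins (sgl ps c) = sgl (triv (source (hd ps)) # ps) c"
 by (simp_all add: ins_def)

lemma consl_sum: "consl (sum f X) u = (\<Sum>x\<in>X. consl (f x) u)"
 unfolding consl_def by (rule klinear_sum[OF klinear_bilin_left])

lemma consl_one:
 assumes "supp u <= {ps. source (hd ps) \<in> verts Q}"
 shows "consl (\<Sum>x\<in>verts Q. basis (triv x)) u = ins u"
 using assms
proof (induction u rule: span_induct)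
 case (single ps c)
 have "consl (\<Sum>x\<in>verts Q. basis (triv x)) (sgl ps c) =
  (\<Sum>x\<in>verts Q. if x = source (hd ps) then sgl (triv (source (hd ps)) # ps) c else 0)"
  unfolding consl_sum by (intro sum.cong) auto
 then show ?case using single by (simp add: sum.delta)
qed simp_all

lemma theta_snoc_one:
 assumes "ps \<noteq> []" "set ps <= paths Q" "comp ps"
 shows "theta (map basis ps @ [\<Sum>x\<in>verts Q. basis (triv x)]) = basis (ps @ [triv (target Q (last ps))])"
 using assms
proof (induction ps)
 case (Cons p ps)
 show ?case
 proof (cases ps)
  case Nil
  have "target Q p \<in> verts Q" using Cons target_in_verts by simp
  moreover have "consl (basis p) (sing (\<Sum>x\<in>verts Q. basis (triv x))) =
  (\<Sum>x\<in>verts Q. if x = target Q p then basis [p, triv (target Q p)] else 0)"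
  unfolding sing_def consl_def klinear_sum[OF klinear_lin] klinear_sum[OF klinear_bilin_right]
  by (intro sum.cong) auto
  ultimately show ?thesis using Nil by (simp add: sum.delta)
 next
  case (Cons q qs)
  then show ?thesis using Cons.IH Cons.prems by (simp add: theta_Cons)
 qed
qed simp

end

definition zlin :: "('x => ('y \<Rightarrow>\<^sub>0 'k::field)) => ('x \<Rightarrow>\<^sub>0 int) => ('y \<Rightarrow>\<^sub>0 'k)" where
 "zlin g c = (\<Sum>x\<in>supp c. smul (of_int (Poly_Mapping.lookup c x)) (g x))"

lemma zlin_superset:
 assumes "finite A" "supp f <= A"
 shows "zlin g f = (\<Sum>x\<in>A. smul (of_int (Poly_Mapping.lookup f x)) (g x))"
 unfolding zlin_def using assms
 by (intro sum.mono_neutral_left) (auto simp: in_keys_iff)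

lemma smul_minus_left: "smul (- c) f = - smul c f"
 by (rule poly_mapping_eqI) simp

lemma zlin_simps [simp]:
 "zlin g 0 = 0" "zlin g (frag_of x) = g x" "zlin g (- f) = - zlin g f"
 by (simp_all add: zlin_def keys_minus smul_minus_left sum_negf)

lemma zlin_add [simp]: "zlin g (f + f') = zlin g f + zlin g f'"
proof -
 let ?A = "supp f \<union> supp f'"
 have "supp (f + f') <= ?A" by (rule Poly_Mapping.keys_add)
 then show ?thesis
  using zlin_superset[of ?A "f + f'" g] zlin_superset[of ?A f g] zlin_superset[of ?A f' g]
  by (simp add: lookup_add smul_add_left sum.distrib)
qed

lemma zlin_diff [simp]: "zlin g (f - f') = zlin g f - zlin g f'"
 using zlin_add[of g f "- f'"] by simp

lemma zlin_sum: "zlin g (sum f A) = (\<Sum>x\<in>A. zlin g (f x))"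
 by (induction A rule: infinite_finite_induct) auto

lemma zlin_frag_extend: "zlin g (frag_extend (\<lambda>x. frag_of (f x)) c) = zlin (\<lambda>x. g (f x)) c"
proof -
 have "supp c <= UNIV" by simp
 then show ?thesis
  by (induction c rule: frag_induction) (simp_all add: frag_extend_diff)
qed

section \<open>Presented groups with a basis\<close>

lemma generate_carrier:
 assumes "\<And>r. r \<in> Rel ==> supp r <= X"
 shows "subgroup (generate (free_Abelian_group X) Rel) (free_Abelian_group X)"
 using assms by (intro group.generate_is_subgroup) auto

locale pre_presented =
 fixes X :: "'x set" and Rel :: "('x \<Rightarrow>\<^sub>0 int) set" and \<theta> :: "'x => ('b \<Rightarrow>\<^sub>0 'k::field)"
  and B :: "'b set" and \<sigma> :: "'b => 'k => 'x"
 assumes rel_keys: "r \<in> Rel ==> supp r <= X"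
  and rel_zero: "r \<in> Rel ==> zlin \<theta> r = 0"
  and \<theta>_keys: "x \<in> X ==> supp (\<theta> x) <= B"
  and \<sigma>_gen: "b \<in> B ==> \<sigma> b c \<in> X"
  and \<theta>_\<sigma>: "b \<in> B ==> \<theta> (\<sigma> b c) = sgl b c"
  and \<sigma>_add: "b \<in> B ==> frag_of (\<sigma> b (c + c')) - frag_of (\<sigma> b c) - frag_of (\<sigma> b c')
  \<in> generate (free_Abelian_group X) Rel"
begin

abbreviation G :: "('x \<Rightarrow>\<^sub>0 int) monoid" where "G \<equiv> free_Abelian_group X"
abbreviation N :: "('x \<Rightarrow>\<^sub>0 int) set" where "N \<equiv> generate G Rel"

sublocale G: comm_group G by (rule abelian_free_Abelian_group)

lemma N_subgroup: "subgroup N G" by (rule generate_carrier) (rule rel_keys)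

lemma N_normal: "N \<lhd> G" by (rule G.subgroup_imp_normal[OF N_subgroup])

lemma N_keys: "c \<in> N ==> supp c <= X"
 using subgroup.mem_carrier[OF N_subgroup] by simp

lemma N_0: "0 \<in> N" using subgroup.one_closed[OF N_subgroup] by simp

lemma N_add: "c \<in> N ==> d \<in> N ==> c + d \<in> N"
 using subgroup.m_closed[OF N_subgroup] by simp

lemma N_minus: "c \<in> N ==> - c \<in> N"
 using subgroup.m_inv_closed[OF N_subgroup] N_keys by fastforce

lemma N_diff: "c \<in> N ==> d \<in> N ==> c - d \<in> N"
 using N_add[OF _ N_minus] by force

lemma N_rel: "r \<in> Rel ==> r \<in> N" by (rule generate.incl)

lemma zlin_N: assumes "c \<in> N" shows "zlin \<theta> c = 0"
 using assms
proof (induction c rule: generate.induct)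
 case one
 then show ?case by simp
next
 case (incl h)
 then show ?case by (rule rel_zero)
next
 case (inv h)
 then show ?case using rel_zero[OF inv] rel_keys[OF inv] by simp
next
 case (eng c d)
 then show ?case by simp
qed

lemma carrier_Mod: "carrier (G Mod N) = {pres_cls X Rel c | c. supp c <= X}"
proof (rule Set.set_eqI)
 fix C
 have "C \<in> carrier (G Mod N) \<longleftrightarrow> (\<exists>c\<in>carrier G. C = N #>\<^bsub>G\<^esub> c)"
  by (simp add: FactGroup_def RCOSETS_def)
 then show "C \<in> carrier (G Mod N) \<longleftrightarrow> C \<in> {pres_cls X Rel c | c. supp c <= X}"
  by (simp add: pres_cls_def Bex_def conj_commute)
qed

lemma pres_cls_carrier: "supp c <= X ==> pres_cls X Rel c \<in> carrier (G Mod N)"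
 unfolding carrier_Mod by blast

lemma pres_cls_mem: "c' \<in> pres_cls X Rel c \<longleftrightarrow> c' - c \<in> N"
proof
 assume "c' \<in> pres_cls X Rel c"
 then show "c' - c \<in> N" by (auto simp: pres_cls_def r_coset_def)
next
 assume "c' - c \<in> N"
 then have "\<exists>h\<in>N. c' = h \<otimes>\<^bsub>G\<^esub> c" by (intro bexI[of _ "c' - c"]) simp_all
 then show "c' \<in> pres_cls X Rel c" by (auto simp: pres_cls_def r_coset_def)
qed

lemma pres_cls_eqI: assumes "c - d \<in> N" shows "pres_cls X Rel c = pres_cls X Rel d"
proof (rule Set.set_eqI)
 fix x
 have "x - c = (x - d) - (c - d)" "x - d = (x - c) + (c - d)" by simp_all
 then show "x \<in> pres_cls X Rel c \<longleftrightarrow> x \<in> pres_cls X Rel d"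
  unfolding pres_cls_mem using assms N_add N_diff by metis
qed

lemma pres_cls_add:
 assumes "supp c <= X" "supp d <= X"
 shows "pres_cls X Rel c <#>\<^bsub>G\<^esub> pres_cls X Rel d = pres_cls X Rel (c + d)"
 using normal.rcos_sum[OF N_normal, of c d] assms by (simp add: pres_cls_def)

definition coord :: "('x \<Rightarrow>\<^sub>0 int) set => ('b \<Rightarrow>\<^sub>0 'k)" where
 "coord C = zlin \<theta> (SOME c. c \<in> C)"

lemma coord_cls: "coord (pres_cls X Rel c) = zlin \<theta> c"
proof -
 have "c \<in> pres_cls X Rel c" unfolding pres_cls_mem using N_0 by simp
 then have "(SOME c'. c' \<in> pres_cls X Rel c) \<in> pres_cls X Rel c" by (rule someI)
 then have "(SOME c'. c' \<in> pres_cls X Rel c) - c \<in> N" unfolding pres_cls_mem .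
 from zlin_N[OF this] show ?thesis by (simp add: coord_def)
qed

lemma coord_gen [simp]: "coord (pres_cls X Rel (frag_of x)) = \<theta> x"
 by (simp add: coord_cls)

definition realize :: "('b \<Rightarrow>\<^sub>0 'k) => ('x \<Rightarrow>\<^sub>0 int)" where
 "realize f = (\<Sum>b\<in>supp f. frag_of (\<sigma> b (Poly_Mapping.lookup f b)))"

lemma \<sigma>_zero: "b \<in> B ==> frag_of (\<sigma> b 0) \<in> N"
 using N_minus[OF \<sigma>_add[of b 0 0]] by simp

lemma realize_superset:
 assumes "finite K" "supp f <= K" "K <= B"
 shows "(\<Sum>b\<in>K. frag_of (\<sigma> b (Poly_Mapping.lookup f b))) - realize f \<in> N"
proof -
 have "(\<Sum>b\<in>K. frag_of (\<sigma> b (Poly_Mapping.lookup f b))) =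
  (\<Sum>b\<in>K - supp f. frag_of (\<sigma> b (Poly_Mapping.lookup f b))) + realize f"
  unfolding realize_def by (rule sum.subset_diff[OF assms(2,1)])
 moreover have "(\<Sum>b\<in>L. frag_of (\<sigma> b (Poly_Mapping.lookup f b))) \<in> N"
  if "finite L" "L <= K - supp f" for L
  using that
 proof (induction L)
  case (insert b L)
  then have "frag_of (\<sigma> b (Poly_Mapping.lookup f b)) \<in> N"
  using \<sigma>_zero[of b] assms(3) by (auto simp: in_keys_iff)
  then show ?case using insert N_add by simp
 qed (simp add: N_0)
 ultimately show ?thesis using assms(1) by simp
qed

lemma realize_add:
 assumes "supp f <= B" "supp g <= B"
 shows "realize (f + g) - realize f - realize g \<in> N"
proof -
 define K where "K = supp f \<union> supp g"
 let ?S = "\<lambda>f. \<Sum>b\<in>K. frag_of (\<sigma> b (Poly_Mapping.lookup f b))"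
 have K: "finite K" "K <= B" "supp f <= K" "supp g <= K"
  "supp (f + g) <= K"
  using assms Poly_Mapping.keys_add[of f g] by (auto simp: K_def)
 have "(\<Sum>b\<in>L. frag_of (\<sigma> b (Poly_Mapping.lookup (f + g) b))) -
  (\<Sum>b\<in>L. frag_of (\<sigma> b (Poly_Mapping.lookup f b))) -
  (\<Sum>b\<in>L. frag_of (\<sigma> b (Poly_Mapping.lookup g b))) \<in> N" if "finite L" "L <= B" for L
  using that
 proof (induction L)
  case (insert b L)
  from N_add[OF \<sigma>_add[of b "Poly_Mapping.lookup f b" "Poly_Mapping.lookup g b"] insert.IH] insert
  show ?case by (simp add: lookup_add algebra_simps)
 qed (simp add: N_0)
 from this[OF K(1,2)] have 1: "?S (f + g) - ?S f - ?S g \<in> N" .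
 have 2: "?S h - realize h \<in> N" if "supp h <= K" for h
  by (rule realize_superset[OF K(1) that K(2)])
 have "(?S (f + g) - ?S f - ?S g) - (?S (f + g) - realize (f + g)) + (?S f - realize f)
  + (?S g - realize g) \<in> N"
  by (intro N_add N_diff 1 2 K)
 then show ?thesis by (simp add: algebra_simps)
qed

lemma realize_keys: "supp f <= B ==> supp (realize f) <= X"
 unfolding realize_def
 by (rule order_trans[OF Poly_Mapping.keys_sum]) (use \<sigma>_gen in auto)

lemma zlin_realize: assumes "supp f <= B" shows "zlin \<theta> (realize f) = f"
proof -
 have "zlin \<theta> (realize f) = (\<Sum>b\<in>supp f. sgl b (Poly_Mapping.lookup f b))"
  unfolding realize_def zlin_sum using \<theta>_\<sigma> assms by (intro sum.cong refl) auto
 also have "\<dots> = lin basis f" unfolding lin_def by simp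
 finally show ?thesis by simp
qed

definition spanned :: "('x \<Rightarrow>\<^sub>0 int) => bool" where
 "spanned c \<longleftrightarrow> (\<exists>f. supp f <= B \<and> c - realize f \<in> N)"

lemma spanned_N: "c \<in> N ==> spanned c"
 unfolding spanned_def by (intro exI[of _ 0]) (simp add: realize_def)

lemma spanned_\<sigma>: assumes "b \<in> B" shows "spanned (frag_of (\<sigma> b c))"
proof (cases "c = 0")
 case True
 then show ?thesis using spanned_N \<sigma>_zero assms by simp
next
 case False
 then have "realize (sgl b c) = frag_of (\<sigma> b c)" by (simp add: realize_def)
 then show ?thesis unfolding spanned_def using assms N_0 by (intro exI[of _ "sgl b c"]) simp
qed

lemma spanned_diff: assumes "spanned a" "spanned b" shows "spanned (a - b)"
proof -
 obtain f g where fg: "supp f <= B" "a - realize f \<in> N"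
  "supp g <= B" "b - realize g \<in> N" using assms unfolding spanned_def by blast
 have k: "supp (f - g) <= B" using fg Poly_Mapping.keys_diff[of f g] by blast
 have r: "realize f - realize (f - g) - realize g \<in> N" using realize_add[OF k fg(3)] by simp
 have "(a - realize f) - (b - realize g) + (realize f - realize (f - g) - realize g) \<in> N"
  by (intro N_add N_diff fg r)
 then have "a - b - realize (f - g) \<in> N" by (simp add: algebra_simps)
 then show ?thesis using k unfolding spanned_def by blast
qed

lemma spanned_add: assumes "spanned a" "spanned b" shows "spanned (a + b)"
 using spanned_diff[OF assms(1) spanned_diff[OF spanned_N[OF N_0] assms(2)]] by simp

lemma spanned_cong: assumes "spanned d" "c - d \<in> N" shows "spanned c"
 using spanned_add[OF spanned_N[OF assms(2)] assms(1)] by simp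

end

locale presented = pre_presented X Rel \<theta> B \<sigma>
 for X :: "'x set" and Rel :: "('x \<Rightarrow>\<^sub>0 int) set" and \<theta> :: "'x => ('b \<Rightarrow>\<^sub>0 'k::field)"
  and B :: "'b set" and \<sigma> :: "'b => 'k => 'x" +
 assumes \<sigma>_span: "x \<in> X ==> spanned (frag_of x)"
begin

lemma realize_exists:
 assumes "supp c <= X"
 shows "\<exists>f. supp f <= B \<and> c - realize f \<in> N"
proof -
 have "spanned c" using assms
  by (induction c rule: frag_induction) (simp_all add: spanned_N N_0 \<sigma>_span spanned_diff)
 then show ?thesis unfolding spanned_def .
qed

lemma zlin_zero_N: assumes "supp c <= X" "zlin \<theta> c = 0" shows "c \<in> N"
proof -
 obtain f where f: "supp f <= B" "c - realize f \<in> N" using realize_exists assms by blast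
 have "zlin \<theta> (c - realize f) = 0" by (rule zlin_N[OF f(2)])
 then have "f = 0" using zlin_realize[OF f(1)] assms by simp
 then show ?thesis using f by (simp add: realize_def)
qed

lemma pres_cls_eq_iff:
 assumes "supp c <= X" "supp d <= X"
 shows "pres_cls X Rel c = pres_cls X Rel d \<longleftrightarrow> zlin \<theta> c = zlin \<theta> d"
proof
 assume "pres_cls X Rel c = pres_cls X Rel d"
 then show "zlin \<theta> c = zlin \<theta> d" by (metis coord_cls)
next
 assume "zlin \<theta> c = zlin \<theta> d"
 moreover have "supp (c - d) <= X" using assms Poly_Mapping.keys_diff[of c d] by blast
 ultimately show "pres_cls X Rel c = pres_cls X Rel d" using zlin_zero_N[of "c - d"] pres_cls_eqI by simp
qed

lemma zlin_keys: assumes "supp c <= X" shows "supp (zlin \<theta> c) <= B"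
 unfolding zlin_def
proof (rule keys_sum_subset)
 fix x assume "x \<in> supp c"
 then have "x \<in> X" using assms by blast
 then show "supp (smul (of_int (Poly_Mapping.lookup c x)) (\<theta> x)) <= B"
  by (rule order_trans[OF keys_smul \<theta>_keys])
qed

lemma coord_bij: "bij_betw coord (carrier (G Mod N)) {f. supp f <= B}"
proof (rule bij_betwI')
 fix C D assume "C \<in> carrier (G Mod N)" "D \<in> carrier (G Mod N)"
 then obtain c d where "C = pres_cls X Rel c" "supp c <= X" "D = pres_cls X Rel d"
  "supp d <= X" unfolding carrier_Mod by blast
 then show "coord C = coord D \<longleftrightarrow> C = D" using pres_cls_eq_iff coord_cls by simp
next
 fix C assume "C \<in> carrier (G Mod N)"
 then obtain c where "C = pres_cls X Rel c" "supp c <= X" unfolding carrier_Mod by blast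
 then show "coord C \<in> {f. supp f <= B}" using zlin_keys[of c] by (simp add: coord_cls)
next
 fix f :: "'b \<Rightarrow>\<^sub>0 'k" assume "f \<in> {f. supp f <= B}"
 then have f: "supp f <= B" by simp
 show "\<exists>C\<in>carrier (G Mod N). f = coord C"
  by (rule bexI[OF _ pres_cls_carrier[OF realize_keys[OF f]]]) (simp add: coord_cls zlin_realize[OF f])
qed

end

text \<open>maps given on generators\<close>

lemma pres_map_coord:
 assumes "presented X Rel \<theta> B \<sigma>" "presented Y Rel' \<theta>' B' \<sigma>'"
  and f: "\<And>x. x \<in> X ==> f x \<in> Y" "\<And>x. x \<in> X ==> \<theta>' (f x) = L (\<theta> x)" and L: "klinear L"
  and c: "supp c <= X"
 shows "pres_map f Y Rel' (pres_cls X Rel c) = pres_cls Y Rel' (frag_extend (\<lambda>x. frag_of (f x)) c)"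
  and "pre_presented.coord \<theta>' (pres_map f Y Rel' (pres_cls X Rel c)) = L (zlin \<theta> c)"
proof -
 interpret P: presented X Rel \<theta> B \<sigma> by fact
 interpret P': presented Y Rel' \<theta>' B' \<sigma>' by fact
 let ?E = "frag_extend (\<lambda>x. frag_of (f x))"
 have k: "supp (?E d) <= Y" if "supp d <= X" for d
  by (rule order_trans[OF keys_frag_extend]) (use that f(1) in auto)
 have z: "zlin \<theta>' (?E d) = L (zlin \<theta> d)" if "supp d <= X" for d
 proof -
  have "zlin \<theta>' (?E d) = zlin (\<lambda>x. \<theta>' (f x)) d" by (rule zlin_frag_extend)
  also have "\<dots> = L (zlin \<theta> d)"
  unfolding zlin_def klinear_sum[OF L] klinear_smul[OF L] using that f(2) by (intro sum.cong) auto
  finally show ?thesis .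
 qed
 have "pres_cls Y Rel' (?E d) = pres_cls Y Rel' (?E c)" if "d \<in> pres_cls X Rel c" for d
 proof -
  have d: "d - c \<in> P.N" using that P.pres_cls_mem by blast
  then have "supp (d - c + c) <= X"
  using P.N_keys[OF d] c Poly_Mapping.keys_add[of "d - c" c] by blast
  then have kd: "supp d <= X" by simp
  have "zlin \<theta> d = zlin \<theta> c" using P.zlin_N[OF d] by simp
  then show ?thesis using P'.pres_cls_eq_iff[OF k[OF kd] k[OF c]] z[OF kd] z[OF c] by simp
 qed
 moreover have "c \<in> pres_cls X Rel c" using P.pres_cls_mem P.N_0 by simp
 ultimately show 1: "pres_map f Y Rel' (pres_cls X Rel c) = pres_cls Y Rel' (?E c)"
  unfolding pres_map_def by blast
 show "P'.coord (pres_map f Y Rel' (pres_cls X Rel c)) = L (zlin \<theta> c)"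
  unfolding 1 P'.coord_cls by (rule z[OF c])
qed

section \<open>The bar modules in coordinates\<close>

lemma keys_frag3: "a \<in> X ==> b \<in> X ==> c \<in> X ==>
  supp (frag_of a - frag_of b - frag_of c) <= X"
 using Poly_Mapping.keys_diff[of "frag_of a - frag_of b" "frag_of c"]
  Poly_Mapping.keys_diff[of "frag_of a" "frag_of b"] by auto

lemma keys_frag2: "a \<in> X ==> b \<in> X ==> supp (frag_of a - frag_of b) <= X"
 using Poly_Mapping.keys_diff[of "frag_of a" "frag_of b"] by auto

context monomial_algebra
begin

definition bar_lists :: "nat => ('v, 'a) path list set" where
 "bar_lists n = {ps. length ps = n + 2 \<and> set ps <= nonzero_paths Q I \<and> comp ps}"

definition ap_lists :: "nat => ('v, 'a) path list set" where
 "ap_lists n = {[p, w, q] | p w q. nz p \<and> w \<in> AP Q I n \<and> nz q \<and> target Q p = source w \<and> target Q w = source q}"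

abbreviation bar_theta :: "('v, 'a, 'k) alg list => (('v, 'a) path list \<Rightarrow>\<^sub>0 'k)" where
 "bar_theta as \<equiv> theta (map nf as)"

definition ap_theta :: "('v, 'a, 'k) ap_gen => (('v, 'a) path list \<Rightarrow>\<^sub>0 'k)" where
 "ap_theta g = theta [nf (fst g), fst (snd g), nf (snd (snd g))]"

definition bar_section :: "('v, 'a) path list => 'k => ('v, 'a, 'k) alg list" where
 "bar_section ps c = qcls Q I (sgl (hd ps) c) # map (pcls Q I) (tl ps)"

definition ap_section :: "('v, 'a) path list => 'k => ('v, 'a, 'k) ap_gen" where
 "ap_section ps c = (qcls Q I (sgl (ps ! 0) c), pbasis (ps ! 1), pcls Q I (ps ! 2))"

lemma vertex_single [simp]: "sgl (triv x) c \<in> vertex_algebra Q \<longleftrightarrow> x \<in> verts Q \<or> c = 0"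
 by (auto simp: vertex_algebra_def pspan_iff triv_def)

lemma vertex_paths: "e \<in> vertex_algebra Q ==> supp e <= paths Q"
 using keys_vertex_algebra keys_paths by blast

lemma map_nf_pcls: "set ps <= nonzero_paths Q I ==> map nf (map (pcls Q I) ps) = map basis ps"
 using nf_pcls nz_paths by (induction ps) auto

lemma nf_single: "nz p ==> nf (qcls Q I (sgl p c)) = sgl p c"
 using nf_qcls[of "sgl p c"] nz_paths[of p] by simp

lemma nf_mult_vertex:
 assumes "a \<in> carrier A" "e \<in> vertex_algebra Q"
 shows "nf (a \<otimes>\<^bsub>A\<^esub> qcls Q I e) = path_times Q (nf a) e" "nf (qcls Q I e \<otimes>\<^bsub>A\<^esub> a) = path_times Q e (nf a)"
proof -
 have e: "qcls Q I e \<in> carrier A" using vertex_paths[OF assms(2)] by simp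
 show "nf (a \<otimes>\<^bsub>A\<^esub> qcls Q I e) = path_times Q (nf a) e"
  unfolding nf_mult[OF assms(1) e] nf_vertex[OF assms(2)]
  by (rule trunc_times_vertex(1)[OF assms(2) nf_keys[OF assms(1)]])
 show "nf (qcls Q I e \<otimes>\<^bsub>A\<^esub> a) = path_times Q e (nf a)"
  unfolding nf_mult[OF e assms(1)] nf_vertex[OF assms(2)]
  by (rule trunc_times_vertex(2)[OF assms(2) nf_keys[OF assms(1)]])
qed

lemma qcls_single_add:
 "p \<in> paths Q ==> qcls Q I (sgl p (c + c')) =
  qcls Q I (sgl p c) \<oplus>\<^bsub>A\<^esub> qcls Q I (sgl p c')"
 by (subst qcls_add) (auto simp: single_add)

lemma single_scalar_left:
 assumes "p \<in> paths Q"
 shows "qcls Q I (sgl p c) = qcls Q I (sgl (triv (source p)) c) \<otimes>\<^bsub>A\<^esub> pcls Q I p"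
 unfolding pcls_def using assms source_in_verts[OF assms]
 by (subst qcls_mult) (auto simp: pbasis_def path_times_single)

lemma bar_add_rel:
 assumes "length as + length bs = n + 1" "set as <= carrier A" "set bs <= carrier A" "x \<in> carrier A" "y \<in> carrier A"
 shows "frag_of (as @ (x \<oplus>\<^bsub>A\<^esub> y) # bs) - frag_of (as @ x # bs) - frag_of (as @ y # bs) \<in> bar_rels Q I n"
proof -
 have "as @ x # bs \<in> bar_gens Q I n" using assms by (simp add: bar_gens_def)
 then show ?thesis unfolding bar_rels_def using assms(5) by blast
qed

lemma bar_bal_rel:
 assumes "length as + length bs = n" "set as <= carrier A" "set bs <= carrier A" "x \<in> carrier A" "y \<in> carrier A"
  "e \<in> vertex_algebra Q"
 shows "frag_of (as @ (x \<otimes>\<^bsub>A\<^esub> qcls Q I e) # y # bs) - frag_of (as @ x # (qcls Q I e \<otimes>\<^bsub>A\<^esub> y) # bs) \<in> bar_rels Q I n"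
proof -
 have "as @ x # y # bs \<in> bar_gens Q I n" using assms by (simp add: bar_gens_def)
 then show ?thesis unfolding bar_rels_def using assms(6) by blast
qed

lemma bar_pre_presented:
 "pre_presented (bar_gens Q I n) (bar_rels Q I n) bar_theta (bar_lists n) bar_section"
proof
 fix r :: "('v, 'a, 'k) alg list \<Rightarrow>\<^sub>0 int" assume r: "r \<in> bar_rels Q I n"
 then consider (add) as x y bs where
  "r = frag_of (as @ (x \<oplus>\<^bsub>A\<^esub> y) # bs) - frag_of (as @ x # bs) - frag_of (as @ y # bs)"
  "as @ x # bs \<in> bar_gens Q I n" "y \<in> carrier A"
  | (bal) as x y bs e where
  "r = frag_of (as @ (x \<otimes>\<^bsub>A\<^esub> qcls Q I e) # y # bs) - frag_of (as @ x # (qcls Q I e \<otimes>\<^bsub>A\<^esub> y) # bs)"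
  "as @ x # y # bs \<in> bar_gens Q I n" "e \<in> vertex_algebra Q"
  unfolding bar_rels_def by blast
 then have "supp r <= bar_gens Q I n \<and> zlin bar_theta r = 0"
 proof cases
  case add
  then have "set as <= carrier A" "set bs <= carrier A" "x \<in> carrier A" "length as + length bs = n + 1"
  by (auto simp: bar_gens_def)
  then have "as @ (x \<oplus>\<^bsub>A\<^esub> y) # bs \<in> bar_gens Q I n" "as @ y # bs \<in> bar_gens Q I n"
  using add by (auto simp: bar_gens_def)
  moreover have "zlin bar_theta r = 0"
  using theta_add[of "map nf as" "nf x" "nf y" "map nf bs"] nf_add[of x y] add \<open>x \<in> carrier A\<close> by simp
  ultimately show ?thesis using keys_frag3[OF _ add(2)] unfolding add(1) by simp
 next
  case bal
  then have c: "set as <= carrier A" "set bs <= carrier A" "x \<in> carrier A" "y \<in> carrier A"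
  "length as + length bs = n" by (auto simp: bar_gens_def)
  have e: "qcls Q I e \<in> carrier A" using vertex_paths[OF bal(3)] by simp
  then have "as @ (x \<otimes>\<^bsub>A\<^esub> qcls Q I e) # y # bs \<in> bar_gens Q I n"
  "as @ x # (qcls Q I e \<otimes>\<^bsub>A\<^esub> y) # bs \<in> bar_gens Q I n"
  using c by (auto simp: bar_gens_def)
  moreover have "zlin bar_theta r = 0"
  using theta_balanced[OF bal(3), of "map nf as" "nf x" "nf y" "map nf bs"] bal
  nf_mult_vertex[OF c(3) bal(3)] nf_mult_vertex[OF c(4) bal(3)] by simp
  ultimately show ?thesis using keys_frag2 unfolding bal(1) by simp
 qed
 then show "supp r <= bar_gens Q I n" "zlin bar_theta r = 0" by auto
next
 fix as assume as: "as \<in> bar_gens Q I n"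
 show "supp (bar_theta as) <= bar_lists n"
 proof
  fix ps assume "ps \<in> supp (bar_theta as)"
  then have ps: "list_all2 (\<lambda>p f. p \<in> supp f) ps (map nf as)" "comp ps"
  using keys_theta by blast+
  have "length ps = n + 2" using list_all2_lengthD[OF ps(1)] as by (simp add: bar_gens_def)
  moreover have "nz p" if p: "p \<in> set ps" for p
  proof -
  obtain i where i: "i < length ps" "p = ps ! i" using p by (auto simp: in_set_conv_nth)
  then have "p \<in> supp (nf (as ! i))"
  using list_all2_nthD[OF ps(1) i(1)] list_all2_lengthD[OF ps(1)] by simp
  moreover have "as ! i \<in> carrier A"
  using as i list_all2_lengthD[OF ps(1)] nth_mem[of i as] by (auto simp: bar_gens_def)
  ultimately show ?thesis using nf_keys by blast
  qed
  ultimately show "ps \<in> bar_lists n" using ps(2) by (auto simp: bar_lists_def)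
 qed
next
 fix ps :: "('v, 'a) path list" and c c' :: 'k assume "ps \<in> bar_lists n"
 then obtain p qs where ps: "ps = p # qs" "nz p" "set qs <= nonzero_paths Q I" "comp (p # qs)" "length qs = n + 1"
  unfolding bar_lists_def by (cases ps) auto
 have p: "p \<in> paths Q" using ps nz_paths by blast
 have qs: "set (map (pcls Q I) qs) <= carrier A" using ps(3) nz_paths by auto
 show "bar_section ps c \<in> bar_gens Q I n"
  using p qs ps by (simp add: bar_section_def bar_gens_def)
 have "map nf (bar_section ps c) = sgl p c # map basis qs"
  using map_nf_pcls[OF ps(3)] nf_single[OF ps(2)] ps(1) by (simp add: bar_section_def)
 then show "bar_theta (bar_section ps c) = sgl ps c"
  using theta_single[of p c qs] ps by simp
 show "frag_of (bar_section ps (c + c')) - frag_of (bar_section ps c) - frag_of (bar_section ps c')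
  \<in> generate (free_Abelian_group (bar_gens Q I n)) (bar_rels Q I n)"
  using bar_add_rel[of "[]" "map (pcls Q I) qs" n "qcls Q I (sgl p c)" "qcls Q I (sgl p c')"]
  qs p ps qcls_single_add[OF p] by (intro generate.incl) (simp add: bar_section_def)
qed

lemma bar_presented:
 "presented (bar_gens Q I n) (bar_rels Q I n) bar_theta (bar_lists n) bar_section"
proof -
 interpret P: pre_presented "bar_gens Q I n" "bar_rels Q I n" bar_theta "bar_lists n" bar_section
  by (rule bar_pre_presented)
 have slot_0: "frag_of (as @ qcls Q I 0 # bs) \<in> P.N"
  if "length as + length bs = n + 1" "set as <= carrier A" "set bs <= carrier A" for as bs
 proof -
  have "qcls Q I 0 \<oplus>\<^bsub>A\<^esub> qcls Q I 0 = qcls Q I 0" using qcls_add[of 0 0] by simp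
  then have "- frag_of (as @ qcls Q I 0 # bs) \<in> P.N"
  using P.N_rel[OF bar_add_rel[OF that, of "qcls Q I 0" "qcls Q I 0"]] by simp
  then show ?thesis using P.N_minus by force
 qed
 have slot: "P.spanned (frag_of (as @ a # bs))"
  if l: "length as + length bs = n + 1" "set as <= carrier A" "set bs <= carrier A" and a: "a \<in> carrier A"
  and sp: "\<And>p c. nz p ==> P.spanned (frag_of (as @ qcls Q I (sgl p c) # bs))" for as a bs
 proof -
  have "supp f <= nonzero_paths Q I ==>
  P.spanned (frag_of (as @ qcls Q I f # bs)) \<and> supp f <= paths Q" for f
  proof (induction f rule: span_induct)
  case zero
  then show ?case using P.spanned_N[OF slot_0[OF l]] by simp
  next
  case (single p c)
  then show ?case using sp nz_paths by auto
  next
  case (add f g)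
  have "qcls Q I (f + g) = qcls Q I f \<oplus>\<^bsub>A\<^esub> qcls Q I g" using qcls_add add by simp
  then have "frag_of (as @ qcls Q I (f + g) # bs) - (frag_of (as @ qcls Q I f # bs) + frag_of (as @ qcls Q I g # bs)) \<in> P.N"
  using P.N_rel[OF bar_add_rel[OF l, of "qcls Q I f" "qcls Q I g"]] add by (simp add: diff_diff_add)
  then have "P.spanned (frag_of (as @ qcls Q I (f + g) # bs))"
  using P.spanned_cong[OF P.spanned_add] add by blast
  moreover have "supp (f + g) <= paths Q" using add Poly_Mapping.keys_add[of f g] by blast
  ultimately show ?case by blast
  qed
  from this[OF nf_keys[OF a]] show ?thesis using qcls_nf[OF a] by simp
 qed
 have noncomp: "frag_of (as @ qcls Q I (sgl p c) # pcls Q I q # bs) \<in> P.N"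
  if l: "length as + length bs = n" "set as <= carrier A" "set bs <= carrier A" and pq: "nz p" "nz q"
  and ne: "target Q p \<noteq> source q" for as p c q bs
 proof -
  let ?e = "basis (triv (target Q p)) :: ('v, 'a) path \<Rightarrow>\<^sub>0 'k"
  let ?x = "qcls Q I (sgl p c)"
  have pq': "p \<in> paths Q" "q \<in> paths Q" using pq nz_paths by auto
  then have e: "?e \<in> vertex_algebra Q" using target_in_verts by simp
  have "?x \<otimes>\<^bsub>A\<^esub> qcls Q I ?e = ?x"
  using qcls_mult[of "sgl p c" ?e] pq' target_in_verts by (simp add: path_times_single)
  moreover have "qcls Q I ?e \<otimes>\<^bsub>A\<^esub> pcls Q I q = qcls Q I 0"
  unfolding pcls_def using qcls_mult[of ?e "pbasis q"] pq' target_in_verts ne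
  by (simp add: path_times_single pbasis_def)
  ultimately have "frag_of (as @ ?x # pcls Q I q # bs) - frag_of (as @ ?x # qcls Q I 0 # bs) \<in> P.N"
  using P.N_rel[OF bar_bal_rel[OF l, of ?x "pcls Q I q" ?e]] e pq' by simp
  moreover have "frag_of (as @ ?x # qcls Q I 0 # bs) \<in> P.N"
  using slot_0[of "as @ [?x]" bs] l pq' by simp
  ultimately show ?thesis using P.N_add by fastforce
 qed
 have main: "P.spanned (frag_of (as @ map (pcls Q I) ps))"
  if "length as + length ps = n + 2" "as \<noteq> []" "set as <= carrier A" "set ps <= nonzero_paths Q I" "comp ps" for as ps
  using that
 proof (induction "length as" arbitrary: as ps)
  case 0
  then show ?case by simp
 next
  case (Suc k)
  then obtain bs a where as: "as = bs @ [a]" by (metis rev_exhaust)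
  have ps: "set (map (pcls Q I) ps) <= carrier A" using Suc.prems nz_paths by auto
  have "P.spanned (frag_of (bs @ qcls Q I (sgl p c) # map (pcls Q I) ps))" if p: "nz p" for p c
  proof (cases "comp (p # ps)")
  case False
  then obtain q qs where q: "ps = q # qs" "target Q p \<noteq> source q" using Suc.prems by (cases ps) auto
  have "frag_of (bs @ qcls Q I (sgl p c) # pcls Q I q # map (pcls Q I) qs) \<in> P.N"
  using noncomp[of bs "map (pcls Q I) qs" p q c] q p Suc.prems as ps by simp
  then show ?thesis using P.spanned_N q by simp
  next
  case True
  show ?thesis
  proof (cases bs rule: rev_cases)
  case Nil
  have "p # ps \<in> bar_lists n" using True Nil p Suc.prems as by (simp add: bar_lists_def)
  from P.spanned_\<sigma>[OF this, of c] show ?thesis using Nil by (simp add: bar_section_def)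
  next
  case (snoc cs b)
  let ?e = "sgl (triv (source p)) c :: ('v, 'a) path \<Rightarrow>\<^sub>0 'k"
  have pp: "p \<in> paths Q" using p nz_paths by blast
  have e: "?e \<in> vertex_algebra Q" using source_in_verts[OF pp] by simp
  have b: "b \<in> carrier A" "set cs <= carrier A" using Suc.prems as snoc by auto
  have be: "b \<otimes>\<^bsub>A\<^esub> qcls Q I ?e \<in> carrier A" using b vertex_paths[OF e] by simp
  have "P.spanned (frag_of ((cs @ [b \<otimes>\<^bsub>A\<^esub> qcls Q I ?e]) @ map (pcls Q I) (p # ps)))"
  by (rule Suc.hyps(1)) (use Suc.hyps(2) Suc.prems as snoc b be p True in auto)
  moreover have "frag_of (cs @ (b \<otimes>\<^bsub>A\<^esub> qcls Q I ?e) # pcls Q I p # map (pcls Q I) ps) -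
  frag_of (cs @ b # (qcls Q I ?e \<otimes>\<^bsub>A\<^esub> pcls Q I p) # map (pcls Q I) ps) \<in> P.N"
  by (rule P.N_rel, rule bar_bal_rel) (use Suc.prems as snoc b ps pp e in auto)
  ultimately have "P.spanned (frag_of (cs @ b # (qcls Q I ?e \<otimes>\<^bsub>A\<^esub> pcls Q I p) # map (pcls Q I) ps))"
  using P.spanned_diff[OF _ P.spanned_N] by fastforce
  then show ?thesis using snoc single_scalar_left[OF pp, of c] by simp
  qed
  qed
  note entries = this
  have "P.spanned (frag_of (bs @ a # map (pcls Q I) ps))"
  proof (rule slot)
  show "length bs + length (map (pcls Q I) ps) = n + 1" "set bs <= carrier A" "a \<in> carrier A"
  using Suc.prems as by auto
  show "set (map (pcls Q I) ps) <= carrier A" by (rule ps)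
  qed (rule entries)
  then show ?case using as by simp
 qed
 show ?thesis
 proof unfold_locales
  fix as assume "as \<in> bar_gens Q I n"
  then have as: "length as = n + 2" "set as <= carrier A" by (auto simp: bar_gens_def)
  then have "as \<noteq> []" by auto
  then show "P.spanned (frag_of as)" using main[of as "[]"] as by simp
 qed
qed

end

section \<open>The Bardzell modules in coordinates\<close>

context monomial_algebra
begin

lemma AP_times_vertex:
 fixes e x :: "('v, 'a) path \<Rightarrow>\<^sub>0 'k"
 assumes "e \<in> vertex_algebra Q" "x \<in> pspan (AP Q I n)"
 shows "path_times Q e x \<in> pspan (AP Q I n)" "path_times Q x e \<in> pspan (AP Q I n)"
proof -
 have e: "supp e <= triv ` verts Q" using assms(1) by (simp add: vertex_algebra_def pspan_iff)
 show "path_times Q e x \<in> pspan (AP Q I n)"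
  unfolding pspan_iff path_times_def
 proof (rule keys_bilin)
  fix q p assume "q \<in> supp e" "p \<in> supp x"
  then have "p \<in> AP Q I n" "q \<in> triv ` verts Q" using assms(2) e by (auto simp: pspan_iff)
  then show "supp (if target Q q = source p then basis (pcat q p) else 0 :: ('v, 'a) path \<Rightarrow>\<^sub>0 'k)
  <= AP Q I n" by auto
 qed
 show "path_times Q x e \<in> pspan (AP Q I n)"
  unfolding pspan_iff path_times_def
 proof (rule keys_bilin)
  fix p q assume "p \<in> supp x" "q \<in> supp e"
  then have "p \<in> AP Q I n" "q \<in> triv ` verts Q" using assms(2) e by (auto simp: pspan_iff)
  then show "supp (if target Q p = source q then basis (pcat p q) else 0 :: ('v, 'a) path \<Rightarrow>\<^sub>0 'k)
  <= AP Q I n" by auto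
 qed
qed

lemma ap_rels_cases:
 assumes "r \<in> ap_rels Q I n"
 obtains (l) a a' x c where "r = frag_of (a \<oplus>\<^bsub>A\<^esub> a', x, c) - frag_of (a, x, c) - frag_of (a', x, c)"
  "a \<in> carrier A" "a' \<in> carrier A" "x \<in> pspan (AP Q I n)" "c \<in> carrier A"
 | (m) a x x' c where "r = frag_of (a, x + x', c) - frag_of (a, x, c) - frag_of (a, x', c)"
  "a \<in> carrier A" "x \<in> pspan (AP Q I n)" "x' \<in> pspan (AP Q I n)" "c \<in> carrier A"
 | (r) a x c c' where "r = frag_of (a, x, c \<oplus>\<^bsub>A\<^esub> c') - frag_of (a, x, c) - frag_of (a, x, c')"
  "a \<in> carrier A" "c' \<in> carrier A" "x \<in> pspan (AP Q I n)" "c \<in> carrier A"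
 | (bl) a x c e where "r = frag_of (a \<otimes>\<^bsub>A\<^esub> qcls Q I e, x, c) - frag_of (a, path_times Q e x, c)"
  "a \<in> carrier A" "x \<in> pspan (AP Q I n)" "c \<in> carrier A" "e \<in> vertex_algebra Q"
 | (br) a x c e where "r = frag_of (a, path_times Q x e, c) - frag_of (a, x, qcls Q I e \<otimes>\<^bsub>A\<^esub> c)"
  "a \<in> carrier A" "x \<in> pspan (AP Q I n)" "c \<in> carrier A" "e \<in> vertex_algebra Q"
 using assms unfolding ap_rels_def ap_gens_def by auto

lemma ap_rel_l: "a \<in> carrier A ==> a' \<in> carrier A ==> x \<in> pspan (AP Q I n) ==> c \<in> carrier A ==>
  frag_of (a \<oplus>\<^bsub>A\<^esub> a', x, c) - frag_of (a, x, c) - frag_of (a', x, c) \<in> ap_rels Q I n"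
 unfolding ap_rels_def ap_gens_def by blast

lemma ap_rel_m: "a \<in> carrier A ==> x \<in> pspan (AP Q I n) ==> x' \<in> pspan (AP Q I n) ==> c \<in> carrier A ==>
  frag_of (a, x + x', c) - frag_of (a, x, c) - frag_of (a, x', c) \<in> ap_rels Q I n"
 unfolding ap_rels_def ap_gens_def path_algebra_simps by blast

lemma ap_rel_r: "a \<in> carrier A ==> c' \<in> carrier A ==> x \<in> pspan (AP Q I n) ==> c \<in> carrier A ==>
  frag_of (a, x, c \<oplus>\<^bsub>A\<^esub> c') - frag_of (a, x, c) - frag_of (a, x, c') \<in> ap_rels Q I n"
 unfolding ap_rels_def ap_gens_def by blast

lemma ap_rel_bl: "a \<in> carrier A ==> x \<in> pspan (AP Q I n) ==> c \<in> carrier A ==> e \<in> vertex_algebra Q ==>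
  frag_of (a \<otimes>\<^bsub>A\<^esub> qcls Q I e, x, c) - frag_of (a, path_times Q e x, c) \<in> ap_rels Q I n"
 unfolding ap_rels_def ap_gens_def path_algebra_mult by blast

lemma ap_rel_br: "a \<in> carrier A ==> x \<in> pspan (AP Q I n) ==> c \<in> carrier A ==> e \<in> vertex_algebra Q ==>
  frag_of (a, path_times Q x e, c) - frag_of (a, x, qcls Q I e \<otimes>\<^bsub>A\<^esub> c) \<in> ap_rels Q I n"
 unfolding ap_rels_def ap_gens_def path_algebra_mult by blast

lemma ap_gens_iff: "(a, x, c) \<in> ap_gens Q I n \<longleftrightarrow> a \<in> carrier A \<and> x \<in> pspan (AP Q I n) \<and> c \<in> carrier A"
 by (simp add: ap_gens_def)

lemma pspan_add: "f \<in> pspan X ==> g \<in> pspan X ==> f + g \<in> pspan X"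
 using Poly_Mapping.keys_add[of f g] by (auto simp: pspan_iff)

lemma ap_lists_Cons: "[p, w, q] \<in> ap_lists n \<longleftrightarrow>
  nz p \<and> w \<in> AP Q I n \<and> nz q \<and> target Q p = source w \<and> target Q w = source q"
 unfolding ap_lists_def mem_Collect_eq list.inject by blast

lemma ap_pre_presented:
 "pre_presented (ap_gens Q I n) (ap_rels Q I n) ap_theta (ap_lists n) ap_section"
proof
 fix r :: "('v, 'a, 'k) ap_gen \<Rightarrow>\<^sub>0 int" assume "r \<in> ap_rels Q I n"
 then have "supp r <= ap_gens Q I n \<and> zlin ap_theta r = 0"
 proof (cases rule: ap_rels_cases)
  case (l a a' x c)
  have "(a \<oplus>\<^bsub>A\<^esub> a', x, c) \<in> ap_gens Q I n" "(a, x, c) \<in> ap_gens Q I n" "(a', x, c) \<in> ap_gens Q I n"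
  using l by (simp_all add: ap_gens_iff)
  from keys_frag3[OF this] show ?thesis
  using l nf_add[of a a'] by (simp add: ap_theta_def)
 next
  case (m a x x' c)
  have "(a, x + x', c) \<in> ap_gens Q I n" "(a, x, c) \<in> ap_gens Q I n" "(a, x', c) \<in> ap_gens Q I n"
  using m pspan_add by (simp_all add: ap_gens_iff)
  from keys_frag3[OF this] show ?thesis
  using m by (simp add: ap_theta_def)
 next
  case (r a x c c')
  have "(a, x, c \<oplus>\<^bsub>A\<^esub> c') \<in> ap_gens Q I n" "(a, x, c) \<in> ap_gens Q I n" "(a, x, c') \<in> ap_gens Q I n"
  using r by (simp_all add: ap_gens_iff)
  from keys_frag3[OF this] show ?thesis
  using r nf_add[of c c'] by (simp add: ap_theta_def)
 next
  case (bl a x c e)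
  have "(a \<otimes>\<^bsub>A\<^esub> qcls Q I e, x, c) \<in> ap_gens Q I n" "(a, path_times Q e x, c) \<in> ap_gens Q I n"
  using bl vertex_paths[OF bl(5)] AP_times_vertex[OF bl(5,3)] by (simp_all add: ap_gens_iff)
  from keys_frag2[OF this] show ?thesis
  using bl theta_balanced[OF bl(5), of "[]" "nf a" x "[nf c]"] nf_mult_vertex[OF bl(2,5)]
  by (simp add: ap_theta_def)
 next
  case (br a x c e)
  have "(a, path_times Q x e, c) \<in> ap_gens Q I n" "(a, x, qcls Q I e \<otimes>\<^bsub>A\<^esub> c) \<in> ap_gens Q I n"
  using br vertex_paths[OF br(5)] AP_times_vertex[OF br(5,3)] by (simp_all add: ap_gens_iff)
  from keys_frag2[OF this] show ?thesis
  using br theta_balanced[OF br(5), of "[nf a]" x "nf c" "[]"] nf_mult_vertex[OF br(4,5)]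
  by (simp add: ap_theta_def)
 qed
 then show "supp r <= ap_gens Q I n" "zlin ap_theta r = 0" by auto
next
 fix g :: "('v, 'a, 'k) ap_gen" assume g: "g \<in> ap_gens Q I n"
 obtain a x c where g': "g = (a, x, c)" by (cases g) auto
 then have acx: "a \<in> carrier A" "x \<in> pspan (AP Q I n)" "c \<in> carrier A" using g by (simp_all add: ap_gens_iff)
 show "supp (ap_theta g) <= ap_lists n"
 proof
  fix ps assume "ps \<in> supp (ap_theta g)"
  then have ps: "list_all2 (\<lambda>p f. p \<in> supp f) ps [nf a, x, nf c]" "comp ps"
  using keys_theta unfolding ap_theta_def g' by fastforce+
  then obtain p w q where "ps = [p, w, q]" "p \<in> supp (nf a)" "w \<in> supp x"
  "q \<in> supp (nf c)" by (auto simp: list_all2_Cons2)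
  moreover from this have "nz p" "nz q" "w \<in> AP Q I n"
  using nf_keys[OF acx(1)] nf_keys[OF acx(3)] acx(2) by (auto simp: pspan_iff)
  ultimately show "ps \<in> ap_lists n" using ps(2) by (simp add: ap_lists_Cons)
 qed
next
 fix ps :: "('v, 'a) path list" and c c' :: 'k assume "ps \<in> ap_lists n"
 then obtain p w q where ps: "ps = [p, w, q]" "nz p" "w \<in> AP Q I n" "nz q" "target Q p = source w" "target Q w = source q"
  unfolding ap_lists_def by auto
 have pq: "p \<in> paths Q" "q \<in> paths Q" using ps nz_paths by auto
 have w: "pbasis w \<in> pspan (AP Q I n)" using ps by (simp add: pspan_iff pbasis_def)
 show "ap_section ps c \<in> ap_gens Q I n" using pq w ps by (simp add: ap_section_def ap_gens_iff)
 show "ap_theta (ap_section ps c) = sgl ps c"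
  using ps nf_single[OF ps(2)] nf_pcls[OF pq(2)] by (simp add: ap_section_def ap_theta_def pbasis_def)
 show "frag_of (ap_section ps (c + c')) - frag_of (ap_section ps c) - frag_of (ap_section ps c')
  \<in> generate (free_Abelian_group (ap_gens Q I n)) (ap_rels Q I n)"
  using ap_rel_l[OF _ _ w, of "qcls Q I (sgl p c)" "qcls Q I (sgl p c')" "pcls Q I q"]
  pq ps qcls_single_add[OF pq(1)] by (intro generate.incl) (simp add: ap_section_def)
qed

lemma ap_presented:
 "presented (ap_gens Q I n) (ap_rels Q I n) ap_theta (ap_lists n) ap_section"
proof -
 interpret P: pre_presented "ap_gens Q I n" "ap_rels Q I n" ap_theta "ap_lists n" ap_section
  by (rule ap_pre_presented)
 have zeros: "frag_of (qcls Q I 0, x, c) \<in> P.N" "frag_of (c, 0, d) \<in> P.N" "frag_of (c, x, qcls Q I 0) \<in> P.N"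
  if "x \<in> pspan (AP Q I n)" "c \<in> carrier A" "d \<in> carrier A" for x c d
 proof -
  have 0: "qcls Q I 0 \<oplus>\<^bsub>A\<^esub> qcls Q I 0 = qcls Q I 0" using qcls_add[of 0 0] by simp
  have z: "0 \<in> pspan (AP Q I n)" by (simp add: pspan_iff)
  have m: "- y \<in> P.N ==> y \<in> P.N" for y using P.N_minus[of "- y"] by simp
  show "frag_of (qcls Q I 0, x, c) \<in> P.N"
  using P.N_rel[OF ap_rel_l[of "qcls Q I 0" "qcls Q I 0" x n c]] that 0 by - (rule m, simp)
  show "frag_of (c, 0, d) \<in> P.N"
  using P.N_rel[OF ap_rel_m[of c 0 n 0 d]] that z by - (rule m, simp)
  show "frag_of (c, x, qcls Q I 0) \<in> P.N"
  using P.N_rel[OF ap_rel_r[of c "qcls Q I 0" x n "qcls Q I 0"]] that 0 by - (rule m, simp)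
 qed
 have noncomp1: "frag_of (qcls Q I (sgl p c), pbasis w, d) \<in> P.N"
  if "nz p" "w \<in> AP Q I n" "d \<in> carrier A" "target Q p \<noteq> source w" for p c w d
 proof -
  let ?e = "basis (triv (target Q p)) :: ('v, 'a) path \<Rightarrow>\<^sub>0 'k"
  let ?x = "qcls Q I (sgl p c)"
  have p: "p \<in> paths Q" using that nz_paths by blast
  have e: "?e \<in> vertex_algebra Q" using target_in_verts[OF p] by simp
  have w: "pbasis w \<in> pspan (AP Q I n)" using that by (simp add: pspan_iff pbasis_def)
  have "?x \<otimes>\<^bsub>A\<^esub> qcls Q I ?e = ?x"
  using qcls_mult[of "sgl p c" ?e] p target_in_verts[OF p] by (simp add: path_times_single)
  moreover have "path_times Q ?e (pbasis w) = 0" using that by (simp add: path_times_single pbasis_def)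
  ultimately have "frag_of (?x, pbasis w, d) - frag_of (?x, 0, d) \<in> P.N"
  using P.N_rel[OF ap_rel_bl[of ?x "pbasis w" n d ?e]] e w p that by simp
  moreover have "frag_of (?x, 0, d) \<in> P.N" using zeros(2)[OF w, of ?x d] p that by simp
  ultimately show ?thesis using P.N_add by fastforce
 qed
 have noncomp2: "frag_of (a, pbasis w, pcls Q I q) \<in> P.N"
  if "nz q" "w \<in> AP Q I n" "a \<in> carrier A" "target Q w \<noteq> source q" for a w q
 proof -
  let ?e = "basis (triv (target Q w)) :: ('v, 'a) path \<Rightarrow>\<^sub>0 'k"
  have q: "q \<in> paths Q" "w \<in> paths Q" using that nz_paths AP_paths by auto
  have e: "?e \<in> vertex_algebra Q" using target_in_verts[OF q(2)] by simp
  have w: "pbasis w \<in> pspan (AP Q I n)" using that by (simp add: pspan_iff pbasis_def)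
  have "qcls Q I ?e \<otimes>\<^bsub>A\<^esub> pcls Q I q = qcls Q I 0"
  unfolding pcls_def using qcls_mult[of ?e "pbasis q"] q target_in_verts[OF q(2)] that
  by (simp add: path_times_single pbasis_def)
  moreover have "path_times Q (pbasis w) ?e = pbasis w" by (simp add: path_times_single pbasis_def)
  ultimately have "frag_of (a, pbasis w, pcls Q I q) - frag_of (a, pbasis w, qcls Q I 0) \<in> P.N"
  using P.N_rel[OF ap_rel_br[of a "pbasis w" n "pcls Q I q" ?e]] e w q that by simp
  moreover have "frag_of (a, pbasis w, qcls Q I 0) \<in> P.N" using zeros(3)[OF w that(3) that(3)] .
  ultimately show ?thesis using P.N_add by fastforce
 qed
 have sl: "P.spanned (frag_of (a, pbasis w, pcls Q I q))"
  if w: "w \<in> AP Q I n" and q: "nz q" and a: "a \<in> carrier A" for a w q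
 proof (cases "target Q w = source q")
  case False
  then show ?thesis using noncomp2[OF q w a] P.spanned_N by blast
 next
  case comp_wq: True
  have qp: "q \<in> paths Q" using q nz_paths by blast
  have pw: "pbasis w \<in> pspan (AP Q I n)" using w by (simp add: pspan_iff pbasis_def)
  have "supp f <= nonzero_paths Q I ==>
  P.spanned (frag_of (qcls Q I f, pbasis w, pcls Q I q)) \<and> supp f <= paths Q" for f
  proof (induction f rule: span_induct)
  case zero
  then show ?case using P.spanned_N[OF zeros(1)[OF pw, of "pcls Q I q" "pcls Q I q"]] qp by simp
  next
  case (single p c)
  have "P.spanned (frag_of (qcls Q I (sgl p c), pbasis w, pcls Q I q))"
  proof (cases "target Q p = source w")
  case True
  then have "[p, w, q] \<in> ap_lists n" using comp_wq single w q by (simp add: ap_lists_Cons)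
  from P.spanned_\<sigma>[OF this, of c] show ?thesis by (simp add: ap_section_def)
  next
  case False
  then show ?thesis using P.spanned_N[OF noncomp1[OF _ w]] single qp by simp
  qed
  then show ?case using single nz_paths by auto
  next
  case (add f g)
  have "qcls Q I (f + g) = qcls Q I f \<oplus>\<^bsub>A\<^esub> qcls Q I g" using qcls_add add by simp
  then have "frag_of (qcls Q I (f + g), pbasis w, pcls Q I q) -
  (frag_of (qcls Q I f, pbasis w, pcls Q I q) + frag_of (qcls Q I g, pbasis w, pcls Q I q)) \<in> P.N"
  using P.N_rel[OF ap_rel_l[of "qcls Q I f" "qcls Q I g" "pbasis w" n "pcls Q I q"]] add pw qp
  by (simp add: diff_diff_add)
  then have "P.spanned (frag_of (qcls Q I (f + g), pbasis w, pcls Q I q))"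
  using P.spanned_cong[OF P.spanned_add] add by blast
  moreover have "supp (f + g) <= paths Q" using add Poly_Mapping.keys_add[of f g] by blast
  ultimately show ?case by blast
  qed
  from this[OF nf_keys[OF a]] show ?thesis using qcls_nf[OF a] by simp
 qed
 have sm: "P.spanned (frag_of (a, x, pcls Q I q)) \<and> x \<in> pspan (AP Q I n)"
  if x: "supp x <= AP Q I n" and q: "nz q" and a: "a \<in> carrier A" for a x q
  using x
 proof (induction x rule: span_induct)
  case zero
  have "(0 :: ('v, 'a) path \<Rightarrow>\<^sub>0 'k) \<in> pspan (AP Q I n)" by (simp add: pspan_iff)
  then show ?case using P.spanned_N[OF zeros(2)[of 0 a "pcls Q I q"]] a q nz_paths by simp
 next
  case (single w c)
  let ?e = "sgl (triv (source w)) c :: ('v, 'a) path \<Rightarrow>\<^sub>0 'k"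
  have e: "?e \<in> vertex_algebra Q" using source_in_verts[OF AP_paths[OF single]] by simp
  have pw: "pbasis w \<in> pspan (AP Q I n)" using single by (simp add: pspan_iff pbasis_def)
  have ae: "a \<otimes>\<^bsub>A\<^esub> qcls Q I ?e \<in> carrier A" using a vertex_paths[OF e] by simp
  have "path_times Q ?e (pbasis w) = sgl w c" by (simp add: path_times_single pbasis_def)
  then have "frag_of (a \<otimes>\<^bsub>A\<^esub> qcls Q I ?e, pbasis w, pcls Q I q) - frag_of (a, sgl w c, pcls Q I q) \<in> P.N"
  using P.N_rel[OF ap_rel_bl[OF a pw _ e, of "pcls Q I q"]] q nz_paths by simp
  from P.spanned_diff[OF sl[OF single q ae] P.spanned_N[OF this]]
  show ?case using single by (simp add: pspan_iff)
 next
  case (add x y)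
  have "frag_of (a, x + y, pcls Q I q) - (frag_of (a, x, pcls Q I q) + frag_of (a, y, pcls Q I q)) \<in> P.N"
  using P.N_rel[OF ap_rel_m[OF a, of x n y "pcls Q I q"]] add q nz_paths by (simp add: diff_diff_add)
  then show ?case using P.spanned_cong[OF P.spanned_add] add pspan_add by blast
 qed
 have sr: "P.spanned (frag_of (a, x, qcls Q I f)) \<and> supp f <= paths Q"
  if f: "supp f <= nonzero_paths Q I" and a: "a \<in> carrier A" and x: "x \<in> pspan (AP Q I n)" for a x f
  using f
 proof (induction f rule: span_induct)
  case zero
  then show ?case using P.spanned_N[OF zeros(3)[OF x a a]] by simp
 next
  case (single q c)
  let ?e = "sgl (triv (source q)) c :: ('v, 'a) path \<Rightarrow>\<^sub>0 'k"
  have q: "q \<in> paths Q" using single nz_paths by blast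
  have e: "?e \<in> vertex_algebra Q" using source_in_verts[OF q] by simp
  have xe: "supp (path_times Q x ?e) <= AP Q I n"
  using AP_times_vertex(2)[OF e x] by (simp add: pspan_iff)
  have r: "frag_of (a, path_times Q x ?e, pcls Q I q) - frag_of (a, x, qcls Q I ?e \<otimes>\<^bsub>A\<^esub> pcls Q I q) \<in> P.N"
  by (rule P.N_rel, rule ap_rel_br[OF a x _ e]) (use q in simp)
  have "P.spanned (frag_of (a, path_times Q x ?e, pcls Q I q))" using sm[OF xe single a] by blast
  from P.spanned_diff[OF this P.spanned_N[OF r]]
  show ?case using q single_scalar_left[OF q, of c] by simp
 next
  case (add f g)
  have "qcls Q I (f + g) = qcls Q I f \<oplus>\<^bsub>A\<^esub> qcls Q I g" using qcls_add add by simp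
  then have "frag_of (a, x, qcls Q I (f + g)) - (frag_of (a, x, qcls Q I f) + frag_of (a, x, qcls Q I g)) \<in> P.N"
  using P.N_rel[OF ap_rel_r[OF a, of "qcls Q I g" x n "qcls Q I f"]] add x by (simp add: diff_diff_add)
  then have "P.spanned (frag_of (a, x, qcls Q I (f + g)))"
  using P.spanned_cong[OF P.spanned_add] add by blast
  moreover have "supp (f + g) <= paths Q" using add Poly_Mapping.keys_add[of f g] by blast
  ultimately show ?case by blast
 qed
 show ?thesis
 proof unfold_locales
  fix g :: "('v, 'a, 'k) ap_gen" assume g: "g \<in> ap_gens Q I n"
  obtain a x c where g': "g = (a, x, c)" by (cases g) auto
  then have acx: "a \<in> carrier A" "x \<in> pspan (AP Q I n)" "c \<in> carrier A" using g by (simp_all add: ap_gens_iff)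
  show "P.spanned (frag_of g)" using sr[OF nf_keys[OF acx(3)] acx(1,2)] qcls_nf[OF acx(3)] g' by simp
 qed
qed

end

section \<open>Models of the bimodules\<close>

locale bimodule_model = monomial_algebra Q I
 for Q :: "('v, 'a) pre_digraph" and I :: "(('v, 'a) path \<Rightarrow>\<^sub>0 'k::field) set" +
 fixes M :: "(('v, 'a, 'k) alg, 'm, 'z) bimodule_scheme" and B :: "('v, 'a) path list set"
  and \<Theta> :: "'m => (('v, 'a) path list \<Rightarrow>\<^sub>0 'k)"
 assumes bij: "bij_betw \<Theta> (carrier M) {u. supp u <= B}"
  and B_nz: "B <= nzlists"
  and add_closed: "x \<in> carrier M ==> y \<in> carrier M ==> x \<oplus>\<^bsub>M\<^esub> y \<in> carrier M"
  and \<Theta>_add: "x \<in> carrier M ==> y \<in> carrier M ==> \<Theta> (x \<oplus>\<^bsub>M\<^esub> y) = \<Theta> x + \<Theta> y"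
  and zero_closed: "\<zero>\<^bsub>M\<^esub> \<in> carrier M" and \<Theta>_zero: "\<Theta> \<zero>\<^bsub>M\<^esub> = 0"
  and lact_closed: "a \<in> carrier (malg Q I) ==> x \<in> carrier M ==> lact M a x \<in> carrier M"
  and \<Theta>_lact: "a \<in> carrier (malg Q I) ==> x \<in> carrier M ==> \<Theta> (lact M a x) = lmul (nf a) (\<Theta> x)"
  and ract_closed: "a \<in> carrier (malg Q I) ==> x \<in> carrier M ==> ract M x a \<in> carrier M"
  and \<Theta>_ract: "a \<in> carrier (malg Q I) ==> x \<in> carrier M ==> \<Theta> (ract M x a) = rmul (nf a) (\<Theta> x)"
begin

lemma \<Theta>_keys: "x \<in> carrier M ==> supp (\<Theta> x) <= B"
 using bij bij_betwE by blast

lemma \<Theta>_eqD: "x \<in> carrier M ==> y \<in> carrier M ==> \<Theta> x = \<Theta> y ==> x = y"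
 using bij unfolding bij_betw_def inj_on_def by blast

definition inv\<Theta> :: "(('v, 'a) path list \<Rightarrow>\<^sub>0 'k) => 'm" where
 "inv\<Theta> = inv_into (carrier M) \<Theta>"

lemma inv\<Theta>: assumes "supp u <= B" shows "inv\<Theta> u \<in> carrier M" "\<Theta> (inv\<Theta> u) = u"
proof -
 have "u \<in> \<Theta> ` carrier M" using bij assms by (simp add: bij_betw_def)
 then show "inv\<Theta> u \<in> carrier M" "\<Theta> (inv\<Theta> u) = u"
  unfolding inv\<Theta>_def by (rule inv_into_into, rule f_inv_into_f)
qed

lemma abelian_group_M: "abelian_group M"
proof (rule abelian_groupI)
 fix x y z assume c: "x \<in> carrier M" "y \<in> carrier M" "z \<in> carrier M"
 show "x \<oplus>\<^bsub>M\<^esub> y \<oplus>\<^bsub>M\<^esub> z = x \<oplus>\<^bsub>M\<^esub> (y \<oplus>\<^bsub>M\<^esub> z)"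
  by (rule \<Theta>_eqD) (use c in \<open>simp_all add: add_closed \<Theta>_add add.assoc\<close>)
next
 fix x y assume c: "x \<in> carrier M" "y \<in> carrier M"
 show "x \<oplus>\<^bsub>M\<^esub> y \<in> carrier M" using c by (rule add_closed)
 show "x \<oplus>\<^bsub>M\<^esub> y = y \<oplus>\<^bsub>M\<^esub> x"
  by (rule \<Theta>_eqD) (use c in \<open>simp_all add: add_closed \<Theta>_add add.commute\<close>)
next
 show "\<zero>\<^bsub>M\<^esub> \<in> carrier M" by (rule zero_closed)
next
 fix x assume c: "x \<in> carrier M"
 show "\<zero>\<^bsub>M\<^esub> \<oplus>\<^bsub>M\<^esub> x = x"
  by (rule \<Theta>_eqD) (use c in \<open>simp_all add: add_closed \<Theta>_add zero_closed \<Theta>_zero\<close>)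
 have k: "supp (- \<Theta> x) <= B" using \<Theta>_keys[OF c] by (simp add: keys_minus)
 have "inv\<Theta> (- \<Theta> x) \<oplus>\<^bsub>M\<^esub> x = \<zero>\<^bsub>M\<^esub>"
  by (rule \<Theta>_eqD) (use c inv\<Theta>[OF k] in \<open>simp_all add: add_closed \<Theta>_add zero_closed \<Theta>_zero\<close>)
 then show "\<exists>y\<in>carrier M. y \<oplus>\<^bsub>M\<^esub> x = \<zero>\<^bsub>M\<^esub>" using inv\<Theta>(1)[OF k] by blast
qed

sublocale M: abelian_group M by (rule abelian_group_M)

lemma \<Theta>_minus: assumes "x \<in> carrier M" shows "\<Theta> (\<ominus>\<^bsub>M\<^esub> x) = - \<Theta> x"
proof -
 have "\<Theta> (\<ominus>\<^bsub>M\<^esub> x \<oplus>\<^bsub>M\<^esub> x) = 0" using M.l_neg[OF assms] \<Theta>_zero by simp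
 then show ?thesis using \<Theta>_add[OF M.a_inv_closed[OF assms] assms] by (simp add: eq_neg_iff_add_eq_0)
qed

lemma \<Theta>_diff: "x \<in> carrier M ==> y \<in> carrier M ==> \<Theta> (x \<ominus>\<^bsub>M\<^esub> y) = \<Theta> x - \<Theta> y"
 unfolding a_minus_def using \<Theta>_add[OF _ M.a_inv_closed] \<Theta>_minus by simp

lemma \<Theta>_finsum:
 assumes "\<And>i. i \<in> S ==> f i \<in> carrier M"
 shows "\<Theta> (finsum M f S) = (\<Sum>i\<in>S. \<Theta> (f i))"
proof (cases "finite S")
 case True
 then show ?thesis using assms
 proof (induction S)
  case empty
  then show ?case by (simp add: \<Theta>_zero)
 next
  case (insert i S)
  then have "finsum M f (insert i S) = f i \<oplus>\<^bsub>M\<^esub> finsum M f S" by (intro M.finsum_insert) auto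
  then show ?case using insert \<Theta>_add[of "f i" "finsum M f S"] by simp
 qed
next
 case False
 then show ?thesis by (simp add: M.finsum_infinite \<Theta>_zero)
qed

lemma finsum_closed: "(\<And>i. i \<in> S ==> f i \<in> carrier M) ==> finsum M f S \<in> carrier M"
 by (rule M.finsum_closed) blast

end

context monomial_algebra
begin

lemma pres_model:
 assumes "presented X Rel \<theta> B \<sigma>" and B: "B <= nzlists"
  and lf: "\<And>a x. a \<in> carrier A ==> x \<in> X ==> lf a x \<in> X" "\<And>a x. a \<in> carrier A ==> x \<in> X ==> \<theta> (lf a x) = lmul (nf a) (\<theta> x)"
  and rf: "\<And>a x. a \<in> carrier A ==> x \<in> X ==> rf a x \<in> X" "\<And>a x. a \<in> carrier A ==> x \<in> X ==> \<theta> (rf a x) = rmul (nf a) (\<theta> x)"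
 shows "bimodule_model Q I (pres_bimodule X Rel (\<lambda>a. pres_map (lf a) X Rel) (\<lambda>C a. pres_map (rf a) X Rel C))
  B (pre_presented.coord \<theta>)"
proof -
 interpret P: presented X Rel \<theta> B \<sigma> by fact
 let ?M = "pres_bimodule X Rel (\<lambda>a. pres_map (lf a) X Rel) (\<lambda>C a. pres_map (rf a) X Rel C)"
 have c: "carrier ?M = carrier (P.G Mod P.N)" by (simp add: pres_bimodule_def Let_def)
 have add: "C \<oplus>\<^bsub>?M\<^esub> D = C <#>\<^bsub>P.G\<^esub> D" for C D
  by (simp add: pres_bimodule_def Let_def FactGroup_def)
 have z: "\<zero>\<^bsub>?M\<^esub> = pres_cls X Rel 0"
  using P.G.coset_mult_one[of P.N] P.N_keys by (simp add: pres_bimodule_def Let_def FactGroup_def pres_cls_def subset_iff)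
 have la: "lact ?M a C = pres_map (lf a) X Rel C" "ract ?M C a = pres_map (rf a) X Rel C" for a C
  by (simp_all add: pres_bimodule_def Let_def)
 have kf: "supp (frag_extend (\<lambda>x. frag_of (f x)) d) <= X"
  if "supp d <= X" "\<And>x. x \<in> X ==> f x \<in> X" for f and d
  by (rule order_trans[OF keys_frag_extend]) (use that in auto)
 show ?thesis
 proof (unfold_locales, unfold c add z la)
  show "bij_betw P.coord (carrier (P.G Mod P.N)) {u. supp u <= B}" by (rule P.coord_bij)
  show "B <= nzlists" by (rule B)
  show "pres_cls X Rel 0 \<in> carrier (P.G Mod P.N)" by (rule P.pres_cls_carrier) simp
  show "P.coord (pres_cls X Rel 0) = 0" by (simp add: P.coord_cls)
 next
  fix C D assume "C \<in> carrier (P.G Mod P.N)" "D \<in> carrier (P.G Mod P.N)"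
  then obtain x y where xy: "C = pres_cls X Rel x" "supp x <= X"
  "D = pres_cls X Rel y" "supp y <= X" unfolding P.carrier_Mod by blast
  have s: "C <#>\<^bsub>P.G\<^esub> D = pres_cls X Rel (x + y)" using P.pres_cls_add xy by simp
  have "supp (x + y) <= X" using Poly_Mapping.keys_add[of x y] xy by blast
  then show "C <#>\<^bsub>P.G\<^esub> D \<in> carrier (P.G Mod P.N)" unfolding s by (rule P.pres_cls_carrier)
  show "P.coord (C <#>\<^bsub>P.G\<^esub> D) = P.coord C + P.coord D" unfolding s using xy by (simp add: P.coord_cls)
 next
  fix a C assume a: "a \<in> carrier A" and "C \<in> carrier (P.G Mod P.N)"
  then obtain x where x: "C = pres_cls X Rel x" "supp x <= X" unfolding P.carrier_Mod by blast
  note l = pres_map_coord[OF assms(1) assms(1) lf(1)[OF a] lf(2)[OF a] klinear_mul(1) x(2)]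
  note r = pres_map_coord[OF assms(1) assms(1) rf(1)[OF a] rf(2)[OF a] klinear_mul(2) x(2)]
  show "P.coord (pres_map (lf a) X Rel C) = lmul (nf a) (P.coord C)" using l(2) x by (simp add: P.coord_cls)
  show "P.coord (pres_map (rf a) X Rel C) = rmul (nf a) (P.coord C)" using r(2) x by (simp add: P.coord_cls)
  have "pres_map (lf a) X Rel C = pres_cls X Rel (frag_extend (\<lambda>y. frag_of (lf a y)) x)"
  unfolding x(1) by (rule l(1))
  then show "pres_map (lf a) X Rel C \<in> carrier (P.G Mod P.N)"
  by (simp only:) (rule P.pres_cls_carrier, rule kf[of x "lf a", OF x(2) lf(1)[OF a]])
  have "pres_map (rf a) X Rel C = pres_cls X Rel (frag_extend (\<lambda>y. frag_of (rf a y)) x)"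
  unfolding x(1) by (rule r(1))
  then show "pres_map (rf a) X Rel C \<in> carrier (P.G Mod P.N)"
  by (simp only:) (rule P.pres_cls_carrier, rule kf[of x "rf a", OF x(2) rf(1)[OF a]])
 qed
qed

definition bar_coord :: "(('v, 'a, 'k) alg list \<Rightarrow>\<^sub>0 int) set => (('v, 'a) path list \<Rightarrow>\<^sub>0 'k)" where
 "bar_coord = pre_presented.coord bar_theta"

definition ap_coord :: "(('v, 'a, 'k) ap_gen \<Rightarrow>\<^sub>0 int) set => (('v, 'a) path list \<Rightarrow>\<^sub>0 'k)" where
 "ap_coord = pre_presented.coord ap_theta"

lemma bar_model: "bimodule_model Q I (Bar Q I n) (bar_lists n) bar_coord"
 unfolding Bar_def bar_coord_def
proof (rule pres_model[OF bar_presented])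
 show "bar_lists n <= nzlists"
 proof
  fix ps assume ps: "ps \<in> bar_lists n"
  then have "ps \<noteq> []" by (auto simp: bar_lists_def)
  then show "ps \<in> nzlists" using ps hd_in_set[of ps] last_in_set[of ps]
  by (auto simp: bar_lists_def nzlists_def)
 qed
next
 fix a as assume a: "a \<in> carrier A" and as: "as \<in> bar_gens Q I n"
 obtain x bs where x: "as = x # bs" "x \<in> carrier A" "set bs <= carrier A" "length bs = n + 1"
  using as by (cases as) (auto simp: bar_gens_def)
 show "(a \<otimes>\<^bsub>A\<^esub> hd as) # tl as \<in> bar_gens Q I n" using x a by (simp add: bar_gens_def)
 show "bar_theta ((a \<otimes>\<^bsub>A\<^esub> hd as) # tl as) = lmul (nf a) (bar_theta as)"
  using x a theta_lmul[of "nf a" "nf x" "map nf bs"] by (simp add: nf_mult)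
 obtain y cs where y: "as = cs @ [y]" "y \<in> carrier A" "set cs <= carrier A" "length cs = n + 1"
  using as by (cases as rule: rev_cases) (auto simp: bar_gens_def)
 show "butlast as @ [last as \<otimes>\<^bsub>A\<^esub> a] \<in> bar_gens Q I n" using y a by (simp add: bar_gens_def)
 show "bar_theta (butlast as @ [last as \<otimes>\<^bsub>A\<^esub> a]) = rmul (nf a) (bar_theta as)"
  using y a theta_rmul[of "map nf cs" "nf y" "nf a"] by (simp add: nf_mult)
qed

lemma ap_model: "bimodule_model Q I (Ap Q I n) (ap_lists n) ap_coord"
 unfolding Ap_def ap_coord_def
proof (rule pres_model[OF ap_presented])
 show "ap_lists n <= nzlists" by (auto simp: ap_lists_def nzlists_def)
next
 fix b g assume b: "b \<in> carrier A" and g: "g \<in> ap_gens Q I n"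
 obtain a x c where g': "g = (a, x, c)" by (cases g) auto
 then have acx: "a \<in> carrier A" "x \<in> pspan (AP Q I n)" "c \<in> carrier A" using g by (simp_all add: ap_gens_iff)
 show "(case g of (a, x, c) => (b \<otimes>\<^bsub>A\<^esub> a, x, c)) \<in> ap_gens Q I n"
  "(case g of (a, x, c) => (a, x, c \<otimes>\<^bsub>A\<^esub> b)) \<in> ap_gens Q I n"
  using acx b g' by (simp_all add: ap_gens_iff)
 show "ap_theta (case g of (a, x, c) => (b \<otimes>\<^bsub>A\<^esub> a, x, c)) = lmul (nf b) (ap_theta g)"
  using acx b g' theta_lmul[of "nf b" "nf a" "[x, nf c]"] by (simp add: nf_mult ap_theta_def)
 show "ap_theta (case g of (a, x, c) => (a, x, c \<otimes>\<^bsub>A\<^esub> b)) = rmul (nf b) (ap_theta g)"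
  using acx b g' theta_rmul[of "[nf a, x]" "nf c" "nf b"] by (simp add: nf_mult ap_theta_def)
qed

definition alg_lists :: "('v, 'a) path list set" where
 "alg_lists = {[p] | p. nz p}"

definition alg_coord :: "('v, 'a, 'k) alg => (('v, 'a) path list \<Rightarrow>\<^sub>0 'k)" where
 "alg_coord a = sing (nf a)"

lemma sing_inj: "sing f = sing g ==> f = g"
proof -
 have "lin (\<lambda>ps. basis (hd ps)) (sing f) = f" for f :: "('v, 'a) path \<Rightarrow>\<^sub>0 'k"
  unfolding sing_def klinear_lin_comp[OF klinear_lin] by simp
 then show "sing f = sing g ==> f = g" by metis
qed

lemma alg_model: "bimodule_model Q I (alg_bimodule Q I) alg_lists alg_coord"
proof
 have c: "carrier (alg_bimodule Q I) = carrier A" "x \<oplus>\<^bsub>alg_bimodule Q I\<^esub> y = x \<oplus>\<^bsub>A\<^esub> y"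
  "\<zero>\<^bsub>alg_bimodule Q I\<^esub> = \<zero>\<^bsub>A\<^esub>" "lact (alg_bimodule Q I) a x = a \<otimes>\<^bsub>A\<^esub> x"
  "ract (alg_bimodule Q I) x a = x \<otimes>\<^bsub>A\<^esub> a" for x y a
  by (simp_all add: alg_bimodule_def ring.defs)
 show "bij_betw alg_coord (carrier (alg_bimodule Q I)) {u. supp u <= alg_lists}"
  unfolding c
 proof (rule bij_betwI')
  fix a b assume "a \<in> carrier A" "b \<in> carrier A"
  then show "alg_coord a = alg_coord b \<longleftrightarrow> a = b"
  unfolding alg_coord_def using sing_inj qcls_nf by metis
 next
  fix a assume a: "a \<in> carrier A"
  have "supp (sing (nf a)) <= alg_lists"
  unfolding sing_def by (rule keys_lin) (use nf_keys[OF a] in \<open>auto simp: alg_lists_def\<close>)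
  then show "alg_coord a \<in> {u. supp u <= alg_lists}" by (simp add: alg_coord_def)
 next
  fix u assume "u \<in> {u :: ('v, 'a) path list \<Rightarrow>\<^sub>0 'k. supp u <= alg_lists}"
  then have u: "supp u <= alg_lists" by simp
  define f where "f = lin (\<lambda>ps. basis (hd ps) :: ('v, 'a) path \<Rightarrow>\<^sub>0 'k) u"
  have f: "supp f <= nonzero_paths Q I"
  unfolding f_def by (rule keys_lin) (use u in \<open>auto simp: alg_lists_def\<close>)
  have "sing f = u"
  unfolding f_def using u
  by (induction u rule: span_induct) (auto simp: alg_lists_def)
  then have "u = alg_coord (qcls Q I f)"
  using nf_qcls[OF keys_paths[OF f]] trunc_id[OF f] by (simp add: alg_coord_def)
  then show "\<exists>a\<in>carrier A. u = alg_coord a" using keys_paths[OF f] by (intro bexI[of _ "qcls Q I f"]) simp_all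
 qed
 show "alg_lists <= nzlists" by (auto simp: alg_lists_def nzlists_def)
 show "alg_coord \<zero>\<^bsub>alg_bimodule Q I\<^esub> = 0"
 proof -
  have "nf \<zero>\<^bsub>A\<^esub> = nf \<zero>\<^bsub>A\<^esub> + nf \<zero>\<^bsub>A\<^esub>" using nf_add[of "\<zero>\<^bsub>A\<^esub>" "\<zero>\<^bsub>A\<^esub>"] by simp
  then show ?thesis unfolding c alg_coord_def by simp
 qed
 show "\<zero>\<^bsub>alg_bimodule Q I\<^esub> \<in> carrier (alg_bimodule Q I)" unfolding c by simp
 fix x y assume "x \<in> carrier (alg_bimodule Q I)" "y \<in> carrier (alg_bimodule Q I)"
 then show "x \<oplus>\<^bsub>alg_bimodule Q I\<^esub> y \<in> carrier (alg_bimodule Q I)"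
  "alg_coord (x \<oplus>\<^bsub>alg_bimodule Q I\<^esub> y) = alg_coord x + alg_coord y"
  unfolding c alg_coord_def by (simp_all add: nf_add)
next
 have c: "carrier (alg_bimodule Q I) = carrier A" "lact (alg_bimodule Q I) a x = a \<otimes>\<^bsub>A\<^esub> x"
  "ract (alg_bimodule Q I) x a = x \<otimes>\<^bsub>A\<^esub> a" for x a
  by (simp_all add: alg_bimodule_def ring.defs)
 fix a x assume "a \<in> carrier A" "x \<in> carrier (alg_bimodule Q I)"
 then show "lact (alg_bimodule Q I) a x \<in> carrier (alg_bimodule Q I)"
  "alg_coord (lact (alg_bimodule Q I) a x) = lmul (nf a) (alg_coord x)"
  "ract (alg_bimodule Q I) x a \<in> carrier (alg_bimodule Q I)"
  "alg_coord (ract (alg_bimodule Q I) x a) = rmul (nf a) (alg_coord x)"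
  unfolding c alg_coord_def
  using theta_lmul[of "nf a" "nf x" "[]"] theta_rmul[of "[]" "nf x" "nf a"] by (simp_all add: nf_mult)
qed

lemma bar_tensor_closed: "as \<in> bar_gens Q I n ==> bar_tensor Q I n as \<in> carrier (Bar Q I n)"
proof -
 interpret P: presented "bar_gens Q I n" "bar_rels Q I n" bar_theta "bar_lists n" bar_section by (rule bar_presented)
 assume "as \<in> bar_gens Q I n"
 then show ?thesis using P.pres_cls_carrier[of "frag_of as"]
  by (simp add: bar_tensor_def Bar_def pres_bimodule_def Let_def)
qed

lemma bar_coord_tensor: "bar_coord (bar_tensor Q I n as) = bar_theta as"
proof -
 interpret P: presented "bar_gens Q I n" "bar_rels Q I n" bar_theta "bar_lists n" bar_section by (rule bar_presented)
 show ?thesis by (simp add: bar_tensor_def bar_coord_def)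
qed

lemma ap_tensor_closed:
 "a \<in> carrier A ==> w \<in> AP Q I n ==> c \<in> carrier A ==> ap_tensor Q I n a w c \<in> carrier (Ap Q I n)"
proof -
 interpret P: presented "ap_gens Q I n" "ap_rels Q I n" ap_theta "ap_lists n" ap_section by (rule ap_presented)
 assume "a \<in> carrier A" "w \<in> AP Q I n" "c \<in> carrier A"
 then have "(a, pbasis w, c) \<in> ap_gens Q I n" by (simp add: ap_gens_iff pspan_iff pbasis_def)
 then show ?thesis using P.pres_cls_carrier[of "frag_of (a, pbasis w, c)"]
  by (simp add: ap_tensor_def Ap_def pres_bimodule_def Let_def)
qed

lemma ap_coord_tensor: "ap_coord (ap_tensor Q I n a w c) = theta [nf a, basis w, nf c]"
proof -
 interpret P: presented "ap_gens Q I n" "ap_rels Q I n" ap_theta "ap_lists n" ap_section by (rule ap_presented)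
 show ?thesis by (simp add: ap_tensor_def ap_coord_def ap_theta_def pbasis_def)
qed

lemma one_tensor_coord:
 assumes "x \<in> carrier (Bar Q I n)"
 shows "one_tensor Q I n x \<in> carrier (Bar Q I (Suc n))" "bar_coord (one_tensor Q I n x) = ins (bar_coord x)"
proof -
 interpret P: presented "bar_gens Q I n" "bar_rels Q I n" bar_theta "bar_lists n" bar_section by (rule bar_presented)
 interpret P': presented "bar_gens Q I (Suc n)" "bar_rels Q I (Suc n)" bar_theta "bar_lists (Suc n)" bar_section
  by (rule bar_presented)
 obtain d where d: "x = pres_cls (bar_gens Q I n) (bar_rels Q I n) d" "supp d <= bar_gens Q I n"
  using assms P.carrier_Mod by (auto simp: Bar_def pres_bimodule_def Let_def)
 have f: "unitA # as \<in> bar_gens Q I (Suc n)" if "as \<in> bar_gens Q I n" for as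
  using that by (simp add: bar_gens_def)
 have t: "bar_theta (unitA # as) = ins (bar_theta as)" if as: "as \<in> bar_gens Q I n" for as
 proof -
  have "as \<noteq> []" using as by (auto simp: bar_gens_def)
  moreover have "supp (bar_theta as) <= {ps. source (hd ps) \<in> verts Q}"
  proof
  fix ps assume "ps \<in> supp (bar_theta as)"
  then have "ps \<in> bar_lists n" using P.\<theta>_keys[OF as] by blast
  then have "nz (hd ps)" by (cases ps) (auto simp: bar_lists_def)
  then show "ps \<in> {ps. source (hd ps) \<in> verts Q}" using nz_paths source_in_verts by blast
  qed
  ultimately show ?thesis by (simp add: theta_Cons nf_one consl_one)
 qed
 have L: "klinear ins" unfolding ins_def by (rule klinear_lin)
 note m = pres_map_coord[OF bar_presented bar_presented f t L d(2)]
 show "bar_coord (one_tensor Q I n x) = ins (bar_coord x)"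
  using m(2) by (simp add: one_tensor_def d(1) bar_coord_def P.coord_cls)
 have "supp (frag_extend (\<lambda>as. frag_of (unitA # as)) d) <= bar_gens Q I (Suc n)"
  by (rule order_trans[OF keys_frag_extend]) (use d(2) f in auto)
 from P'.pres_cls_carrier[OF this] show "one_tensor Q I n x \<in> carrier (Bar Q I (Suc n))"
  using m(1) by (simp add: one_tensor_def d(1) Bar_def pres_bimodule_def Let_def)
qed

end

section \<open>Bimodule maps in coordinates\<close>

context monomial_algebra
begin

text \<open>Equivariance needs to be required on basis lists and for multiplication by nonzero paths only.\<close>

definition chom :: "('v, 'a) path list set => ((('v, 'a) path list \<Rightarrow>\<^sub>0 'k) => (('v, 'a) path list \<Rightarrow>\<^sub>0 'k)) =>
  ('v, 'a) path list set => bool" where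
 "chom B h B' \<longleftrightarrow> klinear h \<and> (\<forall>ps\<in>B. supp (h (basis ps)) <= B') \<and>
  (\<forall>ps\<in>B. \<forall>p. nz p --> h (lmul (basis p) (basis ps)) = lmul (basis p) (h (basis ps)) \<and>
  h (rmul (basis p) (basis ps)) = rmul (basis p) (h (basis ps)))"

lemma single_smul: "sgl x c = smul c (basis x)" by simp

lemma chom_keys:
 assumes "chom B h B'" "supp u <= B" shows "supp (h u) <= B'"
 using assms(2)
proof (induction u rule: span_induct)
 case zero
 then show ?case using assms(1) by (simp add: chom_def klinear_0)
next
 case (single ps c)
 have "h (sgl ps c) = smul c (h (basis ps))"
  using assms(1) unfolding chom_def by (subst single_smul) (rule klinear_smul, blast)
 then show ?case using assms(1) single keys_smul[of c "h (basis ps)"] unfolding chom_def by auto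
next
 case (add u v)
 have "h (u + v) = h u + h v" using assms(1) unfolding chom_def by (intro klinear_add) blast
 then show ?case using add Poly_Mapping.keys_add[of "h u" "h v"] by auto
qed

lemma chom_mul:
 assumes h: "chom B h B'" and f: "supp f <= nonzero_paths Q I" and u: "supp u <= B"
 shows "h (lmul f u) = lmul f (h u)" "h (rmul f u) = rmul f (h u)"
proof -
 have k: "klinear h" using h by (simp add: chom_def)
 note hs = klinear_add[OF k] klinear_0[OF k]
 have "h (lmul f u) = lmul f (h u) \<and> h (rmul f u) = rmul f (h u)" using f
 proof (induction f rule: span_induct)
  case (single p a)
  show ?case using u
  proof (induction u rule: span_induct)
  case (single ps c)
  have e1: "lmul (sgl p a) (sgl ps c) = smul (a * c) (lmul (basis p) (basis ps))"
  "rmul (sgl p a) (sgl ps c) = smul (a * c) (rmul (basis p) (basis ps))"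
  by (simp_all add: mul_single)
  have e2: "lmul (sgl p a) (smul c v) = smul (a * c) (lmul (basis p) v)"
  "rmul (sgl p a) (smul c v) = smul (a * c) (rmul (basis p) v)" for v
  proof -
  have l: "lmul (sgl p a) v = smul a (lmul (basis p) v)"
  "rmul (sgl p a) v = smul a (rmul (basis p) v)"
  using klinear_smul[OF klinear_mul(3), where c = a and f = "basis p"]
  klinear_smul[OF klinear_mul(4), where c = a and f = "basis p"] by simp_all
  have cc: "c * a = a * c" by (rule mult.commute)
  show "lmul (sgl p a) (smul c v) = smul (a * c) (lmul (basis p) v)"
  unfolding klinear_smul[OF klinear_mul(1)] l smul_simps(7) cc ..
  show "rmul (sgl p a) (smul c v) = smul (a * c) (rmul (basis p) v)"
  unfolding klinear_smul[OF klinear_mul(2)] l smul_simps(7) cc ..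
  qed
  have e3: "h (sgl ps c) = smul c (h (basis ps))"
  by (subst single_smul) (rule klinear_smul[OF k])
  have e4: "h (lmul (basis p) (basis ps)) = lmul (basis p) (h (basis ps))"
  "h (rmul (basis p) (basis ps)) = rmul (basis p) (h (basis ps))"
  proof -
  note H = h[unfolded chom_def, THEN conjunct2, THEN conjunct2, THEN bspec, OF single, THEN spec, THEN mp,
  OF \<open>nz p\<close>]
  show "h (lmul (basis p) (basis ps)) = lmul (basis p) (h (basis ps))" by (rule conjunct1[OF H])
  show "h (rmul (basis p) (basis ps)) = rmul (basis p) (h (basis ps))" by (rule conjunct2[OF H])
  qed
  show ?case by (simp only: e1 e2 e3 e4 klinear_smul[OF k] simp_thms)
  qed (simp_all add: hs)
 qed (simp_all add: hs)
 then show "h (lmul f u) = lmul f (h u)" "h (rmul f u) = rmul f (h u)" by auto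
qed

lemma transport_hom:
 assumes M: "bimodule_model Q I M B \<Theta>" and N: "bimodule_model Q I N B' \<Theta>'" and h: "chom B h B'"
 shows "\<exists>H. H \<in> bimod_hom A M N \<and> (\<forall>x\<in>carrier M. \<Theta>' (H x) = h (\<Theta> x))"
proof -
 interpret M: bimodule_model Q I M B \<Theta> by fact
 interpret N: bimodule_model Q I N B' \<Theta>' by fact
 define H where "H x = N.inv\<Theta> (h (\<Theta> x))" for x
 have k: "klinear h" using h by (simp add: chom_def)
 have c: "H x \<in> carrier N" "\<Theta>' (H x) = h (\<Theta> x)" if "x \<in> carrier M" for x
  using N.inv\<Theta>[OF chom_keys[OF h M.\<Theta>_keys[OF that]]] by (simp_all add: H_def)
 have "H \<in> bimod_hom A M N"
  unfolding bimod_hom_def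
 proof (intro CollectI conjI ballI)
  show "H \<in> carrier M \<rightarrow> carrier N" using c by blast
  fix x assume x: "x \<in> carrier M"
  show "H (x \<oplus>\<^bsub>M\<^esub> y) = H x \<oplus>\<^bsub>N\<^esub> H y" if "y \<in> carrier M" for y
  by (rule N.\<Theta>_eqD) (use x that c M.add_closed in \<open>simp_all add: N.add_closed N.\<Theta>_add M.\<Theta>_add klinear_add[OF k]\<close>)
 next
  fix a x assume a: "a \<in> carrier A" and x: "x \<in> carrier M"
  show "H (lact M a x) = lact N a (H x)"
  by (rule N.\<Theta>_eqD) (use a x c M.lact_closed chom_mul(1)[OF h nf_keys[OF a] M.\<Theta>_keys[OF x]] in
  \<open>simp_all add: N.lact_closed N.\<Theta>_lact M.\<Theta>_lact\<close>)
  show "H (ract M x a) = ract N (H x) a"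
  by (rule N.\<Theta>_eqD) (use a x c M.ract_closed chom_mul(2)[OF h nf_keys[OF a] M.\<Theta>_keys[OF x]] in
  \<open>simp_all add: N.ract_closed N.\<Theta>_ract M.\<Theta>_ract\<close>)
 qed
 then show ?thesis using c by blast
qed

text \<open>Up to multiplication on both sides, a basis list is this list with trivial paths at the ends.\<close>

definition gen_list :: "('v, 'a) path list => ('v, 'a) path list" where
 "gen_list ps = triv (target Q (hd ps)) # butlast (tl ps) @ [triv (source (last ps))]"

lemma gen_list_simp: "gen_list (p # vs @ [q]) = triv (target Q p) # vs @ [triv (source q)]"
 by (simp add: gen_list_def)

lemma two_ends:
 assumes "2 <= length ps" obtains p vs q where "ps = p # vs @ [q]"
proof -
 obtain p ps' where 1: "ps = p # ps'" using assms by (cases ps) simp_all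
 obtain vs q where 2: "ps' = vs @ [q]" using assms 1 by (cases ps' rule: rev_cases) simp_all
 show ?thesis by (rule that) (simp add: 1 2)
qed

lemma basis_from_gen:
 assumes "2 <= length ps" "nz (hd ps)" "nz (last ps)"
 shows "sgl ps c = lmul (sgl (hd ps) c) (rmul (basis (last ps)) (basis (gen_list ps)))"
proof -
 obtain p vs q where ps: "ps = p # vs @ [q]" using assms(1) by (rule two_ends)
 have "nz p" "nz q" using assms ps by auto
 then show ?thesis unfolding ps gen_list_simp by (simp add: mul_single target_triv)
qed

lemma unique_hom:
 assumes M: "bimodule_model Q I M B \<Theta>" and N: "bimodule_model Q I N B' \<Theta>'" and h: "chom B h B'"
  and H: "H \<in> bimod_hom A M N"
  and B: "\<And>ps. ps \<in> B ==> 2 <= length ps \<and> gen_list ps \<in> B"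
  and g: "\<And>x ps. x \<in> carrier M ==> ps \<in> B ==> \<Theta> x = basis (gen_list ps) ==> \<Theta>' (H x) = h (\<Theta> x)"
  and x: "x \<in> carrier M"
 shows "\<Theta>' (H x) = h (\<Theta> x)"
proof -
 interpret M: bimodule_model Q I M B \<Theta> by fact
 interpret N: bimodule_model Q I N B' \<Theta>' by fact
 have k: "klinear h" using h by (simp add: chom_def)
 have Hc: "H y \<in> carrier N" if "y \<in> carrier M" for y using H that by (auto simp: bimod_hom_def)
 have Hs: "H (y \<oplus>\<^bsub>M\<^esub> z) = H y \<oplus>\<^bsub>N\<^esub> H z" if "y \<in> carrier M" "z \<in> carrier M" for y z
  using H that by (simp add: bimod_hom_def)
 have Ha: "H (lact M a y) = lact N a (H y)" "H (ract M y a) = ract N (H y) a"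
  if "a \<in> carrier A" "y \<in> carrier M" for a y
  using H that by (simp_all add: bimod_hom_def)
 have "\<exists>y\<in>carrier M. \<Theta> y = u \<and> \<Theta>' (H y) = h u" if "supp u <= B" for u
  using that
 proof (induction u rule: span_induct)
  case zero
  have "\<Theta>' (H \<zero>\<^bsub>M\<^esub>) = \<Theta>' (H \<zero>\<^bsub>M\<^esub>) + \<Theta>' (H \<zero>\<^bsub>M\<^esub>)"
  using Hs[OF M.zero_closed M.zero_closed] N.\<Theta>_add[OF Hc Hc, OF M.zero_closed M.zero_closed] by simp
  then show ?case using M.zero_closed M.\<Theta>_zero klinear_0[OF k] by (intro bexI[of _ "\<zero>\<^bsub>M\<^esub>"]) auto
 next
  case (single ps c)
  have n: "ps \<in> nzlists" using single M.B_nz by blast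
  have kb: "supp (basis (gen_list ps) :: ('v, 'a) path list \<Rightarrow>\<^sub>0 'k) <= B" using B[OF single] by simp
  define y where "y = M.inv\<Theta> (basis (gen_list ps))"
  have y: "y \<in> carrier M" "\<Theta> y = basis (gen_list ps)" using M.inv\<Theta>[OF kb] y_def by simp_all
  define a where "a = qcls Q I (sgl (hd ps) c)"
  define b where "b = pcls Q I (last ps)"
  have ab: "a \<in> carrier A" "b \<in> carrier A" "nf a = sgl (hd ps) c" "nf b = basis (last ps)"
  using nzlistsD[OF n] nz_paths nf_single nf_pcls unfolding a_def b_def by simp_all
  have "\<Theta> (lact M a (ract M y b)) = sgl ps c"
  using y ab M.ract_closed basis_from_gen[of ps c] B[OF single] nzlistsD[OF n] by (simp add: M.\<Theta>_lact M.\<Theta>_ract)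
  moreover have "\<Theta>' (H (lact M a (ract M y b))) = h (\<Theta> (lact M a (ract M y b)))"
  proof -
  have "\<Theta>' (H (lact M a (ract M y b))) = lmul (nf a) (rmul (nf b) (\<Theta>' (H y)))"
  using y ab by (simp add: Ha M.ract_closed Hc N.ract_closed N.\<Theta>_lact N.\<Theta>_ract)
  also have "\<dots> = lmul (nf a) (rmul (nf b) (h (\<Theta> y)))" using g[OF y(1) single y(2)] by simp
  also have "rmul (nf b) (h (\<Theta> y)) = h (rmul (nf b) (\<Theta> y))"
  by (rule chom_mul(2)[OF h nf_keys[OF ab(2)] M.\<Theta>_keys[OF y(1)], symmetric])
  also have "rmul (nf b) (\<Theta> y) = \<Theta> (ract M y b)" using y ab by (simp add: M.\<Theta>_ract)
  also have "lmul (nf a) (h (\<Theta> (ract M y b))) = h (lmul (nf a) (\<Theta> (ract M y b)))"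
  by (rule chom_mul(1)[OF h nf_keys[OF ab(1)] M.\<Theta>_keys[OF M.ract_closed[OF ab(2) y(1)]], symmetric])
  also have "lmul (nf a) (\<Theta> (ract M y b)) = \<Theta> (lact M a (ract M y b))"
  using y ab by (simp add: M.\<Theta>_lact M.ract_closed)
  finally show ?thesis .
  qed
  ultimately show ?case using M.lact_closed[OF ab(1) M.ract_closed[OF ab(2) y(1)]] by auto
 next
  case (add u v)
  then obtain y z where yz: "y \<in> carrier M" "\<Theta> y = u" "\<Theta>' (H y) = h u" "z \<in> carrier M" "\<Theta> z = v" "\<Theta>' (H z) = h v"
  by blast
  then show ?case using M.add_closed[of y z] M.\<Theta>_add[of y z] Hs[of y z] N.\<Theta>_add[OF Hc Hc, of y z] klinear_add[OF k]
  by (intro bexI[of _ "y \<oplus>\<^bsub>M\<^esub> z"]) auto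
 qed
 from this[OF M.\<Theta>_keys[OF x]] obtain y where "y \<in> carrier M" "\<Theta> y = \<Theta> x" "\<Theta>' (H y) = h (\<Theta> x)" by blast
 then show ?thesis using M.\<Theta>_eqD[OF _ x] by blast
qed

lemma gen_list_bar: assumes "ps \<in> bar_lists n" shows "2 <= length ps \<and> gen_list ps \<in> bar_lists n"
proof -
 have "2 <= length ps" using assms by (simp add: bar_lists_def)
 then obtain p vs q where ps: "ps = p # vs @ [q]" by (rule two_ends)
 have s: "length vs = n" "set vs <= nonzero_paths Q I" "nz p" "nz q" "comp (p # vs @ [q])"
  using assms by (auto simp: ps bar_lists_def)
 have "comp (triv (target Q p) # vs @ [triv (source q)])"
  using s(5) by (cases "vs = []") (auto simp: successively_append_iff successively_Cons hd_append)
 then show ?thesis unfolding ps gen_list_simp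
  using s nz_paths target_in_verts source_in_verts by (auto simp: bar_lists_def)
qed

lemma gen_list_ap: assumes "ps \<in> ap_lists n" shows "2 <= length ps \<and> gen_list ps \<in> ap_lists n"
proof -
 obtain p w q where ps: "ps = [p, w, q]" "nz p" "w \<in> AP Q I n" "nz q" "target Q p = source w" "target Q w = source q"
  using assms unfolding ap_lists_def by blast
 then have "source w \<in> verts Q" "target Q w \<in> verts Q"
  using AP_paths source_in_verts target_in_verts by blast+
 then show ?thesis using ps by (simp add: gen_list_def ap_lists_Cons)
qed

definition nz_lists :: "nat => ('v, 'a) path list set" where
 "nz_lists l = {ps. length ps = l \<and> set ps <= nonzero_paths Q I \<and> comp ps}"

lemma bar_lists_eq: "bar_lists n = nz_lists (n + 2)" by (simp add: bar_lists_def nz_lists_def)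

lemma alg_lists_eq: "alg_lists = nz_lists 1"
proof -
 have "ps \<in> alg_lists \<longleftrightarrow> ps \<in> nz_lists 1" for ps
  by (cases ps; cases "tl ps") (auto simp: alg_lists_def nz_lists_def simp del: split_paired_Ex)
 then show ?thesis by blast
qed

lemma bar_theta_keys:
 assumes "set as <= carrier A" shows "supp (bar_theta as) <= nz_lists (length as)"
proof
 fix ps assume "ps \<in> supp (bar_theta as)"
 then have ps: "list_all2 (\<lambda>p f. p \<in> supp f) ps (map nf as)" "comp ps"
  using keys_theta[of "map nf as"] by blast+
 have "nz p" if p: "p \<in> set ps" for p
 proof -
  obtain i where i: "i < length ps" "p = ps ! i" using p by (auto simp: in_set_conv_nth)
  then have "p \<in> supp (nf (as ! i))"
  using list_all2_nthD[OF ps(1) i(1)] list_all2_lengthD[OF ps(1)] by simp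
  moreover have "as ! i \<in> carrier A"
  using assms i list_all2_lengthD[OF ps(1)] nth_mem[of i as] by auto
  ultimately show ?thesis using nf_keys by blast
 qed
 then show "ps \<in> nz_lists (length as)" using ps(2) list_all2_lengthD[OF ps(1)] by (auto simp: nz_lists_def)
qed

definition merge_gens :: "nat => ('v, 'a, 'k) alg list => ('v, 'a, 'k) alg list" where
 "merge_gens i as = take i as @ (as ! i \<otimes>\<^bsub>A\<^esub> as ! (i + 1)) # drop (i + 2) as"

lemma bar_theta_merge:
 assumes "set as <= carrier A" "i + 1 < length as"
 shows "bar_theta (merge_gens i as) = merge i (bar_theta as)" "set (merge_gens i as) <= carrier A"
  "length (merge_gens i as) = length as - 1"
proof -
 have c: "as ! i \<in> carrier A" "as ! (i + 1) \<in> carrier A" using assms nth_mem[of i as] nth_mem[of "i + 1" as] by auto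
 show "bar_theta (merge_gens i as) = merge i (bar_theta as)"
  using theta_merge[of i "map nf as"] assms(2) c by (simp add: merge_gens_def nf_mult take_map drop_map)
 show "set (merge_gens i as) <= carrier A"
  using assms c set_take_subset[of i as] set_drop_subset[of "i + 2" as] by (auto simp: merge_gens_def)
 show "length (merge_gens i as) = length as - 1" using assms(2) by (simp add: merge_gens_def)
qed

lemma klinear_merge: "klinear (merge i)" unfolding merge_def by (rule klinear_lin)

lemma merge_chom:
 assumes "i <= l" shows "chom (nz_lists (l + 2)) (merge i) (nz_lists (l + 1))"
 unfolding chom_def
proof (intro conjI ballI allI impI)
 show "klinear (merge i)" by (rule klinear_merge)
next
 fix ps assume ps: "ps \<in> nz_lists (l + 2)"
 define as where "as = map (pcls Q I) ps"
 have as: "set as <= carrier A" "length as = l + 2" using ps nz_paths by (auto simp: as_def nz_lists_def)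
 have i: "i + 1 < length as" using as assms by simp
 have "ps \<noteq> []" using ps by (auto simp: nz_lists_def)
 then have b: "basis ps = bar_theta as"
  using ps map_nf_pcls[of ps] theta_basis[of ps] unfolding as_def nz_lists_def by (simp del: map_map)
 note m = bar_theta_merge[OF as(1) i]
 show "supp (merge i (basis ps)) <= nz_lists (l + 1)"
  unfolding b m(1)[symmetric] using bar_theta_keys[OF m(2)] m(3) as by simp
 fix p assume p: "nz p"
 define a where "a = pcls Q I p"
 have a: "a \<in> carrier A" "nf a = basis p" using p nz_paths nf_pcls by (auto simp: a_def)
 have L: "lmul (nf a) (bar_theta bs) = bar_theta ((a \<otimes>\<^bsub>A\<^esub> hd bs) # tl bs)" if "set bs <= carrier A" "bs \<noteq> []" for bs
  using that a theta_lmul[of "nf a" "nf (hd bs)" "map nf (tl bs)"] by (cases bs) (simp_all add: nf_mult)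
 have R: "rmul (nf a) (bar_theta bs) = bar_theta (butlast bs @ [last bs \<otimes>\<^bsub>A\<^esub> a])" if "set bs <= carrier A" "bs \<noteq> []" for bs
  using that a theta_rmul[of "map nf (butlast bs)" "nf (last bs)" "nf a"] by (cases bs rule: rev_cases) (simp_all add: nf_mult)
 have ne: "as \<noteq> []" "merge_gens i as \<noteq> []" using as by (auto simp: merge_gens_def)
 obtain x y bs where xy: "as = x # y # bs" using as by (cases as; cases "tl as") auto
 have lc: "set ((a \<otimes>\<^bsub>A\<^esub> hd as) # tl as) <= carrier A" using as a xy by auto
 have eq: "merge_gens i ((a \<otimes>\<^bsub>A\<^esub> hd as) # tl as) = (a \<otimes>\<^bsub>A\<^esub> hd (merge_gens i as)) # tl (merge_gens i as)"
  using as(1) a unfolding xy by (cases i) (simp_all add: merge_gens_def A.m_assoc)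
 have e: "bar_theta (merge_gens i ((a \<otimes>\<^bsub>A\<^esub> hd as) # tl as)) = merge i (bar_theta ((a \<otimes>\<^bsub>A\<^esub> hd as) # tl as))"
  by (rule bar_theta_merge(1)[OF lc]) (use i xy in simp)
 show "merge i (lmul (basis p) (basis ps)) = lmul (basis p) (merge i (basis ps))"
  unfolding b m(1)[symmetric] a(2)[symmetric] L[OF as(1) ne(1)] L[OF m(2) ne(2)]
  by (rule trans[OF e[symmetric] arg_cong[OF eq, of bar_theta]])
 obtain cs z where z: "as = cs @ [z]" using ne by (cases as rule: rev_cases) auto
 have rc: "set (butlast as @ [last as \<otimes>\<^bsub>A\<^esub> a]) <= carrier A" using as a z by auto
 have eq: "merge_gens i (butlast as @ [last as \<otimes>\<^bsub>A\<^esub> a]) = butlast (merge_gens i as) @ [last (merge_gens i as) \<otimes>\<^bsub>A\<^esub> a]"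
 proof (cases "i + 1 < length cs")
  case True
  then show ?thesis unfolding z by (simp add: merge_gens_def nth_append butlast_append)
 next
  case False
  then have il: "length cs = i + 1" using i z by simp
  then obtain ds w where w: "cs = ds @ [w]" by (cases cs rule: rev_cases) auto
  have "w \<in> carrier A" "z \<in> carrier A" using as(1) z w by auto
  then show ?thesis using il a unfolding z w by (simp add: merge_gens_def nth_append butlast_append A.m_assoc)
 qed
 have e: "bar_theta (merge_gens i (butlast as @ [last as \<otimes>\<^bsub>A\<^esub> a])) = merge i (bar_theta (butlast as @ [last as \<otimes>\<^bsub>A\<^esub> a]))"
  by (rule bar_theta_merge(1)[OF rc]) (use i z in simp)
 show "merge i (rmul (basis p) (basis ps)) = rmul (basis p) (merge i (basis ps))"
  unfolding b m(1)[symmetric] a(2)[symmetric] R[OF as(1) ne(1)] R[OF m(2) ne(2)]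
  by (rule trans[OF e[symmetric] arg_cong[OF eq, of bar_theta]])
qed

definition bar_diff :: "nat => (('v, 'a) path list \<Rightarrow>\<^sub>0 'k) => (('v, 'a) path list \<Rightarrow>\<^sub>0 'k)" where
 "bar_diff n u = (\<Sum>i\<le>n. if even i then merge i u else - merge i u)"

lemma chom_uminus: "chom B h B' ==> chom B (\<lambda>u. - h u) B'"
 unfolding chom_def by (simp add: klinear_uminus keys_minus klinear_minus[OF klinear_mul(1)] klinear_minus[OF klinear_mul(2)])

lemma chom_sum:
 assumes "\<And>i. i \<in> S ==> chom B (h i) B'"
 shows "chom B (\<lambda>u. \<Sum>i\<in>S. h i u) B'"
proof -
 have "klinear (\<lambda>u. \<Sum>i\<in>S. h i u)" by (rule klinear_sum_fun) (use assms in \<open>auto simp: chom_def\<close>)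
 moreover have "supp (\<Sum>i\<in>S. h i (basis ps)) <= B'" if "ps \<in> B" for ps
  by (rule keys_sum_subset) (use assms that in \<open>auto simp: chom_def\<close>)
 ultimately show ?thesis using assms unfolding chom_def
  by (simp add: klinear_sum[OF klinear_mul(1)] klinear_sum[OF klinear_mul(2)] cong: sum.cong)
qed

lemma bar_diff_chom: "chom (nz_lists (n + 2)) (bar_diff n) (nz_lists (n + 1))"
proof -
 have "chom (nz_lists (n + 2)) (\<lambda>u. if even i then merge i u else - merge i u) (nz_lists (n + 1))" if "i \<in> {..n}" for i
  using merge_chom[of i n] chom_uminus[OF merge_chom[of i n]] that by (cases "even i") simp_all
 from chom_sum[OF this] show ?thesis unfolding bar_diff_def[abs_def] .
qed

end

section \<open>Translation of positions and extension from generators\<close>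

definition shift_occ :: "nat => occ => occ" where
 "shift_occ i w = (i + fst w, i + snd w)"

lemma shift_occ_simps [simp]: "fst (shift_occ i w) = i + fst w" "snd (shift_occ i w) = i + snd w"
 by (simp_all add: shift_occ_def)

lemma inj_shift_occ: "inj_on (shift_occ i) W"
 by (auto simp: inj_on_def shift_occ_def prod_eq_iff)

lemma sum_shift_occ: "(\<Sum>\<zeta>\<in>shift_occ i ` W. \<tau> \<zeta>) = (\<Sum>\<zeta>\<in>W. \<tau> (shift_occ i \<zeta>))"
 using sum.reindex[OF inj_shift_occ[of i W], of \<tau>] by (simp add: o_def)

lemma ap_inside_shift:
 assumes "zero_intervals z" "zero_intervals z'"
  and s: "\<And>a b. a <= N ==> b <= N ==> z a b = z' (i + a) (i + b)" and b: "b <= N"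
 shows "ap_inside z' n (i + a) (i + b) = shift_occ i ` ap_inside z n a b"
proof (rule Set.set_eqI)
 interpret z: zero_intervals z by fact
 interpret z': zero_intervals z' by fact
 note ap_iff = ap_intervals_shift[OF assms(1,2) s]
 fix w show "w \<in> ap_inside z' n (i + a) (i + b) \<longleftrightarrow> w \<in> shift_occ i ` ap_inside z n a b"
 proof
  assume "w \<in> ap_inside z' n (i + a) (i + b)"
  then obtain s t where w: "w = (s, t)" "(s, t) \<in> ap_intervals z' n" "i + a <= s" "t <= i + b"
  unfolding ap_inside_def by blast
  have "s <= t" using w(2) z'.ap_le by blast
  then have "(i + (s - i), i + (t - i)) = (s, t)" using w by auto
  moreover have "t - i <= N" using w b by simp
  ultimately have "(s - i, t - i) \<in> ap_intervals z n" using w(2) ap_iff[where i = "s - i" and j = "t - i" and n = n] by simp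
  then have "(s - i, t - i) \<in> ap_inside z n a b" using w \<open>s <= t\<close> by (auto simp: ap_inside_def)
  moreover have "w = shift_occ i (s - i, t - i)" using w \<open>s <= t\<close> by (simp add: shift_occ_def)
  ultimately show "w \<in> shift_occ i ` ap_inside z n a b" by blast
 next
  assume "w \<in> shift_occ i ` ap_inside z n a b"
  then obtain s t where w: "w = (i + s, i + t)" "(s, t) \<in> ap_intervals z n" "a <= s" "t <= b"
  unfolding ap_inside_def by (auto simp: shift_occ_def)
  then have "(i + s, i + t) \<in> ap_intervals z' n" using ap_iff[where i = s and j = t and n = n] b by simp
  then show "w \<in> ap_inside z' n (i + a) (i + b)" using w by (simp add: ap_inside_def)
 qed
qed

lemma boundary_sum_shift:
 assumes "zero_intervals z" "zero_intervals z'"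
  and "\<And>a b. a <= N ==> b <= N ==> z a b = z' (i + a) (i + b)" and "b <= N"
 shows "boundary_sum z' \<tau> n (i + a, i + b) = boundary_sum z (\<lambda>\<zeta>. \<tau> (shift_occ i \<zeta>)) n (a, b)"
proof -
 have 1: "ap_inside z' (n - 1) (i + a) (i + b) = shift_occ i ` ap_inside z (n - 1) a b"
  by (rule ap_inside_shift[OF assms])
 have 2: "{\<zeta> \<in> shift_occ i ` W. snd \<zeta> = i + b} = shift_occ i ` {\<zeta> \<in> W. snd \<zeta> = b}"
  "{\<zeta> \<in> shift_occ i ` W. fst \<zeta> = i + a} = shift_occ i ` {\<zeta> \<in> W. fst \<zeta> = a}" for W
  by (auto simp: shift_occ_def)
 show ?thesis unfolding boundary_sum_def fst_conv snd_conv 1 2 sum_shift_occ ..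
qed

lemma cut_sum_shift:
 assumes "zero_intervals z" "zero_intervals z'"
  and s: "\<And>a b. a <= N ==> b <= N ==> z a b = z' (i + a) (i + b)" and y: "\<And>k. k <= n ==> y k <= N"
 shows "cut_sum z' \<tau> n (\<lambda>k. i + y k) = cut_sum z (\<lambda>\<zeta>. \<tau> (shift_occ i \<zeta>)) n y"
proof -
 have 1: "ap_inside z' n (i + y 0) (i + y n) = shift_occ i ` ap_inside z n (y 0) (y n)"
  by (rule ap_inside_shift[OF assms(1-3)]) (use y in auto)
 have 2: "leftmost (shift_occ i ` W) = shift_occ i ` leftmost W"
  "{w \<in> shift_occ i ` W. fst w < i + c} = shift_occ i ` {w \<in> W. fst w < c}" for W c
  by (auto simp: leftmost_def)
 have 3: "selected z' n (\<lambda>k. i + y k) = shift_occ i ` selected z n y"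
  unfolding selected_def 1 2 by simp
 have 4: "cuts_good z' n (\<lambda>k. i + y k) = cuts_good z n y"
  unfolding cuts_good_def by (intro arg_cong2[where f = "(\<and>)"] all_cong1 imp_cong refl)
  (subst s; use y in simp)+
 show ?thesis unfolding cut_sum_def 3 4 sum_shift_occ ..
qed

lemma boundary_sum_linear:
 assumes "klinear h" shows "h (boundary_sum z \<tau> n w) = boundary_sum z (\<lambda>\<zeta>. h (\<tau> \<zeta>)) n w"
 by (simp add: boundary_sum_def klinear_sum[OF assms] klinear_diff[OF assms])

lemma cut_sum_linear:
 assumes "klinear h" shows "h (cut_sum z \<tau> n y) = cut_sum z (\<lambda>\<zeta>. h (\<tau> \<zeta>)) n y"
 by (simp add: cut_sum_def klinear_sum[OF assms] klinear_0[OF assms])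

lemma boundary_sum_cong:
 assumes "\<And>\<zeta>. \<zeta> \<in> ap_inside z (n - 1) (fst w) (snd w) ==> \<tau> \<zeta> = \<tau>' \<zeta>"
 shows "boundary_sum z \<tau> n w = boundary_sum z \<tau>' n w"
proof -
 have "sum \<tau> W = sum \<tau>' W" if "W <= ap_inside z (n - 1) (fst w) (snd w)" for W
  by (rule sum.cong[OF refl]) (use assms that in blast)
 note eqs = this[OF order_refl] this[of "{\<zeta> \<in> ap_inside z (n - 1) (fst w) (snd w). P \<zeta>}" for P, OF Collect_restrict]
 show ?thesis unfolding boundary_sum_def eqs ..
qed

lemma selected_inside: "selected z n y <= ap_inside z n (y 0) (y n)"
 by (auto simp: selected_def leftmost_def)

lemma cut_sum_cong:
 assumes "\<And>\<zeta>. \<zeta> \<in> ap_inside z n (y 0) (y n) ==> \<tau> \<zeta> = \<tau>' \<zeta>"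
 shows "cut_sum z \<tau> n y = cut_sum z \<tau>' n y"
proof -
 have "sum \<tau> (selected z n y) = sum \<tau>' (selected z n y)"
  by (rule sum.cong[OF refl]) (use assms selected_inside[of z n y] in blast)
 then show ?thesis unfolding cut_sum_def by simp
qed

lemma keys_boundary_sum:
 assumes "\<And>\<zeta>. \<zeta> \<in> ap_inside z (n - 1) (fst w) (snd w) ==> supp (\<tau> \<zeta>) <= B"
 shows "supp (boundary_sum z \<tau> n w) <= B"
proof -
 have k: "supp (sum \<tau> W) <= B" if "W <= ap_inside z (n - 1) (fst w) (snd w)" for W
  by (rule keys_sum_subset) (use assms that in blast)
 have d: "supp (f - g) <= B" if "supp f <= B" "supp g <= B" for f g
  using Poly_Mapping.keys_diff[of f g] that by blast
 show ?thesis unfolding boundary_sum_def by (simp add: k d)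
qed

lemma keys_cut_sum:
 assumes "\<And>\<zeta>. \<zeta> \<in> ap_inside z n (y 0) (y n) ==> supp (\<tau> \<zeta>) <= B"
 shows "supp (cut_sum z \<tau> n y) <= B"
proof -
 have "supp (sum \<tau> (selected z n y)) <= B"
  by (rule keys_sum_subset) (use assms selected_inside[of z n y] in blast)
 then show ?thesis by (simp add: cut_sum_def)
qed

context monomial_algebra
begin

definition bimod_lists :: "('v, 'a) path list set => bool" where
 "bimod_lists B \<longleftrightarrow> B <= nzlists \<and> (\<forall>p u. nz p --> supp u <= B -->
  supp (lmul (basis p) u) <= B \<and> supp (rmul (basis p) u) <= B)"

lemma bimod_listsD:
 assumes "bimod_lists B"
 shows "B <= nzlists" "nz p ==> supp u <= B ==> supp (lmul (basis p) u) <= B"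
  "nz p ==> supp u <= B ==> supp (rmul (basis p) u) <= B"
 using assms unfolding bimod_lists_def by blast+

lemma model_bimod_lists:
 assumes "bimodule_model Q I M B \<Theta>" shows "bimod_lists B"
proof -
 interpret M: bimodule_model Q I M B \<Theta> by fact
 have "supp (lmul (basis p) u) <= B \<and> supp (rmul (basis p) u) <= B"
  if p: "nz p" and u: "supp u <= B" for p u
 proof -
  have a: "pcls Q I p \<in> carrier A" "nf (pcls Q I p) = basis p" using p nz_paths nf_pcls by auto
  note x = M.inv\<Theta>[OF u]
  show ?thesis
  using M.\<Theta>_keys[OF M.lact_closed[OF a(1) x(1)]] M.\<Theta>_keys[OF M.ract_closed[OF a(1) x(1)]]
  by (simp only: M.\<Theta>_lact[OF a(1) x(1)] M.\<Theta>_ract[OF a(1) x(1)] a x simp_thms)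
 qed
 then show ?thesis using M.B_nz unfolding bimod_lists_def by blast
qed

lemmas bimod_lists_bar = model_bimod_lists[OF bar_model]
lemmas bimod_lists_ap = model_bimod_lists[OF ap_model]
lemmas bimod_lists_alg = model_bimod_lists[OF alg_model]

lemma chom_mul_path:
 assumes h: "chom B h B'" and B: "bimod_lists B" "bimod_lists B'" and p: "p \<in> paths Q"
  and u: "supp u <= B"
 shows "h (lmul (basis p) u) = lmul (basis p) (h u)" "h (rmul (basis p) u) = rmul (basis p) (h u)"
proof -
 have "h (lmul (basis p) u) = lmul (basis p) (h u) \<and> h (rmul (basis p) u) = rmul (basis p) (h u)"
 proof (cases "nz p")
  case True
  then have k: "supp (basis p :: ('v, 'a) path \<Rightarrow>\<^sub>0 'k) <= nonzero_paths Q I" by simp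
  show ?thesis using chom_mul[OF h k u] by blast
 next
  case False
  then have z: "zpath p" using p by (simp add: nonzero_iff)
  have k: "supp u <= nzlists" "supp (h u) <= nzlists"
  using u chom_keys[OF h u] bimod_listsD(1)[OF B(1)] bimod_listsD(1)[OF B(2)] by blast+
  have "h 0 = 0" using h by (intro klinear_0) (simp add: chom_def)
  then show ?thesis by (simp only: lmul_zpath[OF z k(1)] lmul_zpath[OF z k(2)]
  rmul_zpath[OF z k(1)] rmul_zpath[OF z k(2)] simp_thms)
 qed
 then show "h (lmul (basis p) u) = lmul (basis p) (h u)" "h (rmul (basis p) u) = rmul (basis p) (h u)"
  by blast+
qed

lemma chom_klinear: "chom B h B' ==> klinear h" by (simp add: chom_def)

lemma chom_comp:
 assumes h: "chom B h B'" and h': "chom B' h' B''"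
 shows "chom B (\<lambda>u. h' (h u)) B''"
 unfolding chom_def
proof (intro conjI ballI allI impI)
 show "klinear (\<lambda>u. h' (h u))" by (rule klinear_comp[OF chom_klinear[OF h'] chom_klinear[OF h]])
 fix ps assume ps: "ps \<in> B"
 then have k: "supp (basis ps :: ('v, 'a) path list \<Rightarrow>\<^sub>0 'k) <= B" by simp
 note k' = chom_keys[OF h k]
 show "supp (h' (h (basis ps))) <= B''" by (rule chom_keys[OF h' k'])
 fix p assume "nz p"
 then have p: "supp (basis p :: ('v, 'a) path \<Rightarrow>\<^sub>0 'k) <= nonzero_paths Q I" by simp
 show "h' (h (lmul (basis p) (basis ps))) = lmul (basis p) (h' (h (basis ps)))"
  unfolding chom_mul(1)[OF h p k] chom_mul(1)[OF h' p k'] ..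
 show "h' (h (rmul (basis p) (basis ps))) = rmul (basis p) (h' (h (basis ps)))"
  unfolding chom_mul(2)[OF h p k] chom_mul(2)[OF h' p k'] ..
qed

lemma chom_eqI:
 assumes h: "chom B h B1" and h': "chom B h' B2" and B: "bimod_lists B"
  and g: "\<And>ps. ps \<in> B ==> 2 <= length ps \<and> gen_list ps \<in> B"
  and eq: "\<And>ps. ps \<in> B ==> h (basis (gen_list ps)) = h' (basis (gen_list ps))"
  and u: "supp u <= B"
 shows "h u = h' u"
proof (rule klinear_eqI[OF chom_klinear[OF h] chom_klinear[OF h']])
 fix ps assume "ps \<in> supp u"
 then have ps: "ps \<in> B" using u by blast
 then have n: "nz (hd ps)" "nz (last ps)" using bimod_listsD(1)[OF B] nzlistsD by blast+
 then have p: "supp (basis (hd ps) :: ('v, 'a) path \<Rightarrow>\<^sub>0 'k) <= nonzero_paths Q I"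
  "supp (basis (last ps) :: ('v, 'a) path \<Rightarrow>\<^sub>0 'k) <= nonzero_paths Q I" by simp_all
 have k: "supp (basis (gen_list ps) :: ('v, 'a) path list \<Rightarrow>\<^sub>0 'k) <= B" using g[OF ps] by simp
 note k' = bimod_listsD(3)[OF B n(2) k]
 have b: "basis ps = lmul (basis (hd ps)) (rmul (basis (last ps)) (basis (gen_list ps)))"
  by (rule basis_from_gen) (use g[OF ps] n in simp_all)
 show "h (basis ps) = h' (basis ps)"
  unfolding b chom_mul(1)[OF h p(1) k'] chom_mul(2)[OF h p(2) k] chom_mul(1)[OF h' p(1) k'] chom_mul(2)[OF h' p(2) k]
  eq[OF ps] ..
qed

text \<open>Values on a generator must start and end at the vertices of that generator, since the trivial
  paths there act as the identity on it.\<close>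

definition anchored :: "'v => 'v => ('v, 'a) path list set" where
 "anchored s t = {ps \<in> nzlists. source (hd ps) = s \<and> target Q (last ps) = t}"

lemma mul_triv:
 assumes "supp u <= anchored s t"
 shows "lmul (basis (triv s)) u = u \<and> rmul (basis (triv t)) u = u"
 using assms
proof (induction u rule: span_induct)
 case (single ps c)
 then have ps: "ps \<noteq> []" "nz (hd ps)" "nz (last ps)" "s = source (hd ps)" "t = target Q (last ps)"
  unfolding anchored_def nzlists_def by blast+
 then show ?case by (simp add: mul_single)
qed simp_all

text \<open>The equivariant extension of prescribed values on lists with trivial ends.\<close>

definition hext :: "(('v, 'a) path list => (('v, 'a) path list \<Rightarrow>\<^sub>0 'k)) =>
  (('v, 'a) path list \<Rightarrow>\<^sub>0 'k) => (('v, 'a) path list \<Rightarrow>\<^sub>0 'k)" where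
 "hext g = lin (\<lambda>ps. lmul (basis (hd ps)) (rmul (basis (last ps)) (g (gen_list ps))))"

lemma hext_basis: "hext g (basis ps) = lmul (basis (hd ps)) (rmul (basis (last ps)) (g (gen_list ps)))"
 by (simp add: hext_def)

lemma gen_list_gen_list: "2 <= length ps ==> gen_list (gen_list ps) = gen_list ps"
 by (erule two_ends) (simp add: gen_list_simp)

lemma hext_gen:
 assumes "2 <= length ps" "supp (g (gen_list ps)) <= anchored (target Q (hd ps)) (source (last ps))"
 shows "hext g (basis (gen_list ps)) = g (gen_list ps)"
 using mul_triv[OF assms(2)] gen_list_gen_list[OF assms(1)] unfolding hext_basis
 by (simp add: gen_list_def)

text \<open>Associativity of the path product gives equivariance; a product of outer paths that falls into \<open>I\<close> acts as
  zero on both sides.\<close>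

lemma hext_chom:
 assumes B: "\<And>ps. ps \<in> B ==> 2 <= length ps \<and> nz (hd ps) \<and> nz (last ps)" and B': "bimod_lists B'"
  and g: "\<And>ps. ps \<in> B ==> supp (g (gen_list ps)) <= B'"
 shows "chom B (hext g) B'"
 unfolding chom_def
proof (intro conjI ballI allI impI)
 show "klinear (hext g)" unfolding hext_def by (rule klinear_lin)
 fix ps assume ps: "ps \<in> B"
 have "2 <= length ps" using B[OF ps] by blast
 then obtain x vs y where xy: "ps = x # vs @ [y]" by (rule two_ends)
 have n: "nz x" "nz y" using B[OF ps] xy by auto
 define G where "G = g (gen_list ps)"
 have G: "supp G <= B'" using g[OF ps] G_def by simp
 have k: "supp (rmul (basis y) G) <= B'" by (rule bimod_listsD(3)[OF B' n(2) G])
 have v: "hext g (basis ps) = lmul (basis x) (rmul (basis y) G)" by (simp add: hext_basis G_def xy)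
 show "supp (hext g (basis ps)) <= B'" unfolding v by (rule bimod_listsD(2)[OF B' n(1) k])
 fix p assume p: "nz p"
 have nz: "supp G <= nzlists" "supp (rmul (basis y) G) <= nzlists"
  "supp (lmul (basis x) (rmul (basis y) G)) <= nzlists"
  using G k bimod_listsD(1)[OF B'] bimod_listsD(2)[OF B' n(1) k] by blast+
 have P: "supp (basis q :: ('v, 'a) path \<Rightarrow>\<^sub>0 'k) <= paths Q" if "nz q" for q
  using that nz_paths by simp
 have l: "lmul (basis p) (hext g (basis ps)) =
  lmul (path_times Q (basis p) (basis x)) (rmul (basis y) G)"
  unfolding v by (rule lmul_lmul[OF P[OF p] P[OF n(1)] nz(2)])
 have r: "rmul (basis p) (hext g (basis ps)) =
  lmul (basis x) (rmul (path_times Q (basis y) (basis p)) G)"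
  unfolding v lmul_rmul[OF P[OF n(1)] P[OF p] nz(2), symmetric] rmul_rmul[OF P[OF p] P[OF n(2)] nz(1)] ..
 have h0: "hext g 0 = 0" by (simp add: hext_def)
 show "hext g (lmul (basis p) (basis ps)) = lmul (basis p) (hext g (basis ps))"
 proof (cases "target Q p = source x")
  case True
  then have c: "pcat p x \<in> paths Q" using p n pcat_in_paths nz_paths by blast
  have t: "path_times Q (basis p) (basis x) = (basis (pcat p x) :: ('v, 'a) path \<Rightarrow>\<^sub>0 'k)"
  using True by (simp add: path_times_single)
  show ?thesis
  proof (cases "nz (pcat p x)")
  case nzp: True
  have "gen_list (pcat p x # vs @ [y]) = gen_list ps"
  using True by (simp add: xy gen_list_simp target_pcat)
  then show ?thesis unfolding l t using True nzp
  by (simp add: xy mul_single hext_basis G_def)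
  next
  case False
  then have z: "zpath (pcat p x)" using c by (simp add: nonzero_iff)
  show ?thesis unfolding l t lmul_zpath[OF z nz(2)] using False h0 by (simp add: xy mul_single)
  qed
 next
  case False
  then show ?thesis unfolding l using h0 by (simp add: xy mul_single path_times_single)
 qed
 show "hext g (rmul (basis p) (basis ps)) = rmul (basis p) (hext g (basis ps))"
 proof (cases "target Q y = source p")
  case True
  then have c: "pcat y p \<in> paths Q" using p n pcat_in_paths nz_paths by blast
  have t: "path_times Q (basis y) (basis p) = (basis (pcat y p) :: ('v, 'a) path \<Rightarrow>\<^sub>0 'k)"
  using True by (simp add: path_times_single)
  show ?thesis
  proof (cases "nz (pcat y p)")
  case nzp: True
  have "gen_list (x # vs @ [pcat y p]) = gen_list ps"
  by (simp add: xy gen_list_simp)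
  then show ?thesis unfolding r t using True nzp
  by (simp add: xy mul_single hext_basis G_def butlast_append)
  next
  case False
  then have z: "zpath (pcat y p)" using c by (simp add: nonzero_iff)
  show ?thesis unfolding r t rmul_zpath[OF z nz(1)] using False h0 by (simp add: xy mul_single)
  qed
 next
  case False
  then show ?thesis unfolding r using h0 by (simp add: xy mul_single path_times_single)
 qed
qed

end

section \<open>Bardzell's differential and the map G in coordinates\<close>

context monomial_algebra
begin

text \<open>The coordinates of \<open>L(\<zeta>) \<otimes> \<zeta> \<otimes> R(\<zeta>)\<close> for an occurrence in \<open>T\<close>; it vanishes if an outer part lies in \<open>I\<close>.\<close>

definition tri :: "('v, 'a) path => occ => (('v, 'a) path list \<Rightarrow>\<^sub>0 'k)" where
 "tri T w = (if nz (lpart Q T w) \<and> nz (rpart Q T w)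
  then basis [lpart Q T w, pseg Q T w, rpart Q T w] else 0)"

lemma tri_eq: "tri T (i, j) = (if nz (pseg Q T (0, i)) \<and> nz (pseg Q T (j, plength T))
  then basis [pseg Q T (0, i), pseg Q T (i, j), pseg Q T (j, plength T)] else 0)"
 by (simp add: tri_def lpart_eq rpart_eq)

lemma nz_pseg: "T \<in> paths Q ==> i <= j ==> j <= plength T ==> nz (pseg Q T (i, j)) \<longleftrightarrow> \<not> zint T i j"
 using pseg_in_paths by (simp add: nonzero_iff zint_iff)

lemma zint_ap_le: "(i, j) \<in> ap_intervals (zint T) n ==> i <= j"
 by (rule zint.ap_le)

lemma ap_insideD:
 assumes "(i, j) \<in> ap_inside (zint T) n a b"
 shows "i <= j" "a <= i" "j <= b" "(i, j) \<in> ap_intervals (zint T) n"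
proof -
 show "a <= i" "j <= b" "(i, j) \<in> ap_intervals (zint T) n" using assms by (simp_all add: ap_inside_def)
 then show "i <= j" by (intro zint_ap_le)
qed

lemma tri_keys:
 assumes T: "T \<in> paths Q" and w: "(i, j) \<in> ap_inside (zint T) n 0 (plength T)"
 shows "supp (tri T (i, j)) <= ap_lists n \<inter> anchored (source T) (target Q T)"
proof -
 have ij: "i <= j" "j <= plength T" "(i, j) \<in> ap_intervals (zint T) n" using ap_insideD[OF w] by blast+
 then have "pseg Q T (i, j) \<in> AP Q I n" using pseg_AP_iff[OF T ij(1,2)] by simp
 then show ?thesis using ij
  by (auto simp: tri_eq ap_lists_Cons anchored_def nzlists_def target_pseg simp del: split_paired_Ex)
qed

lemma tri_whole:
 assumes "w \<in> paths Q"
 shows "tri w (0, plength w) = basis [triv (source w), w, triv (target Q w)]"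
 using assms source_in_verts[OF assms] target_in_verts[OF assms] by (simp add: tri_eq)

context
 fixes T i j
 assumes T: "T \<in> paths Q" and ij: "i <= j" "j <= plength T"
begin

text \<open>An occurrence in a segment of \<open>T\<close> is an occurrence in \<open>T\<close>, and its outer parts are completed by those of the
  segment. Through this, formulas on a generator become formulas on every path \<open>T\<close> around it.\<close>

lemma tri_seg:
 assumes ab: "a <= b" "b <= j - i"
 shows "lmul (basis (pseg Q T (0, i))) (rmul (basis (pseg Q T (j, plength T))) (tri (pseg Q T (i, j)) (a, b))) =
  tri T (i + a, i + b)"
proof -
 let ?L = "pseg Q T (0, i)" and ?R = "pseg Q T (j, plength T)" and ?w = "pseg Q T (i, j)"
 let ?l = "pseg Q T (i, i + a)" and ?r = "pseg Q T (i + b, j)" and ?m = "pseg Q T (i + a, i + b)"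
 have s: "pseg Q ?w (0, a) = ?l" "pseg Q ?w (b, plength ?w) = ?r" "pseg Q ?w (a, b) = ?m"
  using ab ij pseg_pseg[of i j T 0 a Q] pseg_pseg[of i j T b "j - i" Q] pseg_pseg[of i j T a b Q] by simp_all
 have c: "pcat ?L ?l = pseg Q T (0, i + a)" "pcat ?r ?R = pseg Q T (i + b, plength T)"
  using ab ij pcat_pseg[of 0 i "i + a" Q T] pcat_pseg[of "i + b" j "plength T" Q T] by simp_all
 have t: "target Q ?L = source ?l" "target Q ?r = source ?R" using ab ij by (simp_all add: target_pseg)
 have p: "?L \<in> paths Q" "?l \<in> paths Q" "?r \<in> paths Q" "?R \<in> paths Q"
  using T ab ij by (simp_all add: pseg_in_paths)
 have w: "tri ?w (a, b) = (if nz ?l \<and> nz ?r then basis [?l, ?m, ?r] else 0)" unfolding tri_eq s ..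
 have n: "nz (pcat ?L ?l) ==> nz ?l" "nz (pcat ?r ?R) ==> nz ?r"
  using nz_pcatD p t by blast+
 show ?thesis
 proof (cases "nz ?l \<and> nz ?r")
  case False
  then have "\<not> (nz (pcat ?L ?l) \<and> nz (pcat ?r ?R))" using n by blast
  then show ?thesis unfolding w using False by (auto simp: tri_eq c)
 next
  case True
  then have "lmul (basis ?L) (rmul (basis ?R) (tri ?w (a, b))) =
  (if nz (pcat ?L ?l) \<and> nz (pcat ?r ?R) then basis [pcat ?L ?l, ?m, pcat ?r ?R] else 0)"
  unfolding w using t by (simp add: mul_single)
  then show ?thesis unfolding tri_eq c .
 qed
qed

lemma klinear_sides:
 "klinear (\<lambda>u. lmul (basis (pseg Q T (0, i))) (rmul (basis (pseg Q T (j, plength T))) u))"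
 by (rule klinear_comp[OF klinear_mul(1) klinear_mul(2)])

lemma zint_seg: "a <= j - i ==> b <= j - i ==> zint (pseg Q T (i, j)) a b = zint T (i + a) (i + b)"
 using zint_pseg[OF T ij] .

lemma tri_seg_inside:
 assumes "\<zeta> \<in> ap_inside (zint (pseg Q T (i, j))) n a b" "b <= j - i"
 shows "lmul (basis (pseg Q T (0, i))) (rmul (basis (pseg Q T (j, plength T))) (tri (pseg Q T (i, j)) \<zeta>)) =
  tri T (shift_occ i \<zeta>)"
proof -
 obtain s t where \<zeta>: "\<zeta> = (s, t)" by (cases \<zeta>)
 have "s <= t" "t <= j - i" using ap_insideD[OF assms(1)[unfolded \<zeta>]] assms(2) by linarith+
 then show ?thesis unfolding \<zeta> shift_occ_def fst_conv snd_conv by (rule tri_seg)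
qed

lemma boundary_sum_seg:
 assumes "b <= j - i"
 shows "lmul (basis (pseg Q T (0, i))) (rmul (basis (pseg Q T (j, plength T)))
  (boundary_sum (zint (pseg Q T (i, j))) (tri (pseg Q T (i, j))) n (a, b))) =
  boundary_sum (zint T) (tri T) n (i + a, i + b)"
proof -
 have e: "boundary_sum (zint T) (tri T) n (i + a, i + b) = boundary_sum (zint (pseg Q T (i, j))) (\<lambda>\<zeta>. tri T (shift_occ i \<zeta>)) n (a, b)"
  by (rule boundary_sum_shift[where N = "j - i", OF zint.zero_intervals_axioms zint.zero_intervals_axioms _ assms])
  (erule (1) zint_seg)
 show ?thesis unfolding boundary_sum_linear[OF klinear_sides] e
  by (rule boundary_sum_cong) (rule tri_seg_inside, assumption, use assms in simp)
qed

lemma cut_sum_seg: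
 assumes "\<And>k. k <= n ==> y k <= j - i"
 shows "lmul (basis (pseg Q T (0, i))) (rmul (basis (pseg Q T (j, plength T)))
  (cut_sum (zint (pseg Q T (i, j))) (tri (pseg Q T (i, j))) n y)) =
  cut_sum (zint T) (tri T) n (\<lambda>k. i + y k)"
proof -
 have e: "cut_sum (zint T) (tri T) n (\<lambda>k. i + y k) = cut_sum (zint (pseg Q T (i, j))) (\<lambda>\<zeta>. tri T (shift_occ i \<zeta>)) n y"
  by (rule cut_sum_shift[where N = "j - i", OF zint.zero_intervals_axioms zint.zero_intervals_axioms _ assms])
  (erule (1) zint_seg)
 show ?thesis unfolding cut_sum_linear[OF klinear_sides] e
  by (rule cut_sum_cong) (rule tri_seg_inside, assumption, use assms in simp)
qed

end

definition ap_gen_diff :: "nat => ('v, 'a) path list => (('v, 'a) path list \<Rightarrow>\<^sub>0 'k)" where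
 "ap_gen_diff n gs = boundary_sum (zint (gs ! 1)) (tri (gs ! 1)) n (0, plength (gs ! 1))"

definition ap_diff :: "nat => (('v, 'a) path list \<Rightarrow>\<^sub>0 'k) => (('v, 'a) path list \<Rightarrow>\<^sub>0 'k)" where
 "ap_diff n = hext (ap_gen_diff n)"

lemma ap_listsE:
 assumes "ps \<in> ap_lists n"
 obtains p w q where "ps = [p, w, q]" "nz p" "w \<in> AP Q I n" "w \<in> paths Q" "nz q" "target Q p = source w"
  "target Q w = source q" "gen_list ps = [triv (source w), w, triv (target Q w)]"
proof -
 obtain p w q where ps: "ps = [p, w, q]" "nz p" "w \<in> AP Q I n" "nz q" "target Q p = source w" "target Q w = source q"
  using assms unfolding ap_lists_def by blast
 then have "w \<in> paths Q" "gen_list ps = [triv (source w), w, triv (target Q w)]"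
  using AP_paths by (auto simp: gen_list_def)
 then show ?thesis using that ps by blast
qed

lemma ap_listsD: assumes "ps \<in> ap_lists n" shows "2 <= length ps \<and> nz (hd ps) \<and> nz (last ps)"
 using assms by (rule ap_listsE) simp

lemma keys_ap_gen_diff:
 assumes "ps \<in> ap_lists n"
 shows "supp (ap_gen_diff n (gen_list ps)) \<subseteq>
  ap_lists (n - 1) \<inter> anchored (target Q (hd ps)) (source (last ps))"
proof -
 obtain p w q where ps: "ps = [p, w, q]" "w \<in> paths Q" "target Q p = source w" "target Q w = source q"
  "gen_list ps = [triv (source w), w, triv (target Q w)]" using assms by (rule ap_listsE)
 have "supp (tri w \<zeta>) <= ap_lists (n - 1) \<inter> anchored (source w) (target Q w)"
  if "\<zeta> \<in> ap_inside (zint w) (n - 1) 0 (plength w)" for \<zeta>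
  using tri_keys[OF ps(2), of "fst \<zeta>" "snd \<zeta>"] that by simp
 then have "supp (boundary_sum (zint w) (tri w) n (0, plength w)) \<subseteq>
  ap_lists (n - 1) \<inter> anchored (source w) (target Q w)"
  by (intro keys_boundary_sum) simp
 then show ?thesis unfolding ap_gen_diff_def ps(5) by (simp add: ps(1) ps(3) ps(4))
qed

lemma ap_diff_chom: "chom (ap_lists n) (ap_diff n) (ap_lists (n - 1))"
 unfolding ap_diff_def by (rule hext_chom[OF ap_listsD bimod_lists_ap]) (use keys_ap_gen_diff in blast)+

lemma ap_diff_gen:
 assumes "ps \<in> ap_lists n" shows "ap_diff n (basis (gen_list ps)) = ap_gen_diff n (gen_list ps)"
 unfolding ap_diff_def by (rule hext_gen) (use ap_listsD[OF assms] keys_ap_gen_diff[OF assms] in blast)+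

lemma whole_ap_list:
 assumes "w \<in> AP Q I n"
 shows "[triv (source w), w, triv (target Q w)] \<in> ap_lists n"
  "gen_list [triv (source w), w, triv (target Q w)] = [triv (source w), w, triv (target Q w)]"
 using assms AP_paths[OF assms] source_in_verts target_in_verts by (simp_all add: ap_lists_Cons gen_list_def)

lemma ap_diff_whole:
 assumes "w \<in> AP Q I n"
 shows "ap_diff n (tri w (0, plength w)) = boundary_sum (zint w) (tri w) n (0, plength w)"
 using ap_diff_gen[OF whole_ap_list(1)[OF assms]]
 unfolding whole_ap_list(2)[OF assms] tri_whole[OF AP_paths[OF assms]] by (simp add: ap_gen_diff_def)

lemma ap_diff_tri:
 assumes T: "T \<in> paths Q" and w: "(i, j) \<in> ap_inside (zint T) n 0 (plength T)"
 shows "ap_diff n (tri T (i, j)) = boundary_sum (zint T) (tri T) n (i, j)"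
proof -
 have ij: "i <= j" "j <= plength T" "(i, j) \<in> ap_intervals (zint T) n" using ap_insideD[OF w] by blast+
 let ?w = "pseg Q T (i, j)"
 have A: "?w \<in> AP Q I n" using pseg_AP_iff[OF T ij(1,2)] ij by simp
 have l: "plength ?w = j - i" using ij by simp
 have k: "supp (tri ?w (0, j - i)) <= ap_lists n"
  using whole_ap_list(1)[OF A] tri_whole[OF AP_paths[OF A]] unfolding l by simp
 have pL: "pseg Q T (0, i) \<in> paths Q" and pR: "pseg Q T (j, plength T) \<in> paths Q"
  using T ij by (simp_all add: pseg_in_paths)
 have k': "supp (rmul (basis (pseg Q T (j, plength T))) (tri ?w (0, j - i))) <= ap_lists n"
 proof (cases "nz (pseg Q T (j, plength T))")
  case True
  then show ?thesis by (rule bimod_listsD(3)[OF bimod_lists_ap _ k])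
 next
  case False
  then have "zpath (pseg Q T (j, plength T))" using pR by (simp add: nonzero_iff)
  from rmul_zpath[OF this] k bimod_listsD(1)[OF bimod_lists_ap] show ?thesis by fastforce
 qed
 have "tri T (i, j) = lmul (basis (pseg Q T (0, i))) (rmul (basis (pseg Q T (j, plength T))) (tri ?w (0, j - i)))"
  using tri_seg[OF T ij(1,2), of 0 "j - i"] ij by simp
 then have "ap_diff n (tri T (i, j)) =
  lmul (basis (pseg Q T (0, i))) (rmul (basis (pseg Q T (j, plength T))) (ap_diff n (tri ?w (0, j - i))))"
  using chom_mul_path(1)[OF ap_diff_chom bimod_lists_ap bimod_lists_ap pL k']
  chom_mul_path(2)[OF ap_diff_chom bimod_lists_ap bimod_lists_ap pR k] by simp
 also have "ap_diff n (tri ?w (0, j - i)) = boundary_sum (zint ?w) (tri ?w) n (0, j - i)"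
  using ap_diff_whole[OF A] unfolding l .
 also have "lmul (basis (pseg Q T (0, i))) (rmul (basis (pseg Q T (j, plength T))) \<dots>) =
  boundary_sum (zint T) (tri T) n (i, j)"
  using boundary_sum_seg[OF T ij(1,2), of "j - i" n 0] ij by simp
 finally show ?thesis .
qed

definition pos :: "('v, 'a) path list => nat => nat" where
 "pos ps k = sum_list (map plength (take k ps))"

lemma pconcat_Cons: "ps \<noteq> [] ==> pconcat (p # ps) = pcat p (pconcat ps)"
 by (simp add: pconcat_def pcat_def)

lemma pconcat_single: "pconcat [p] = p" by (simp add: pconcat_def)

lemma source_pconcat: "ps \<noteq> [] ==> source (pconcat ps) = source (hd ps)"
 by (simp add: pconcat_def source_def)

lemma pos_0 [simp]: "pos ps 0 = 0" and pos_Suc [simp]: "pos (p # ps) (Suc k) = plength p + pos ps k"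
 and pos_Nil [simp]: "pos [] k = 0"
 by (simp_all add: pos_def)

lemma plength_pconcat: "plength (pconcat ps) = sum_list (map plength ps)"
 by (simp add: pconcat_def plength_def length_concat o_def plength_def[abs_def])

lemma pos_length: "length ps <= k ==> pos ps k = plength (pconcat ps)"
 by (simp add: pos_def plength_pconcat)

lemma pos_mono: "k <= l ==> pos ps k <= pos ps l"
proof (induction ps arbitrary: k l)
 case (Cons p ps)
 then show ?case by (cases k; cases l) simp_all
qed simp

lemma pos_le: "pos ps k <= plength (pconcat ps)"
 using pos_mono[of k "max k (length ps)" ps] pos_length[of ps "max k (length ps)"] by simp

lemma pconcat_path:
 assumes "ps \<noteq> []" "set ps <= paths Q" "comp ps"
 shows "pconcat ps \<in> paths Q \<and> target Q (pconcat ps) = target Q (last ps)"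
 using assms
proof (induction ps)
 case (Cons p ps)
 show ?case
 proof (cases "ps = []")
  case True
  then show ?thesis using Cons.prems by (simp add: pconcat_single)
 next
  case False
  then have "target Q p = source (hd ps) \<and> comp ps" using Cons.prems(3) by (cases ps) simp_all
  then have "target Q p = source (pconcat ps)" "comp ps" using source_pconcat[OF False] by simp_all
  then show ?thesis using Cons False by (simp add: pconcat_Cons pcat_in_paths target_pcat)
 qed
qed simp

lemma pconcat_seg:
 assumes "set ps <= paths Q" "comp ps" "k < length ps"
 shows "pseg Q (pconcat ps) (pos ps k, pos ps (Suc k)) = ps ! k"
 using assms
proof (induction ps arbitrary: k)
 case (Cons p ps)
 show ?case
 proof (cases "ps = []")
  case True
  then show ?thesis using Cons.prems by (simp add: pconcat_single)
 next
  case False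
  then have "target Q p = source (hd ps) \<and> comp ps" using Cons.prems(2) by (cases ps) simp_all
  then have t: "target Q p = source (pconcat ps)" "comp ps" using source_pconcat[OF False] by simp_all
  show ?thesis
  proof (cases k)
  case 0
  then show ?thesis using False pseg_pcat_left[of "plength p" p 0 Q "pconcat ps"] by (simp add: pconcat_Cons)
  next
  case (Suc l)
  then show ?thesis using Cons.IH[of l] Cons.prems t False pseg_pcat_right[OF t(1), of "pos ps l" "pos ps (Suc l)"]
  by (simp add: pconcat_Cons)
  qed
 qed
qed simp

definition bar_gen_ap :: "nat => ('v, 'a) path list => (('v, 'a) path list \<Rightarrow>\<^sub>0 'k)" where
 "bar_gen_ap n gs = cut_sum (zint (pconcat gs)) (tri (pconcat gs)) n (\<lambda>k. pos gs (Suc k))"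

definition bar_to_ap :: "nat => (('v, 'a) path list \<Rightarrow>\<^sub>0 'k) => (('v, 'a) path list \<Rightarrow>\<^sub>0 'k)" where
 "bar_to_ap n = hext (bar_gen_ap n)"

lemma bar_listsD: assumes "ps \<in> bar_lists n"
 shows "2 <= length ps \<and> nz (hd ps) \<and> nz (last ps)" "length ps = n + 2" "set ps <= paths Q" "comp ps" "ps \<noteq> []"
  "pconcat ps \<in> paths Q" "set ps <= nonzero_paths Q I"
proof -
 show l: "length ps = n + 2" "comp ps" "set ps <= nonzero_paths Q I" using assms by (simp_all add: bar_lists_def)
 show n: "ps \<noteq> []" using l by auto
 show "2 <= length ps \<and> nz (hd ps) \<and> nz (last ps)" using l n hd_in_set last_in_set by force
 show p: "set ps <= paths Q" using l nz_paths by blast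
 show "pconcat ps \<in> paths Q" using pconcat_path[OF n p l(2)] by blast
qed

lemma keys_bar_gen_ap:
 assumes "ps \<in> bar_lists n"
 shows "supp (bar_gen_ap n (gen_list ps)) \<subseteq>
  ap_lists n \<inter> anchored (target Q (hd ps)) (source (last ps))"
proof -
 let ?g = "gen_list ps" and ?T = "pconcat (gen_list ps)"
 have g: "?g \<in> bar_lists n" using gen_list_bar[OF assms] by blast
 note gD = bar_listsD[OF g]
 have st: "source ?T = target Q (hd ps)" "target Q ?T = source (last ps)"
  using source_pconcat[OF gD(5)] pconcat_path[OF gD(5,3,4)] by (simp_all add: gen_list_def)
 have "supp (tri ?T \<zeta>) <= ap_lists n \<inter> anchored (source ?T) (target Q ?T)"
  if "\<zeta> \<in> ap_inside (zint ?T) n (pos ?g (Suc 0)) (pos ?g (Suc n))" for \<zeta>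
 proof -
  have "\<zeta> \<in> ap_inside (zint ?T) n 0 (plength ?T)"
  using that pos_le[of ?g "Suc n"] by (auto simp: ap_inside_def)
  then show ?thesis using tri_keys[OF gD(6), of "fst \<zeta>" "snd \<zeta>"] by simp
 qed
 then show ?thesis unfolding bar_gen_ap_def st[symmetric] by (rule keys_cut_sum)
qed

lemma bar_to_ap_chom: "chom (bar_lists n) (bar_to_ap n) (ap_lists n)"
 unfolding bar_to_ap_def by (rule hext_chom[OF bar_listsD(1) bimod_lists_ap]) (use keys_bar_gen_ap in blast)+

text \<open>The defining formula of \<open>G\<close> on generators holds for all lists if positions are taken on the product of the
  whole list, the outer paths included.\<close>

lemma bar_to_ap_basis:
 assumes "ps \<in> bar_lists n"
 shows "bar_to_ap n (basis ps) = cut_sum (zint (pconcat ps)) (tri (pconcat ps)) n (\<lambda>k. pos ps (Suc k))"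
proof -
 note D = bar_listsD[OF assms]
 have "2 <= length ps" using D by blast
 then obtain p vs q where ps: "ps = p # vs @ [q]" by (rule two_ends)
 let ?T = "pconcat ps" and ?g = "gen_list ps"
 have vs: "length vs = n" using D(2) ps by simp
 define i j where "i = plength p" and "j = i + sum_list (map plength vs)"
 have T: "?T = pcat p (pcat (pconcat ?g) q)" unfolding ps gen_list_simp by (simp add: pconcat_def pcat_def triv_def)
 have g: "?g \<in> bar_lists n" using gen_list_bar[OF assms] by blast
 note gD = bar_listsD[OF g]
 have st: "source (pconcat ?g) = target Q p" "target Q (pconcat ?g) = source q"
  using source_pconcat[OF gD(5)] pconcat_path[OF gD(5,3,4)] by (simp_all add: gen_list_def ps)
 have lg: "plength (pconcat ?g) = j - i" unfolding plength_pconcat by (simp add: ps gen_list_simp i_def j_def)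
 have lT: "plength ?T = j + plength q" unfolding plength_pconcat by (simp add: ps i_def j_def)
 have ij: "i <= j" "j <= plength ?T" using lT by (simp_all add: j_def)
 have s1: "pseg Q ?T (0, i) = p" unfolding T by (subst pseg_pcat_left) (simp_all add: i_def)
 have s2: "pseg Q ?T (i, j) = pconcat ?g"
 proof -
  have "pseg Q ?T (i, j) = pseg Q (pcat (pconcat ?g) q) (0, j - i)"
  unfolding T using st pseg_pcat_right[of Q p "pcat (pconcat ?g) q" 0 "j - i"] by (simp add: i_def j_def)
  also have "\<dots> = pconcat ?g" using lg by (subst pseg_pcat_left) (simp_all flip: lg)
  finally show ?thesis .
 qed
 have s3: "pseg Q ?T (j, plength ?T) = q"
 proof -
  have "pseg Q ?T (j, plength ?T) = pseg Q (pcat (pconcat ?g) q) (j - i, j - i + plength q)"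
  using st pseg_pcat_right[of Q p "pcat (pconcat ?g) q" "j - i" "j - i + plength q"] lT unfolding T by (simp add: i_def j_def)
  also have "\<dots> = q" using pseg_pcat_right[OF st(2), of 0 "plength q"] lg by simp
  finally show ?thesis .
 qed
 have y: "pos ?g (Suc k) <= j - i" for k using pos_le[of ?g "Suc k"] lg by simp
 have e: "i + pos ?g (Suc k) = pos ps (Suc k)" if "k <= n" for k
  using that vs unfolding ps gen_list_simp i_def by (simp add: pos_def)
 have "bar_to_ap n (basis ps) = lmul (basis p) (rmul (basis q) (bar_gen_ap n ?g))"
  unfolding bar_to_ap_def hext_basis by (simp add: ps)
 also have "\<dots> = cut_sum (zint ?T) (tri ?T) n (\<lambda>k. i + pos ?g (Suc k))"
  using cut_sum_seg[OF D(6) ij, of n "\<lambda>k. pos ?g (Suc k)"] y unfolding s1 s2 s3 bar_gen_ap_def by blast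
 also have "\<dots> = cut_sum (zint ?T) (tri ?T) n (\<lambda>k. pos ps (Suc k))"
 proof -
  let ?y = "\<lambda>k. i + pos ?g (Suc k)" and ?y' = "\<lambda>k. pos ps (Suc k)"
  have "cuts_good (zint ?T) n ?y = cuts_good (zint ?T) n ?y'"
  unfolding cuts_good_def by (intro arg_cong2[where f = "(\<and>)"] all_cong1 imp_cong refl) (subst (1 2) e; simp)+
  moreover have "selected (zint ?T) n ?y = selected (zint ?T) n ?y'"
  proof (cases "n = 0")
  case True
  then show ?thesis unfolding selected_def using e by simp
  next
  case False
  then show ?thesis unfolding selected_def using e[of 0] e[of 1] e[of n] by simp
  qed
  ultimately show ?thesis unfolding cut_sum_def by simp
 qed
 finally show ?thesis .
qed

end

section \<open>G commutes with the differentials\<close>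

context monomial_algebra
begin

lemma tri_zint':
 assumes T: "T \<in> paths Q" and j: "j <= plength T" and z: "zint T 0 i \<or> zint T j (plength T)"
 shows "tri T (i, j) = 0"
 using z
proof
 assume z: "zint T 0 i"
 have "\<not> nz (pseg Q T (0, i))"
 proof (cases "i <= plength T")
  case True
  then show ?thesis using nz_pseg[OF T, of 0 i] z by simp
 next
  case False
  then have "pseg Q T (0, i) = pseg Q T (0, plength T)" by (simp add: pseg_def plength_def)
  moreover have "zint T 0 (plength T)" using z rocc_iff unfolding zint_def by blast
  ultimately show ?thesis using nz_pseg[OF T, of 0 "plength T"] by simp
 qed
 then show ?thesis by (simp add: tri_eq)
next
 assume "zint T j (plength T)"
 then have "\<not> nz (pseg Q T (j, plength T))" using nz_pseg[OF T j] by simp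
 then show ?thesis by (simp add: tri_eq)
qed

lemma bar_diff_bar: "chom (bar_lists (Suc n)) (bar_diff (Suc n)) (bar_lists n)"
 using bar_diff_chom[of "Suc n"] by (simp add: bar_lists_eq)

lemma bar_diff_alg: "chom (bar_lists 0) (bar_diff 0) alg_lists"
 using bar_diff_chom[of 0] by (simp only: bar_lists_eq alg_lists_eq add_0)

abbreviation merged :: "nat => ('v, 'a) path list => ('v, 'a) path list" where
 "merged i ps \<equiv> take i ps @ pcat (ps ! i) (ps ! (i + 1)) # drop (i + 2) ps"

lemma merged_Cons: "merged (Suc i) (p # ps) = p # merged i ps" by simp

lemma pos_merged:
 assumes "i + 1 < length ps"
 shows "pos (merged i ps) (Suc k) = (if k < i then pos ps (Suc k) else pos ps (Suc (Suc k)))"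
 using assms
proof (induction i arbitrary: ps k)
 case 0
 then obtain a b cs where ps: "ps = a # b # cs" by (cases ps; cases "tl ps") auto
 show ?case by (simp add: ps)
next
 case (Suc i)
 then obtain a qs where ps: "ps = a # qs" by (cases ps) auto
 show ?case
 proof (cases k)
  case 0
  then show ?thesis unfolding ps merged_Cons by simp
 next
  case (Suc l)
  then show ?thesis unfolding ps merged_Cons using Suc.IH[of qs l] Suc.prems ps by simp
 qed
qed

lemma pconcat_merged:
 assumes "i + 1 < length ps" shows "pconcat (merged i ps) = pconcat ps"
 using assms
proof (induction i arbitrary: ps)
 case 0
 then obtain a b cs where ps: "ps = a # b # cs" by (cases ps; cases "tl ps") auto
 show ?case by (simp add: ps pconcat_def pcat_def)
next
 case (Suc i)
 then obtain a qs where ps: "ps = a # qs" by (cases ps) auto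
 have "qs \<noteq> []" using Suc.prems ps by auto
 then show ?case using Suc.IH[of qs] Suc.prems unfolding ps merged_Cons by (simp add: pconcat_Cons)
qed

text \<open>Multiplying two neighbours drops the cut between them. If their product vanishes then the remaining
  cuts are not good, so both sides are zero.\<close>

lemma bar_to_ap_merge:
 assumes ps: "ps \<in> bar_lists (Suc n)" and i: "i <= Suc n"
  and e: "ps ! 0 = triv (source (ps ! 1))" "ps ! (n + 2) = triv (target Q (ps ! (n + 1)))"
 shows "bar_to_ap n (merge i (basis ps)) =
  cut_sum (zint (pconcat ps)) (tri (pconcat ps)) n (drop_cut i (\<lambda>k. pos ps (Suc k)))"
proof -
 note D = bar_listsD[OF ps]
 let ?T = "pconcat ps" and ?x = "\<lambda>k. pos ps (Suc k)"
 have i': "i + 1 < length ps" using i D(2) by simp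
 show ?thesis
 proof (cases "nz (pcat (ps ! i) (ps ! (i + 1)))")
  case True
  then have m: "merge i (basis ps) = basis (merged i ps)" by simp
  have "supp (merge i (basis ps) :: ('v, 'a) path list \<Rightarrow>\<^sub>0 'k) <= bar_lists n"
  using chom_keys[OF merge_chom[OF i], of "basis ps"] ps by (simp add: bar_lists_eq)
  then have mb: "merged i ps \<in> bar_lists n" unfolding m by simp
  have "(\<lambda>k. pos (merged i ps) (Suc k)) = drop_cut i ?x"
  proof (rule ext)
  fix k show "pos (merged i ps) (Suc k) = drop_cut i ?x k" unfolding pos_merged[OF i'] drop_cut_def by simp
  qed
  then show ?thesis unfolding m bar_to_ap_basis[OF mb] pconcat_merged[OF i'] by simp
 next
  case False
  have nzp: "nz (ps ! k)" if "k < length ps" for k using D(7) nth_mem[OF that] by blast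
  have i0: "i \<noteq> 0" using False e(1) nzp[of 1] D(2) by (intro notI) simp
  have iN: "i \<noteq> Suc n" using False e(2) nzp[of "n + 1"] D(2) by (intro notI) simp
  obtain l where l: "i = Suc l" using i0 by (cases i) auto
  have ln: "l < n" using l i iN by simp
  have s: "pseg Q ?T (pos ps i, pos ps (Suc i)) = ps ! i"
  "pseg Q ?T (pos ps (Suc i), pos ps (Suc (Suc i))) = ps ! (i + 1)"
  using pconcat_seg[OF D(3,4), of i] pconcat_seg[OF D(3,4), of "Suc i"] i' by simp_all
  have "pseg Q ?T (pos ps i, pos ps (Suc (Suc i))) = pcat (ps ! i) (ps ! (i + 1))"
  using pcat_pseg[of "pos ps i" "pos ps (Suc i)" "pos ps (Suc (Suc i))" Q ?T] unfolding s
  by (simp add: pos_mono)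
  then have "zint ?T (pos ps i) (pos ps (Suc (Suc i)))"
  using False nz_pseg[OF D(6) pos_mono[of i "Suc (Suc i)" ps] pos_le] by simp
  then have "zint ?T (drop_cut i ?x l) (drop_cut i ?x (l + 1))" by (simp add: drop_cut_def l)
  then have "\<not> cuts_good (zint ?T) n (drop_cut i ?x)" unfolding cuts_good_def using ln by blast
  moreover have "bar_to_ap n 0 = 0" by (rule klinear_0[OF chom_klinear[OF bar_to_ap_chom]])
  ultimately show ?thesis using False by (simp add: cut_sum_def)
 qed
qed

theorem bar_to_ap_commutes:
 assumes u: "supp u <= bar_lists (Suc n)"
 shows "bar_to_ap n (bar_diff (Suc n) u) = ap_diff (Suc n) (bar_to_ap (Suc n) u)"
proof -
 have c1: "chom (bar_lists (Suc n)) (\<lambda>u. bar_to_ap n (bar_diff (Suc n) u)) (ap_lists n)"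
  by (rule chom_comp[OF bar_diff_bar bar_to_ap_chom])
 have c2: "chom (bar_lists (Suc n)) (\<lambda>u. ap_diff (Suc n) (bar_to_ap (Suc n) u)) (ap_lists n)"
  using chom_comp[OF bar_to_ap_chom ap_diff_chom, of "Suc n"] by simp
 show ?thesis
 proof (rule chom_eqI[OF c1 c2 bimod_lists_bar gen_list_bar _ u])
  fix ps assume "ps \<in> bar_lists (Suc n)"
  define gs where "gs = gen_list ps"
  have gs: "gs \<in> bar_lists (Suc n)" using gen_list_bar[OF \<open>ps \<in> bar_lists (Suc n)\<close>] gs_def by blast
  note D = bar_listsD[OF gs]
  let ?T = "pconcat gs" and ?x = "\<lambda>k. pos gs (Suc k)" and ?N = "Suc n"
  have "2 <= length ps" using bar_listsD(1)[OF \<open>ps \<in> bar_lists (Suc n)\<close>] by blast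
  then obtain p vs q where ps': "ps = p # vs @ [q]" by (rule two_ends)
  have gs': "gs = triv (target Q p) # vs @ [triv (source q)]" unfolding gs_def ps' gen_list_simp ..
  have vs: "length vs = Suc n" using D(2) gs' by simp
  have c: "comp (triv (target Q p) # vs @ [triv (source q)])" using D(4) gs' by simp
  have e: "gs ! 0 = triv (source (gs ! 1))" "gs ! (n + 2) = triv (target Q (gs ! (n + 1)))"
  proof -
  obtain v vs' where v: "vs = v # vs'" using vs by (cases vs) auto
  show "gs ! 0 = triv (source (gs ! 1))" using c unfolding gs' v by simp
  obtain vs'' w where w: "vs = vs'' @ [w]" using vs by (cases vs rule: rev_cases) auto
  have "target Q w = source q" using c unfolding w by (simp add: successively_append_iff successively_Cons)
  moreover have "length vs'' = n" using vs w by simp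
  ultimately show "gs ! (n + 2) = triv (target Q (gs ! (n + 1)))" unfolding gs' w by (simp add: nth_append)
  qed
  have x0: "?x 0 = 0" using e(1) D(2) by (cases gs) (simp_all add: pos_def)
  have xN: "?x ?N = plength ?T" 
  proof -
  have "pos gs (Suc ?N) = pos gs (length gs)" unfolding gs' using vs by (simp add: pos_def)
  then show ?thesis using pos_length[of gs "length gs"] by simp
  qed
  have step: "bar_to_ap n (if even i then merge i (basis gs) else - merge i (basis gs)) =
  (if even i then cut_sum (zint ?T) (tri ?T) (?N - 1) (drop_cut i ?x)
  else - cut_sum (zint ?T) (tri ?T) (?N - 1) (drop_cut i ?x))" if "i \<in> {..?N}" for i
  using bar_to_ap_merge[OF gs _ e, of i] that klinear_minus[OF chom_klinear[OF bar_to_ap_chom], of n "merge i (basis gs)"]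
  by simp
  have "bar_to_ap n (bar_diff ?N (basis gs)) =
  (\<Sum>i\<le>?N. bar_to_ap n (if even i then merge i (basis gs) else - merge i (basis gs)))"
  unfolding bar_diff_def by (rule klinear_sum[OF chom_klinear[OF bar_to_ap_chom]])
  also have "\<dots> = (\<Sum>i\<le>?N. if even i then cut_sum (zint ?T) (tri ?T) (?N - 1) (drop_cut i ?x)
  else - cut_sum (zint ?T) (tri ?T) (?N - 1) (drop_cut i ?x))"
  by (rule sum.cong[OF refl step])
  also have "\<dots> = (if cuts_good (zint ?T) ?N ?x then (\<Sum>w\<in>selected (zint ?T) ?N ?x. boundary_sum (zint ?T) (tri ?T) ?N w) else 0)"
  proof (rule zint.cut_sum_boundary)
  show "1 <= ?N" by simp
  fix k assume k: "k < ?N"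
  show "?x k <= ?x (k + 1)" by (rule pos_mono) simp
  have "pseg Q ?T (?x k, ?x (k + 1)) = gs ! Suc k" using pconcat_seg[OF D(3,4), of "Suc k"] k D(2) by simp
  moreover have "nz (gs ! Suc k)" using D(7) nth_mem[of "Suc k" gs] k D(2) by auto
  ultimately show "\<not> zint ?T (?x k) (?x (k + 1))"
  using nz_pseg[OF D(6) pos_mono[of "Suc k" "Suc (k + 1)" gs] pos_le] by simp
  next
  fix i j assume "j <= ?x ?N" "zint ?T (?x 0) i \<or> zint ?T j (?x ?N)"
  then show "tri ?T (i, j) = 0" unfolding x0 xN by (rule tri_zint'[OF D(6)])
  qed
  also have "\<dots> = cut_sum (zint ?T) (\<lambda>\<zeta>. boundary_sum (zint ?T) (tri ?T) ?N \<zeta>) ?N ?x"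
  by (simp add: cut_sum_def)
  also have "\<dots> = cut_sum (zint ?T) (\<lambda>\<zeta>. ap_diff ?N (tri ?T \<zeta>)) ?N ?x"
  proof (rule cut_sum_cong)
  fix \<zeta> assume "\<zeta> \<in> ap_inside (zint ?T) ?N (?x 0) (?x ?N)"
  then show "boundary_sum (zint ?T) (tri ?T) ?N \<zeta> = ap_diff ?N (tri ?T \<zeta>)"
  using ap_diff_tri[OF D(6), of "fst \<zeta>" "snd \<zeta>" ?N] unfolding x0 xN by simp
  qed
  also have "\<dots> = ap_diff ?N (cut_sum (zint ?T) (tri ?T) ?N ?x)"
  by (rule cut_sum_linear[OF chom_klinear[OF ap_diff_chom], symmetric])
  also have "\<dots> = ap_diff ?N (bar_to_ap ?N (basis gs))" unfolding bar_to_ap_basis[OF gs] ..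
  finally show "bar_to_ap n (bar_diff (Suc n) (basis (gen_list ps))) = ap_diff (Suc n) (bar_to_ap (Suc n) (basis (gen_list ps)))"
  unfolding gs_def .
 qed
qed

definition ap_aug :: "(('v, 'a) path list \<Rightarrow>\<^sub>0 'k) => (('v, 'a) path list \<Rightarrow>\<^sub>0 'k)" where
 "ap_aug = hext (\<lambda>gs. basis [gs ! 1])"

lemma AP_0_E:
 assumes "ps \<in> ap_lists 0"
 obtains x where "gen_list ps = [triv x, triv x, triv x]" "x \<in> verts Q" "target Q (hd ps) = x" "source (last ps) = x"
 using assms
proof (rule ap_listsE)
 fix p w q assume ps: "ps = [p, w, q]" "w \<in> AP Q I 0" "target Q p = source w" "target Q w = source q"
  "gen_list ps = [triv (source w), w, triv (target Q w)]"
 then obtain x where "w = triv x" "x \<in> verts Q" by (auto simp: AP_def)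
 then show ?thesis using that ps by simp
qed

lemma keys_ap_aug:
 assumes "ps \<in> ap_lists 0"
 shows "supp (basis [gen_list ps ! 1] :: ('v, 'a) path list \<Rightarrow>\<^sub>0 'k) \<subseteq>
  alg_lists \<inter> anchored (target Q (hd ps)) (source (last ps))"
 using assms by (rule AP_0_E) (simp add: alg_lists_def anchored_def nzlists_def del: split_paired_Ex)

lemma ap_aug_chom: "chom (ap_lists 0) ap_aug alg_lists"
 unfolding ap_aug_def by (rule hext_chom[OF ap_listsD bimod_lists_alg]) (use keys_ap_aug in blast)+

lemma ap_aug_gen:
 assumes "ps \<in> ap_lists 0" shows "ap_aug (basis (gen_list ps)) = basis [gen_list ps ! 1]"
 unfolding ap_aug_def by (rule hext_gen) (use ap_listsD[OF assms] keys_ap_aug[OF assms] in blast)+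

lemma bar_0_E:
 assumes "ps \<in> bar_lists 0"
 obtains x where "gen_list ps = [triv x, triv x]" "x \<in> verts Q"
proof -
 have "2 <= length ps" using bar_listsD(1)[OF assms] by blast
 then obtain p vs q where ps: "ps = p # vs @ [q]" by (rule two_ends)
 have "vs = []" "target Q p = source q" "nz p" using assms by (auto simp: bar_lists_def ps)
 then show ?thesis using that[of "source q"] target_in_verts[OF nz_paths, of p] by (simp add: ps gen_list_def)
qed

lemma bar_to_ap_0:
 assumes "x \<in> verts Q" shows "bar_to_ap 0 (basis [triv x, triv x]) = basis [triv x, triv x, triv x]"
proof -
 have b: "[triv x, triv x] \<in> bar_lists 0" using assms by (simp add: bar_lists_def)
 have T: "pconcat [triv x, triv x] = triv x" by (simp add: pconcat_def triv_def)
 have "ap_inside (zint (triv x)) 0 0 0 = {(0, 0)}" unfolding ap_inside_def zint.ap_0 by auto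
 note in0 = this
 have lm: "leftmost {(0, 0)} = {(0, 0)}" by (auto simp: leftmost_def)
 have s: "selected (zint (triv x)) 0 (\<lambda>k. 0) = {(0, 0)}"
  unfolding selected_def by (subst if_P) (simp_all only: in0 lm dvd_0_right)
 have p: "(\<lambda>k. pos [triv x, triv x] (Suc k)) = (\<lambda>k. 0)"
 proof
  fix k show "pos [triv x, triv x] (Suc k) = 0"
  using pos_le[of "[triv x, triv x]" "Suc k"] unfolding T by simp
 qed
 have g: "cuts_good (zint (triv x)) 0 (\<lambda>k. 0)" by (simp add: cuts_good_def)
 have t: "tri (triv x) (0, 0) = basis [triv x, triv x, triv x]" using tri_whole[of "triv x"] assms by simp
 show ?thesis unfolding bar_to_ap_basis[OF b] T p cut_sum_def s using g t by simp
qed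

lemma bar_to_ap_aug:
 assumes u: "supp u <= bar_lists 0"
 shows "ap_aug (bar_to_ap 0 u) = bar_diff 0 u"
proof (rule chom_eqI[OF chom_comp[OF bar_to_ap_chom ap_aug_chom] bar_diff_alg bimod_lists_bar gen_list_bar _ u])
 fix ps assume "ps \<in> bar_lists 0"
 then obtain x where x: "gen_list ps = [triv x, triv x]" "x \<in> verts Q" by (rule bar_0_E)
 have l: "[triv x, triv x, triv x] \<in> ap_lists 0" "gen_list [triv x, triv x, triv x] = [triv x, triv x, triv x]"
  using whole_ap_list[of "triv x" 0] x(2) by (simp_all add: AP_def)
 have "ap_aug (basis [triv x, triv x, triv x]) = basis [triv x]" using ap_aug_gen[OF l(1)] unfolding l(2) by simp
 moreover have "pcat (triv x) (triv x) = triv x" by simp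
 ultimately show "ap_aug (bar_to_ap 0 (basis (gen_list ps))) = bar_diff 0 (basis (gen_list ps))"
  unfolding x(1) bar_to_ap_0[OF x(2)] using x(2) by (simp add: bar_diff_def)
qed

end

section \<open>F commutes with the differentials\<close>

context monomial_algebra
begin

text \<open>The faces \<open>\<zeta>\<^sub>2, \<dots>, \<zeta>\<^sub>m\<close>: the first face starts at \<open>0\<close> because every chain interval has a prefix.\<close>

definition later_faces :: "nat => ('v, 'a) path => (('v, 'a) path list \<Rightarrow>\<^sub>0 'k)" where
 "later_faces n w = (\<Sum>\<zeta>\<in>{\<zeta> \<in> ap_inside (zint w) (n - 1) 0 (plength w). 0 < fst \<zeta>}. tri w \<zeta>)"

primrec ap_gen_bar :: "nat => ('v, 'a) path list => (('v, 'a) path list \<Rightarrow>\<^sub>0 'k)" where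
 "ap_gen_bar 0 = (\<lambda>gs. basis [gs ! 1, gs ! 1])"
| "ap_gen_bar (Suc n) = (\<lambda>gs. ins (hext (ap_gen_bar n) (later_faces (Suc n) (gs ! 1))))"

definition ap_to_bar :: "nat => (('v, 'a) path list \<Rightarrow>\<^sub>0 'k) => (('v, 'a) path list \<Rightarrow>\<^sub>0 'k)" where
 "ap_to_bar n = hext (ap_gen_bar n)"

lemma anchoredI:
 assumes u: "supp u <= nzlists" and t: "lmul (basis (triv s)) u = u" "rmul (basis (triv t)) u = u"
 shows "supp u <= anchored s t"
proof -
 have "supp (lmul (basis (triv s)) u) <= {ps. source (hd ps) = s}"
  unfolding lmul_def by (rule keys_bilin) auto
 moreover have "supp (rmul (basis (triv t)) u) <= {ps. target Q (last ps) = t}"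
  unfolding rmul_def by (rule keys_bilin) auto
 ultimately show ?thesis using u unfolding t anchored_def by blast
qed

lemma chom_anchored:
 assumes h: "chom B h B'" and B: "bimod_lists B" "bimod_lists B'"
  and u: "supp u <= B \<inter> anchored s t" and st: "s \<in> verts Q" "t \<in> verts Q"
 shows "supp (h u) <= B' \<inter> anchored s t"
proof -
 have uB: "supp u <= B" and uA: "supp u <= anchored s t" using u by blast+
 have P: "triv s \<in> paths Q" "triv t \<in> paths Q" using st by simp_all
 have k: "supp (h u) <= B'" by (rule chom_keys[OF h uB])
 moreover have "supp (h u) <= anchored s t"
 proof (rule anchoredI)
  show "supp (h u) <= nzlists" using k bimod_listsD(1)[OF B(2)] by blast
  show "lmul (basis (triv s)) (h u) = h u"
  unfolding chom_mul_path(1)[OF h B P(1) uB, symmetric] using mul_triv[OF uA] by simp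
  show "rmul (basis (triv t)) (h u) = h u"
  unfolding chom_mul_path(2)[OF h B P(2) uB, symmetric] using mul_triv[OF uA] by simp
 qed
 ultimately show ?thesis by blast
qed

lemma keys_ins:
 assumes "supp u <= bar_lists n \<inter> anchored s t"
 shows "supp (ins u) <= bar_lists (Suc n) \<inter> anchored s t"
 unfolding ins_def
proof (rule keys_lin)
 fix ps assume "ps \<in> supp u"
 then have ps: "ps \<in> bar_lists n" "ps \<in> anchored s t" using assms by blast+
 then obtain a as where a: "ps = a # as" using bar_listsD(5)[OF ps(1)] by (cases ps) auto
 have na: "nz a" "source a \<in> verts Q" using bar_listsD(1)[OF ps(1)] nz_paths source_in_verts by (auto simp: a)
 have "triv (source (hd ps)) # ps \<in> bar_lists (Suc n)" using ps(1) na by (simp add: a bar_lists_def)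
 moreover have "triv (source (hd ps)) # ps \<in> anchored s t"
  using ps(2) na by (simp add: a anchored_def nzlists_def)
 ultimately show "supp (basis (triv (source (hd ps)) # ps) :: ('v, 'a) path list \<Rightarrow>\<^sub>0 'k) \<subseteq>
  bar_lists (Suc n) \<inter> anchored s t" by simp
qed

lemma keys_later_faces:
 assumes "w \<in> paths Q"
 shows "supp (later_faces (Suc n) w) <= ap_lists n \<inter> anchored (source w) (target Q w)"
 unfolding later_faces_def
proof (rule keys_sum_subset)
 fix \<zeta> assume "\<zeta> \<in> {\<zeta> \<in> ap_inside (zint w) (Suc n - 1) 0 (plength w). 0 < fst \<zeta>}"
 then show "supp (tri w \<zeta>) <= ap_lists n \<inter> anchored (source w) (target Q w)"
  using tri_keys[OF assms, of "fst \<zeta>" "snd \<zeta>" n] by simp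
qed

lemma keys_ap_gen_bar:
 "ps \<in> ap_lists n ==> supp (ap_gen_bar n (gen_list ps)) \<subseteq>
  bar_lists n \<inter> anchored (target Q (hd ps)) (source (last ps))"
proof (induction n arbitrary: ps)
 case 0
 then show ?case by (rule AP_0_E) (simp add: bar_lists_def anchored_def nzlists_def del: split_paired_Ex)
next
 case (Suc n)
 from Suc.prems obtain p w q where ps: "ps = [p, w, q]" "w \<in> paths Q" "target Q p = source w" "target Q w = source q"
  "gen_list ps = [triv (source w), w, triv (target Q w)]" by (rule ap_listsE)
 have h: "chom (ap_lists n) (hext (ap_gen_bar n)) (bar_lists n)"
  by (rule hext_chom[OF ap_listsD bimod_lists_bar]) (use Suc.IH in blast)+
 have "supp (hext (ap_gen_bar n) (later_faces (Suc n) w)) <= bar_lists n \<inter> anchored (source w) (target Q w)"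
  by (rule chom_anchored[OF h bimod_lists_ap bimod_lists_bar keys_later_faces[OF ps(2)] source_in_verts[OF ps(2)]
  target_in_verts[OF ps(2)]])
 from keys_ins[OF this] show ?case unfolding ps(5) ap_gen_bar.simps by (simp add: ps(1,3,4))
qed

lemma ap_to_bar_chom: "chom (ap_lists n) (ap_to_bar n) (bar_lists n)"
 unfolding ap_to_bar_def by (rule hext_chom[OF ap_listsD bimod_lists_bar]) (use keys_ap_gen_bar in blast)+

lemma ap_to_bar_gen:
 assumes "ps \<in> ap_lists n" shows "ap_to_bar n (basis (gen_list ps)) = ap_gen_bar n (gen_list ps)"
 unfolding ap_to_bar_def by (rule hext_gen) (use ap_listsD[OF assms] keys_ap_gen_bar[OF assms] in blast)+

lemma ap_to_bar_whole:
 assumes "w \<in> AP Q I (Suc n)"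
 shows "ap_to_bar (Suc n) (tri w (0, plength w)) = ins (ap_to_bar n (later_faces (Suc n) w))"
 using ap_to_bar_gen[OF whole_ap_list(1)[OF assms]]
 unfolding whole_ap_list(2)[OF assms] tri_whole[OF AP_paths[OF assms]] by (simp add: ap_to_bar_def)

lemma ap_to_bar_aug:
 assumes u: "supp u <= ap_lists 0"
 shows "bar_diff 0 (ap_to_bar 0 u) = ap_aug u"
proof (rule chom_eqI[OF chom_comp[OF ap_to_bar_chom bar_diff_alg] ap_aug_chom bimod_lists_ap gen_list_ap _ u])
 fix ps assume ps: "ps \<in> ap_lists 0"
 then obtain x where x: "gen_list ps = [triv x, triv x, triv x]" "x \<in> verts Q" by (rule AP_0_E)
 have "pcat (triv x) (triv x) = triv x" by simp
 then show "bar_diff 0 (ap_to_bar 0 (basis (gen_list ps))) = ap_aug (basis (gen_list ps))"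
  unfolding ap_to_bar_gen[OF ps] ap_aug_gen[OF ps] unfolding x(1) using x(2) by (simp add: bar_diff_def)
qed

lemma klinear_ins: "klinear ins" unfolding ins_def by (rule klinear_lin)

text \<open>The contracting homotopy of the bar complex.\<close>

lemma bar_diff_ins:
 assumes "supp u <= nz_lists (n + 2)"
 shows "bar_diff (Suc n) (ins u) = u - ins (bar_diff n u)"
proof -
 have m0: "merge 0 (ins u) = u" using assms
 proof (induction u rule: span_induct)
  case (single ps c)
  then obtain a as where "ps = a # as" by (cases ps) (auto simp: nz_lists_def)
  then show ?case using single by (auto simp: nz_lists_def)
 qed simp_all
 have mS: "merge (Suc i) (ins u) = ins (merge i u)" if "i <= n" for i using assms
 proof (induction u rule: span_induct)
  case (single ps c)
  have "ps \<noteq> []" using single by (auto simp: nz_lists_def)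
  then obtain a as where a: "ps = a # as" by (cases ps) blast
  have "source (hd (merged i ps)) = source a" unfolding a by (cases i) simp_all
  then show ?case unfolding a by (simp add: a)
 qed simp_all
 have "bar_diff (Suc n) (ins u) = u + (\<Sum>i\<le>n. if even (Suc i) then merge (Suc i) (ins u) else - merge (Suc i) (ins u))"
  unfolding bar_diff_def sum.atMost_Suc_shift using m0 by simp
 also have "(\<Sum>i\<le>n. if even (Suc i) then merge (Suc i) (ins u) else - merge (Suc i) (ins u)) =
  (\<Sum>i\<le>n. - ins (if even i then merge i u else - merge i u))"
  by (rule sum.cong[OF refl]) (simp add: mS)
 also have "\<dots> = - ins (bar_diff n u)" unfolding bar_diff_def klinear_sum[OF klinear_ins] sum_negf ..
 finally show ?thesis by simp
qed

text \<open>In odd degrees the suffix is the only face that does not start first, by \<open>ap_odd_end_le\<close>.\<close>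

lemma boundary_split:
 assumes w: "(0, N) \<in> ap_intervals (zint T) (Suc n)" and e: "(0, e) \<in> ap_intervals (zint T) n" "e <= N" and N: "N = plength T"
 shows "boundary_sum (zint T) (tri T) (Suc n) (0, N) =
  later_faces (Suc n) T + (if even (Suc n) then tri T (0, e) else - tri T (0, e))"
proof -
 let ?W = "ap_inside (zint T) n 0 N"
 have first: "{\<zeta> \<in> ?W. fst \<zeta> = 0} = {(0, e)}"
 proof (rule Set.set_eqI)
  fix \<zeta> show "\<zeta> \<in> {\<zeta> \<in> ?W. fst \<zeta> = 0} \<longleftrightarrow> \<zeta> \<in> {(0, e)}"
  using zint.ap_end_unique[OF e(1), of "snd \<zeta>"] e by (cases \<zeta>) (auto simp: ap_inside_def)
 qed
 have L: "later_faces (Suc n) T = (\<Sum>\<zeta>\<in>{\<zeta> \<in> ?W. 0 < fst \<zeta>}. tri T \<zeta>)" by (simp add: later_faces_def N)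
 show ?thesis
 proof (cases "even (Suc n)")
  case True
  have "?W = {\<zeta> \<in> ?W. 0 < fst \<zeta>} \<union> {(0, e)}" using first by (auto simp flip: first)
  moreover have "finite {\<zeta> \<in> ?W. 0 < fst \<zeta>}" by simp
  moreover have "{\<zeta> \<in> ?W. 0 < fst \<zeta>} \<inter> {(0, e)} = {}" by auto
  ultimately have "sum (tri T) ?W = sum (tri T) {\<zeta> \<in> ?W. 0 < fst \<zeta>} + sum (tri T) {(0, e)}"
  using sum.union_disjoint[of "{\<zeta> \<in> ?W. 0 < fst \<zeta>}" "{(0, e)}" "tri T"] by simp
  then show ?thesis unfolding L using True by (simp add: boundary_sum_def)
 next
  case False
  then obtain m where m: "n = 2 * m" by (auto elim: evenE)
  have "{\<zeta> \<in> ?W. snd \<zeta> = N} = {\<zeta> \<in> ?W. 0 < fst \<zeta>}"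
  proof (rule Set.set_eqI)
  fix \<zeta> :: occ
  obtain s t where \<zeta>: "\<zeta> = (s, t)" by (cases \<zeta>)
  have "N <= t" if "(s, t) \<in> ?W" "0 < s"
  using zint.ap_odd_end_le[of 0 N T m s t] w that m by (simp add: ap_inside_def)
  moreover have "0 < s" if "(s, t) \<in> ?W" "t = N"
  proof (rule ccontr)
  assume "\<not> 0 < s"
  obtain s' where "0 < s'" "(s', N) \<in> ap_intervals (zint T) n" using zint.ap_suffix[OF w] by blast
  then show False using zint.ap_start_unique[of s N T n s'] that \<open>\<not> 0 < s\<close> by (simp add: ap_inside_def)
  qed
  ultimately show "\<zeta> \<in> {\<zeta> \<in> ?W. snd \<zeta> = N} \<longleftrightarrow> \<zeta> \<in> {\<zeta> \<in> ?W. 0 < fst \<zeta>}"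
  unfolding \<zeta> using ap_insideD(3)[of s t T n 0 N] by auto
  qed
  then show ?thesis unfolding L using False first by (simp add: boundary_sum_def)
 qed
qed

lemma ap_prefix_chain:
 assumes "(0, N) \<in> ap_intervals (zint T) (Suc (Suc n))"
 obtains e e' where "(0, e) \<in> ap_intervals (zint T) (Suc n)" "(0, e') \<in> ap_intervals (zint T) n"
  "zint T e' N" "e' <= e" "e <= N"
proof -
 obtain u where u: "anick_chain (zint T) (Suc (Suc n)) u" "u 0 = 0" "u (Suc (Suc n)) = N"
  using zint.apE[OF assms] by blast
 have "(0, u (Suc n)) \<in> ap_intervals (zint T) (Suc n)" "(0, u n) \<in> ap_intervals (zint T) n"
  using zint.apI[OF zint.chain_prefix[OF u(1), of "Suc n"]] zint.apI[OF zint.chain_prefix[OF u(1), of n]] u(2) by simp_all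
 moreover have "zint T (u n) N" using zint.chain_zer[OF u(1), of n] u(3) by simp
 moreover have "u n <= u (Suc n)" "u (Suc n) <= N"
  using zint.chain_mono[OF u(1), of n "Suc n"] zint.chain_mono[OF u(1), of "Suc n" "Suc (Suc n)"] u(3) by simp_all
 ultimately show ?thesis by (rule that)
qed

lemma rmul_ins:
 assumes "supp u <= nzlists" shows "rmul (basis p) (ins u) = ins (rmul (basis p) u)"
 using assms
proof (induction u rule: span_induct)
 case (single ps c)
 then have ne: "ps \<noteq> []" by (rule nzlistsD)
 then have "hd (butlast ps @ [pcat (last ps) p]) = (if butlast ps = [] then pcat (hd ps) p else hd ps)"
  by (cases ps) auto
 then show ?case using ne by (simp add: mul_single)
qed simp_all

lemma tri_prefix:
 assumes T: "T \<in> paths Q" and ab: "a <= b" "b <= e" "e <= plength T"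
 shows "rmul (basis (pseg Q T (e, plength T))) (tri (pseg Q T (0, e)) (a, b)) = tri T (a, b)"
proof -
 let ?w = "pseg Q T (0, e)" and ?R = "pseg Q T (e, plength T)"
 have w: "?w \<in> paths Q" "?R \<in> paths Q" using T ab by (simp_all add: pseg_in_paths)
 have k: "supp (tri ?w (a, b)) <= anchored (source T) (target Q ?w)"
  using ab w by (auto simp: tri_eq anchored_def nzlists_def target_pseg vat_pseg)
 then have n: "supp (tri ?w (a, b)) <= nzlists" unfolding anchored_def by blast
 have s: "triv (source T) \<in> paths Q" using source_in_verts[OF T] by simp
 have P: "supp (basis (triv (source T)) :: ('v, 'a) path \<Rightarrow>\<^sub>0 'k) <= paths Q"
  "supp (basis ?R :: ('v, 'a) path \<Rightarrow>\<^sub>0 'k) <= paths Q" using s w by simp_all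
 have "tri T (a, b) = lmul (basis (triv (source T))) (rmul (basis ?R) (tri ?w (a, b)))"
  using tri_seg[OF T _ ab(3), of 0 a b] ab by simp
 also have "\<dots> = rmul (basis ?R) (tri ?w (a, b))"
  unfolding lmul_rmul[OF P n] using mul_triv[OF k] by simp
 finally show ?thesis ..
qed

text \<open>The first face of the first face carries the zero segment from \<open>e'\<close> to the end of \<open>w\<close> in its right
  factor, so only the later faces of the first face contribute.\<close>

lemma first_face_step:
 assumes w: "w \<in> paths Q" "(0, plength w) \<in> ap_intervals (zint w) (Suc (Suc m))"
  and e: "(0, e) \<in> ap_intervals (zint w) (Suc m)" "(0, e') \<in> ap_intervals (zint w) m" "zint w e' (plength w)"
  "e' <= e" "e <= plength w"
 shows "ap_to_bar (Suc m) (tri w (0, e)) = ins (ap_to_bar m (ap_diff (Suc m) (tri w (0, e))))"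
proof -
 let ?w = "pseg Q w (0, e)" and ?R = "pseg Q w (e, plength w)"
 have p: "?w \<in> paths Q" "?R \<in> paths Q" using w e by (simp_all add: pseg_in_paths)
 have A: "?w \<in> AP Q I (Suc m)" using pseg_AP_iff[OF w(1), of 0 e] e by simp
 have l: "plength ?w = e" using e by simp
 let ?X = "tri ?w (0, e)"
 have X: "supp ?X <= ap_lists (Suc m)"
  using whole_ap_list(1)[OF A] tri_whole[OF p(1)] unfolding l by simp
 have t: "tri w (0, e) = rmul (basis ?R) ?X" using tri_prefix[OF w(1), of 0 e e] e by simp
 let ?D = "later_faces (Suc m) ?w"
 have D: "supp ?D <= ap_lists m" using keys_later_faces[OF p(1)] by blast
 have FD: "supp (ap_to_bar m ?D) <= nzlists"
  using chom_keys[OF ap_to_bar_chom D] bimod_listsD(1)[OF bimod_lists_bar] by blast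
 have "ap_to_bar (Suc m) (tri w (0, e)) = rmul (basis ?R) (ap_to_bar (Suc m) ?X)"
  unfolding t by (rule chom_mul_path(2)[OF ap_to_bar_chom bimod_lists_ap bimod_lists_bar p(2) X])
 also have "ap_to_bar (Suc m) ?X = ins (ap_to_bar m ?D)" using ap_to_bar_whole[OF A] unfolding l .
 also have "rmul (basis ?R) (ins (ap_to_bar m ?D)) = ins (rmul (basis ?R) (ap_to_bar m ?D))" by (rule rmul_ins[OF FD])
 also have "rmul (basis ?R) (ap_to_bar m ?D) = ap_to_bar m (rmul (basis ?R) ?D)"
  by (rule chom_mul_path(2)[OF ap_to_bar_chom bimod_lists_ap bimod_lists_bar p(2) D, symmetric])
 also have "rmul (basis ?R) ?D = ap_diff (Suc m) (tri w (0, e))"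
 proof -
  have z: "zint ?w a b = zint w a b" if "a <= e" "b <= e" for a b
  using zint_pseg[OF w(1), of 0 e a b] e that by simp
  have ap: "(a, b) \<in> ap_intervals (zint ?w) n \<longleftrightarrow> (a, b) \<in> ap_intervals (zint w) n" if "b <= e" for a b n
  using ap_intervals_shift[of "zint ?w" "zint w" e 0, OF zint.zero_intervals_axioms zint.zero_intervals_axioms _ that] z by simp
  have "boundary_sum (zint ?w) (tri ?w) (Suc m) (0, e) =
  ?D + (if even (Suc m) then tri ?w (0, e') else - tri ?w (0, e'))"
  by (rule boundary_split) (use e ap l in auto)
  then have "ap_diff (Suc m) ?X = ?D + (if even (Suc m) then tri ?w (0, e') else - tri ?w (0, e'))"
  using ap_diff_whole[OF A] unfolding l by simp
  moreover have "rmul (basis ?R) (tri ?w (0, e')) = 0"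
  using tri_prefix[OF w(1), of 0 e' e] tri_zint'[OF w(1), of e' 0] e by simp
  ultimately have "rmul (basis ?R) (ap_diff (Suc m) ?X) = rmul (basis ?R) ?D"
  by (simp add: klinear_minus[OF klinear_mul(2)])
  moreover have "ap_diff (Suc m) (tri w (0, e)) = rmul (basis ?R) (ap_diff (Suc m) ?X)"
  unfolding t by (rule chom_mul_path(2)[OF ap_diff_chom bimod_lists_ap bimod_lists_ap p(2) X])
  ultimately show ?thesis by simp
 qed
 finally show ?thesis .
qed

lemma ap_diff_ap_diff_whole:
 assumes w: "w \<in> AP Q I (Suc (Suc m))"
 shows "ap_diff (Suc m) (boundary_sum (zint w) (tri w) (Suc (Suc m)) (0, plength w)) = 0"
proof -
 note P = AP_paths[OF w]
 have "ap_diff (Suc m) (boundary_sum (zint w) (tri w) (Suc (Suc m)) (0, plength w)) =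
  boundary_sum (zint w) (\<lambda>\<zeta>. ap_diff (Suc m) (tri w \<zeta>)) (Suc (Suc m)) (0, plength w)"
  by (rule boundary_sum_linear[OF chom_klinear[OF ap_diff_chom]])
 also have "\<dots> = boundary_sum (zint w) (boundary_sum (zint w) (tri w) (Suc m)) (Suc (Suc m)) (0, plength w)"
 proof (rule boundary_sum_cong)
  fix \<zeta> assume "\<zeta> \<in> ap_inside (zint w) (Suc (Suc m) - 1) (fst (0, plength w)) (snd (0, plength w))"
  then show "ap_diff (Suc m) (tri w \<zeta>) = boundary_sum (zint w) (tri w) (Suc m) \<zeta>"
  using ap_diff_tri[OF P, of "fst \<zeta>" "snd \<zeta>" "Suc m"] by simp
 qed
 also have "\<dots> = 0"
 proof -
  have "boundary_sum (zint w) (boundary_sum (zint w) (tri w) (Suc (Suc m) - 1)) (Suc (Suc m)) (0, plength w) = 0"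
  proof (rule zint.boundary_boundary)
  show "(0, plength w) \<in> ap_intervals (zint w) (Suc (Suc m))" using w AP_iff by blast
  fix i j assume "j <= plength w" "zint w 0 i \<or> zint w j (plength w)"
  then show "tri w (i, j) = 0" by (rule tri_zint'[OF P])
  qed simp
  then show ?thesis by simp
 qed
 finally show ?thesis .
qed

lemma ap_diff_chom_Suc: "chom (ap_lists (Suc n)) (ap_diff (Suc n)) (ap_lists n)"
 using ap_diff_chom[of "Suc n"] by simp

text \<open>The induction runs over the degree; the homotopy formula reduces the claim to the first face.\<close>

theorem ap_to_bar_commutes:
 "supp u <= ap_lists (Suc n) ==>
  ap_to_bar n (ap_diff (Suc n) u) = bar_diff (Suc n) (ap_to_bar (Suc n) u)"
proof (induction n arbitrary: u)
 case n: (0 u)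
 have c: "chom (ap_lists (Suc 0)) (\<lambda>u. ap_to_bar 0 (ap_diff (Suc 0) u)) (bar_lists 0)"
  by (rule chom_comp[OF ap_diff_chom_Suc ap_to_bar_chom])
 show ?case
 proof (rule chom_eqI[OF c chom_comp[OF ap_to_bar_chom bar_diff_bar] bimod_lists_ap gen_list_ap _ n])
  fix ps assume "ps \<in> ap_lists (Suc 0)"
  then obtain w where w: "w \<in> AP Q I (Suc 0)" "gen_list ps = [triv (source w), w, triv (target Q w)]"
  by (rule ap_listsE)
  note P = AP_paths[OF w(1)]
  have l: "plength w = 1" using w(1) by (auto simp: AP_def)
  have nw: "nz w" using w(1) nz_arrow by (auto simp: AP_def)
  have ap0: "ap_intervals (zint w) 0 = {(i, i) | i. True}" by (rule zint.ap_0)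
  have full: "(0, plength w) \<in> ap_intervals (zint w) (Suc 0)" using w(1) AP_iff by blast
  let ?D = "later_faces (Suc 0) w"
  have st: "source w \<in> verts Q" "target Q w \<in> verts Q" using source_in_verts[OF P] target_in_verts[OF P] by simp_all
  have p01: "pseg Q w (0, Suc 0) = w" using pseg_full[of Q w] l by simp
  have v1: "vat Q w (Suc 0) = target Q w" using vat_end[of Q w] l by simp
  have "{\<zeta> \<in> ap_inside (zint w) 0 0 (plength w). 0 < fst \<zeta>} = {(1, 1)}"
  unfolding ap_inside_def ap0 l by auto
  then have D: "?D = basis [w, triv (target Q w), triv (target Q w)]"
  unfolding later_faces_def using nw st by (simp add: tri_eq l p01 v1)
  have t0: "tri w (0, 0) = basis [triv (source w), triv (source w), w]"
  using nw st by (simp add: tri_eq l p01)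
  have "[w, triv (target Q w), triv (target Q w)] \<in> ap_lists 0"
  using nw st by (simp add: ap_lists_Cons AP_def)
  then have kD: "supp ?D <= ap_lists 0" unfolding D by simp
  let ?V = "ap_to_bar 0 ?D"
  have V: "supp ?V <= nz_lists (0 + 2)"
  using chom_keys[OF ap_to_bar_chom kD] unfolding bar_lists_eq .
  have "ap_to_bar 0 (tri w (0, 0)) = ins (basis [w])"
  unfolding t0 ap_to_bar_def hext_basis using nw st by (simp add: gen_list_def mul_single)
  moreover have "bar_diff 0 ?V = basis [w]"
  unfolding ap_to_bar_aug[OF kD] unfolding D ap_aug_def hext_basis using nw st by (simp add: gen_list_def mul_single)
  moreover have "ap_diff (Suc 0) (tri w (0, plength w)) = ?D - tri w (0, 0)"
  unfolding ap_diff_whole[OF w(1)] using boundary_split[OF full, of 0] ap0 by simp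
  moreover have "bar_diff (Suc 0) (ins ?V) = ?V - ins (bar_diff 0 ?V)" by (rule bar_diff_ins[OF V])
  ultimately show "ap_to_bar 0 (ap_diff (Suc 0) (basis (gen_list ps))) =
  bar_diff (Suc 0) (ap_to_bar (Suc 0) (basis (gen_list ps)))"
  unfolding w(2) tri_whole[OF P, symmetric] ap_to_bar_whole[OF w(1)]
  by (simp add: klinear_diff[OF chom_klinear[OF ap_to_bar_chom]])
 qed
next
 case m: (Suc m u)
 have c: "chom (ap_lists (Suc (Suc m))) (\<lambda>u. ap_to_bar (Suc m) (ap_diff (Suc (Suc m)) u)) (bar_lists (Suc m))"
  by (rule chom_comp[OF ap_diff_chom_Suc ap_to_bar_chom])
 show ?case
 proof (rule chom_eqI[OF c chom_comp[OF ap_to_bar_chom bar_diff_bar] bimod_lists_ap gen_list_ap _ m.prems])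
  fix ps assume "ps \<in> ap_lists (Suc (Suc m))"
  then obtain w where w: "w \<in> AP Q I (Suc (Suc m))" "gen_list ps = [triv (source w), w, triv (target Q w)]"
  by (rule ap_listsE)
  note P = AP_paths[OF w(1)]
  have full: "(0, plength w) \<in> ap_intervals (zint w) (Suc (Suc m))" using w(1) AP_iff by blast
  obtain e e' where e: "(0, e) \<in> ap_intervals (zint w) (Suc m)" "(0, e') \<in> ap_intervals (zint w) m"
  "zint w e' (plength w)" "e' <= e" "e <= plength w" using ap_prefix_chain[OF full] by blast
  let ?D = "later_faces (Suc (Suc m)) w" and ?t = "tri w (0, e)"
  define S where "S = (if even (Suc (Suc m)) then ?t else - ?t)"
  have split: "boundary_sum (zint w) (tri w) (Suc (Suc m)) (0, plength w) = ?D + S"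
  unfolding S_def by (rule boundary_split[OF full e(1) e(5) refl])
  have kD: "supp ?D <= ap_lists (Suc m)" using keys_later_faces[OF P] by blast
  note Fk = chom_klinear[OF ap_to_bar_chom] and dk = chom_klinear[OF ap_diff_chom]
  let ?V = "ap_to_bar (Suc m) ?D"
  have V: "supp ?V <= nz_lists (Suc m + 2)"
  using chom_keys[OF ap_to_bar_chom kD] unfolding bar_lists_eq .
  have S: "ap_to_bar (Suc m) S = ins (ap_to_bar m (ap_diff (Suc m) S))"
  using first_face_step[OF P full e] unfolding S_def by (simp add: klinear_minus[OF Fk] klinear_minus[OF dk])
  have "ap_diff (Suc m) ?D + ap_diff (Suc m) S = 0"
  using ap_diff_ap_diff_whole[OF w(1)] unfolding split by (simp add: klinear_add[OF dk])
  then have dD: "ap_diff (Suc m) ?D = - ap_diff (Suc m) S" by (simp add: eq_neg_iff_add_eq_0)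
  have "bar_diff (Suc (Suc m)) (ins ?V) = ?V - ins (bar_diff (Suc m) ?V)" by (rule bar_diff_ins[OF V])
  also have "bar_diff (Suc m) ?V = ap_to_bar m (ap_diff (Suc m) ?D)" using m.IH[OF kD] by simp
  also have "?V - ins \<dots> = ?V + ap_to_bar (Suc m) S" unfolding dD S by (simp add: klinear_minus[OF Fk])
  also have "\<dots> = ap_to_bar (Suc m) (?D + S)" by (rule klinear_add[OF Fk, symmetric])
  also have "?D + S = ap_diff (Suc (Suc m)) (tri w (0, plength w))" unfolding ap_diff_whole[OF w(1)] split ..
  finally show "ap_to_bar (Suc m) (ap_diff (Suc (Suc m)) (basis (gen_list ps))) =
  bar_diff (Suc (Suc m)) (ap_to_bar (Suc (Suc m)) (basis (gen_list ps)))"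
  unfolding w(2) tri_whole[OF P, symmetric] ap_to_bar_whole[OF w(1)] by simp
 qed
qed

end

section \<open>The resolutions in coordinates\<close>

context monomial_algebra
begin

text \<open>The bimodule map \<open>H\<close> acts on coordinates as the linear map \<open>h\<close>.\<close>

definition represents where
 "represents M \<Theta> N \<Theta>' h H \<longleftrightarrow> H \<in> bimod_hom A M N \<and> (\<forall>x\<in>carrier M. \<Theta>' (H x) = h (\<Theta> x))"

lemma representsD:
 assumes "represents M \<Theta> N \<Theta>' h H"
 shows "H \<in> bimod_hom A M N" "x \<in> carrier M ==> H x \<in> carrier N" "x \<in> carrier M ==> \<Theta>' (H x) = h (\<Theta> x)"
 using assms by (auto simp: represents_def bimod_hom_def)

lemma represents_value:
 assumes "bimodule_model Q I N B' \<Theta>'" "represents M \<Theta> N \<Theta>' h H" "y \<in> carrier M" "z \<in> carrier N" "\<Theta>' z = h (\<Theta> y)"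
 shows "H y = z"
proof -
 interpret N: bimodule_model Q I N B' \<Theta>' by fact
 show ?thesis by (rule N.\<Theta>_eqD[OF representsD(2)[OF assms(2,3)] assms(4)])
  (simp only: representsD(3)[OF assms(2,3)] assms(5))
qed

lemma representsI:
 assumes M: "bimodule_model Q I M B \<Theta>" and N: "bimodule_model Q I N B' \<Theta>'" and h: "chom B h B'"
  and H: "H \<in> bimod_hom A M N"
  and B: "\<And>ps. ps \<in> B ==> 2 <= length ps \<and> gen_list ps \<in> B"
  and g: "\<And>ps. ps \<in> B ==> \<exists>y\<in>carrier M. \<Theta> y = basis (gen_list ps) \<and> \<Theta>' (H y) = h (\<Theta> y)"
 shows "represents M \<Theta> N \<Theta>' h H"
 unfolding represents_def
proof (intro conjI ballI)
 interpret M: bimodule_model Q I M B \<Theta> by fact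
 show "H \<in> bimod_hom A M N" by (rule H)
 fix x assume x: "x \<in> carrier M"
 show "\<Theta>' (H x) = h (\<Theta> x)"
 proof (rule unique_hom[OF M N h H B _ x])
  fix z ps assume z: "z \<in> carrier M" "ps \<in> B" "\<Theta> z = basis (gen_list ps)"
  obtain y where y: "y \<in> carrier M" "\<Theta> y = basis (gen_list ps)" "\<Theta>' (H y) = h (\<Theta> y)" using g[OF z(2)] by blast
  have "z = y" by (rule M.\<Theta>_eqD[OF z(1) y(1)]) (simp only: z(3) y(2))
  then show "\<Theta>' (H z) = h (\<Theta> z)" using y(3) by simp
 qed
qed

text \<open>Existence of every map in the theorem reduces to an equivariant linear map on coordinates.\<close>

lemma represents_exists:
 assumes M: "bimodule_model Q I M B \<Theta>" and N: "bimodule_model Q I N B' \<Theta>'" and h: "chom B h B'"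
 shows "\<exists>H. represents M \<Theta> N \<Theta>' h H"
 using transport_hom[OF M N h] unfolding represents_def by blast

lemma represents_comp_eq:
 assumes K: "bimodule_model Q I K B' \<Theta>''"
  and "represents M \<Theta> N \<Theta>' h H" "represents N \<Theta>' K \<Theta>'' h' H'"
  and "represents M \<Theta> N2 \<Theta>2 g G" "represents N2 \<Theta>2 K \<Theta>'' g' G'"
  and x: "x \<in> carrier M" and eq: "h' (h (\<Theta> x)) = g' (g (\<Theta> x))"
 shows "H' (H x) = G' (G x)"
proof -
 interpret K: bimodule_model Q I K B' \<Theta>'' by fact
 note 1 = representsD[OF assms(2)] and 2 = representsD[OF assms(3)] and 3 = representsD[OF assms(4)] and 4 = representsD[OF assms(5)]
 show ?thesis
  by (rule K.\<Theta>_eqD[OF 2(2)[OF 1(2)[OF x]] 4(2)[OF 3(2)[OF x]]])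
  (simp only: 2(3)[OF 1(2)[OF x]] 1(3)[OF x] 4(3)[OF 3(2)[OF x]] 3(3)[OF x] eq)
qed

lemma one_closed: "unitA \<in> carrier A" by (rule A.one_closed)

lemma bar_elem:
 assumes "gs \<in> bar_lists n"
 shows "map (pcls Q I) gs \<in> bar_gens Q I n" "bar_coord (bar_tensor Q I n (map (pcls Q I) gs)) = basis gs"
proof -
 note D = bar_listsD[OF assms]
 show "map (pcls Q I) gs \<in> bar_gens Q I n" using D(2,3) by (auto simp: bar_gens_def)
 show "bar_coord (bar_tensor Q I n (map (pcls Q I) gs)) = basis gs"
  unfolding bar_coord_tensor map_nf_pcls[OF D(7)] using theta_basis[OF D(5)] D(4) by simp
qed

lemma theta_units:
 assumes "vs \<noteq> []" "set vs <= paths Q" "comp vs"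
 shows "theta (nf unitA # map basis vs @ [nf unitA]) = basis (triv (source (hd vs)) # vs @ [triv (target Q (last vs))])"
proof -
 have s: "source (hd vs) \<in> verts Q" 
  by (rule source_in_verts[OF subsetD[OF assms(2) hd_in_set[OF assms(1)]]])
 have "theta (nf unitA # map basis vs @ [nf unitA]) = consl (nf unitA) (basis (vs @ [triv (target Q (last vs))]))"
  using theta_snoc_one[OF assms] by (subst theta_Cons) (simp_all add: nf_one)
 also have "\<dots> = ins (basis (vs @ [triv (target Q (last vs))]))"
  unfolding nf_one by (rule consl_one) (use assms s in simp)
 finally show ?thesis using assms(1) by simp
qed

lemma bar_units:
 assumes "vs \<noteq> []" "set vs <= nonzero_paths Q I" "comp vs" "n = length vs"
 shows "unitA # map (pcls Q I) vs @ [unitA] \<in> bar_gens Q I n"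
  "bar_coord (bar_tensor Q I n (unitA # map (pcls Q I) vs @ [unitA])) =
  basis (triv (source (hd vs)) # vs @ [triv (target Q (last vs))])"
proof -
 have p: "set vs <= paths Q" using assms(2) nz_paths by blast
 show "unitA # map (pcls Q I) vs @ [unitA] \<in> bar_gens Q I n" using p assms(4) by (auto simp: bar_gens_def)
 have m: "map nf (unitA # map (pcls Q I) vs @ [unitA]) = nf unitA # map basis vs @ [nf unitA]"
  using map_nf_pcls[OF assms(2)] by simp
 show "bar_coord (bar_tensor Q I n (unitA # map (pcls Q I) vs @ [unitA])) =
  basis (triv (source (hd vs)) # vs @ [triv (target Q (last vs))])"
  unfolding bar_coord_tensor m by (rule theta_units[OF assms(1) p assms(3)])
qed

lemma ap_units:
 assumes "w \<in> AP Q I n"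
 shows "ap_tensor Q I n unitA w unitA \<in> carrier (Ap Q I n)" "ap_coord (ap_tensor Q I n unitA w unitA) = tri w (0, plength w)"
proof -
 show "ap_tensor Q I n unitA w unitA \<in> carrier (Ap Q I n)" by (rule ap_tensor_closed[OF one_closed assms one_closed])
 show "ap_coord (ap_tensor Q I n unitA w unitA) = tri w (0, plength w)"
  unfolding ap_coord_tensor tri_whole[OF AP_paths[OF assms]] using theta_units[of "[w]"] AP_paths[OF assms] by simp
qed

lemma occ_coord:
 assumes T: "T \<in> paths Q" and w: "(i, j) \<in> ap_inside (zint T) n 0 (plength T)"
 shows "occ_tensor Q I n T (i, j) \<in> carrier (Ap Q I n)" "ap_coord (occ_tensor Q I n T (i, j)) = tri T (i, j)"
proof -
 have ij: "i <= j" "j <= plength T" "(i, j) \<in> ap_intervals (zint T) n" using ap_insideD[OF w] by blast+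
 have m: "pseg Q T (i, j) \<in> AP Q I n" using pseg_AP_iff[OF T ij(1,2)] ij by simp
 have p: "pseg Q T (0, i) \<in> paths Q" "pseg Q T (j, plength T) \<in> paths Q" using T ij by (simp_all add: pseg_in_paths)
 show "occ_tensor Q I n T (i, j) \<in> carrier (Ap Q I n)"
  unfolding occ_tensor_def lpart_eq rpart_eq by (rule ap_tensor_closed[OF pcls_closed[OF p(1)] m pcls_closed[OF p(2)]])
 have "theta (map basis [pseg Q T (0, i), pseg Q T (i, j), pseg Q T (j, plength T)]) =
  basis [pseg Q T (0, i), pseg Q T (i, j), pseg Q T (j, plength T)]"
  using ij by (subst theta_basis) (simp_all add: target_pseg)
 then show "ap_coord (occ_tensor Q I n T (i, j)) = tri T (i, j)"
  unfolding occ_tensor_def lpart_eq rpart_eq ap_coord_tensor tri_eq nf_pcls[OF p(1)] nf_pcls[OF p(2)] by simp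
qed

lemma theta_one_right:
 assumes "m \<in> paths Q" shows "theta [f, basis m, nf unitA] = theta [f, basis m, basis (triv (target Q m))]"
proof -
 have "theta [basis m, nf unitA] = theta [basis m, basis (triv (target Q m))]"
  using theta_snoc_one[of "[m]"] theta_basis[of "[m, triv (target Q m)]"] assms by (simp add: nf_one)
 then show ?thesis by simp
qed

lemma theta_one_left:
 assumes m: "m \<in> paths Q" shows "theta [nf unitA, basis m, f] = theta [basis (triv (source m)), basis m, f]"
proof -
 have k: "supp (theta [basis m, f]) <= {ps. source (hd ps) = source m}"
 proof
  fix ps assume "ps \<in> supp (theta [basis m, f])"
  then have "list_all2 (\<lambda>p f. p \<in> supp f) ps [basis m, f]" using keys_theta by blast
  then have "hd ps = m" by (cases ps) simp_all
  then show "ps \<in> {ps. source (hd ps) = source m}" by simp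
 qed
 have "consl (basis (triv (source m))) u = ins u" if "supp u <= {ps. source (hd ps) = source m}" for u
  using that by (induction u rule: span_induct) auto
 from this[OF k] have "consl (basis (triv (source m))) (theta [basis m, f]) = ins (theta [basis m, f])" .
 moreover have "consl (nf unitA) (theta [basis m, f]) = ins (theta [basis m, f])"
  unfolding nf_one by (rule consl_one) (use k source_in_verts[OF m] in auto)
 ultimately show ?thesis by simp
qed

lemma end_coord:
 assumes w: "w \<in> paths Q" and i: "(i, plength w) \<in> ap_inside (zint w) n 0 (plength w)"
 shows "ap_tensor Q I n (pcls Q I (lpart Q w (i, plength w))) (pseg Q w (i, plength w)) unitA \<in> carrier (Ap Q I n)"
  "ap_coord (ap_tensor Q I n (pcls Q I (lpart Q w (i, plength w))) (pseg Q w (i, plength w)) unitA) = tri w (i, plength w)"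
proof -
 have ij: "i <= plength w" "(i, plength w) \<in> ap_intervals (zint w) n" using ap_insideD[OF i] by blast+
 have m: "pseg Q w (i, plength w) \<in> AP Q I n" using pseg_AP_iff[OF w ij(1) order_refl] ij by simp
 have p: "pseg Q w (0, i) \<in> paths Q" "pseg Q w (i, plength w) \<in> paths Q" using w ij by (simp_all add: pseg_in_paths)
 show "ap_tensor Q I n (pcls Q I (lpart Q w (i, plength w))) (pseg Q w (i, plength w)) unitA \<in> carrier (Ap Q I n)"
  unfolding lpart_eq by (rule ap_tensor_closed[OF pcls_closed[OF p(1)] m one_closed])
 have r: "nf (pcls Q I (rpart Q w (i, plength w))) = basis (triv (target Q (pseg Q w (i, plength w))))"
  unfolding rpart_eq using ij target_in_verts[OF w] nf_pcls[of "triv (target Q w)"] by (simp add: target_pseg)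
 show "ap_coord (ap_tensor Q I n (pcls Q I (lpart Q w (i, plength w))) (pseg Q w (i, plength w)) unitA) = tri w (i, plength w)"
  unfolding occ_coord(2)[OF w i, symmetric] occ_tensor_def ap_coord_tensor r theta_one_right[OF p(2)] ..
qed

lemma start_coord:
 assumes w: "w \<in> paths Q" and j: "(0, j) \<in> ap_inside (zint w) n 0 (plength w)"
 shows "ap_tensor Q I n unitA (pseg Q w (0, j)) (pcls Q I (rpart Q w (0, j))) \<in> carrier (Ap Q I n)"
  "ap_coord (ap_tensor Q I n unitA (pseg Q w (0, j)) (pcls Q I (rpart Q w (0, j)))) = tri w (0, j)"
proof -
 have ij: "j <= plength w" "(0, j) \<in> ap_intervals (zint w) n" using ap_insideD[OF j] by blast+
 have m: "pseg Q w (0, j) \<in> AP Q I n" using pseg_AP_iff[OF w _ ij(1), of 0] ij by simp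
 have p: "pseg Q w (0, j) \<in> paths Q" "pseg Q w (j, plength w) \<in> paths Q" using w ij by (simp_all add: pseg_in_paths)
 show "ap_tensor Q I n unitA (pseg Q w (0, j)) (pcls Q I (rpart Q w (0, j))) \<in> carrier (Ap Q I n)"
  unfolding rpart_eq by (rule ap_tensor_closed[OF one_closed m pcls_closed[OF p(2)]])
 have l: "nf (pcls Q I (lpart Q w (0, j))) = basis (triv (source (pseg Q w (0, j))))"
  unfolding lpart_eq using source_in_verts[OF w] nf_pcls[of "triv (source w)"] by simp
 show "ap_coord (ap_tensor Q I n unitA (pseg Q w (0, j)) (pcls Q I (rpart Q w (0, j)))) = tri w (0, j)"
  unfolding occ_coord(2)[OF w j, symmetric] occ_tensor_def ap_coord_tensor l theta_one_left[OF p(1)] ..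
qed

lemma bar_diff_value:
 assumes as: "as \<in> bar_gens Q I (Suc n)"
 defines "E \<equiv> \<Oplus>\<^bsub>Bar Q I n\<^esub>i\<in>{0..n + 1}.
  let u = bar_tensor Q I n (take i as @ (as ! i \<otimes>\<^bsub>A\<^esub> as ! (i + 1)) # drop (i + 2) as)
  in if even i then u else \<ominus>\<^bsub>Bar Q I n\<^esub> u"
 shows "E \<in> carrier (Bar Q I n)" "bar_coord E = bar_diff (Suc n) (bar_coord (bar_tensor Q I (Suc n) as))"
proof -
 interpret M: bimodule_model Q I "Bar Q I n" "bar_lists n" bar_coord by (rule bar_model)
 have s: "set as <= carrier A" "length as = n + 3" using as by (auto simp: bar_gens_def)
 define t where "t i = bar_tensor Q I n (merge_gens i as)" for i
 have t: "t i \<in> carrier (Bar Q I n)" "bar_coord (t i) = merge i (bar_theta as)" if "i \<in> {0..n + 1}" for i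
 proof -
  have i: "i + 1 < length as" using that s by simp
  have "merge_gens i as \<in> bar_gens Q I n" using bar_theta_merge(2,3)[OF s(1) i] s(2) by (simp add: bar_gens_def)
  then show "t i \<in> carrier (Bar Q I n)" unfolding t_def by (rule bar_tensor_closed)
  show "bar_coord (t i) = merge i (bar_theta as)"
  unfolding t_def bar_coord_tensor by (rule bar_theta_merge(1)[OF s(1) i])
 qed
 have E: "E = (\<Oplus>\<^bsub>Bar Q I n\<^esub>i\<in>{0..n + 1}. if even i then t i else \<ominus>\<^bsub>Bar Q I n\<^esub> t i)"
  unfolding E_def t_def merge_gens_def Let_def ..
 have c: "(if even i then t i else \<ominus>\<^bsub>Bar Q I n\<^esub> t i) \<in> carrier (Bar Q I n)" if "i \<in> {0..n + 1}" for i
  using t(1)[OF that] M.M.a_inv_closed by simp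
 show "E \<in> carrier (Bar Q I n)" unfolding E by (rule M.finsum_closed[OF c])
 have "bar_coord E = (\<Sum>i\<in>{0..n + 1}. bar_coord (if even i then t i else \<ominus>\<^bsub>Bar Q I n\<^esub> t i))"
  unfolding E by (rule M.\<Theta>_finsum[OF c])
 also have "\<dots> = (\<Sum>i\<in>{0..n + 1}. if even i then merge i (bar_theta as) else - merge i (bar_theta as))"
 proof (rule sum.cong[OF refl])
  fix i assume i: "i \<in> {0..n + 1}"
  show "bar_coord (if even i then t i else \<ominus>\<^bsub>Bar Q I n\<^esub> t i) = (if even i then merge i (bar_theta as) else - merge i (bar_theta as))"
  using t[OF i] M.\<Theta>_minus[OF t(1)[OF i]] by simp
 qed
 finally show "bar_coord E = bar_diff (Suc n) (bar_coord (bar_tensor Q I (Suc n) as))"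
  unfolding bar_diff_def bar_coord_tensor atLeast0AtMost by simp
qed

lemma bar_aug_value:
 assumes "a \<in> carrier A" "c \<in> carrier A"
 shows "a \<otimes>\<^bsub>A\<^esub> c \<in> carrier (alg_bimodule Q I)" "alg_coord (a \<otimes>\<^bsub>A\<^esub> c) = bar_diff 0 (bar_coord (bar_tensor Q I 0 [a, c]))"
proof -
 show "a \<otimes>\<^bsub>A\<^esub> c \<in> carrier (alg_bimodule Q I)" using assms by (simp add: alg_bimodule_def ring.defs)
 have "merge 0 (bar_theta [a, c]) = bar_theta (merge_gens 0 [a, c])" by (rule bar_theta_merge(1)[symmetric]) (use assms in simp_all)
 then show "alg_coord (a \<otimes>\<^bsub>A\<^esub> c) = bar_diff 0 (bar_coord (bar_tensor Q I 0 [a, c]))"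
  unfolding bar_coord_tensor bar_diff_def alg_coord_def by (simp add: merge_gens_def)
qed

abbreviation bar_rep where
 "bar_rep n \<equiv> represents (Bar Q I (Suc n)) bar_coord (Bar Q I n) bar_coord (bar_diff (Suc n))"

abbreviation bar_aug_rep where
 "bar_aug_rep \<equiv> represents (Bar Q I 0) bar_coord (alg_bimodule Q I) alg_coord (bar_diff 0)"

text \<open>The clauses of the specification hold exactly for the maps with the expected coordinates; the value of
  each clause on pure tensors suffices because generators span.\<close>

theorem bar_resolution_iff:
 "is_bar_resolution Q I b \<epsilon> \<longleftrightarrow> (\<forall>n. bar_rep n (b (Suc n))) \<and> bar_aug_rep \<epsilon>"
proof
 assume r: "is_bar_resolution Q I b \<epsilon>"
 have "bar_rep n (b (Suc n))" for n
 proof (rule representsI[OF bar_model bar_model bar_diff_bar _ gen_list_bar])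
  show "b (Suc n) \<in> bimod_hom A (Bar Q I (Suc n)) (Bar Q I n)" using r by (simp add: is_bar_resolution_def)
  fix ps assume "ps \<in> bar_lists (Suc n)"
  then have "gen_list ps \<in> bar_lists (Suc n)" using gen_list_bar by blast
  note y = bar_elem[OF this]
  note e = r[unfolded is_bar_resolution_def, THEN conjunct2, THEN conjunct1, THEN spec, THEN bspec, OF y(1)]
  show "\<exists>y\<in>carrier (Bar Q I (Suc n)). bar_coord y = basis (gen_list ps) \<and> bar_coord (b (Suc n) y) = bar_diff (Suc n) (bar_coord y)"
  by (rule bexI[OF _ bar_tensor_closed[OF y(1)]], unfold e) (rule conjI[OF y(2) bar_diff_value(2)[OF y(1)]])
 qed
 moreover have "bar_aug_rep \<epsilon>"
 proof (rule representsI[OF bar_model alg_model bar_diff_alg _ gen_list_bar])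
  show "\<epsilon> \<in> bimod_hom A (Bar Q I 0) (alg_bimodule Q I)" using r by (simp add: is_bar_resolution_def)
  fix ps assume "ps \<in> bar_lists 0"
  then have g: "gen_list ps \<in> bar_lists 0" using gen_list_bar by blast
  note y = bar_elem[OF g]
  obtain x where x: "gen_list ps = [triv x, triv x]" "x \<in> verts Q" using \<open>ps \<in> bar_lists 0\<close> by (rule bar_0_E)
  let ?a = "pcls Q I (triv x)"
  have a: "?a \<in> carrier A" using x by simp
  have e: "\<epsilon> (bar_tensor Q I 0 [?a, ?a]) = ?a \<otimes>\<^bsub>A\<^esub> ?a" using r a unfolding is_bar_resolution_def by blast
  have m: "map (pcls Q I) (gen_list ps) = [?a, ?a]" using x by simp
  show "\<exists>y\<in>carrier (Bar Q I 0). bar_coord y = basis (gen_list ps) \<and> alg_coord (\<epsilon> y) = bar_diff 0 (bar_coord y)"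
  by (rule bexI[OF _ bar_tensor_closed[OF y(1)]], unfold m e)
  (rule conjI[OF y(2)[unfolded m] bar_aug_value(2)[OF a a]])
 qed
 ultimately show "(\<forall>n. bar_rep n (b (Suc n))) \<and> bar_aug_rep \<epsilon>" by blast
next
 assume r: "(\<forall>n. bar_rep n (b (Suc n))) \<and> bar_aug_rep \<epsilon>"
 then have b: "bar_rep n (b (Suc n))" and e: "bar_aug_rep \<epsilon>" for n by blast+
 show "is_bar_resolution Q I b \<epsilon>"
  unfolding is_bar_resolution_def
 proof (intro conjI allI ballI)
  fix n show "b (Suc n) \<in> bimod_hom A (Bar Q I (Suc n)) (Bar Q I n)" by (rule representsD(1)[OF b])
 next
  fix n as assume as: "as \<in> bar_gens Q I (Suc n)"
  show "b (Suc n) (bar_tensor Q I (Suc n) as) =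
  (\<Oplus>\<^bsub>Bar Q I n\<^esub>i\<in>{0..n + 1}.
  let u = bar_tensor Q I n (take i as @ (as ! i \<otimes>\<^bsub>A\<^esub> as ! (i + 1)) # drop (i + 2) as)
  in if even i then u else \<ominus>\<^bsub>Bar Q I n\<^esub> u)"
  by (rule represents_value[OF bar_model b[of n], OF bar_tensor_closed[OF as], OF bar_diff_value(1)[OF as], OF bar_diff_value(2)[OF as]])
 next
  show "\<epsilon> \<in> bimod_hom A (Bar Q I 0) (alg_bimodule Q I)" by (rule representsD(1)[OF e])
  fix a c assume ac: "a \<in> carrier A" "c \<in> carrier A"
  have "[a, c] \<in> bar_gens Q I 0" using ac by (simp add: bar_gens_def)
  then show "\<epsilon> (bar_tensor Q I 0 [a, c]) = a \<otimes>\<^bsub>A\<^esub> c"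
  by (rule represents_value[OF alg_model e bar_tensor_closed bar_aug_value[OF ac]])
 qed
qed

lemma Sub_eq: "w \<in> AP Q I n ==> Sub Q I n w = ap_inside (zint w) (n - 1) 0 (plength w)"
 unfolding Sub_def by (rule occs_AP[OF AP_paths])

lemma arrow_AP: "\<alpha> \<in> arcs Q ==> arrow Q \<alpha> \<in> AP Q I 1" by (simp add: AP_def)

lemma ends_unique:
 assumes "(a, b) \<in> ap_inside (zint w) n 0 (plength w)"
 shows "{\<zeta> \<in> ap_inside (zint w) n 0 (plength w). fst \<zeta> = a} = {(a, b)}"
  "{\<zeta> \<in> ap_inside (zint w) n 0 (plength w). snd \<zeta> = b} = {(a, b)}"
proof -
 let ?W = "ap_inside (zint w) n 0 (plength w)"
 show "{\<zeta> \<in> ?W. fst \<zeta> = a} = {(a, b)}"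
 proof (intro equalityI subsetI)
  fix \<zeta> :: occ assume "\<zeta> \<in> {\<zeta> \<in> ?W. fst \<zeta> = a}"
  then have z: "(a, snd \<zeta>) \<in> ?W" "fst \<zeta> = a" by (cases \<zeta>; simp)+ 
  have "snd \<zeta> = b" by (rule zint.ap_end_unique[OF ap_insideD(4)[OF z(1)] ap_insideD(4)[OF assms]])
  then show "\<zeta> \<in> {(a, b)}" using z(2) by (simp add: prod_eq_iff)
 next
  fix \<zeta> assume "\<zeta> \<in> {(a, b)}"
  then show "\<zeta> \<in> {\<zeta> \<in> ?W. fst \<zeta> = a}" using assms by simp
 qed
 show "{\<zeta> \<in> ?W. snd \<zeta> = b} = {(a, b)}"
 proof (intro equalityI subsetI)
  fix \<zeta> :: occ assume "\<zeta> \<in> {\<zeta> \<in> ?W. snd \<zeta> = b}"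
  then have z: "(fst \<zeta>, b) \<in> ?W" "snd \<zeta> = b" by (cases \<zeta>; simp)+
  have "fst \<zeta> = a" by (rule zint.ap_start_unique[OF ap_insideD(4)[OF z(1)] ap_insideD(4)[OF assms]])
  then show "\<zeta> \<in> {(a, b)}" using z(2) by (simp add: prod_eq_iff)
 next
  fix \<zeta> assume "\<zeta> \<in> {(a, b)}"
  then show "\<zeta> \<in> {\<zeta> \<in> ?W. snd \<zeta> = b}" using assms by simp
 qed
qed

lemma ap_odd_value:
 assumes w: "w \<in> AP Q I (Suc n)" "even n"
  and ends: "(s, plength w) \<in> ap_inside (zint w) n 0 (plength w)" "(0, e) \<in> ap_inside (zint w) n 0 (plength w)"
 defines "E \<equiv> ap_tensor Q I n (pcls Q I (lpart Q w (s, plength w))) (pseg Q w (s, plength w)) unitA \<ominus>\<^bsub>Ap Q I n\<^esub>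
  ap_tensor Q I n unitA (pseg Q w (0, e)) (pcls Q I (rpart Q w (0, e)))"
 shows "E \<in> carrier (Ap Q I n)" "ap_coord E = ap_diff (Suc n) (ap_coord (ap_tensor Q I (Suc n) unitA w unitA))"
proof -
 interpret M: bimodule_model Q I "Ap Q I n" "ap_lists n" ap_coord by (rule ap_model)
 note P = AP_paths[OF w(1)]
 note c = end_coord[OF P ends(1)] start_coord[OF P ends(2)]
 show "E \<in> carrier (Ap Q I n)" unfolding E_def by (rule M.M.minus_closed[OF c(1) c(3)])
 have "ap_coord E = tri w (s, plength w) - tri w (0, e)"
  unfolding E_def M.\<Theta>_diff[OF c(1) c(3)] c(2) c(4) ..
 also have "\<dots> = boundary_sum (zint w) (tri w) (Suc n) (0, plength w)"
  using w(2) ends_unique(2)[OF ends(1)] ends_unique(1)[OF ends(2)] by (simp add: boundary_sum_def)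
 finally show "ap_coord E = ap_diff (Suc n) (ap_coord (ap_tensor Q I (Suc n) unitA w unitA))"
  unfolding ap_units(2)[OF w(1)] ap_diff_whole[OF w(1)] .
qed

lemma ap_even_value:
 assumes w: "w \<in> AP Q I (Suc n)" "odd n"
 defines "E \<equiv> \<Oplus>\<^bsub>Ap Q I n\<^esub>\<psi>\<in>Sub Q I (Suc n) w. occ_tensor Q I n w \<psi>"
 shows "E \<in> carrier (Ap Q I n)" "ap_coord E = ap_diff (Suc n) (ap_coord (ap_tensor Q I (Suc n) unitA w unitA))"
proof -
 interpret M: bimodule_model Q I "Ap Q I n" "ap_lists n" ap_coord by (rule ap_model)
 note P = AP_paths[OF w(1)]
 have S: "Sub Q I (Suc n) w = ap_inside (zint w) n 0 (plength w)" using Sub_eq[OF w(1)] by simp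
 have c: "occ_tensor Q I n w \<psi> \<in> carrier (Ap Q I n)" "ap_coord (occ_tensor Q I n w \<psi>) = tri w \<psi>"
  if "\<psi> \<in> Sub Q I (Suc n) w" for \<psi>
  using occ_coord[OF P, of "fst \<psi>" "snd \<psi>" n] that unfolding S by simp_all
 show "E \<in> carrier (Ap Q I n)" unfolding E_def by (rule M.finsum_closed[OF c(1)])
 have "ap_coord E = (\<Sum>\<psi>\<in>Sub Q I (Suc n) w. ap_coord (occ_tensor Q I n w \<psi>))"
  unfolding E_def by (rule M.\<Theta>_finsum[OF c(1)])
 also have "\<dots> = (\<Sum>\<psi>\<in>Sub Q I (Suc n) w. tri w \<psi>)" by (rule sum.cong[OF refl c(2)])
 also have "\<dots> = boundary_sum (zint w) (tri w) (Suc n) (0, plength w)" using w(2) by (simp add: S boundary_sum_def)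
 finally show "ap_coord E = ap_diff (Suc n) (ap_coord (ap_tensor Q I (Suc n) unitA w unitA))"
  unfolding ap_units(2)[OF w(1)] ap_diff_whole[OF w(1)] .
qed

lemma Sub_odd:
 assumes w: "w \<in> AP Q I (Suc n)" "even n"
 obtains s e where "ap_inside (zint w) n 0 (plength w) = {(0, e), (s, plength w)}"
proof -
 let ?N = "plength w"
 have full: "(0, ?N) \<in> ap_intervals (zint w) (Suc n)" using w(1) AP_iff by blast
 obtain e where e: "e < ?N" "(0, e) \<in> ap_intervals (zint w) n" using zint.ap_prefix[OF full] by blast
 obtain s where s: "0 < s" "(s, ?N) \<in> ap_intervals (zint w) n" using zint.ap_suffix[OF full] by blast
 obtain m where m: "n = 2 * m" using w(2) by (rule evenE)
 have "(a, b) \<in> ap_inside (zint w) n 0 ?N \<longleftrightarrow> (a, b) = (0, e) \<or> (a, b) = (s, ?N)" for a b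
 proof
  assume "(a, b) \<in> ap_inside (zint w) n 0 ?N"
  note ab = ap_insideD[OF this]
  show "(a, b) = (0, e) \<or> (a, b) = (s, ?N)"
  proof (cases "a = 0")
  case True
  then show ?thesis using zint.ap_end_unique[OF e(2), of b] ab by simp
  next
  case False
  then have "?N <= b" using zint.ap_odd_end_le[of 0 ?N w m a b] full ab(4) m by simp
  then have "b = ?N" using ab by simp
  then show ?thesis using zint.ap_start_unique[OF s(2), of a] ab by simp
  qed
 next
  assume "(a, b) = (0, e) \<or> (a, b) = (s, ?N)"
  then show "(a, b) \<in> ap_inside (zint w) n 0 ?N" using e s by (auto simp: ap_inside_def)
 qed
 note iff = this
 have "\<zeta> \<in> ap_inside (zint w) n 0 ?N \<longleftrightarrow> \<zeta> \<in> {(0, e), (s, ?N)}" for \<zeta>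
  by (cases \<zeta>) (simp only: iff insert_iff empty_iff simp_thms)
 then have "ap_inside (zint w) n 0 ?N = {(0, e), (s, ?N)}" by (rule Set.set_eqI)
 then show ?thesis by (rule that)
qed

lemma arrow_value:
 assumes "\<alpha> \<in> arcs Q"
 defines "E \<equiv> ap_tensor Q I 0 (pcls Q I (arrow Q \<alpha>)) (triv (head Q \<alpha>)) unitA \<ominus>\<^bsub>Ap Q I 0\<^esub>
  ap_tensor Q I 0 unitA (triv (tail Q \<alpha>)) (pcls Q I (arrow Q \<alpha>))"
 shows "E \<in> carrier (Ap Q I 0)" "ap_coord E = ap_diff 1 (ap_coord (ap_tensor Q I 1 unitA (arrow Q \<alpha>) unitA))"
proof -
 let ?w = "arrow Q \<alpha>"
 have w: "?w \<in> AP Q I (Suc 0)" using arrow_AP[OF assms(1)] by simp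
 have ap0: "ap_intervals (zint ?w) 0 = {(i, i) | i. True}" by (rule zint.ap_0)
 have i: "(plength ?w, plength ?w) \<in> ap_inside (zint ?w) 0 0 (plength ?w)" "(0, 0) \<in> ap_inside (zint ?w) 0 0 (plength ?w)"
  unfolding ap_inside_def ap0 by simp_all
 have e: "lpart Q ?w (plength ?w, plength ?w) = ?w" "rpart Q ?w (0, 0) = ?w"
  "pseg Q ?w (plength ?w, plength ?w) = triv (head Q \<alpha>)" "pseg Q ?w (0, 0) = triv (tail Q \<alpha>)"
  unfolding lpart_eq rpart_eq pseg_triv vat_end by (simp_all only: pseg_full target_arrow vat_0 source_arrow)
 note v = ap_odd_value[OF w _ i, unfolded e]
 show "E \<in> carrier (Ap Q I 0)" unfolding E_def by (rule v(1)) simp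
 show "ap_coord E = ap_diff 1 (ap_coord (ap_tensor Q I 1 unitA ?w unitA))"
  unfolding E_def One_nat_def by (rule v(2)) simp
qed

lemma vertex_value:
 assumes "x \<in> verts Q"
 shows "pcls Q I (triv x) \<in> carrier (alg_bimodule Q I)"
  "alg_coord (pcls Q I (triv x)) = ap_aug (ap_coord (ap_tensor Q I 0 unitA (triv x) unitA))"
proof -
 show "pcls Q I (triv x) \<in> carrier (alg_bimodule Q I)" using assms by (simp add: alg_bimodule_def ring.defs)
 have w: "triv x \<in> AP Q I 0" using assms by (simp add: AP_def)
 have "ap_aug (basis [triv x, triv x, triv x]) = basis [triv x]"
  using ap_aug_gen[OF whole_ap_list(1)[OF w]] unfolding whole_ap_list(2)[OF w] by simp
 then show "alg_coord (pcls Q I (triv x)) = ap_aug (ap_coord (ap_tensor Q I 0 unitA (triv x) unitA))"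
  unfolding ap_units(2)[OF w] tri_whole[OF AP_paths[OF w]] alg_coord_def using assms nf_pcls[of "triv x"] by simp
qed

abbreviation ap_rep where
 "ap_rep n \<equiv> represents (Ap Q I (Suc n)) ap_coord (Ap Q I n) ap_coord (ap_diff (Suc n))"

abbreviation ap_aug_rep where
 "ap_aug_rep \<equiv> represents (Ap Q I 0) ap_coord (alg_bimodule Q I) alg_coord ap_aug"

lemma ap_representsI:
 assumes N: "bimodule_model Q I N B' \<Theta>'" and h: "chom (ap_lists n) h B'" and H: "H \<in> bimod_hom A (Ap Q I n) N"
  and g: "\<And>w. w \<in> AP Q I n ==> \<Theta>' (H (ap_tensor Q I n unitA w unitA)) = h (ap_coord (ap_tensor Q I n unitA w unitA))"
 shows "represents (Ap Q I n) ap_coord N \<Theta>' h H"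
proof (rule representsI[OF ap_model N h H gen_list_ap])
 fix ps assume "ps \<in> ap_lists n"
 then obtain w where w: "w \<in> AP Q I n" "gen_list ps = [triv (source w), w, triv (target Q w)]" by (rule ap_listsE)
 show "\<exists>y\<in>carrier (Ap Q I n). ap_coord y = basis (gen_list ps) \<and> \<Theta>' (H y) = h (ap_coord y)"
  by (rule bexI[OF _ ap_units(1)[OF w(1)]], rule conjI[OF _ g[OF w(1)]])
  (simp only: ap_units(2)[OF w(1)] tri_whole[OF AP_paths[OF w(1)]] w(2))
qed

theorem Bardzell_resolution_iff:
 "is_Bardzell_resolution Q I d \<mu> \<longleftrightarrow> (\<forall>n. ap_rep n (d (Suc n))) \<and> ap_aug_rep \<mu>"
proof
 assume "is_Bardzell_resolution Q I d \<mu>"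
 note r = this[unfolded is_Bardzell_resolution_def]
 note r1 = r[THEN conjunct1] and r2 = r[THEN conjunct2, THEN conjunct1]
  and r3 = r[THEN conjunct2, THEN conjunct2, THEN conjunct1]
  and r4 = r[THEN conjunct2, THEN conjunct2, THEN conjunct2, THEN conjunct1]
  and r5 = r[THEN conjunct2, THEN conjunct2, THEN conjunct2, THEN conjunct2]
 have "ap_rep n (d (Suc n))" for n
 proof (rule ap_representsI[OF ap_model ap_diff_chom_Suc r1[THEN spec]])
  fix w assume w: "w \<in> AP Q I (Suc n)"
  have "n = 0 \<or> odd n \<or> even n \<and> 2 <= n" by presburger
  then consider "n = 0" | "odd n" | "even n" "2 <= n" by blast
  then show "ap_coord (d (Suc n) (ap_tensor Q I (Suc n) unitA w unitA)) =
  ap_diff (Suc n) (ap_coord (ap_tensor Q I (Suc n) unitA w unitA))"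
  proof cases
  case 1
  then obtain \<alpha> where a: "\<alpha> \<in> arcs Q" "w = arrow Q \<alpha>" using w by (auto simp: AP_def)
  show ?thesis using arrow_value(2)[OF a(1)] unfolding r2[THEN bspec, OF a(1), symmetric] a(2) 1 One_nat_def .
  next
  case 2
  then have "even (Suc n)" by simp
  then obtain m where m: "Suc n = 2 * m" by (rule evenE)
  have m1: "1 <= m" "2 * m - 1 = n" using m by simp_all
  have "w \<in> AP Q I (2 * m)" using w m by simp
  then have e: "d (2 * m) (ap_tensor Q I (2 * m) unitA w unitA) =
  (\<Oplus>\<^bsub>Ap Q I (2 * m - 1)\<^esub>\<psi>\<in>Sub Q I (2 * m) w. occ_tensor Q I (2 * m - 1) w \<psi>)"
  using r3 m1(1) by blast
  show ?thesis unfolding e[unfolded m1(2), folded m] by (rule ap_even_value(2)[OF w 2])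
  next
  case 3
  obtain m where m: "n = 2 * m" using 3(1) by (rule evenE)
  have m1: "1 <= m" "2 * m + 1 = Suc n" using m 3 by simp_all
  obtain s e where S: "ap_inside (zint w) n 0 (plength w) = {(0, e), (s, plength w)}" by (rule Sub_odd[OF w 3(1)])
  have S': "Sub Q I (2 * m + 1) w = {(0, e), (s, plength w)}" unfolding m1(2) Sub_eq[OF w] using S by simp
  have w': "w \<in> AP Q I (2 * m + 1)" using w m1 by simp
  have e: "d (2 * m + 1) (ap_tensor Q I (2 * m + 1) unitA w unitA) =
  ap_tensor Q I (2 * m) (pcls Q I (lpart Q w (s, plength w))) (pseg Q w (s, plength w)) unitA \<ominus>\<^bsub>Ap Q I (2 * m)\<^esub>
  ap_tensor Q I (2 * m) unitA (pseg Q w (0, e)) (pcls Q I (rpart Q w (0, e)))"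
  by (rule r4[THEN spec, THEN mp, OF m1(1), THEN bspec, OF w', THEN spec, THEN spec, THEN mp]) (simp add: S'[simplified])
  show ?thesis unfolding e[unfolded m1(2), folded m]
  by (rule ap_odd_value(2)[OF w 3(1)]) (simp_all add: S)
  qed
 qed
 moreover have "ap_aug_rep \<mu>"
 proof (rule ap_representsI[OF alg_model ap_aug_chom r5[THEN conjunct1]])
  fix w assume "w \<in> AP Q I 0"
  then obtain x where x: "w = triv x" "x \<in> verts Q" by (auto simp: AP_def)
  have e: "\<mu> (ap_tensor Q I 0 unitA (triv x) unitA) = pcls Q I (triv x)" using r5 x(2) by blast
  show "alg_coord (\<mu> (ap_tensor Q I 0 unitA w unitA)) = ap_aug (ap_coord (ap_tensor Q I 0 unitA w unitA))"
  unfolding x(1) e by (rule vertex_value(2)[OF x(2)])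
 qed
 ultimately show "(\<forall>n. ap_rep n (d (Suc n))) \<and> ap_aug_rep \<mu>" by blast
next
 assume "(\<forall>n. ap_rep n (d (Suc n))) \<and> ap_aug_rep \<mu>"
 then have d: "ap_rep n (d (Suc n))" and e: "ap_aug_rep \<mu>" for n by blast+
 have D1: "\<forall>n. d (Suc n) \<in> bimod_hom A (Ap Q I (Suc n)) (Ap Q I n)"
  by (rule allI) (rule representsD(1)[OF d])
 have D2: "d 1 (ap_tensor Q I 1 unitA (arrow Q \<alpha>) unitA) =
  ap_tensor Q I 0 (pcls Q I (arrow Q \<alpha>)) (triv (head Q \<alpha>)) unitA \<ominus>\<^bsub>Ap Q I 0\<^esub>
  ap_tensor Q I 0 unitA (triv (tail Q \<alpha>)) (pcls Q I (arrow Q \<alpha>))"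
  if a: "\<alpha> \<in> arcs Q" for \<alpha>
 proof -
  have d1: "represents (Ap Q I 1) ap_coord (Ap Q I 0) ap_coord (ap_diff 1) (d 1)"
  using d[of 0] by (simp only: One_nat_def)
  show ?thesis
  by (rule represents_value[OF ap_model d1, OF ap_units(1)[OF arrow_AP[OF a]], OF arrow_value(1)[OF a], OF arrow_value(2)[OF a]])
 qed
 have D3: "d (2 * m) (ap_tensor Q I (2 * m) unitA w unitA) =
  (\<Oplus>\<^bsub>Ap Q I (2 * m - 1)\<^esub>\<psi>\<in>Sub Q I (2 * m) w. occ_tensor Q I (2 * m - 1) w \<psi>)"
  if m: "1 <= m" and w: "w \<in> AP Q I (2 * m)" for m w
 proof -
  define n where "n = 2 * m - 1"
  have n: "2 * m = Suc n" "odd n" using m by (simp_all add: n_def)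
  show ?thesis
  unfolding n_def[symmetric] unfolding n(1)
  by (rule represents_value[OF ap_model d[of n], OF ap_units(1)[OF w[unfolded n(1)]],
  OF ap_even_value(1)[OF w[unfolded n(1)] n(2)], OF ap_even_value(2)[OF w[unfolded n(1)] n(2)]])
 qed
 have D4: "d (2 * m + 1) (ap_tensor Q I (2 * m + 1) unitA w unitA) =
  ap_tensor Q I (2 * m) (pcls Q I (lpart Q w \<psi>\<^sub>2)) (pseg Q w \<psi>\<^sub>2) unitA \<ominus>\<^bsub>Ap Q I (2 * m)\<^esub>
  ap_tensor Q I (2 * m) unitA (pseg Q w \<psi>\<^sub>1) (pcls Q I (rpart Q w \<psi>\<^sub>1))"
  if w: "w \<in> AP Q I (2 * m + 1)"
  and S: "Sub Q I (2 * m + 1) w = {\<psi>\<^sub>1, \<psi>\<^sub>2} \<and> fst \<psi>\<^sub>1 = 0 \<and> snd \<psi>\<^sub>2 = plength w" for m w \<psi>\<^sub>1 \<psi>\<^sub>2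
 proof -
  have w': "w \<in> AP Q I (Suc (2 * m))" using w by simp
  obtain e where e: "\<psi>\<^sub>1 = (0, e)" using S by (cases \<psi>\<^sub>1) auto
  obtain s where s: "\<psi>\<^sub>2 = (s, plength w)" using S by (cases \<psi>\<^sub>2) auto
  have S': "ap_inside (zint w) (2 * m) 0 (plength w) = {(0, e), (s, plength w)}"
  using S Sub_eq[OF w'] unfolding e s by simp
  have i: "(s, plength w) \<in> ap_inside (zint w) (2 * m) 0 (plength w)" "(0, e) \<in> ap_inside (zint w) (2 * m) 0 (plength w)"
  unfolding S' by simp_all
  have ev: "even (2 * m)" by simp
  show ?thesis
  unfolding e s Suc_eq_plus1[symmetric]
  by (rule represents_value[OF ap_model d[of "2 * m"], OF ap_units(1)[OF w'], OF ap_odd_value(1)[OF w' ev i], OF ap_odd_value(2)[OF w' ev i]])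
 qed
 have D6: "\<mu> (ap_tensor Q I 0 unitA (triv x) unitA) = pcls Q I (triv x)" if x: "x \<in> verts Q" for x
 proof -
  have w: "triv x \<in> AP Q I 0" using x by (simp add: AP_def)
  show ?thesis by (rule represents_value[OF alg_model e, OF ap_units(1)[OF w], OF vertex_value(1)[OF x], OF vertex_value(2)[OF x]])
 qed
 show "is_Bardzell_resolution Q I d \<mu>"
  unfolding is_Bardzell_resolution_def
  apply (rule conjI[OF D1])
  apply (rule conjI)
  apply (rule ballI, erule D2)
  apply (rule conjI)
  apply (rule allI, rule impI, rule ballI, erule (1) D3)
  apply (rule conjI)
  apply (rule allI, rule impI, rule ballI, rule allI, rule allI, rule impI, erule (1) D4)
  apply (rule conjI[OF representsD(1)[OF e]])
  apply (rule ballI, erule D6)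
  done
qed

end

section \<open>The map F in coordinates\<close>

context monomial_algebra
begin

abbreviation F_rep where
 "F_rep n \<equiv> represents (Ap Q I n) ap_coord (Bar Q I n) bar_coord (ap_to_bar n)"

lemma vertex_AP: "x \<in> verts Q ==> triv x \<in> AP Q I 0" by (simp add: AP_def)

lemma F_value_vertex:
 assumes x: "x \<in> verts Q"
 defines "E \<equiv> bar_tensor Q I 0 [pcls Q I (triv x), unitA]"
 shows "E \<in> carrier (Bar Q I 0)" "bar_coord E = ap_to_bar 0 (ap_coord (ap_tensor Q I 0 unitA (triv x) unitA))"
proof -
 note w = vertex_AP[OF x]
 have "[pcls Q I (triv x), unitA] \<in> bar_gens Q I 0" using x by (simp add: bar_gens_def)
 then show "E \<in> carrier (Bar Q I 0)" unfolding E_def by (rule bar_tensor_closed)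
 have "bar_coord E = basis [triv x, triv x]"
  unfolding E_def bar_coord_tensor using theta_snoc_one[of "[triv x]"] nf_pcls[of "triv x"] x by (simp add: nf_one)
 also have "\<dots> = ap_to_bar 0 (basis [triv x, triv x, triv x])"
  using ap_to_bar_gen[OF whole_ap_list(1)[OF w]] unfolding whole_ap_list(2)[OF w] by simp
 finally show "bar_coord E = ap_to_bar 0 (ap_coord (ap_tensor Q I 0 unitA (triv x) unitA))"
  unfolding ap_units(2)[OF w] tri_whole[OF AP_paths[OF w]] by simp
qed

lemma F_value_arrow:
 assumes a: "\<alpha> \<in> arcs Q"
 defines "E \<equiv> bar_tensor Q I 1 [unitA, pcls Q I (arrow Q \<alpha>), unitA]"
 shows "E \<in> carrier (Bar Q I 1)" "bar_coord E = ap_to_bar 1 (ap_coord (ap_tensor Q I 1 unitA (arrow Q \<alpha>) unitA))"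
proof -
 let ?w = "arrow Q \<alpha>"
 have w: "?w \<in> AP Q I (Suc 0)" using arrow_AP[OF a] by simp
 note P = AP_paths[OF w]
 have nw: "nz ?w" by (rule nz_arrow[OF a])
 have E: "E \<in> carrier (Bar Q I (Suc 0))" "bar_coord E = basis [triv (source ?w), ?w, triv (target Q ?w)]"
  using bar_tensor_closed[OF bar_units(1)[of "[?w]" "Suc 0"]] bar_units(2)[of "[?w]" "Suc 0"] nw
  unfolding E_def by simp_all
 then show "E \<in> carrier (Bar Q I 1)" by simp
 have st: "source ?w \<in> verts Q" "target Q ?w \<in> verts Q" using source_in_verts[OF P] target_in_verts[OF P] by simp_all
 have l: "plength ?w = 1" by simp
 have ap0: "ap_intervals (zint ?w) 0 = {(i, i) | i. True}" by (rule zint.ap_0)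
 have p01: "pseg Q ?w (0, Suc 0) = ?w" using pseg_full[of Q ?w] l by simp
 have v1: "vat Q ?w (Suc 0) = target Q ?w" using vat_end[of Q ?w] l by simp
 have "{\<zeta> \<in> ap_inside (zint ?w) 0 0 (plength ?w). 0 < fst \<zeta>} = {(1, 1)}"
  unfolding ap_inside_def ap0 l by auto
 then have D: "later_faces (Suc 0) ?w = basis [?w, triv (target Q ?w), triv (target Q ?w)]"
  unfolding later_faces_def using nw st p01 v1 by (simp add: tri_eq)
 have "ap_to_bar 0 (basis [?w, triv (target Q ?w), triv (target Q ?w)]) = basis [?w, triv (target Q ?w)]"
  unfolding ap_to_bar_def hext_basis using nw st by (simp add: gen_list_def mul_single)
 then have "ap_to_bar (Suc 0) (tri ?w (0, plength ?w)) = bar_coord E"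
  unfolding ap_to_bar_whole[OF w] D E(2) by simp
 then show "bar_coord E = ap_to_bar 1 (ap_coord (ap_tensor Q I 1 unitA ?w unitA))"
  unfolding One_nat_def ap_units(2)[OF w] by simp
qed

lemma F_value:
 assumes w: "w \<in> AP Q I (Suc (Suc m))" and F: "F_rep (Suc m) F"
 defines "E \<equiv> \<Oplus>\<^bsub>Bar Q I (Suc (Suc m))\<^esub>\<zeta>\<in>{\<zeta> \<in> Sub Q I (Suc (Suc m)) w. \<exists>\<zeta>'\<in>Sub Q I (Suc (Suc m)) w. fst \<zeta>' < fst \<zeta>}.
  one_tensor Q I (Suc m)
  (ract (Bar Q I (Suc m))
  (lact (Bar Q I (Suc m)) (pcls Q I (lpart Q w \<zeta>))
  (F (ap_tensor Q I (Suc m) unitA (pseg Q w \<zeta>) unitA)))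
  (pcls Q I (rpart Q w \<zeta>)))"
 shows "E \<in> carrier (Bar Q I (Suc (Suc m)))"
  "bar_coord E = ap_to_bar (Suc (Suc m)) (ap_coord (ap_tensor Q I (Suc (Suc m)) unitA w unitA))"
proof -
 interpret B: bimodule_model Q I "Bar Q I (Suc m)" "bar_lists (Suc m)" bar_coord by (rule bar_model)
 interpret B': bimodule_model Q I "Bar Q I (Suc (Suc m))" "bar_lists (Suc (Suc m))" bar_coord by (rule bar_model)
 note P = AP_paths[OF w]
 let ?W = "ap_inside (zint w) (Suc m) 0 (plength w)"
 define S where "S = {\<zeta> \<in> ?W. 0 < fst \<zeta>}"
 define t where "t \<zeta> = one_tensor Q I (Suc m)
  (ract (Bar Q I (Suc m))
  (lact (Bar Q I (Suc m)) (pcls Q I (lpart Q w \<zeta>))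
  (F (ap_tensor Q I (Suc m) unitA (pseg Q w \<zeta>) unitA)))
  (pcls Q I (rpart Q w \<zeta>)))" for \<zeta>
 have "(0, plength w) \<in> ap_intervals (zint w) (Suc (Suc m))" using w AP_iff by blast
 then obtain e where e: "e < plength w" "(0, e) \<in> ap_intervals (zint w) (Suc m)" using zint.ap_prefix by blast
 then have e': "(0, e) \<in> ?W" by (simp add: ap_inside_def)
 have Sub: "Sub Q I (Suc (Suc m)) w = ?W" using Sub_eq[OF w] by simp
 have S: "{\<zeta> \<in> Sub Q I (Suc (Suc m)) w. \<exists>\<zeta>'\<in>Sub Q I (Suc (Suc m)) w. fst \<zeta>' < fst \<zeta>} = S"
 proof (intro equalityI subsetI)
  fix \<zeta> assume "\<zeta> \<in> {\<zeta> \<in> Sub Q I (Suc (Suc m)) w. \<exists>\<zeta>'\<in>Sub Q I (Suc (Suc m)) w. fst \<zeta>' < fst \<zeta>}"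
  then have "\<zeta> \<in> ?W" "\<exists>\<zeta>'\<in>?W. fst \<zeta>' < fst \<zeta>" unfolding Sub by blast+
  then show "\<zeta> \<in> S" unfolding S_def by (metis (no_types, lifting) gr0I mem_Collect_eq not_less_zero)
 next
  fix \<zeta> assume "\<zeta> \<in> S"
  then have "\<zeta> \<in> ?W" "fst (0 :: nat, e) < fst \<zeta>" unfolding S_def by simp_all
  then show "\<zeta> \<in> {\<zeta> \<in> Sub Q I (Suc (Suc m)) w. \<exists>\<zeta>'\<in>Sub Q I (Suc (Suc m)) w. fst \<zeta>' < fst \<zeta>}"
  unfolding Sub using e' by blast
 qed
 have E: "E = (\<Oplus>\<^bsub>Bar Q I (Suc (Suc m))\<^esub>\<zeta>\<in>S. t \<zeta>)" unfolding E_def S t_def ..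
 have t: "t \<zeta> \<in> carrier (Bar Q I (Suc (Suc m))) \<and> bar_coord (t \<zeta>) = ins (ap_to_bar (Suc m) (tri w \<zeta>))" if "\<zeta> \<in> S" for \<zeta>
 proof -
  obtain i j where \<zeta>: "\<zeta> = (i, j)" by (cases \<zeta>)
  have "(i, j) \<in> ?W" using that unfolding S_def \<zeta> by simp
  note ij = ap_insideD[OF this]
  let ?L = "pseg Q w (0, i)" and ?R = "pseg Q w (j, plength w)" and ?v = "pseg Q w (i, j)"
  have p: "?L \<in> paths Q" "?R \<in> paths Q" using P ij by (simp_all add: pseg_in_paths)
  have v: "?v \<in> AP Q I (Suc m)" using pseg_AP_iff[OF P ij(1,3)] ij(4) by simp
  have l: "plength ?v = j - i" using ij by simp
  note u = ap_units[OF v]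
  define x where "x = F (ap_tensor Q I (Suc m) unitA ?v unitA)"
  have x: "x \<in> carrier (Bar Q I (Suc m))" "bar_coord x = ap_to_bar (Suc m) (tri ?v (0, plength ?v))"
  unfolding x_def using representsD(2,3)[OF F u(1)] u(2) by simp_all
  have X: "supp (tri ?v (0, plength ?v)) <= ap_lists (Suc m)"
  using whole_ap_list(1)[OF v] tri_whole[OF AP_paths[OF v]] by simp
  have nzk: "supp (bar_coord x) <= nzlists" using B.\<Theta>_keys[OF x(1)] B.B_nz by blast
  have c: "lact (Bar Q I (Suc m)) (pcls Q I ?L) x \<in> carrier (Bar Q I (Suc m))"
  by (rule B.lact_closed[OF pcls_closed[OF p(1)] x(1)])
  have c': "ract (Bar Q I (Suc m)) (lact (Bar Q I (Suc m)) (pcls Q I ?L) x) (pcls Q I ?R) \<in> carrier (Bar Q I (Suc m))"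
  by (rule B.ract_closed[OF pcls_closed[OF p(2)] c])
  have l': "lmul (nf (pcls Q I ?L)) (bar_coord x) = lmul (basis ?L) (bar_coord x)"
  unfolding nf_pcls[OF p(1)] using lmul_zpath[OF _ nzk, of ?L] p(1) by (simp add: nonzero_iff)
  have kl: "supp (lmul (basis ?L) (bar_coord x)) <= nzlists" by (rule keys_lmul[OF nzk])
  have r': "rmul (nf (pcls Q I ?R)) (lmul (basis ?L) (bar_coord x)) = rmul (basis ?R) (lmul (basis ?L) (bar_coord x))"
  unfolding nf_pcls[OF p(2)] using rmul_zpath[OF _ kl, of ?R] p(2) by (simp add: nonzero_iff)
  have P1: "supp (basis ?L :: ('v, 'a) path \<Rightarrow>\<^sub>0 'k) <= paths Q"
  "supp (basis ?R :: ('v, 'a) path \<Rightarrow>\<^sub>0 'k) <= paths Q" using p by simp_all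
  have kr: "supp (rmul (basis ?R) (tri ?v (0, plength ?v))) <= ap_lists (Suc m)"
  proof (cases "nz ?R")
  case True
  then show ?thesis by (rule bimod_listsD(3)[OF bimod_lists_ap _ X])
  next
  case False
  then have "zpath ?R" using p(2) by (simp add: nonzero_iff)
  then have "rmul (basis ?R) (tri ?v (0, plength ?v)) = 0"
  by (rule rmul_zpath) (use X bimod_listsD(1)[OF bimod_lists_ap] in blast)
  then show ?thesis by simp
  qed
  have "bar_coord (ract (Bar Q I (Suc m)) (lact (Bar Q I (Suc m)) (pcls Q I ?L) x) (pcls Q I ?R)) =
  lmul (basis ?L) (rmul (basis ?R) (bar_coord x))"
  unfolding B.\<Theta>_ract[OF pcls_closed[OF p(2)] c] B.\<Theta>_lact[OF pcls_closed[OF p(1)] x(1)] l' r'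
  by (rule lmul_rmul[OF P1 nzk, symmetric])
  also have "\<dots> = ap_to_bar (Suc m) (lmul (basis ?L) (rmul (basis ?R) (tri ?v (0, plength ?v))))"
  unfolding x(2) chom_mul_path(1)[OF ap_to_bar_chom bimod_lists_ap bimod_lists_bar p(1) kr]
  chom_mul_path(2)[OF ap_to_bar_chom bimod_lists_ap bimod_lists_bar p(2) X] ..
  also have "lmul (basis ?L) (rmul (basis ?R) (tri ?v (0, plength ?v))) = tri w (i, j)"
  using tri_seg[OF P ij(1,3), of 0 "j - i"] ij(1) unfolding l by simp
  finally have cx: "bar_coord (ract (Bar Q I (Suc m)) (lact (Bar Q I (Suc m)) (pcls Q I ?L) x) (pcls Q I ?R)) =
  ap_to_bar (Suc m) (tri w (i, j))" .
  show ?thesis unfolding t_def \<zeta> lpart_eq rpart_eq x_def[symmetric]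
  using one_tensor_coord[OF c'] unfolding cx by blast
 qed
 have tc: "t \<zeta> \<in> carrier (Bar Q I (Suc (Suc m)))" if "\<zeta> \<in> S" for \<zeta> using t[OF that] by blast
 show "E \<in> carrier (Bar Q I (Suc (Suc m)))" unfolding E by (rule B'.finsum_closed[OF tc])
 have "bar_coord E = (\<Sum>\<zeta>\<in>S. bar_coord (t \<zeta>))" unfolding E by (rule B'.\<Theta>_finsum[OF tc])
 also have "\<dots> = (\<Sum>\<zeta>\<in>S. ins (ap_to_bar (Suc m) (tri w \<zeta>)))" by (rule sum.cong[OF refl conjunct2[OF t]])
 also have "\<dots> = ins (ap_to_bar (Suc m) (later_faces (Suc (Suc m)) w))"
  unfolding later_faces_def diff_Suc_1 S_def[symmetric] klinear_sum[OF chom_klinear[OF ap_to_bar_chom]]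
  klinear_sum[OF klinear_ins] ..
 also have "\<dots> = ap_to_bar (Suc (Suc m)) (ap_coord (ap_tensor Q I (Suc (Suc m)) unitA w unitA))"
  unfolding ap_units(2)[OF w] ap_to_bar_whole[OF w] ..
 finally show "bar_coord E = ap_to_bar (Suc (Suc m)) (ap_coord (ap_tensor Q I (Suc (Suc m)) unitA w unitA))" .
qed

theorem is_F_iff: "is_F Q I F \<longleftrightarrow> (\<forall>n. F_rep n (F n))"
proof
 assume "is_F Q I F"
 note r = this[unfolded is_F_def]
 note r1 = r[THEN conjunct1] and r2 = r[THEN conjunct2, THEN conjunct1]
  and r3 = r[THEN conjunct2, THEN conjunct2, THEN conjunct1]
  and r4 = r[THEN conjunct2, THEN conjunct2, THEN conjunct2]
 have "F_rep n (F n)" for n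
 proof (induction n)
  case 0
  show ?case
  proof (rule ap_representsI[OF bar_model ap_to_bar_chom r1[THEN spec]])
  fix w assume "w \<in> AP Q I 0"
  then obtain x where x: "w = triv x" "x \<in> verts Q" by (auto simp: AP_def)
  show "bar_coord (F 0 (ap_tensor Q I 0 unitA w unitA)) = ap_to_bar 0 (ap_coord (ap_tensor Q I 0 unitA w unitA))"
  unfolding x(1) r2[THEN bspec, OF x(2)] by (rule F_value_vertex(2)[OF x(2)])
  qed
 next
  case (Suc k)
  show ?case
  proof (rule ap_representsI[OF bar_model ap_to_bar_chom r1[THEN spec]])
  fix w assume w: "w \<in> AP Q I (Suc k)"
  show "bar_coord (F (Suc k) (ap_tensor Q I (Suc k) unitA w unitA)) =
  ap_to_bar (Suc k) (ap_coord (ap_tensor Q I (Suc k) unitA w unitA))"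
  proof (cases k)
  case 0
  then obtain \<alpha> where a: "w = arrow Q \<alpha>" "\<alpha> \<in> arcs Q" using w by (auto simp: AP_def)
  have "bar_coord (F 1 (ap_tensor Q I 1 unitA (arrow Q \<alpha>) unitA)) =
  ap_to_bar 1 (ap_coord (ap_tensor Q I 1 unitA (arrow Q \<alpha>) unitA))"
  unfolding r3[THEN bspec, OF a(2)] by (rule F_value_arrow(2)[OF a(2)])
  then show ?thesis unfolding a(1) 0 One_nat_def .
  next
  case k: (Suc m)
  have w': "w \<in> AP Q I (Suc (Suc m))" using w k by simp
  have F: "F_rep (Suc m) (F (Suc m))" using Suc.IH k by simp
  have n2: "2 <= Suc (Suc m)" by simp
  show ?thesis using F_value(2)[OF w' F] r4[THEN spec, THEN mp, OF n2, THEN bspec, OF w'] unfolding k diff_Suc_1 by simp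
  qed
  qed
 qed
 then show "\<forall>n. F_rep n (F n)" by blast
next
 assume "\<forall>n. F_rep n (F n)"
 then have F: "F_rep n (F n)" for n by blast
 have F0: "F 0 (ap_tensor Q I 0 unitA (triv x) unitA) = bar_tensor Q I 0 [pcls Q I (triv x), unitA]" if x: "x \<in> verts Q" for x
  by (rule represents_value[OF bar_model F[of 0], OF ap_units(1)[OF vertex_AP[OF x]], OF F_value_vertex(1)[OF x], OF F_value_vertex(2)[OF x]])
 have F1: "F 1 (ap_tensor Q I 1 unitA (arrow Q \<alpha>) unitA) = bar_tensor Q I 1 [unitA, pcls Q I (arrow Q \<alpha>), unitA]"
  if a: "\<alpha> \<in> arcs Q" for \<alpha>
  by (rule represents_value[OF bar_model F[of 1], OF ap_units(1)[OF arrow_AP[OF a]], OF F_value_arrow(1)[OF a], OF F_value_arrow(2)[OF a]])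
 have F2: "F n (ap_tensor Q I n unitA w unitA) =
  (\<Oplus>\<^bsub>Bar Q I n\<^esub>\<zeta>\<in>{\<zeta> \<in> Sub Q I n w. \<exists>\<zeta>'\<in>Sub Q I n w. fst \<zeta>' < fst \<zeta>}.
  one_tensor Q I (n - 1)
  (ract (Bar Q I (n - 1))
  (lact (Bar Q I (n - 1)) (pcls Q I (lpart Q w \<zeta>))
  (F (n - 1) (ap_tensor Q I (n - 1) unitA (pseg Q w \<zeta>) unitA)))
  (pcls Q I (rpart Q w \<zeta>))))" if n: "2 <= n" and w: "w \<in> AP Q I n" for n w
 proof -
  define m where "m = n - 2"
  have m: "n = Suc (Suc m)" using n by (simp add: m_def)
  have w': "w \<in> AP Q I (Suc (Suc m))" using w m by simp
  show ?thesis unfolding m diff_Suc_1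
  by (rule represents_value[OF bar_model F[of "Suc (Suc m)"], OF ap_units(1)[OF w'], OF F_value(1)[OF w' F], OF F_value(2)[OF w' F]])
 qed
 have F3: "\<forall>n. F n \<in> bimod_hom A (Ap Q I n) (Bar Q I n)" by (rule allI) (rule representsD(1)[OF F])
 show "is_F Q I F"
  unfolding is_F_def
  apply (rule conjI[OF F3])
  apply (rule conjI)
  apply (rule ballI, erule F0)
  apply (rule conjI)
  apply (rule ballI, erule F1)
  apply (rule allI, rule impI, rule ballI, erule (1) F2)
  done
qed

end

section \<open>The map G in coordinates\<close>

context monomial_algebra
begin

abbreviation G_rep where
 "G_rep n \<equiv> represents (Bar Q I n) bar_coord (Ap Q I n) ap_coord (bar_to_ap n)"

abbreviation bar_unit where
 "bar_unit n vs \<equiv> bar_tensor Q I n (unitA # map (pcls Q I) vs @ [unitA])"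

lemma pos_snoc_triv: "pos (vs @ [triv x]) k = pos vs k"
 by (cases "k - length vs") (simp_all add: pos_def)

lemma pos_triv_Cons: "pos (triv y # vs @ [triv x]) (Suc k) = pos vs k"
 by (simp add: pos_snoc_triv)

lemma pconcat_trivs: "vs \<noteq> [] ==> pconcat (triv (source (hd vs)) # vs @ [triv x]) = pconcat vs"
 by (simp add: pconcat_def triv_def source_def)

lemma unit_list:
 assumes vs: "vs \<noteq> []" "set vs <= nonzero_paths Q I" "comp vs" "n = length vs"
 shows "triv (source (hd vs)) # vs @ [triv (target Q (last vs))] \<in> bar_lists n"
proof -
 have h: "nz (hd vs)" "nz (last vs)" using vs(1,2) hd_in_set[OF vs(1)] last_in_set[OF vs(1)] by blast+
 have "source (hd vs) \<in> verts Q" "target Q (last vs) \<in> verts Q"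
  using source_in_verts[OF nz_paths[OF h(1)]] target_in_verts[OF nz_paths[OF h(2)]] by simp_all
 then show ?thesis using vs by (simp add: bar_lists_def successively_append_iff successively_Cons)
qed

lemma G_unit:
 assumes vs: "vs \<noteq> []" "set vs <= nonzero_paths Q I" "comp vs" "n = length vs"
 shows "bar_unit n vs \<in> carrier (Bar Q I n)"
  "bar_to_ap n (bar_coord (bar_unit n vs)) = cut_sum (zint (pconcat vs)) (tri (pconcat vs)) n (pos vs)"
proof -
 show "bar_unit n vs \<in> carrier (Bar Q I n)" by (rule bar_tensor_closed[OF bar_units(1)[OF vs]])
 show "bar_to_ap n (bar_coord (bar_unit n vs)) = cut_sum (zint (pconcat vs)) (tri (pconcat vs)) n (pos vs)"
  unfolding bar_units(2)[OF vs] bar_to_ap_basis[OF unit_list[OF vs]] pconcat_trivs[OF vs(1)] pos_triv_Cons ..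
qed

lemma G_value_zero:
 defines "E \<equiv> \<Oplus>\<^bsub>Ap Q I 0\<^esub>x\<in>verts Q. ap_tensor Q I 0 unitA (triv x) unitA"
  and "u \<equiv> bar_tensor Q I 0 [unitA, unitA]"
 shows "E \<in> carrier (Ap Q I 0)" "u \<in> carrier (Bar Q I 0)"
  "bar_coord u = (\<Sum>x\<in>verts Q. basis [triv x, triv x])" "ap_coord E = bar_to_ap 0 (bar_coord u)"
proof -
 interpret M: bimodule_model Q I "Ap Q I 0" "ap_lists 0" ap_coord by (rule ap_model)
 have w: "triv x \<in> AP Q I 0" if "x \<in> verts Q" for x using that by (simp add: AP_def)
 show "E \<in> carrier (Ap Q I 0)" unfolding E_def by (rule M.finsum_closed[OF ap_units(1)[OF w]])
 have "[unitA, unitA] \<in> bar_gens Q I 0" by (simp add: bar_gens_def)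
 then show "u \<in> carrier (Bar Q I 0)" unfolding u_def by (rule bar_tensor_closed)
 have s: "sing (\<Sum>x\<in>verts Q. basis (triv x)) = (\<Sum>x\<in>verts Q. basis [triv x])"
  unfolding sing_def klinear_sum[OF klinear_lin] by simp
 have k: "supp (\<Sum>x\<in>verts Q. basis [triv x] :: ('v, 'a) path list \<Rightarrow>\<^sub>0 'k) <= {ps. source (hd ps) \<in> verts Q}"
  by (rule keys_sum_subset) simp
 show u: "bar_coord u = (\<Sum>x\<in>verts Q. basis [triv x, triv x])"
  unfolding u_def bar_coord_tensor by (simp add: nf_one s consl_one[OF k] klinear_sum[OF klinear_ins])
 have "ap_coord E = (\<Sum>x\<in>verts Q. ap_coord (ap_tensor Q I 0 unitA (triv x) unitA))"
  unfolding E_def by (rule M.\<Theta>_finsum[OF ap_units(1)[OF w]])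
 also have "\<dots> = (\<Sum>x\<in>verts Q. bar_to_ap 0 (basis [triv x, triv x]))"
 proof (rule sum.cong[OF refl])
  fix x assume x: "x \<in> verts Q"
  show "ap_coord (ap_tensor Q I 0 unitA (triv x) unitA) = bar_to_ap 0 (basis [triv x, triv x])"
  unfolding ap_units(2)[OF w[OF x]] tri_whole[OF AP_paths[OF w[OF x]]] bar_to_ap_0[OF x] by simp
 qed
 also have "\<dots> = bar_to_ap 0 (bar_coord u)" unfolding u klinear_sum[OF chom_klinear[OF bar_to_ap_chom]] ..
 finally show "ap_coord E = bar_to_ap 0 (bar_coord u)" .
qed

lemma G_value_one:
 assumes v: "nz v"
 defines "E \<equiv> (if plength v = 0 then \<zero>\<^bsub>Ap Q I 1\<^esub>
  else (\<Oplus>\<^bsub>Ap Q I 1\<^esub>i\<in>{1..plength v}. occ_tensor Q I 1 v (i - 1, i)))"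
 shows "E \<in> carrier (Ap Q I 1)" "ap_coord E = bar_to_ap 1 (bar_coord (bar_unit 1 [v]))"
proof -
 interpret M: bimodule_model Q I "Ap Q I 1" "ap_lists 1" ap_coord by (rule ap_model)
 have P: "v \<in> paths Q" by (rule nz_paths[OF v])
 have ap1: "ap_intervals (zint v) 1 = {(i, Suc i) | i. True}" by (rule zint.ap_1)
 have i: "(i - 1, i) \<in> ap_inside (zint v) 1 0 (plength v)" if "i \<in> {1..plength v}" for i
  using that unfolding ap_inside_def ap1 by auto
 note c = occ_coord[OF P i]
 have f: "(\<Oplus>\<^bsub>Ap Q I 1\<^esub>i\<in>{1..plength v}. occ_tensor Q I 1 v (i - 1, i)) \<in> carrier (Ap Q I 1)"
  by (rule M.finsum_closed[OF c(1)])
 have f': "ap_coord (\<Oplus>\<^bsub>Ap Q I 1\<^esub>i\<in>{1..plength v}. occ_tensor Q I 1 v (i - 1, i)) =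
  (\<Sum>i\<in>{1..plength v}. ap_coord (occ_tensor Q I 1 v (i - 1, i)))"
  by (rule M.\<Theta>_finsum[OF c(1)])
 show "E \<in> carrier (Ap Q I 1)"
 proof (cases "plength v = 0")
  case True
  show ?thesis unfolding E_def if_P[OF True] by (rule M.zero_closed)
 next
  case False
  show ?thesis unfolding E_def if_not_P[OF False] by (rule f)
 qed
 have E: "ap_coord E = (\<Sum>i\<in>{1..plength v}. tri v (i - 1, i))"
 proof (cases "plength v = 0")
  case True
  then show ?thesis unfolding E_def using M.\<Theta>_zero by simp
 next
  case False
  then have "ap_coord E = (\<Sum>i\<in>{1..plength v}. ap_coord (occ_tensor Q I 1 v (i - 1, i)))"
  unfolding E_def if_not_P[OF False] by (intro f')
  also have "\<dots> = (\<Sum>i\<in>{1..plength v}. tri v (i - 1, i))" by (rule sum.cong[OF refl c(2)])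
  finally show ?thesis .
 qed
 have p: "pos [v] 0 = 0" "pos [v] 1 = plength v" by (simp_all add: pos_def)
 have g: "cuts_good (zint v) 1 (pos [v])"
  unfolding cuts_good_def using nz_pseg[OF P, of 0 "plength v"] v by (simp add: pos_def)
 have "selected (zint v) 1 (pos [v]) = {w \<in> ap_inside (zint v) 1 0 (plength v). fst w < plength v}"
  unfolding selected_def p by simp
 also have "\<dots> = (\<lambda>i. (i - 1, i)) ` {1..plength v}"
  unfolding ap_inside_def ap1 by (auto simp: image_iff)
 finally have s: "selected (zint v) 1 (pos [v]) = (\<lambda>i. (i - 1, i)) ` {1..plength v}" .
 have "sum (tri v) (selected (zint v) 1 (pos [v])) = (\<Sum>i\<in>{1..plength v}. tri v (i - 1, i))"
  unfolding s by (subst sum.reindex) (auto simp: inj_on_def)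
 then show "ap_coord E = bar_to_ap 1 (bar_coord (bar_unit 1 [v]))"
  using G_unit(2)[of "[v]" 1] v g unfolding E by (simp add: cut_sum_def pconcat_single)
qed

context
 fixes n and vs :: "('v, 'a) path list"
 assumes n: "2 <= n" and wc: "well_concatenated Q I n vs"
begin

lemma vs_props: "vs \<noteq> []" "set vs <= nonzero_paths Q I" "comp vs" "n = length vs" "set vs <= paths Q" "pconcat vs \<in> paths Q"
proof -
 show l: "n = length vs" and s: "set vs <= nonzero_paths Q I" using wc by (simp_all add: well_concatenated_def)
 show ne: "vs \<noteq> []" using l n by auto
 have "target Q (vs ! i) = source (vs ! Suc i)" if "Suc i < length vs" for i
 proof -
  have "1 <= Suc i \<and> Suc i <= n - 1" using that l by simp
  then have "target Q (vs ! (Suc i - 1)) = source (vs ! Suc i)" using wc unfolding well_concatenated_def by blast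
  then show ?thesis by simp
 qed
 then show c: "comp vs" unfolding successively_conv_nth by blast
 show p: "set vs <= paths Q" using s nz_paths by blast
 show "pconcat vs \<in> paths Q" using pconcat_path[OF ne p c] by blast
qed

lemma chi_eq: "\<chi> Q I vs = ap_inside (zint (pconcat vs)) n 0 (plength (pconcat vs))"
 unfolding \<chi>_def vs_props(4)[symmetric] by (rule occs_AP[OF vs_props(6)])

lemma product_zint:
 assumes "i + 1 < n"
 shows "pbasis (pcat (vs ! i) (vs ! (i + 1))) \<in> I \<longleftrightarrow> zint (pconcat vs) (pos vs i) (pos vs (i + 2))"
proof -
 have s: "pseg Q (pconcat vs) (pos vs i, pos vs (Suc i)) = vs ! i"
  "pseg Q (pconcat vs) (pos vs (Suc i), pos vs (Suc (Suc i))) = vs ! (i + 1)"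
  using pconcat_seg[OF vs_props(5,3), of i] pconcat_seg[OF vs_props(5,3), of "Suc i"] assms vs_props(4) by simp_all
 have "pseg Q (pconcat vs) (pos vs i, pos vs (Suc (Suc i))) = pcat (vs ! i) (vs ! (i + 1))"
  using pcat_pseg[of "pos vs i" "pos vs (Suc i)" "pos vs (Suc (Suc i))" Q "pconcat vs"] unfolding s
  by (simp add: pos_mono)
 then show ?thesis
  using zint_iff[OF vs_props(6) pos_mono[of i "Suc (Suc i)" vs] pos_le] unfolding pbasis_in_I_iff by simp
qed

lemma M_empty:
 "even n ==> M_odd I vs = {} \<longleftrightarrow> (\<forall>k. 2 * k + 2 <= n --> pbasis (pcat (vs ! (2 * k)) (vs ! (2 * k + 1))) \<in> I)"
 "odd n ==> M_even I vs = {} \<longleftrightarrow> (\<forall>k. 1 + 2 * k + 2 <= n --> pbasis (pcat (vs ! (1 + 2 * k)) (vs ! (1 + 2 * k + 1))) \<in> I)"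
proof -
 have o: "Suc k \<in> M_odd I vs \<longleftrightarrow> 2 * k + 2 <= n \<and> pbasis (pcat (vs ! (2 * k)) (vs ! (2 * k + 1))) \<notin> I" for k
  unfolding M_odd_def vs_props(4)[symmetric] by simp
 have e: "Suc k \<in> M_even I vs \<longleftrightarrow> 1 + 2 * k + 2 <= n \<and> pbasis (pcat (vs ! (1 + 2 * k)) (vs ! (1 + 2 * k + 1))) \<notin> I" for k
  unfolding M_even_def vs_props(4)[symmetric] by simp
 have ex: "M = {} \<longleftrightarrow> (\<forall>k. Suc k \<notin> M)" if "0 \<notin> M" for M :: "nat set"
  using that not0_implies_Suc by (metis all_not_in_conv)
 have z: "0 \<notin> M_odd I vs" "0 \<notin> M_even I vs" by (simp_all add: M_odd_def M_even_def)
 show "M_odd I vs = {} \<longleftrightarrow> (\<forall>k. 2 * k + 2 <= n --> pbasis (pcat (vs ! (2 * k)) (vs ! (2 * k + 1))) \<in> I)"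
  unfolding ex[OF z(1)] o by blast
 show "M_even I vs = {} \<longleftrightarrow> (\<forall>k. 1 + 2 * k + 2 <= n --> pbasis (pcat (vs ! (1 + 2 * k)) (vs ! (1 + 2 * k + 1))) \<in> I)"
  unfolding ex[OF z(2)] e by blast
qed

text \<open>Both conditions say that the same products of neighbouring factors vanish, indexed from one and from
  zero.\<close>

lemma good_iff: "good I vs \<longleftrightarrow> cuts_good (zint (pconcat vs)) n (pos vs)"
proof -
 have nzk: "\<not> zint (pconcat vs) (pos vs k) (pos vs (k + 1))" if "k < n" for k
 proof -
  have "pseg Q (pconcat vs) (pos vs k, pos vs (Suc k)) = vs ! k" using pconcat_seg[OF vs_props(5,3), of k] that vs_props(4) by simp
  moreover have "nz (vs ! k)" using vs_props(2,4) nth_mem[of k vs] that by auto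
  ultimately show ?thesis using nz_pseg[OF vs_props(6) pos_mono[of k "Suc k" vs] pos_le] by simp
 qed
 have "good I vs \<longleftrightarrow> (\<forall>k. n mod 2 + 2 * k + 2 <= n -->
  pbasis (pcat (vs ! (n mod 2 + 2 * k)) (vs ! (n mod 2 + 2 * k + 1))) \<in> I)"
 proof (cases "even n")
  case True
  then have "n mod 2 = 0" by presburger
  then show ?thesis unfolding good_def vs_props(4)[symmetric] M_empty(1)[OF True] using True by simp
 next
  case False
  then have "n mod 2 = 1" by presburger
  then show ?thesis unfolding good_def vs_props(4)[symmetric] M_empty(2)[OF False] using False by simp
 qed
 also have "\<dots> \<longleftrightarrow> (\<forall>k. n mod 2 + 2 * k + 2 <= n -->
  zint (pconcat vs) (pos vs (n mod 2 + 2 * k)) (pos vs (n mod 2 + 2 * k + 2)))"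
  using product_zint by (intro all_cong1 imp_cong refl) simp
 also have "\<dots> \<longleftrightarrow> cuts_good (zint (pconcat vs)) n (pos vs)" unfolding cuts_good_def using nzk by blast
 finally show ?thesis .
qed

lemma pos_ends: "pos vs 0 = 0" "pos vs n = plength (pconcat vs)" "pos vs 1 = plength (hd vs)"
 using pos_length[of vs n] vs_props(1,4) by (simp, simp, cases vs, simp_all)

lemma G_cases:
 defines "V \<equiv> bar_to_ap n (bar_coord (bar_unit n vs))"
 shows "\<not> good I vs \<or> \<chi> Q I vs = {} ==> V = 0"
  "good I vs ==> even n ==> least_start (\<chi> Q I vs) w ==> V = tri (pconcat vs) w"
  "good I vs ==> odd n ==> V = (\<Sum>w\<in>{w \<in> \<chi> Q I vs. 0 <= fst w \<and> fst w < plength (hd vs)}. tri (pconcat vs) w)"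
proof -
 have V: "V = cut_sum (zint (pconcat vs)) (tri (pconcat vs)) n (pos vs)" unfolding V_def by (rule G_unit(2)[OF vs_props(1-4)])
 show "V = 0" if "\<not> good I vs \<or> \<chi> Q I vs = {}"
  using that
 proof
  assume "\<not> good I vs"
  then show "V = 0" unfolding V cut_sum_def good_iff by simp
 next
  assume "\<chi> Q I vs = {}"
  then have "selected (zint (pconcat vs)) n (pos vs) = {}"
  using selected_inside[of "zint (pconcat vs)" n "pos vs"] unfolding pos_ends chi_eq by simp
  then show "V = 0" unfolding V cut_sum_def by simp
 qed
 show "V = tri (pconcat vs) w" if g: "good I vs" "even n" "least_start (\<chi> Q I vs) w"
 proof -
  have w: "w \<in> \<chi> Q I vs" "\<And>q. q \<in> \<chi> Q I vs ==> fst w <= fst q" using g(3) unfolding least_start_def by blast+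
  have w': "(fst w, snd w) \<in> ap_inside (zint (pconcat vs)) n 0 (plength (pconcat vs))" using w(1) unfolding chi_eq by simp
  have "leftmost (\<chi> Q I vs) = {q \<in> \<chi> Q I vs. fst q = fst w}"
  unfolding leftmost_def using w by (intro Collect_cong) (metis order_antisym)
  also have "\<dots> = {w}" unfolding chi_eq using ends_unique(1)[OF w'] by simp
  finally have "selected (zint (pconcat vs)) n (pos vs) = {w}"
  unfolding selected_def pos_ends chi_eq[symmetric] using g(2) by simp
  then show ?thesis unfolding V cut_sum_def using g(1) good_iff by simp
 qed
 show "V = (\<Sum>w\<in>{w \<in> \<chi> Q I vs. 0 <= fst w \<and> fst w < plength (hd vs)}. tri (pconcat vs) w)" if g: "good I vs" "odd n"
 proof -
  have "selected (zint (pconcat vs)) n (pos vs) = {w \<in> \<chi> Q I vs. fst w < plength (hd vs)}"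
  unfolding selected_def pos_ends chi_eq[symmetric] using g(2) by simp
  then show ?thesis unfolding V cut_sum_def using g(1) good_iff by simp
 qed
qed

lemma chi_coord:
 assumes "w \<in> \<chi> Q I vs"
 shows "occ_tensor Q I n (pconcat vs) w \<in> carrier (Ap Q I n)" "ap_coord (occ_tensor Q I n (pconcat vs) w) = tri (pconcat vs) w"
 using occ_coord[OF vs_props(6), of "fst w" "snd w" n] assms unfolding chi_eq by simp_all

end

theorem is_G_iff: "is_G Q I G \<longleftrightarrow> (\<forall>n. G_rep n (G n))"
proof
 assume "is_G Q I G"
 note r = this[unfolded is_G_def]
 note r1 = r[THEN conjunct1] and r2 = r[THEN conjunct2, THEN conjunct1]
  and r3 = r[THEN conjunct2, THEN conjunct2, THEN conjunct1]
  and r4 = r[THEN conjunct2, THEN conjunct2, THEN conjunct2]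
 have "G_rep n (G n)" for n
 proof (rule representsI[OF bar_model ap_model bar_to_ap_chom r1[THEN spec] gen_list_bar])
  interpret B: bimodule_model Q I "Bar Q I n" "bar_lists n" bar_coord by (rule bar_model)
  interpret M: bimodule_model Q I "Ap Q I n" "ap_lists n" ap_coord by (rule ap_model)
  fix ps assume ps: "ps \<in> bar_lists n"
  then have g: "gen_list ps \<in> bar_lists n" using gen_list_bar by blast
  show "\<exists>y\<in>carrier (Bar Q I n). bar_coord y = basis (gen_list ps) \<and> ap_coord (G n y) = bar_to_ap n (bar_coord y)"
  proof (cases "n = 0")
  case n: True
  obtain x where x: "gen_list ps = [triv x, triv x]" "x \<in> verts Q" using ps[unfolded n] by (rule bar_0_E)
  let ?u = "bar_tensor Q I 0 [unitA, unitA]" and ?a = "pcls Q I (triv x)"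
  have a: "?a \<in> carrier A" "nf ?a = basis (triv x)" "triv x \<in> paths Q" using x(2) nf_pcls[of "triv x"] by simp_all
  note u = G_value_zero
  have un: "?u \<in> carrier (Bar Q I n)" using u(2) n by simp
  have Gu: "G n ?u \<in> carrier (Ap Q I n)" "ap_coord (G n ?u) = bar_to_ap n (bar_coord ?u)"
  using u(1,4) r2 n by simp_all
  have "lmul (basis (triv x)) (bar_coord ?u) = (\<Sum>z\<in>verts Q. if x = z then basis [triv x, triv x] else 0)"
  unfolding u(3) klinear_sum[OF klinear_mul(1)] by (rule sum.cong[OF refl]) (use x(2) in \<open>auto simp: mul_single\<close>)
  also have "\<dots> = basis [triv x, triv x]" using x(2) by simp
  finally have 1: "bar_coord (lact (Bar Q I n) ?a ?u) = basis (gen_list ps)"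
  unfolding B.\<Theta>_lact[OF a(1) un] a(2) x(1) .
  have "G n (lact (Bar Q I n) ?a ?u) = lact (Ap Q I n) ?a (G n ?u)"
  using r1[THEN spec, of n] a(1) un unfolding bimod_hom_def by blast
  then have "ap_coord (G n (lact (Bar Q I n) ?a ?u)) = lmul (basis (triv x)) (bar_to_ap n (bar_coord ?u))"
  using M.\<Theta>_lact[OF a(1) Gu(1)] unfolding a(2) Gu(2) by simp
  also have "\<dots> = bar_to_ap n (lmul (basis (triv x)) (bar_coord ?u))"
  by (rule chom_mul_path(1)[OF bar_to_ap_chom bimod_lists_bar bimod_lists_ap a(3) B.\<Theta>_keys[OF un], symmetric])
  also have "lmul (basis (triv x)) (bar_coord ?u) = bar_coord (lact (Bar Q I n) ?a ?u)"
  unfolding B.\<Theta>_lact[OF a(1) un] a(2) ..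
  finally show ?thesis using 1 B.lact_closed[OF a(1) un] by blast
  next
  case n: False
  have "2 <= length ps" using bar_listsD(1)[OF ps] by blast
  then obtain p vs q where ps': "ps = p # vs @ [q]" by (rule two_ends)
  have gs: "gen_list ps = triv (target Q p) # vs @ [triv (source q)]" unfolding ps' gen_list_simp ..
  have vs: "n = length vs" "set vs <= nonzero_paths Q I" using g unfolding gs by (auto simp: bar_lists_def)
  have ne: "vs \<noteq> []" using vs n by auto
  have c: "comp (triv (target Q p) # vs @ [triv (source q)])" using g unfolding gs by (simp add: bar_lists_def)
  then have cv: "comp vs" "target Q p = source (hd vs)" "source q = target Q (last vs)"
  using ne by (simp_all add: successively_append_iff successively_Cons)
  have gs': "gen_list ps = triv (source (hd vs)) # vs @ [triv (target Q (last vs))]" unfolding gs cv(2,3) ..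
  note y = G_unit(1)[OF ne vs(2) cv(1) vs(1)] bar_units(2)[OF ne vs(2) cv(1) vs(1)]
  have "ap_coord (G n (bar_unit n vs)) = bar_to_ap n (bar_coord (bar_unit n vs))"
  proof (cases "n = 1")
  case n1: True
  then obtain v where v: "vs = [v]" using vs(1) by (cases vs) auto
  have nv: "nz v" using vs(2) v by simp
  have "G 1 (bar_unit 1 [v]) = (if plength v = 0 then \<zero>\<^bsub>Ap Q I 1\<^esub>
  else (\<Oplus>\<^bsub>Ap Q I 1\<^esub>i\<in>{1..plength v}. occ_tensor Q I 1 v (i - 1, i)))"
  using r3[THEN bspec, OF nv] by simp
  then show ?thesis unfolding n1 v using G_value_one(2)[OF nv] by simp
  next
  case False
  then have n2: "2 <= n" using n by simp
  have wc: "well_concatenated Q I n vs" unfolding well_concatenated_def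
  proof (intro conjI allI impI)
  fix i assume i: "1 <= i \<and> i <= n - 1"
  then obtain k where k: "i = Suc k" by (cases i) auto
  have "Suc k < length vs" using i k vs(1) n2 by simp
  then have "target Q (vs ! k) = source (vs ! Suc k)" using cv(1) unfolding successively_conv_nth by blast
  then show "target Q (vs ! (i - 1)) = source (vs ! i)" unfolding k by simp
  qed (use vs in simp_all)
  note cl = r4[THEN spec, THEN mp, OF n2, THEN spec, THEN mp, OF wc, unfolded Let_def]
  note val = G_cases[OF n2 wc] and cc = chi_coord[OF n2 wc]
  show ?thesis
  proof (cases "\<not> good I vs \<or> \<chi> Q I vs = {}")
  case True
  then have "G n (bar_unit n vs) = \<zero>\<^bsub>Ap Q I n\<^esub>" using cl by simp
  then show ?thesis using val(1)[OF True] M.\<Theta>_zero by simp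
  next
  case False
  then have gd: "good I vs" and x: "\<chi> Q I vs \<noteq> {}" by simp_all
  show ?thesis
  proof (cases "even n")
  case True
  obtain w0 where "w0 \<in> \<chi> Q I vs" using x by blast
  from ex_has_least_nat[of "\<lambda>w. w \<in> \<chi> Q I vs" w0 fst, OF this]
  obtain w where w: "w \<in> \<chi> Q I vs" "least_start (\<chi> Q I vs) w" unfolding least_start_def by blast
  have "G n (bar_unit n vs) = occ_tensor Q I n (pconcat vs) w" using cl gd True w(2) by blast
  then show ?thesis using val(2)[OF gd True w(2)] cc(2)[OF w(1)] by simp
  next
  case False
  let ?S = "{w \<in> \<chi> Q I vs. 0 <= fst w \<and> fst w < plength (hd vs)}"
  have S: "w \<in> \<chi> Q I vs" if "w \<in> ?S" for w using that by simp
  have e: "G n (bar_unit n vs) = (\<Oplus>\<^bsub>Ap Q I n\<^esub>w\<in>?S. occ_tensor Q I n (pconcat vs) w)" using cl gd False x by blast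
  have "ap_coord (G n (bar_unit n vs)) = (\<Sum>w\<in>?S. ap_coord (occ_tensor Q I n (pconcat vs) w))"
  unfolding e by (rule M.\<Theta>_finsum[OF cc(1)[OF S]])
  also have "\<dots> = (\<Sum>w\<in>?S. tri (pconcat vs) w)" by (rule sum.cong[OF refl cc(2)[OF S]])
  finally show ?thesis using val(3)[OF gd False] by simp
  qed
  qed
  qed
  then show ?thesis using y unfolding gs' by blast
  qed
 qed
 then show "\<forall>n. G_rep n (G n)" by blast
next
 assume "\<forall>n. G_rep n (G n)"
 then have G: "G_rep n (G n)" for n by blast
 have G1: "\<forall>n. G n \<in> bimod_hom A (Bar Q I n) (Ap Q I n)" by (rule allI) (rule representsD(1)[OF G])
 have G2: "G 0 (bar_tensor Q I 0 [unitA, unitA]) = (\<Oplus>\<^bsub>Ap Q I 0\<^esub>x\<in>verts Q. ap_tensor Q I 0 unitA (triv x) unitA)"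
  by (rule represents_value[OF ap_model G[of 0], OF G_value_zero(2), OF G_value_zero(1), OF G_value_zero(4)])
 have G3: "G 1 (bar_tensor Q I 1 [unitA, pcls Q I v, unitA]) =
  (if plength v = 0 then \<zero>\<^bsub>Ap Q I 1\<^esub>
  else (\<Oplus>\<^bsub>Ap Q I 1\<^esub>i\<in>{1..plength v}. occ_tensor Q I 1 v (i - 1, i)))" if v: "nz v" for v
 proof -
  have y: "bar_unit 1 [v] \<in> carrier (Bar Q I 1)" by (rule G_unit(1)) (use v in simp_all)
  have "G 1 (bar_unit 1 [v]) = (if plength v = 0 then \<zero>\<^bsub>Ap Q I 1\<^esub>
  else (\<Oplus>\<^bsub>Ap Q I 1\<^esub>i\<in>{1..plength v}. occ_tensor Q I 1 v (i - 1, i)))"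
  by (rule represents_value[OF ap_model G[of 1], OF y, OF G_value_one(1)[OF v], OF G_value_one(2)[OF v]])
  then show ?thesis by simp
 qed
 have G4: "let T = pconcat vs; z = G n (bar_unit n vs)
  in (\<not> good I vs \<or> \<chi> Q I vs = {} --> z = \<zero>\<^bsub>Ap Q I n\<^esub>) \<and>
  (good I vs \<and> even n --> (\<forall>w\<^sub>1. least_start (\<chi> Q I vs) w\<^sub>1 --> z = occ_tensor Q I n T w\<^sub>1)) \<and>
  (good I vs \<and> odd n \<and> \<chi> Q I vs \<noteq> {} -->
  z = (\<Oplus>\<^bsub>Ap Q I n\<^esub>w\<in>{w \<in> \<chi> Q I vs. 0 <= fst w \<and> fst w < plength (hd vs)}. occ_tensor Q I n T w))"
  if n: "2 <= n" and wc: "well_concatenated Q I n vs" for n vs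
  unfolding Let_def
 proof (intro conjI allI impI)
  interpret M: bimodule_model Q I "Ap Q I n" "ap_lists n" ap_coord by (rule ap_model)
  note val = G_cases[OF n wc] and cc = chi_coord[OF n wc]
  note R = represents_value[OF ap_model G[of n], OF G_unit(1)[OF vs_props(1-4)[OF n wc]]]
  show "G n (bar_unit n vs) = \<zero>\<^bsub>Ap Q I n\<^esub>" if "\<not> good I vs \<or> \<chi> Q I vs = {}"
  by (rule R[OF M.zero_closed]) (simp only: val(1)[OF that] M.\<Theta>_zero)
  show "G n (bar_unit n vs) = occ_tensor Q I n (pconcat vs) w" if "good I vs \<and> even n" "least_start (\<chi> Q I vs) w" for w
  proof -
  have w: "w \<in> \<chi> Q I vs" using that(2) unfolding least_start_def by blast
  show ?thesis by (rule R[OF cc(1)[OF w]]) (simp only: cc(2)[OF w] val(2)[OF conjunct1[OF that(1)] conjunct2[OF that(1)] that(2)])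
  qed
  let ?S = "{w \<in> \<chi> Q I vs. 0 <= fst w \<and> fst w < plength (hd vs)}"
  have S: "w \<in> \<chi> Q I vs" if "w \<in> ?S" for w using that by simp
  show "G n (bar_unit n vs) = (\<Oplus>\<^bsub>Ap Q I n\<^esub>w\<in>?S. occ_tensor Q I n (pconcat vs) w)"
  if g: "good I vs \<and> odd n \<and> \<chi> Q I vs \<noteq> {}"
  proof (rule R[OF M.finsum_closed[OF cc(1)[OF S]]])
  have "ap_coord (\<Oplus>\<^bsub>Ap Q I n\<^esub>w\<in>?S. occ_tensor Q I n (pconcat vs) w) = (\<Sum>w\<in>?S. ap_coord (occ_tensor Q I n (pconcat vs) w))"
  by (rule M.\<Theta>_finsum[OF cc(1)[OF S]])
  also have "\<dots> = (\<Sum>w\<in>?S. tri (pconcat vs) w)" by (rule sum.cong[OF refl cc(2)[OF S]])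
  finally show "ap_coord (\<Oplus>\<^bsub>Ap Q I n\<^esub>w\<in>?S. occ_tensor Q I n (pconcat vs) w) = bar_to_ap n (bar_coord (bar_unit n vs))"
  using val(3) g by simp
  qed
 qed
 show "is_G Q I G"
  unfolding is_G_def
  apply (rule conjI[OF G1])
  apply (rule conjI[OF G2])
  apply (rule conjI)
  apply (rule ballI, erule G3)
  apply (rule allI, rule impI, rule allI, rule impI, erule (1) G4)
  done
qed

end

section \<open>The comparison theorem\<close>

theorem mainTheorem1:
  fixes Q :: "('v, 'a) pre_digraph"
    and I :: "(('v, 'a) path \<Rightarrow>\<^sub>0 'k::field) set"
  assumes "monomial_algebra Q I"
  shows "(\<exists>b \<epsilon> d \<mu> F G. is_bar_resolution Q I b \<epsilon> \<and> is_Bardzell_resolution Q I d \<mu> \<and>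
            is_F Q I F \<and> is_G Q I G) \<and>
         (\<forall>b \<epsilon> d \<mu> F G. is_bar_resolution Q I b \<epsilon> \<and> is_Bardzell_resolution Q I d \<mu> \<and>
            is_F Q I F \<and> is_G Q I G \<longrightarrow>
            (\<forall>u\<in>carrier (Ap Q I 0). \<epsilon> (F 0 u) = \<mu> u) \<and>
            (\<forall>n\<ge>1. \<forall>u\<in>carrier (Ap Q I n). F (n - 1) (d n u) = b n (F n u)) \<and>
            (\<forall>u\<in>carrier (Bar Q I 0). \<mu> (G 0 u) = \<epsilon> u) \<and>
            (\<forall>n\<ge>1. \<forall>u\<in>carrier (Bar Q I n). G (n - 1) (b n u) = d n (G n u)))"
proof (intro conjI allI impI)
 interpret monomial_algebra Q I by fact
 have "\<forall>n. \<exists>H. bar_rep n H" by (intro allI represents_exists[OF bar_model bar_model bar_diff_bar])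
 then obtain b where b: "\<And>n. bar_rep n (b n)" by (meson choice)
 have "\<forall>n. \<exists>H. ap_rep n H" by (intro allI represents_exists[OF ap_model ap_model ap_diff_chom_Suc])
 then obtain d where d: "\<And>n. ap_rep n (d n)" by (meson choice)
 have "\<forall>n. \<exists>H. F_rep n H" by (intro allI represents_exists[OF ap_model bar_model ap_to_bar_chom])
 then obtain F where F: "\<And>n. F_rep n (F n)" by (meson choice)
 have "\<forall>n. \<exists>H. G_rep n H" by (intro allI represents_exists[OF bar_model ap_model bar_to_ap_chom])
 then obtain G where G: "\<And>n. G_rep n (G n)" by (meson choice)
 obtain \<epsilon> where e: "bar_aug_rep \<epsilon>" using represents_exists[OF bar_model alg_model bar_diff_alg] by blast
 obtain \<mu> where m: "ap_aug_rep \<mu>" using represents_exists[OF ap_model alg_model ap_aug_chom] by blast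
 have 1: "is_bar_resolution Q I (\<lambda>n. b (n - 1)) \<epsilon>"
  unfolding bar_resolution_iff diff_Suc_1 using b e by blast
 have 2: "is_Bardzell_resolution Q I (\<lambda>n. d (n - 1)) \<mu>"
  unfolding Bardzell_resolution_iff diff_Suc_1 using d m by blast
 have 3: "is_F Q I F" unfolding is_F_iff using F by blast
 have 4: "is_G Q I G" unfolding is_G_iff using G by blast
 show "\<exists>b \<epsilon> d \<mu> F G. is_bar_resolution Q I b \<epsilon> \<and> is_Bardzell_resolution Q I d \<mu> \<and> is_F Q I F \<and> is_G Q I G"
  by (rule exI)+ (rule conjI[OF 1 conjI[OF 2 conjI[OF 3 4]]])
next
 interpret monomial_algebra Q I by fact
 fix b \<epsilon> d \<mu> F G
 assume spec: "is_bar_resolution Q I b \<epsilon> \<and> is_Bardzell_resolution Q I d \<mu> \<and> is_F Q I F \<and> is_G Q I G"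
 have b: "bar_rep n (b (Suc n))" and e: "bar_aug_rep \<epsilon>" for n using spec unfolding bar_resolution_iff by blast+
 have d: "ap_rep n (d (Suc n))" and m: "ap_aug_rep \<mu>" for n using spec unfolding Bardzell_resolution_iff by blast+
 have F: "F_rep n (F n)" for n using spec unfolding is_F_iff by blast
 have G: "G_rep n (G n)" for n using spec unfolding is_G_iff by blast
 have ap_keys: "supp (ap_coord u) <= ap_lists n" if "u \<in> carrier (Ap Q I n)" for u n
  by (rule bimodule_model.\<Theta>_keys[OF ap_model that])
 have bar_keys: "supp (bar_coord u) <= bar_lists n" if "u \<in> carrier (Bar Q I n)" for u n
  by (rule bimodule_model.\<Theta>_keys[OF bar_model that])
 show "\<forall>u\<in>carrier (Ap Q I 0). \<epsilon> (F 0 u) = \<mu> u"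
 proof
  fix u assume u: "u \<in> carrier (Ap Q I 0)"
  note Fu = representsD(2)[OF F u] representsD(3)[OF F u]
  have "alg_coord (\<epsilon> (F 0 u)) = ap_aug (ap_coord u)"
  unfolding representsD(3)[OF e Fu(1)] Fu(2) by (rule ap_to_bar_aug[OF ap_keys[OF u]])
  from represents_value[OF alg_model m, OF u, OF representsD(2)[OF e Fu(1)], OF this]
  show "\<epsilon> (F 0 u) = \<mu> u" by (rule sym)
 qed
 show "\<forall>u\<in>carrier (Bar Q I 0). \<mu> (G 0 u) = \<epsilon> u"
 proof
  fix u assume u: "u \<in> carrier (Bar Q I 0)"
  note Gu = representsD(2)[OF G u] representsD(3)[OF G u]
  have "alg_coord (\<mu> (G 0 u)) = bar_diff 0 (bar_coord u)"
  unfolding representsD(3)[OF m Gu(1)] Gu(2) by (rule bar_to_ap_aug[OF bar_keys[OF u]])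
  from represents_value[OF alg_model e, OF u, OF representsD(2)[OF m Gu(1)], OF this]
  show "\<mu> (G 0 u) = \<epsilon> u" by (rule sym)
 qed
 show "\<forall>u\<in>carrier (Ap Q I n). F (n - 1) (d n u) = b n (F n u)" if n1: "1 <= n" for n
 proof
  fix u assume "u \<in> carrier (Ap Q I n)"
  obtain k where n: "n = Suc k" using n1 by (cases n) auto
  have u: "u \<in> carrier (Ap Q I (Suc k))" using \<open>u \<in> carrier (Ap Q I n)\<close> n by simp
  show "F (n - 1) (d n u) = b n (F n u)"
  unfolding n diff_Suc_1
  by (rule represents_comp_eq[OF bar_model, OF d[of k], OF F[of k], OF F[of "Suc k"], OF b[of k], OF u,
  OF ap_to_bar_commutes[OF ap_keys[OF u]]])
 qed
 show "\<forall>u\<in>carrier (Bar Q I n). G (n - 1) (b n u) = d n (G n u)" if n1: "1 <= n" for n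
 proof
  fix u assume "u \<in> carrier (Bar Q I n)"
  obtain k where n: "n = Suc k" using n1 by (cases n) auto
  have u: "u \<in> carrier (Bar Q I (Suc k))" using \<open>u \<in> carrier (Bar Q I n)\<close> n by simp
  show "G (n - 1) (b n u) = d n (G n u)"
  unfolding n diff_Suc_1
  by (rule represents_comp_eq[OF ap_model, OF b[of k], OF G[of k], OF G[of "Suc k"], OF d[of k], OF u,
  OF bar_to_ap_commutes[OF bar_keys[OF u]]])
 qed
qed

end
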